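(* Let $N\ge 2$, $\Omega=\mathbb{R}^{N-1}\times(0,\infty)$, $D=\overline{\Omega}\times\overline{\Omega}\times(0,\infty)$, and let $\epsilon>0$, $\delta>0$, $k\ge 0$. Define for $(x,y,t)\in D$ \[ H(x,y,t):=-2\int_0^t\Gamma_{N-1}\!\left(x'-y',\frac{t-\tau}{\epsilon}+\frac{k}{\delta}\tau\right)\partial_{\xi}\Gamma_1\!\left(x_N+y_N+\frac{\tau}{\delta},\frac{t-\tau}{\epsilon}\right)d\tau, \qquad G(x,y,t):=G_0\!\left(x,y,\frac{t}{\epsilon}\right)+\frac{1}{\delta}H(x,y,t). \] Then: (1) $G(x,y,t)=G(y,x,t)>0$ for all $(x,y,t)\in D$. (2) For every fixed $y\in\overline{\Omega}$, as a function of $(x,t)\in\overline{\Omega}\times(0,\infty)$, $G$ satisfies $\epsilon\partial_tG-\Delta_xG=0$ in $\Omega\times(0,\infty)$ and $\delta\partial_tG-k\Delta'_xG-\partial_{x_N}G=0$ on $\partial\Omega\times(0,\infty)$. (3) For every $(x,t)\in\overline{\Omega}\times(0,\infty)$, $\int_\Omega G(x,y,t)\,dy+\frac{\delta}{\epsilon}\int_{\partial\Omega}G(x,y,t)\,d\sigma(y)=1$. (4) For every $(x,y,t)\in D$ and $s>0$, \[G(x,y,t+s)=\int_\Omega G(x,z,t)G(z,y,s)\,dz+\frac{\delta}{\epsilon}\int_{\partial\Omega}G(x,z,t)G(z,y,s)\,d\sigma(z).\] (5) Let $(\phi,\psi)\in BC(\Omega)\times BC(\partial\Omega)$ and define for $(x,t)\in\overline{\Omega}\times(0,\infty)$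 \[ u(x,t):=\int_\Omega G(x,y,t)\phi(y)\,dy+\frac{\delta}{\epsilon}\int_{\partial\Omega}G(x,y,t)\psi(y)\,d\sigma(y) =\int_\Omega G_0\!\left(x,y,\frac{t}{\epsilon}\right)\phi(y)dy+\frac1\delta\int_\Omega H(x,y,t)\phi(y)dy+\frac1\epsilon\int_{\partial\Omega}H(x,y,t)\psi(y)d\sigma(y). \] Then $u$ is the unique bounded classical solution of problem (HDD) when $k>0$ (resp. of problem (HD) when $k=0$). In particular this formula represents every bounded classical solution of (HDD) when $k>0$ (resp. (HD) when $k=0$).
   Context: Points of $\overline{\Omega}$ are written $x=(x',x_N)$ with $x'\in\mathbb{R}^{N-1}$, $x_N\ge0$; $\partial\Omega$ is identified with $\mathbb{R}^{N-1}$, $d\sigma$ is the surface measure on $\partial\Omega$, $\Delta$ is the Laplacian on $\mathbb{R}^N$ and $\Delta'$ the Laplacian on $\partial\Omega$ (in the $x'$ variables). For $d\ge1$, $\Gamma_d(x,t)=(4\pi t)^{-d/2}\exp(-|x|^2/(4t))$, $(x,t)\in\mathbb{R}^d\times(0,\infty)$; $\partial_\xi\Gamma_1(\xi,s)$ denotes the derivative of $\Gamma_1$ in its spatial variable. For $y=(y',y_N)$, $y^*:=(y',-y_N)$, and $G_0(x,y,s):=\Gamma_N(x-y,s)-\Gamma_N(x-y^*,s)$. Problem (HDD) (for $k>0$) is: $\epsilon\partial_tu-\Delta u=0$ in $\Omega\times(0,\infty)$; $\delta\partial_tu-k\Delta'u-\partial_{x_N}u=0$ on $\partial\Omega\times(0,\infty)$;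 $u=\phi$ in $\Omega\times\{0\}$; $u=\psi$ on $\partial\Omega\times\{0\}$. Problem (HD) is the same with $k=0$. A classical solution of (HDD) is a function $u$ on $\overline{\Omega}\times[0,\infty)$ with $u\in C^{2;1}(\overline{\Omega}\times(0,\infty))\cap C(\Omega\times[0,\infty))$, $u|_{\partial\Omega}\in C(\partial\Omega\times[0,\infty))$, satisfying the equations of (HDD) pointwise (continuity on $\overline\Omega\times[0,\infty)$ is not required). A classical solution of (HD) is a function $u$ on $\overline{\Omega}\times[0,\infty)$ with $u\in C^{2;1}(\Omega\times(0,\infty))\cap C^{1;1}(\overline{\Omega}\times(0,\infty))\cap C(\Omega\times[0,\infty))$, $u|_{\partial\Omega}\in C(\partial\Omega\times[0,\infty))$, satisfying the equations of (HD) pointwise. *)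

theory Defs
  imports "HOL-Analysis.Analysis"
begin

text \<open>Points of the closed half space are pairs (x', x_N) with x' in R^(N-1) = real^'n and
  x_N real; thus N = CARD('n) + 1 \<ge> 2 automatically. The boundary is identified with real^'n
  via x' \<mapsto> (x',0), and the surface measure with Lebesgue measure on real^'n.\<close>

definition Omega :: "((real^'n) \<times> real) set" where
  "Omega = {x. snd x > 0}"

definition Omega_bar :: "((real^'n) \<times> real) set" where
  "Omega_bar = {x. snd x \<ge> 0}"

definition Gam :: "'a::euclidean_space \<Rightarrow> real \<Rightarrow> real" where
  "Gam x t = (4 * pi * t) powr (- real DIM('a) / 2) * exp (- (norm x)\<^sup>2 / (4 * t))"

definition dGam1 :: "real \<Rightarrow> real \<Rightarrow> real" where
  "dGam1 \<xi> s = deriv (\<lambda>z. Gam z s) \<xi>"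

definition refl :: "(real^'n) \<times> real \<Rightarrow> (real^'n) \<times> real" where
  "refl y = (fst y, - snd y)"

definition G0 :: "(real^'n) \<times> real \<Rightarrow> (real^'n) \<times> real \<Rightarrow> real \<Rightarrow> real" where
  "G0 x y s = Gam (x - y) s - Gam (x - refl y) s"

definition Hker :: "real \<Rightarrow> real \<Rightarrow> real \<Rightarrow> (real^'n) \<times> real \<Rightarrow> (real^'n) \<times> real \<Rightarrow> real \<Rightarrow> real" where
  "Hker eps delta k x y t =
     - 2 * integral {0..t} (\<lambda>\<tau>. Gam (fst x - fst y) ((t - \<tau>) / eps + k / delta * \<tau>)
                                 * dGam1 (snd x + snd y + \<tau> / delta) ((t - \<tau>) / eps))"

definition Gker :: "real \<Rightarrow> real \<Rightarrow> real \<Rightarrow> (real^'n) \<times> real \<Rightarrow> (real^'n) \<times> real \<Rightarrow> real \<Rightarrow> real" where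
  "Gker eps delta k x y t = G0 x y (t / eps) + Hker eps delta k x y t / delta"

definition C11_derivs :: "'a::euclidean_space set \<Rightarrow> ('a \<Rightarrow> real \<Rightarrow> real) \<Rightarrow>
    ('a \<Rightarrow> real \<Rightarrow> real) \<Rightarrow> ('a \<Rightarrow> real \<Rightarrow> 'a \<Rightarrow> real) \<Rightarrow> bool" where
  "C11_derivs S u ut Du \<longleftrightarrow>
     (\<forall>x\<in>S. \<forall>t>0. ((\<lambda>s. u x s) has_real_derivative ut x t) (at t)
                 \<and> ((\<lambda>y. u y t) has_derivative Du x t) (at x within S))
   \<and> continuous_on (S \<times> {0<..}) (\<lambda>(x,t). u x t)
   \<and> continuous_on (S \<times> {0<..}) (\<lambda>(x,t). ut x t)
   \<and> (\<forall>b\<in>Basis. continuous_on (S \<times> {0<..}) (\<lambda>(x,t). Du x t b))"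

definition C21_derivs :: "'a::euclidean_space set \<Rightarrow> ('a \<Rightarrow> real \<Rightarrow> real) \<Rightarrow>
    ('a \<Rightarrow> real \<Rightarrow> real) \<Rightarrow> ('a \<Rightarrow> real \<Rightarrow> 'a \<Rightarrow> real) \<Rightarrow> ('a \<Rightarrow> real \<Rightarrow> 'a \<Rightarrow> 'a \<Rightarrow> real) \<Rightarrow> bool" where
  "C21_derivs S u ut Du D2u \<longleftrightarrow>
     C11_derivs S u ut Du
   \<and> (\<forall>x\<in>S. \<forall>t>0. \<forall>b\<in>Basis. ((\<lambda>y. Du y t b) has_derivative D2u x t b) (at x within S))
   \<and> (\<forall>b\<in>Basis. \<forall>c\<in>Basis. continuous_on (S \<times> {0<..}) (\<lambda>(x,t). D2u x t b c))"

definition trace_derivs :: "((real^'n) \<times> real \<Rightarrow> real \<Rightarrow> real) \<Rightarrow>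
    (real^'n \<Rightarrow> real \<Rightarrow> real^'n \<Rightarrow> real) \<Rightarrow> (real^'n \<Rightarrow> real \<Rightarrow> real^'n \<Rightarrow> real^'n \<Rightarrow> real) \<Rightarrow> bool" where
  "trace_derivs u Dw D2w \<longleftrightarrow>
     (\<forall>x'. \<forall>t>0. ((\<lambda>z. u (z, 0) t) has_derivative Dw x' t) (at x')
        \<and> (\<forall>b\<in>Basis. ((\<lambda>z. Dw z t b) has_derivative D2w x' t b) (at x')))"

text \<open>The equations of (HDD) (k > 0) / (HD) (k = 0) hold pointwise (derivatives exist).
  At boundary points the normal derivative is the (one-sided) derivative within the closed
  half space; the direction (0,1) is the x_N direction.\<close>
definition dyn_eqs :: "real \<Rightarrow> real \<Rightarrow> real \<Rightarrow> ((real^'n) \<times> real \<Rightarrow> real \<Rightarrow> real) \<Rightarrow> bool" where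
  "dyn_eqs eps delta k u \<longleftrightarrow>
     (\<exists>ut Du D2u.
        (\<forall>x\<in>Omega_bar. \<forall>t>0. ((\<lambda>s. u x s) has_real_derivative ut x t) (at t)
                 \<and> ((\<lambda>y. u y t) has_derivative Du x t) (at x within Omega_bar))
      \<and> (\<forall>x\<in>Omega. \<forall>t>0. \<forall>b\<in>Basis. ((\<lambda>y. Du y t b) has_derivative D2u x t b) (at x))
      \<and> (\<forall>x\<in>Omega. \<forall>t>0. eps * ut x t - (\<Sum>b\<in>Basis. D2u x t b b) = 0)
      \<and> (if k = 0 then
           (\<forall>x'. \<forall>t>0. delta * ut (x', 0) t - Du (x', 0) t (0, 1) = 0)
         else
           (\<exists>Dw D2w. trace_derivs u Dw D2w \<and>
              (\<forall>x'. \<forall>t>0. delta * ut (x', 0) t - k * (\<Sum>b\<in>Basis. D2w x' t b b)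
                             - Du (x', 0) t (0, 1) = 0))))"

definition classical_HDD :: "real \<Rightarrow> real \<Rightarrow> real \<Rightarrow> ((real^'n) \<times> real \<Rightarrow> real) \<Rightarrow>
    (real^'n \<Rightarrow> real) \<Rightarrow> ((real^'n) \<times> real \<Rightarrow> real \<Rightarrow> real) \<Rightarrow> bool" where
  "classical_HDD eps delta k \<phi> \<psi> u \<longleftrightarrow>
     (\<exists>ut Du D2u Dw D2w.
        C21_derivs Omega_bar u ut Du D2u \<and> trace_derivs u Dw D2w
      \<and> (\<forall>x\<in>Omega. \<forall>t>0. eps * ut x t - (\<Sum>b\<in>Basis. D2u x t b b) = 0)
      \<and> (\<forall>x'. \<forall>t>0. delta * ut (x', 0) t - k * (\<Sum>b\<in>Basis. D2w x' t b b)
                      - Du (x', 0) t (0, 1) = 0))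
   \<and> continuous_on (Omega \<times> {0..}) (\<lambda>(x,t). u x t)
   \<and> continuous_on (UNIV \<times> {0..}) (\<lambda>(x',t). u (x', 0) t)
   \<and> (\<forall>x\<in>Omega. u x 0 = \<phi> x)
   \<and> (\<forall>x'. u (x', 0) 0 = \<psi> x')"

definition classical_HD :: "real \<Rightarrow> real \<Rightarrow> ((real^'n) \<times> real \<Rightarrow> real) \<Rightarrow>
    (real^'n \<Rightarrow> real) \<Rightarrow> ((real^'n) \<times> real \<Rightarrow> real \<Rightarrow> real) \<Rightarrow> bool" where
  "classical_HD eps delta \<phi> \<psi> u \<longleftrightarrow>
     (\<exists>ut Du D2u.
        C21_derivs Omega u ut Du D2u \<and> C11_derivs Omega_bar u ut Du
      \<and> (\<forall>x\<in>Omega. \<forall>t>0. eps * ut x t - (\<Sum>b\<in>Basis. D2u x t b b) = 0)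
      \<and> (\<forall>x'. \<forall>t>0. delta * ut (x', 0) t - Du (x', 0) t (0, 1) = 0))
   \<and> continuous_on (Omega \<times> {0..}) (\<lambda>(x,t). u x t)
   \<and> continuous_on (UNIV \<times> {0..}) (\<lambda>(x',t). u (x', 0) t)
   \<and> (\<forall>x\<in>Omega. u x 0 = \<phi> x)
   \<and> (\<forall>x'. u (x', 0) 0 = \<psi> x')"

definition sol :: "real \<Rightarrow> real \<Rightarrow> real \<Rightarrow> ((real^'n) \<times> real \<Rightarrow> real) \<Rightarrow>
    (real^'n \<Rightarrow> real) \<Rightarrow> (real^'n) \<times> real \<Rightarrow> real \<Rightarrow> real" where
  "sol eps delta k \<phi> \<psi> x t =
     (if t = 0 then (if snd x = 0 then \<psi> (fst x) else \<phi> x)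
      else integral Omega (\<lambda>y. Gker eps delta k x y t * \<phi> y)
           + delta / eps * integral UNIV (\<lambda>y'. Gker eps delta k x (y', 0) t * \<psi> y'))"

end

theory Submission
  imports Defs "HOL-Probability.Probability"
begin

text \<open>After the substitution $\tau = t\theta$ the function H is an integral over $\theta \in (0,1)$ of products of
  Gaussians that solve the heat equation. Every derivative of the integrand is a polynomial in the coordinates and
  in the inverse diffusion times, times two Gaussians; since the argument $x_N + y_N + \tau/\delta$ stays away
  from 0 when the normal diffusion time degenerates, all of these are dominated by one Gaussian, uniformly in
  $\theta$. This gives smoothness up to the boundary, and the two equations for G follow from the fundamental
  theorem of calculus in $\theta$. Conservation of mass is Tonelli plus the fundamental theorem for the error
  function. Comparing G with the kernel for doubled diffusion times shows that its mass concentrates at x as t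
  tends to 0. Uniqueness is the maximum principle with the barrier $|x|^2 + Lt$; the semigroup law is uniqueness
  applied to a time-shifted kernel.\<close>

section \<open>Integrals depending on parameters\<close>

text \<open>The substitution makes the interval of integration independent of t, so differentiating
  in t produces no boundary term. The delicate end is \<theta> = 1: the normal diffusion time
  t(1-\<theta>)/eps vanishes there, for k = 0 the tangential one as well, and for x and y both on
  the boundary only the shift t\<theta>/delta keeps the integrand regular. Let \<phi>(\<theta>) be
  the integrand without its Jacobian t. The difference \<phi>(1) - \<phi>(0) = -\<phi>(0) gives the
  boundary equation, with a source that the normal derivative of \<open>G0\<close> cancels; the
  function \<theta>\<phi>(\<theta>) vanishes at both ends and gives the heat equation. For the mass,
  the primitive in \<theta> is erf of the shifted normal variable over twice the root of the normal
  diffusion time; it runs from the mass of \<open>G0\<close> at \<theta> = 0 to 1 at \<theta> = 1.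
  The data need not match along the boundary, so continuity at t = 0 is proved separately inside and
  on the boundary. There the interior sources are negligible because their total mass is of order
  sqrt t.\<close>

lemma tendsto_integral_within:
  fixes f :: "'p::metric_space \<Rightarrow> 'b::euclidean_space \<Rightarrow> real"
  assumes ev: "eventually (\<lambda>q. f q integrable_on S \<and> (\<forall>\<omega>\<in>S. \<bar>f q \<omega>\<bar> \<le> h \<omega>)) (at p within P)"
    and h: "h integrable_on S"
    and lim: "\<And>\<omega>. \<omega> \<in> S \<Longrightarrow> ((\<lambda>q. f q \<omega>) \<longlongrightarrow> g \<omega>) (at p within P)"
  shows "((\<lambda>q. integral S (f q)) \<longlongrightarrow> integral S g) (at p within P)"
  unfolding tendsto_at_iff_sequentially
proof (intro allI impI)
  fix X assume X: "\<forall>i. X i \<in> P - {p}" "X \<longlonglongrightarrow> p"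
  have "filterlim X (at p within P) sequentially"
    using X by (auto simp: filterlim_at)
  then have "eventually (\<lambda>n. f (X n) integrable_on S \<and> (\<forall>\<omega>\<in>S. \<bar>f (X n) \<omega>\<bar> \<le> h \<omega>)) sequentially"
    using ev by (auto simp: filterlim_iff)
  then obtain N where N: "\<And>n. n \<ge> N \<Longrightarrow> f (X n) integrable_on S"
      "\<And>n \<omega>. n \<ge> N \<Longrightarrow> \<omega> \<in> S \<Longrightarrow> \<bar>f (X n) \<omega>\<bar> \<le> h \<omega>"
    by (auto simp: eventually_sequentially)
  \<comment> \<open>The bound by \<open>h\<close> is available only from index \<open>N\<close> on,
    hence the shifted sequence; \<open>LIMSEQ_offset\<close> removes the shift.\<close>
  have "(\<lambda>n. integral S (f (X (n + N)))) \<longlonglongrightarrow> integral S g"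
  proof (rule dominated_convergence(2)[OF _ h])
    show "f (X (n + N)) integrable_on S" for n using N by simp
    show "norm (f (X (n + N)) \<omega>) \<le> h \<omega>" if "\<omega> \<in> S" for n \<omega> using N that by simp
    fix \<omega> assume "\<omega> \<in> S"
    from lim[OF this] X have "(\<lambda>n. f (X n) \<omega>) \<longlonglongrightarrow> g \<omega>"
      unfolding tendsto_at_iff_sequentially by (auto simp: o_def)
    then show "(\<lambda>n. f (X (n + N)) \<omega>) \<longlonglongrightarrow> g \<omega>" by (rule LIMSEQ_ignore_initial_segment)
  qed
  then show "((\<lambda>q. integral S (f q)) \<circ> X) \<longlonglongrightarrow> integral S g"
    unfolding o_def by (rule LIMSEQ_offset)
qed

text \<open>Dominated convergence is applied to the normalised Taylor remainder \<open>q\<close>.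
  The mean value inequality on the convex set X \<inter> ball x0 r bounds the increment by
  \<open>g\<close>, and the linear term contributes another \<open>g\<close>. Derivatives are taken
  within X, so that boundary points of the closed half space are covered.\<close>

lemma has_derivative_integral:
  fixes K :: "'b::euclidean_space \<Rightarrow> 'a::euclidean_space \<Rightarrow> real"
  assumes X: "convex X" "x0 \<in> X" and r: "r > 0"
    and der: "\<And>\<omega> x. \<omega> \<in> S \<Longrightarrow> x \<in> X \<Longrightarrow> dist x x0 < r \<Longrightarrow> (K \<omega> has_derivative K' \<omega> x) (at x within X)"
    and bnd: "\<And>\<omega> x v. \<omega> \<in> S \<Longrightarrow> x \<in> X \<Longrightarrow> dist x x0 < r \<Longrightarrow> \<bar>K' \<omega> x v\<bar> \<le> g \<omega> * norm v"
    and g: "g integrable_on S"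
    and K: "\<And>x. x \<in> X \<Longrightarrow> dist x x0 < r \<Longrightarrow> (\<lambda>\<omega>. K \<omega> x) integrable_on S"
    and K': "\<And>v. (\<lambda>\<omega>. K' \<omega> x0 v) integrable_on S"
  shows "((\<lambda>x. integral S (\<lambda>\<omega>. K \<omega> x)) has_derivative (\<lambda>v. integral S (\<lambda>\<omega>. K' \<omega> x0 v))) (at x0 within X)"
  unfolding has_derivative_within
proof
  have lin: "linear (K' \<omega> x0)" if "\<omega> \<in> S" for \<omega>
    using der[OF that X(2)] r by (auto dest: has_derivative_linear)
  have "linear (\<lambda>v. integral S (\<lambda>\<omega>. K' \<omega> x0 v))"
  proof (rule linearI)
    fix v w
    have "integral S (\<lambda>\<omega>. K' \<omega> x0 (v + w)) = integral S (\<lambda>\<omega>. K' \<omega> x0 v + K' \<omega> x0 w)"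
      by (intro integral_cong) (simp add: linear_add[OF lin])
    also have "\<dots> = integral S (\<lambda>\<omega>. K' \<omega> x0 v) + integral S (\<lambda>\<omega>. K' \<omega> x0 w)"
      by (rule Henstock_Kurzweil_Integration.integral_add[OF K' K'])
    finally show "integral S (\<lambda>\<omega>. K' \<omega> x0 (v + w)) =
        integral S (\<lambda>\<omega>. K' \<omega> x0 v) + integral S (\<lambda>\<omega>. K' \<omega> x0 w)" .
  next
    fix c v
    have "integral S (\<lambda>\<omega>. K' \<omega> x0 (c *\<^sub>R v)) = integral S (\<lambda>\<omega>. c *\<^sub>R K' \<omega> x0 v)"
      by (intro integral_cong) (simp add: linear_cmul[OF lin])
    then show "integral S (\<lambda>\<omega>. K' \<omega> x0 (c *\<^sub>R v)) = c *\<^sub>R integral S (\<lambda>\<omega>. K' \<omega> x0 v)" by simp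
  qed
  then show "bounded_linear (\<lambda>v. integral S (\<lambda>\<omega>. K' \<omega> x0 v))"
    by (simp add: linear_conv_bounded_linear)
  define q where "q x \<omega> = (1 / norm (x - x0)) *\<^sub>R (K \<omega> x - (K \<omega> x0 + K' \<omega> x0 (x - x0)))" for x \<omega>
  have K0: "(\<lambda>\<omega>. K \<omega> x0) integrable_on S" using K X r by simp
  have near: "eventually (\<lambda>x. x \<in> X \<and> dist x x0 < r) (at x0 within X)"
    using r by (auto simp: eventually_at)
  have lim: "((\<lambda>x. integral S (q x)) \<longlongrightarrow> integral S (\<lambda>\<omega>. 0)) (at x0 within X)"
  proof (rule tendsto_integral_within)
    show "(\<lambda>\<omega>. 2 * g \<omega>) integrable_on S" using integrable_on_cmult_left[OF g, of 2] by simp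
    show "((\<lambda>x. q x \<omega>) \<longlongrightarrow> 0) (at x0 within X)" if "\<omega> \<in> S" for \<omega>
      using der[OF that X(2)] r unfolding has_derivative_within q_def by auto
    show "eventually (\<lambda>x. q x integrable_on S \<and> (\<forall>\<omega>\<in>S. \<bar>q x \<omega>\<bar> \<le> 2 * g \<omega>)) (at x0 within X)"
      using near
    proof (rule eventually_mono, intro conjI ballI)
      fix x assume x: "x \<in> X \<and> dist x x0 < r"
      show "q x integrable_on S" unfolding q_def
        using x by (intro integrable_cmul integrable_diff integrable_add K K0 K') auto
      fix \<omega> assume w: "\<omega> \<in> S"
      have "norm (K \<omega> x - K \<omega> x0) \<le> g \<omega> * norm (x - x0)"
      proof (rule differentiable_bound)
        show "convex (X \<inter> ball x0 r)" using X by (simp add: convex_Int)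
        show "x \<in> X \<inter> ball x0 r" "x0 \<in> X \<inter> ball x0 r" using x X r by (auto simp: dist_commute)
        fix y assume y: "y \<in> X \<inter> ball x0 r"
        show "(K \<omega> has_derivative K' \<omega> y) (at y within X \<inter> ball x0 r)"
          using der[OF w, of y] y by (auto intro: has_derivative_subset simp: dist_commute)
        show "onorm (K' \<omega> y) \<le> g \<omega>"
          using bnd[OF w, of y] y by (intro onorm_le) (auto simp: dist_commute)
      qed
      moreover have "\<bar>K' \<omega> x0 (x - x0)\<bar> \<le> g \<omega> * norm (x - x0)"
        using bnd[OF w X(2)] r by simp
      ultimately have "\<bar>K \<omega> x - (K \<omega> x0 + K' \<omega> x0 (x - x0))\<bar> \<le> 2 * g \<omega> * norm (x - x0)"
        by simp
      moreover have "0 \<le> g \<omega>" if "x \<noteq> x0"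
        using bnd[OF w X(2), of "x - x0"] r that
        by (smt (verit) dist_self mult_neg_pos right_minus_eq zero_less_norm_iff)
      ultimately show "\<bar>q x \<omega>\<bar> \<le> 2 * g \<omega>"
        using bnd[OF w X(2), of "SOME b. b \<in> Basis"] r SOME_Basis
        by (cases "x = x0") (auto simp: q_def abs_mult divide_simps)
    qed
  qed
  have eq: "eventually (\<lambda>x. integral S (q x) = (1 / norm (x - x0)) *\<^sub>R
      (integral S (\<lambda>\<omega>. K \<omega> x) - (integral S (\<lambda>\<omega>. K \<omega> x0) + integral S (\<lambda>\<omega>. K' \<omega> x0 (x - x0)))))
     (at x0 within X)"
    using near
  proof (rule eventually_mono)
    fix x assume x: "x \<in> X \<and> dist x x0 < r"
    have Kx: "(\<lambda>\<omega>. K \<omega> x) integrable_on S" using K x by simp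
    show "integral S (q x) = (1 / norm (x - x0)) *\<^sub>R
      (integral S (\<lambda>\<omega>. K \<omega> x) - (integral S (\<lambda>\<omega>. K \<omega> x0) + integral S (\<lambda>\<omega>. K' \<omega> x0 (x - x0))))"
      unfolding q_def
      by (subst integral_cmul, subst Henstock_Kurzweil_Integration.integral_diff[OF Kx integrable_add[OF K0 K']],
          subst Henstock_Kurzweil_Integration.integral_add[OF K0 K']) simp
  qed
  show "((\<lambda>x. (1 / norm (x - x0)) *\<^sub>R
      (integral S (\<lambda>\<omega>. K \<omega> x) - (integral S (\<lambda>\<omega>. K \<omega> x0) + integral S (\<lambda>\<omega>. K' \<omega> x0 (x - x0)))))
       \<longlongrightarrow> 0) (at x0 within X)"
    using tendsto_cong[OF eq, of 0] lim by simp
qed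

text \<open>Domination is asked for only near each (x0, t0), since the Gaussian bounds degenerate as
  t tends to 0. The predicate serves both the integrals over \<theta> and the integrals over the
  sources y.\<close>

definition dominated_family ::
    "'b::euclidean_space set \<Rightarrow> 'a::euclidean_space set \<Rightarrow> ('b \<Rightarrow> 'a \<Rightarrow> real \<Rightarrow> real) \<Rightarrow> bool" where
  "dominated_family S X F \<longleftrightarrow>
     (\<forall>x\<in>X. \<forall>t>0. (\<lambda>\<omega>. F \<omega> x t) integrable_on S)
   \<and> (\<forall>\<omega>\<in>S. continuous_on (X \<times> {0<..}) (\<lambda>(x,t). F \<omega> x t))
   \<and> (\<forall>x0\<in>X. \<forall>t0>0. \<exists>r>0. \<exists>g. g integrable_on S \<and>
        (\<forall>\<omega>\<in>S. \<forall>x\<in>X. \<forall>t>0. dist x x0 < r \<longrightarrow> dist t t0 < r \<longrightarrow> \<bar>F \<omega> x t\<bar> \<le> g \<omega>))"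

lemma dominated_familyD:
  assumes "dominated_family S X F"
  shows dominated_family_integrable: "x \<in> X \<Longrightarrow> t > 0 \<Longrightarrow> (\<lambda>\<omega>. F \<omega> x t) integrable_on S"
    and dominated_family_continuous: "\<omega> \<in> S \<Longrightarrow> continuous_on (X \<times> {0<..}) (\<lambda>(x,t). F \<omega> x t)"
    and dominated_family_bound: "x0 \<in> X \<Longrightarrow> t0 > 0 \<Longrightarrow> \<exists>r>0. \<exists>g. g integrable_on S \<and>
        (\<forall>\<omega>\<in>S. \<forall>x\<in>X. \<forall>t>0. dist x x0 < r \<longrightarrow> dist t t0 < r \<longrightarrow> \<bar>F \<omega> x t\<bar> \<le> g \<omega>)"
  using assms unfolding dominated_family_def by auto

lemma continuous_on_integral_dominated:
  assumes F: "dominated_family S X F"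
  shows "continuous_on (X \<times> {0<..}) (\<lambda>(x,t). integral S (\<lambda>\<omega>. F \<omega> x t))"
  unfolding continuous_on_def
proof
  fix p :: "'b \<times> real" assume p: "p \<in> X \<times> {0<..}"
  obtain x0 t0 where p0: "p = (x0, t0)" "x0 \<in> X" "t0 > 0" using p by auto
  obtain r g where r: "r > 0" "g integrable_on S"
    "\<And>\<omega> x t. \<omega> \<in> S \<Longrightarrow> x \<in> X \<Longrightarrow> t > 0 \<Longrightarrow> dist x x0 < r \<Longrightarrow> dist t t0 < r \<Longrightarrow> \<bar>F \<omega> x t\<bar> \<le> g \<omega>"
    using dominated_family_bound[OF F p0(2,3)] by blast
  have "((\<lambda>q. integral S (\<lambda>\<omega>. F \<omega> (fst q) (snd q))) \<longlongrightarrow> integral S (\<lambda>\<omega>. F \<omega> (fst p) (snd p)))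
     (at p within X \<times> {0<..})"
  proof (rule tendsto_integral_within[OF _ r(2)])
    have "eventually (\<lambda>q. q \<in> X \<times> {0<..} \<and> dist q p < r) (at p within X \<times> {0<..})"
      using r by (auto simp: eventually_at)
    then show "eventually (\<lambda>q. (\<lambda>\<omega>. F \<omega> (fst q) (snd q)) integrable_on S \<and>
       (\<forall>\<omega>\<in>S. \<bar>F \<omega> (fst q) (snd q)\<bar> \<le> g \<omega>)) (at p within X \<times> {0<..})"
    proof (rule eventually_mono, intro conjI ballI)
      fix q \<omega> assume q: "q \<in> X \<times> {0<..} \<and> dist q p < r"
      show "(\<lambda>\<omega>. F \<omega> (fst q) (snd q)) integrable_on S"
        using q by (auto intro: dominated_family_integrable[OF F])
      have "dist (fst q) x0 < r" "dist (snd q) t0 < r"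
        using q p0 dist_fst_le[of q p] dist_snd_le[of q p] by auto
      then show "\<bar>F \<omega> (fst q) (snd q)\<bar> \<le> g \<omega>" if "\<omega> \<in> S"
        using q that by (auto intro!: r(3))
    qed
    show "((\<lambda>q. F \<omega> (fst q) (snd q)) \<longlongrightarrow> F \<omega> (fst p) (snd p)) (at p within X \<times> {0<..})" if "\<omega> \<in> S" for \<omega>
      using bspec[OF dominated_family_continuous[OF F that, unfolded continuous_on_def] p]
      by (simp add: split_beta')
  qed
  then show "((\<lambda>(x, t). integral S (\<lambda>\<omega>. F \<omega> x t)) \<longlongrightarrow> (case p of (x, t) \<Rightarrow> integral S (\<lambda>\<omega>. F \<omega> x t)))
     (at p within X \<times> {0<..})"
    by (simp add: split_beta')
qed

text \<open>Domination is known per basis vector. Linearity of \<open>F'\<close> in its last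
  argument expands an arbitrary direction, so the sum of the finitely many dominating functions
  bounds the derivative on the smallest of the radii.\<close>

lemma has_derivative_integral_dominated:
  fixes F :: "'b::euclidean_space \<Rightarrow> 'a::euclidean_space \<Rightarrow> real \<Rightarrow> real"
  assumes X: "convex X" "x0 \<in> X" and t: "t > 0"
    and F: "dominated_family S X F"
    and F': "\<And>b. b \<in> Basis \<Longrightarrow> dominated_family S X (\<lambda>\<omega> x t. F' \<omega> x t b)"
    and der: "\<And>\<omega> x. \<omega> \<in> S \<Longrightarrow> x \<in> X \<Longrightarrow> ((\<lambda>x. F \<omega> x t) has_derivative F' \<omega> x t) (at x within X)"
  shows "((\<lambda>x. integral S (\<lambda>\<omega>. F \<omega> x t)) has_derivative (\<lambda>v. integral S (\<lambda>\<omega>. F' \<omega> x0 t v))) (at x0 within X)"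
proof -
  have "\<forall>b\<in>Basis. \<exists>r>0. \<exists>g. g integrable_on S \<and>
        (\<forall>\<omega>\<in>S. \<forall>x\<in>X. dist x x0 < r \<longrightarrow> \<bar>F' \<omega> x t b\<bar> \<le> g \<omega>)"
  proof
    fix b :: 'a assume b: "b \<in> Basis"
    from dominated_family_bound[OF F'[OF b] X(2) t]
    obtain r g where "r > 0" "g integrable_on S" and
      "\<forall>\<omega>\<in>S. \<forall>x\<in>X. \<forall>s>0. dist x x0 < r \<longrightarrow> dist s t < r \<longrightarrow> \<bar>F' \<omega> x s b\<bar> \<le> g \<omega>"
      by blast
    then show "\<exists>r>0. \<exists>g. g integrable_on S \<and>
        (\<forall>\<omega>\<in>S. \<forall>x\<in>X. dist x x0 < r \<longrightarrow> \<bar>F' \<omega> x t b\<bar> \<le> g \<omega>)"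
      using t by (intro exI[of _ r] conjI exI[of _ g]) auto
  qed
  then obtain r g where r: "\<And>b. b \<in> Basis \<Longrightarrow> r b > (0::real)"
    and g: "\<And>b. b \<in> Basis \<Longrightarrow> g b integrable_on S"
    and le: "\<And>b \<omega> x. b \<in> Basis \<Longrightarrow> \<omega> \<in> S \<Longrightarrow> x \<in> X \<Longrightarrow> dist x x0 < r b \<Longrightarrow> \<bar>F' \<omega> x t b\<bar> \<le> g b \<omega>"
    by metis
  define R where "R = Min (r ` Basis)"
  have R: "R > 0" "\<And>b. b \<in> Basis \<Longrightarrow> R \<le> r b"
    using r by (auto simp: R_def)
  have expand: "F' \<omega> x t v = (\<Sum>b\<in>Basis. (v \<bullet> b) * F' \<omega> x t b)" if "\<omega> \<in> S" "x \<in> X" for \<omega> x v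
  proof -
    have "linear (F' \<omega> x t)" using der[OF that] by (rule has_derivative_linear)
    then have "F' \<omega> x t (\<Sum>b\<in>Basis. (v \<bullet> b) *\<^sub>R b) = (\<Sum>b\<in>Basis. (v \<bullet> b) * F' \<omega> x t b)"
      by (simp add: linear_sum linear_cmul)
    then show ?thesis by (simp add: euclidean_representation)
  qed
  show ?thesis
  proof (rule has_derivative_integral[OF X R(1), where g = "\<lambda>\<omega>. \<Sum>b\<in>Basis. g b \<omega>"])
    show "(\<lambda>\<omega>. \<Sum>b\<in>Basis. g b \<omega>) integrable_on S" using g by (intro integrable_sum) auto
    show "(\<lambda>\<omega>. F \<omega> x t) integrable_on S" if "x \<in> X" for x
      by (rule dominated_family_integrable[OF F that t])
    show "(\<lambda>\<omega>. F' \<omega> x0 t v) integrable_on S" for v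
    proof -
      have "(\<lambda>\<omega>. \<Sum>b\<in>Basis. (v \<bullet> b) * F' \<omega> x0 t b) integrable_on S"
        using dominated_family_integrable[OF F' X(2) t]
        by (intro integrable_sum integrable_on_mult_right) auto
      then show ?thesis
        by (rule integrable_spike[where S = "{}"]) (auto simp: expand X)
    qed
    fix \<omega> x v assume w: "\<omega> \<in> S" "x \<in> X" "dist x x0 < R"
    have "\<bar>F' \<omega> x t v\<bar> \<le> (\<Sum>b\<in>Basis. \<bar>(v \<bullet> b) * F' \<omega> x t b\<bar>)"
      by (subst expand[OF w(1,2)]) (rule sum_abs)
    also have "\<dots> \<le> (\<Sum>b\<in>Basis. norm v * g b \<omega>)"
    proof (rule sum_mono)
      fix b :: 'a assume b: "b \<in> Basis"
      have "\<bar>F' \<omega> x t b\<bar> \<le> g b \<omega>" using le[OF b w(1,2)] w(3) R(2)[OF b] by linarith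
      then show "\<bar>(v \<bullet> b) * F' \<omega> x t b\<bar> \<le> norm v * g b \<omega>"
        using Basis_le_norm[OF b, of v] by (auto simp: abs_mult intro!: mult_mono)
    qed
    finally show "\<bar>F' \<omega> x t v\<bar> \<le> (\<Sum>b\<in>Basis. g b \<omega>) * norm v"
      by (simp add: sum_distrib_left mult.commute)
  qed (use der in auto)
qed

text \<open>The general differentiation lemma is used on the convex set \<open>{0<..}\<close>; this
  set is open, so the derivative within it is the full derivative.\<close>

lemma has_real_derivative_integral_dominated:
  fixes F :: "'b::euclidean_space \<Rightarrow> 'a::euclidean_space \<Rightarrow> real \<Rightarrow> real"
  assumes x: "x \<in> X" and t: "t > 0"
    and F: "dominated_family S X F" and Ft: "dominated_family S X Ft"
    and der: "\<And>\<omega> t. \<omega> \<in> S \<Longrightarrow> t > 0 \<Longrightarrow> ((\<lambda>t. F \<omega> x t) has_real_derivative Ft \<omega> x t) (at t)"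
  shows "((\<lambda>t. integral S (\<lambda>\<omega>. F \<omega> x t)) has_real_derivative integral S (\<lambda>\<omega>. Ft \<omega> x t)) (at t)"
proof -
  from dominated_family_bound[OF Ft x t]
  obtain r g where r: "r > 0" and g: "g integrable_on S" and
    le: "\<And>\<omega> s. \<omega> \<in> S \<Longrightarrow> s > 0 \<Longrightarrow> dist s t < r \<Longrightarrow> \<bar>Ft \<omega> x s\<bar> \<le> g \<omega>"
    using x by (metis dist_self)
  have "((\<lambda>t. integral S (\<lambda>\<omega>. F \<omega> x t)) has_derivative (\<lambda>v. integral S (\<lambda>\<omega>. Ft \<omega> x t * v))) (at t within {0<..})"
  proof (rule has_derivative_integral[OF _ _ r, where g = g and K' = "\<lambda>\<omega> t v. Ft \<omega> x t * v"])
    show "((\<lambda>t. F \<omega> x t) has_derivative (*) (Ft \<omega> x s)) (at s within {0<..})"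
      if "\<omega> \<in> S" "s \<in> {0<..}" for \<omega> s
      using der[OF that(1), of s] that(2)
      by (auto simp: has_field_derivative_def intro: has_derivative_at_withinI)
    show "\<bar>Ft \<omega> x s * v\<bar> \<le> g \<omega> * norm v" if "\<omega> \<in> S" "s \<in> {0<..}" "dist s t < r" for \<omega> s v
      using le[of \<omega> s] that by (auto simp: abs_mult intro!: mult_right_mono)
  qed (use t g x in \<open>auto intro!: integrable_on_mult_left dominated_family_integrable[OF F] dominated_family_integrable[OF Ft]\<close>)
  then have "((\<lambda>t. integral S (\<lambda>\<omega>. F \<omega> x t)) has_derivative (\<lambda>v. integral S (\<lambda>\<omega>. Ft \<omega> x t * v))) (at t)"
    using t by (simp add: at_within_open[of t "{0<..}"])
  moreover have "(\<lambda>v. integral S (\<lambda>\<omega>. Ft \<omega> x t * v)) = (*) (integral S (\<lambda>\<omega>. Ft \<omega> x t))"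
    by auto
  ultimately show ?thesis by (simp add: has_field_derivative_def)
qed

lemma C21_derivs_integral:
  fixes F :: "'b::euclidean_space \<Rightarrow> 'a::euclidean_space \<Rightarrow> real \<Rightarrow> real"
  assumes X: "convex X"
    and C21: "\<And>\<omega>. \<omega> \<in> S \<Longrightarrow> C21_derivs X (F \<omega>) (Ft \<omega>) (DF \<omega>) (D2F \<omega>)"
    and F: "dominated_family S X F" and Ft: "dominated_family S X Ft"
    and DF: "\<And>b. b \<in> Basis \<Longrightarrow> dominated_family S X (\<lambda>\<omega> x t. DF \<omega> x t b)"
    and D2F: "\<And>b c. b \<in> Basis \<Longrightarrow> c \<in> Basis \<Longrightarrow> dominated_family S X (\<lambda>\<omega> x t. D2F \<omega> x t b c)"
  shows "C21_derivs X (\<lambda>x t. integral S (\<lambda>\<omega>. F \<omega> x t)) (\<lambda>x t. integral S (\<lambda>\<omega>. Ft \<omega> x t))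
     (\<lambda>x t v. integral S (\<lambda>\<omega>. DF \<omega> x t v)) (\<lambda>x t b c. integral S (\<lambda>\<omega>. D2F \<omega> x t b c))"
  unfolding C21_derivs_def C11_derivs_def
proof (intro conjI ballI allI impI)
  fix x t assume x: "x \<in> X" and t: "(0::real) < t"
  show "((\<lambda>s. integral S (\<lambda>\<omega>. F \<omega> x s)) has_real_derivative integral S (\<lambda>\<omega>. Ft \<omega> x t)) (at t)"
    using C21 by (intro has_real_derivative_integral_dominated[OF x t F Ft]) (auto simp: C21_derivs_def C11_derivs_def x)
  show "((\<lambda>y. integral S (\<lambda>\<omega>. F \<omega> y t)) has_derivative (\<lambda>v. integral S (\<lambda>\<omega>. DF \<omega> x t v))) (at x within X)"
    using C21 by (intro has_derivative_integral_dominated[OF X x t F DF]) (auto simp: C21_derivs_def C11_derivs_def t)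
  show "((\<lambda>y. integral S (\<lambda>\<omega>. DF \<omega> y t b)) has_derivative (\<lambda>v. integral S (\<lambda>\<omega>. D2F \<omega> x t b v))) (at x within X)"
    if "b \<in> Basis" for b
    using C21 that by (intro has_derivative_integral_dominated[OF X x t DF D2F]) (auto simp: C21_derivs_def C11_derivs_def t)
qed (use F Ft DF D2F in \<open>auto intro!: continuous_on_integral_dominated\<close>)

section \<open>Gaussians times polynomials\<close>

lemma Gam_nonneg: "0 \<le> Gam x s"
  by (simp add: Gam_def)

lemma Gam_pos: "0 < s \<Longrightarrow> 0 < Gam x s"
  by (simp add: Gam_def)

lemma Gam_0 [simp]: "Gam x 0 = 0"
  by (simp add: Gam_def)

lemma Gam_minus [simp]: "Gam (- x) s = Gam x s"
  by (simp add: Gam_def)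

text \<open>Differentiating the logarithm \<open>L\<close> turns the power and the exponential into
  sums, and on the open set of positive times exp \<open>L\<close> is \<open>Gam\<close>. Both
  arguments may move, so that space, time and \<theta> derivatives all come from this one
  formula.\<close>

lemma has_derivative_Gam [derivative_intros]:
  fixes f :: "'p::real_normed_vector \<Rightarrow> 'a::euclidean_space"
  assumes f: "(f has_derivative f') (at x within S)" and g: "(g has_derivative g') (at x within S)"
    and pos: "g x > 0"
  shows "((\<lambda>p. Gam (f p) (g p)) has_derivative
     (\<lambda>v. (g' v * ((f x \<bullet> f x) / (4 * (g x)\<^sup>2) - DIM('a) / (2 * g x)) - (f x \<bullet> f' v) / (2 * g x))
           * Gam (f x) (g x))) (at x within S)"
proof -
  have "((\<lambda>q::'a \<times> real. Gam (fst q) (snd q)) has_derivative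
     (\<lambda>v. (snd v * ((y \<bullet> y) / (4 * s\<^sup>2) - DIM('a) / (2 * s)) - (y \<bullet> fst v) / (2 * s)) * Gam y s)) (at (y, s))"
    if s: "s > 0" for y :: 'a and s :: real
  proof -
    define L where "L q = - (DIM('a) / 2) * ln (4 * pi * snd q) - (fst q \<bullet> fst q) / (4 * snd q)" for q :: "'a \<times> real"
    have Gam_eq: "exp (L q) = Gam (fst q) (snd q)" if "snd q > 0" for q
      using that by (simp add: L_def Gam_def powr_def power2_norm_eq_inner flip: exp_add)
    have "(L has_derivative (\<lambda>v. snd v * ((y \<bullet> y) / (4 * s\<^sup>2) - DIM('a) / (2 * s)) - (y \<bullet> fst v) / (2 * s)))
        (at (y, s))"
    proof -
      have 1: "((\<lambda>q::'a \<times> real. ln (4 * pi * snd q)) has_derivative (\<lambda>v. snd v / s)) (at (y, s))"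
        using s by (auto intro!: derivative_eq_intros simp: field_simps)
      have 2: "((\<lambda>q::'a \<times> real. fst q \<bullet> fst q) has_derivative (\<lambda>v. 2 * (y \<bullet> fst v))) (at (y, s))"
        by (auto intro!: derivative_eq_intros simp: inner_commute)
      have 3: "((\<lambda>q::'a \<times> real. 1 / (4 * snd q)) has_derivative (\<lambda>v. - snd v / (4 * s\<^sup>2))) (at (y, s))"
        using s by (auto intro!: derivative_eq_intros simp: field_simps power2_eq_square)
      have L_eq: "L = (\<lambda>q. - (DIM('a) / 2) * ln (4 * pi * snd q) - (fst q \<bullet> fst q) * (1 / (4 * snd q)))"
        by (simp add: L_def fun_eq_iff)
      show ?thesis unfolding L_eq
        by (rule has_derivative_eq_rhs[OF has_derivative_diff[OF has_derivative_mult_right[OF 1] has_derivative_mult[OF 2 3]]])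
           (use s in \<open>simp add: fun_eq_iff field_simps power2_eq_square\<close>)
    qed
    from has_derivative_exp[OF this]
    have "((\<lambda>q. exp (L q)) has_derivative
       (\<lambda>v. (snd v * ((y \<bullet> y) / (4 * s\<^sup>2) - DIM('a) / (2 * s)) - (y \<bullet> fst v) / (2 * s)) * Gam y s)) (at (y, s))"
      using Gam_eq[of "(y, s)"] s by (simp add: mult.commute)
    then show ?thesis
    proof (rule has_derivative_transform_within_open)
      show "open {q::'a \<times> real. snd q > 0}" by (intro open_Collect_less continuous_intros)
    qed (use s Gam_eq in auto)
  qed
  from has_derivative_compose[OF has_derivative_Pair[OF f g] this[OF pos]] show ?thesis by simp
qed

lemma continuous_on_Gam [continuous_intros]:
  fixes f :: "'p::topological_space \<Rightarrow> 'a::euclidean_space"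
  assumes "continuous_on S f" "continuous_on S g" "\<And>x. x \<in> S \<Longrightarrow> g x > 0"
  shows "continuous_on S (\<lambda>p. Gam (f p) (g p))"
  unfolding Gam_def using assms
  by (intro continuous_intros) (auto dest: order.strict_implies_not_eq[symmetric])

text \<open>The half-integer power is replaced by an integer power of 1 + 1/s, the only form in
  which the singularity at s = 0 enters the growth bounds.\<close>

lemma Gam_prefactor_le:
  fixes s :: real
  assumes "s > 0"
  shows "(4 * pi * s) powr (- real d / 2) \<le> (1 + 1 / s) ^ d"
proof -
  have "1 \<le> 4 * pi" using pi_gt3 by simp
  then have "s \<le> 4 * pi * s" using assms by (simp add: mult_le_cancel_right1)
  then have "1 / (4 * pi * s) \<le> 1 + 1 / s"
    using assms frac_le[of 1 1 s "4 * pi * s"] by linarith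
  moreover have "1 \<le> 1 + 1 / s" using assms by simp
  ultimately have "(1 / (4 * pi * s)) powr (real d / 2) \<le> (1 + 1 / s) powr (real d / 2)"
    using assms by (intro powr_mono2) auto
  also have "\<dots> \<le> (1 + 1 / s) powr real d"
    using assms by (intro powr_mono) auto
  also have "\<dots> = (1 + 1 / s) ^ d"
    using assms by (intro powr_realpow) (simp add: add_pos_pos)
  finally show ?thesis
    using assms by (simp add: powr_minus powr_divide divide_simps)
qed

lemma power_le_fact_exp:
  fixes y :: real
  assumes "y \<ge> 0"
  shows "y ^ m \<le> fact m * exp y"
proof -
  have "y ^ m /\<^sub>R fact m \<le> (\<Sum>n. y ^ n /\<^sub>R fact n)"
    using sum_le_suminf[OF summable_exp_generic[of y], of "{m}"] assms by simp
  then have "y ^ m / fact m \<le> exp y" by (simp add: exp_def divide_inverse_commute)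
  then show ?thesis by (simp add: field_simps)
qed

lemma one_plus_power_le_exp:
  fixes \<kappa> :: real
  assumes "\<kappa> > 0"
  shows "\<exists>C>0. \<forall>y\<ge>0. (1 + y) ^ m \<le> C * exp (\<kappa> * y)"
proof (intro exI conjI allI impI)
  show "0 < fact m * exp \<kappa> / \<kappa> ^ m" using assms by simp
  fix y :: real assume "y \<ge> 0"
  then have "(\<kappa> * (1 + y)) ^ m \<le> fact m * exp (\<kappa> * (1 + y))"
    using assms by (intro power_le_fact_exp) simp
  then show "(1 + y) ^ m \<le> fact m * exp \<kappa> / \<kappa> ^ m * exp (\<kappa> * y)"
    unfolding power_mult_distrib
    using assms by (simp add: distrib_left[of \<kappa> 1] exp_add pos_le_divide_eq mult_ac)
qed

lemma one_plus_power_le_exp_square: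
  fixes \<kappa> :: real
  assumes "\<kappa> > 0"
  shows "\<exists>C>0. \<forall>y\<ge>0. (1 + y) ^ m \<le> C * exp (\<kappa> * y\<^sup>2)"
proof -
  obtain C where C: "C > 0" "\<And>y. y \<ge> 0 \<Longrightarrow> (1 + y) ^ m \<le> C * exp (\<kappa> * y)"
    using one_plus_power_le_exp[OF assms] by blast
  have "(1 + y) ^ m \<le> (2 ^ m * C) * exp (\<kappa> * y\<^sup>2)" if "y \<ge> 0" for y :: real
  proof -
    have "0 \<le> (y - 1)\<^sup>2 + 3 * y\<^sup>2 + 1" by simp
    then have "1 + y \<le> 2 * (1 + y\<^sup>2)" by (simp add: power2_eq_square algebra_simps)
    then have "(1 + y) ^ m \<le> (2 * (1 + y\<^sup>2)) ^ m" using that by (intro power_mono) auto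
    also have "\<dots> = 2 ^ m * (1 + y\<^sup>2) ^ m" by (rule power_mult_distrib)
    also have "\<dots> \<le> 2 ^ m * (C * exp (\<kappa> * y\<^sup>2))" using C(2)[of "y\<^sup>2"] by simp
    finally show ?thesis by simp
  qed
  then show ?thesis using C(1) by (intro exI[of _ "2 ^ m * C"]) auto
qed

text \<open>A small s is harmless if \<xi> stays away from 0: with y = 1/s the factor exp(-c^2 y /
  8) absorbs every power of 1 + y. The two cases of the disjunction will be the two halves of the
  \<theta>-interval.\<close>

lemma singular_time_bound:
  fixes c :: real
  assumes "c > 0"
  shows "\<exists>C>0. \<forall>s>0. \<forall>\<xi>. s \<ge> c \<or> \<xi> \<ge> c \<longrightarrow> (1 + 1 / s) ^ m * exp (- \<xi>\<^sup>2 / (8 * s)) \<le> C"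
proof -
  obtain C where C: "C > 0" "\<And>y. y \<ge> 0 \<Longrightarrow> (1 + y) ^ m \<le> C * exp (c\<^sup>2 / 8 * y)"
    using one_plus_power_le_exp[of "c\<^sup>2 / 8" m] assms by auto
  have "(1 + 1 / s) ^ m * exp (- \<xi>\<^sup>2 / (8 * s)) \<le> max C ((1 + 1 / c) ^ m)"
    if s: "s > 0" and "s \<ge> c \<or> \<xi> \<ge> c" for s \<xi> :: real
    using that(2)
  proof
    assume "s \<ge> c"
    then have "(1 + 1 / s) ^ m \<le> (1 + 1 / c) ^ m"
      using assms by (intro power_mono add_left_mono frac_le) auto
    moreover have "exp (- \<xi>\<^sup>2 / (8 * s)) \<le> 1" using s by simp
    ultimately have "(1 + 1 / s) ^ m * exp (- \<xi>\<^sup>2 / (8 * s)) \<le> (1 + 1 / c) ^ m * 1"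
      using s assms by (intro mult_mono) auto
    then show ?thesis by simp
  next
    assume "\<xi> \<ge> c"
    then have "c\<^sup>2 \<le> \<xi>\<^sup>2" using assms by (intro power_mono) auto
    then have "- \<xi>\<^sup>2 / (8 * s) \<le> - (c\<^sup>2 / 8 * (1 / s))"
      using s by (simp add: divide_simps)
    then have "(1 + 1 / s) ^ m * exp (- \<xi>\<^sup>2 / (8 * s)) \<le>
        (C * exp (c\<^sup>2 / 8 * (1 / s))) * exp (- (c\<^sup>2 / 8 * (1 / s)))"
      using s C(1) C(2)[of "1 / s"] by (intro mult_mono) auto
    also have "\<dots> = C * (exp (c\<^sup>2 / 8 * (1 / s)) * exp (- (c\<^sup>2 / 8 * (1 / s))))"
      by (simp only: mult.assoc)
    also have "\<dots> = C" by (simp flip: exp_add)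
    finally show ?thesis by simp
  qed
  moreover have "0 < max C ((1 + 1 / c) ^ m)" using C by simp
  ultimately show ?thesis by blast
qed

section \<open>Polynomially growing coefficients against a Gaussian weight\<close>

locale gauss_weight =
  fixes D :: "'p::topological_space set" and T Q E W :: "'p \<Rightarrow> real"
  assumes Q_ge_1: "\<And>p. p \<in> D \<Longrightarrow> 1 \<le> Q p"
    and E_nonneg: "\<And>p. 0 \<le> E p"
    and continuous_E: "continuous_on D E"
    and weight_bound: "\<And>(m::nat) t1 t2. t1 > 0 \<Longrightarrow>
      \<exists>C. \<exists>c>0. \<forall>p\<in>D. T p \<in> {t1..t2} \<longrightarrow> E p * Q p ^ m \<le> C * exp (- c * (W p)\<^sup>2)"
begin

definition poly_growth :: "('p \<Rightarrow> real) \<Rightarrow> bool" where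
  "poly_growth R \<longleftrightarrow> continuous_on D R \<and>
     (\<exists>m. \<forall>t1>0. \<forall>t2. \<exists>C\<ge>0. \<forall>p\<in>D. T p \<in> {t1..t2} \<longrightarrow> \<bar>R p\<bar> \<le> C * Q p ^ m)"

text \<open>All derivatives of the kernels lie in this class. Membership follows from introduction
  rules alone, so no derivative has to be estimated by hand.\<close>

definition gauss_poly :: "('p \<Rightarrow> real) \<Rightarrow> bool" where
  "gauss_poly K \<longleftrightarrow> (\<exists>R. poly_growth R \<and> (\<forall>p\<in>D. K p = R p * E p))"

lemma poly_growthI:
  assumes "continuous_on D R"
    "\<And>t1 t2. t1 > 0 \<Longrightarrow> \<exists>C\<ge>0. \<forall>p\<in>D. T p \<in> {t1..t2} \<longrightarrow> \<bar>R p\<bar> \<le> C * Q p ^ m"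
  shows "poly_growth R"
  using assms unfolding poly_growth_def by blast

lemma poly_growth_bound1:
  assumes "continuous_on D R" "\<And>p. p \<in> D \<Longrightarrow> \<bar>R p\<bar> \<le> c * Q p" "c \<ge> 0"
  shows "poly_growth R"
  using assms by (intro poly_growthI[of R 1]) auto

lemma poly_growth_const: "poly_growth (\<lambda>p. c)"
  by (rule poly_growthI[of _ 0]) (auto intro: exI[of _ "\<bar>c\<bar>"])

lemma poly_growth_add:
  assumes "poly_growth R" "poly_growth S"
  shows "poly_growth (\<lambda>p. R p + S p)"
proof -
  obtain m where R: "continuous_on D R"
    "\<And>t1 t2. t1 > 0 \<Longrightarrow> \<exists>C\<ge>0. \<forall>p\<in>D. T p \<in> {t1..t2} \<longrightarrow> \<bar>R p\<bar> \<le> C * Q p ^ m"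
    using assms(1) unfolding poly_growth_def by blast
  obtain n where S: "continuous_on D S"
    "\<And>t1 t2. t1 > 0 \<Longrightarrow> \<exists>C\<ge>0. \<forall>p\<in>D. T p \<in> {t1..t2} \<longrightarrow> \<bar>S p\<bar> \<le> C * Q p ^ n"
    using assms(2) unfolding poly_growth_def by blast
  show ?thesis
  proof (rule poly_growthI[of _ "m + n"])
    show "continuous_on D (\<lambda>p. R p + S p)" using R S by (intro continuous_intros) auto
    fix t1 t2 :: real assume t1: "t1 > 0"
    obtain C1 C2 where C: "C1 \<ge> 0" "C2 \<ge> 0"
      "\<And>p. p \<in> D \<Longrightarrow> T p \<in> {t1..t2} \<Longrightarrow> \<bar>R p\<bar> \<le> C1 * Q p ^ m"
      "\<And>p. p \<in> D \<Longrightarrow> T p \<in> {t1..t2} \<Longrightarrow> \<bar>S p\<bar> \<le> C2 * Q p ^ n"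
      using R(2)[OF t1, of t2] S(2)[OF t1, of t2] by blast
    have "\<bar>R p + S p\<bar> \<le> (C1 + C2) * Q p ^ (m + n)" if p: "p \<in> D" "T p \<in> {t1..t2}" for p
    proof -
      have "Q p ^ m \<le> Q p ^ (m + n)" "Q p ^ n \<le> Q p ^ (m + n)"
        using Q_ge_1[OF p(1)] by (auto intro: power_increasing)
      then have "C1 * Q p ^ m \<le> C1 * Q p ^ (m + n)" "C2 * Q p ^ n \<le> C2 * Q p ^ (m + n)"
        using C by (auto intro: mult_left_mono)
      then show ?thesis using C(3,4)[OF p] by (simp add: algebra_simps)
    qed
    then show "\<exists>C\<ge>0. \<forall>p\<in>D. T p \<in> {t1..t2} \<longrightarrow> \<bar>R p + S p\<bar> \<le> C * Q p ^ (m + n)"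
      using C by (intro exI[of _ "C1 + C2"]) auto
  qed
qed

lemma poly_growth_mult:
  assumes "poly_growth R" "poly_growth S"
  shows "poly_growth (\<lambda>p. R p * S p)"
proof -
  obtain m where R: "continuous_on D R"
    "\<And>t1 t2. t1 > 0 \<Longrightarrow> \<exists>C\<ge>0. \<forall>p\<in>D. T p \<in> {t1..t2} \<longrightarrow> \<bar>R p\<bar> \<le> C * Q p ^ m"
    using assms(1) unfolding poly_growth_def by blast
  obtain n where S: "continuous_on D S"
    "\<And>t1 t2. t1 > 0 \<Longrightarrow> \<exists>C\<ge>0. \<forall>p\<in>D. T p \<in> {t1..t2} \<longrightarrow> \<bar>S p\<bar> \<le> C * Q p ^ n"
    using assms(2) unfolding poly_growth_def by blast
  show ?thesis
  proof (rule poly_growthI[of _ "m + n"])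
    show "continuous_on D (\<lambda>p. R p * S p)" using R S by (intro continuous_intros) auto
    fix t1 t2 :: real assume t1: "t1 > 0"
    obtain C1 C2 where C: "C1 \<ge> 0" "C2 \<ge> 0"
      "\<And>p. p \<in> D \<Longrightarrow> T p \<in> {t1..t2} \<Longrightarrow> \<bar>R p\<bar> \<le> C1 * Q p ^ m"
      "\<And>p. p \<in> D \<Longrightarrow> T p \<in> {t1..t2} \<Longrightarrow> \<bar>S p\<bar> \<le> C2 * Q p ^ n"
      using R(2)[OF t1, of t2] S(2)[OF t1, of t2] by blast
    have "\<bar>R p * S p\<bar> \<le> (C1 * C2) * Q p ^ (m + n)" if p: "p \<in> D" "T p \<in> {t1..t2}" for p
    proof -
      have "\<bar>R p\<bar> * \<bar>S p\<bar> \<le> (C1 * Q p ^ m) * (C2 * Q p ^ n)"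
        using C(1,3,4) p by (intro mult_mono) (auto intro: order_trans[OF abs_ge_zero])
      then show ?thesis by (simp add: abs_mult power_add algebra_simps)
    qed
    then show "\<exists>C\<ge>0. \<forall>p\<in>D. T p \<in> {t1..t2} \<longrightarrow> \<bar>R p * S p\<bar> \<le> C * Q p ^ (m + n)"
      using C by (intro exI[of _ "C1 * C2"]) auto
  qed
qed

lemma poly_growth_minus: "poly_growth R \<Longrightarrow> poly_growth (\<lambda>p. - R p)"
  using poly_growth_mult[OF poly_growth_const[of "-1"], of R] by simp

lemma poly_growth_diff: "poly_growth R \<Longrightarrow> poly_growth S \<Longrightarrow> poly_growth (\<lambda>p. R p - S p)"
  using poly_growth_add[OF _ poly_growth_minus, of R S] by simp

lemma poly_growth_power: "poly_growth R \<Longrightarrow> poly_growth (\<lambda>p. R p ^ n)"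
  by (induction n) (auto intro: poly_growth_const poly_growth_mult)

lemma gauss_polyI: "poly_growth R \<Longrightarrow> (\<And>p. p \<in> D \<Longrightarrow> K p = R p * E p) \<Longrightarrow> gauss_poly K"
  unfolding gauss_poly_def by blast

lemma gauss_poly_mult: "poly_growth R \<Longrightarrow> gauss_poly K \<Longrightarrow> gauss_poly (\<lambda>p. R p * K p)"
proof -
  assume R: "poly_growth R" and "gauss_poly K"
  then obtain S where "poly_growth S" "\<forall>p\<in>D. K p = S p * E p"
    unfolding gauss_poly_def by blast
  then show ?thesis by (intro gauss_polyI[OF poly_growth_mult[OF R, of S]]) auto
qed

lemma gauss_poly_add:
  assumes "gauss_poly K" "gauss_poly L"
  shows "gauss_poly (\<lambda>p. K p + L p)"
proof -
  obtain R S where "poly_growth R" "\<forall>p\<in>D. K p = R p * E p" "poly_growth S" "\<forall>p\<in>D. L p = S p * E p"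
    using assms unfolding gauss_poly_def by blast
  then show ?thesis
    by (intro gauss_polyI[OF poly_growth_add[of R S]]) (auto simp: distrib_right)
qed

lemma gauss_poly_continuous:
  assumes "gauss_poly K"
  shows "continuous_on D K"
proof -
  obtain R where R: "poly_growth R" "\<forall>p\<in>D. K p = R p * E p"
    using assms unfolding gauss_poly_def by blast
  have "continuous_on D (\<lambda>p. R p * E p)"
    using R(1) by (intro continuous_intros continuous_E) (simp add: poly_growth_def)
  then show ?thesis by (rule continuous_on_eq) (use R in auto)
qed

text \<open>\<open>weight_bound\<close> pays for the power of \<open>Q\<close> with part of the
  decay of \<open>E\<close>, which leaves a Gaussian in \<open>W\<close> alone.\<close>

lemma gauss_poly_bound:
  assumes "gauss_poly K" "t1 > 0"
  shows "\<exists>C\<ge>0. \<exists>c>0. \<forall>p\<in>D. T p \<in> {t1..t2} \<longrightarrow> \<bar>K p\<bar> \<le> C * exp (- c * (W p)\<^sup>2)"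
proof -
  obtain R m where R: "\<forall>p\<in>D. K p = R p * E p" and
    bR: "\<And>t1 t2. t1 > 0 \<Longrightarrow> \<exists>C\<ge>0. \<forall>p\<in>D. T p \<in> {t1..t2} \<longrightarrow> \<bar>R p\<bar> \<le> C * Q p ^ m"
    using assms unfolding gauss_poly_def poly_growth_def by blast
  obtain C1 where C1: "C1 \<ge> 0" "\<And>p. p \<in> D \<Longrightarrow> T p \<in> {t1..t2} \<Longrightarrow> \<bar>R p\<bar> \<le> C1 * Q p ^ m"
    using bR[OF assms(2), of t2] by blast
  obtain C2 c where C2: "c > 0" "\<And>p. p \<in> D \<Longrightarrow> T p \<in> {t1..t2} \<Longrightarrow> E p * Q p ^ m \<le> C2 * exp (- c * (W p)\<^sup>2)"
    using weight_bound[OF assms(2), of t2 m] by blast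
  have "\<bar>K p\<bar> \<le> C1 * \<bar>C2\<bar> * exp (- c * (W p)\<^sup>2)" if p: "p \<in> D" "T p \<in> {t1..t2}" for p
  proof -
    have "\<bar>K p\<bar> = \<bar>R p\<bar> * E p" using R p E_nonneg[of p] by (simp add: abs_mult)
    also have "\<dots> \<le> (C1 * Q p ^ m) * E p" using C1(2)[OF p] E_nonneg[of p] by (intro mult_right_mono)
    also have "\<dots> = C1 * (E p * Q p ^ m)" by simp
    also have "\<dots> \<le> C1 * (C2 * exp (- c * (W p)\<^sup>2))" using C1(1) C2(2)[OF p] by (intro mult_left_mono)
    also have "\<dots> \<le> C1 * (\<bar>C2\<bar> * exp (- c * (W p)\<^sup>2))" using C1(1) by (intro mult_left_mono mult_right_mono) auto
    finally show ?thesis by simp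
  qed
  then show ?thesis using C1 C2 by (intro exI[of _ "C1 * \<bar>C2\<bar>"] conjI exI[of _ c]) auto
qed

lemmas poly_growth_intros = poly_growth_const poly_growth_add poly_growth_mult poly_growth_minus
  poly_growth_diff poly_growth_power

end

section \<open>Derivatives of the heat kernel\<close>

text \<open>Here and in the following definitions the coefficients are spelled as polynomials in the
  coordinates and in \<open>1 / s\<close>, so that the growth rules match them
  syntactically.\<close>

definition gauss_grad :: "'a::euclidean_space \<Rightarrow> real \<Rightarrow> 'a \<Rightarrow> real" where
  "gauss_grad x s v = - (1/2) * (x \<bullet> v) * (1 / s) * Gam x s"

definition gauss_hess :: "'a::euclidean_space \<Rightarrow> real \<Rightarrow> 'a \<Rightarrow> 'a \<Rightarrow> real" where
  "gauss_hess x s v u = ((1/4) * (x \<bullet> v) * (x \<bullet> u) * (1 / s)\<^sup>2 - (1/2) * (v \<bullet> u) * (1 / s)) * Gam x s"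

definition gauss_laplace :: "'a::euclidean_space \<Rightarrow> real \<Rightarrow> real" where
  "gauss_laplace x s = ((1/4) * (x \<bullet> x) * (1 / s)\<^sup>2 - (DIM('a) / 2) * (1 / s)) * Gam x s"

text \<open>This is -2 times the spatial derivative of the one-dimensional kernel and thus absorbs
  the factor -2 of \<open>Hker\<close>. At s = 0 it equals 0, because \<open>1 / 0\<close> and
  \<open>Gam \<xi> 0\<close> are both 0.\<close>

definition flux :: "real \<Rightarrow> real \<Rightarrow> real" where
  "flux \<xi> s = \<xi> * (1 / s) * Gam \<xi> s"

definition flux1 :: "real \<Rightarrow> real \<Rightarrow> real" where
  "flux1 \<xi> s = (1 / s - (1/2) * \<xi>\<^sup>2 * (1 / s)\<^sup>2) * Gam \<xi> s"

text \<open>At once the second spatial derivative and the time derivative of \<open>flux\<close>,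
  which as a derivative of the heat kernel solves the heat equation.\<close>

definition flux2 :: "real \<Rightarrow> real \<Rightarrow> real" where
  "flux2 \<xi> s = ((1/4) * \<xi> ^ 3 * (1 / s) ^ 3 - (3/2) * \<xi> * (1 / s)\<^sup>2) * Gam \<xi> s"

lemma flux_nonneg: "0 \<le> \<xi> \<Longrightarrow> 0 \<le> s \<Longrightarrow> 0 \<le> flux \<xi> s"
  by (simp add: flux_def Gam_nonneg)

lemma flux_pos: "0 < \<xi> \<Longrightarrow> 0 < s \<Longrightarrow> 0 < flux \<xi> s"
  by (simp add: flux_def Gam_pos)

lemma flux_0 [simp]: "flux \<xi> 0 = 0"
  by (simp add: flux_def)

lemma sum_gauss_hess: "(\<Sum>b\<in>Basis. gauss_hess x s b b) = gauss_laplace x s"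
proof -
  have "(\<Sum>b\<in>Basis. gauss_hess x s b b) =
      (\<Sum>b\<in>Basis. (x \<bullet> b) * (x \<bullet> b) * ((1/4) * (1 / s)\<^sup>2 * Gam x s) - (1/2) * (1 / s) * Gam x s)"
    by (intro sum.cong) (auto simp: gauss_hess_def algebra_simps)
  also have "\<dots> = (x \<bullet> x) * ((1/4) * (1 / s)\<^sup>2 * Gam x s) - DIM('a) * ((1/2) * (1 / s) * Gam x s)"
    by (simp add: sum_subtractf sum_distrib_right euclidean_inner[of x x])
  finally show ?thesis by (simp add: gauss_laplace_def algebra_simps)
qed

lemma has_derivative_Gam_space:
  assumes "(f has_derivative f') (at x within S)" "s > 0"
  shows "((\<lambda>p. Gam (f p) s) has_derivative (\<lambda>u. gauss_grad (f x) s (f' u))) (at x within S)"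
  by (rule has_derivative_eq_rhs[OF has_derivative_Gam[OF assms(1) has_derivative_const assms(2)]])
     (use assms in \<open>simp add: gauss_grad_def fun_eq_iff field_simps\<close>)

lemma has_derivative_gauss_grad:
  assumes f: "(f has_derivative f') (at x within S)" and s: "s > 0"
  shows "((\<lambda>p. gauss_grad (f p) s v) has_derivative (\<lambda>u. gauss_hess (f x) s v (f' u))) (at x within S)"
proof -
  have "((\<lambda>p. - (1/2) * (1 / s) * (f p \<bullet> v)) has_derivative (\<lambda>u. - (1/2) * (1 / s) * (f' u \<bullet> v))) (at x within S)"
    by (intro has_derivative_mult_right has_derivative_inner_left f)
  from has_derivative_mult[OF this has_derivative_Gam_space[OF f s]] show ?thesis
    by (simp add: gauss_grad_def gauss_hess_def mult_ac) 
       (erule has_derivative_eq_rhs, simp add: fun_eq_iff power2_eq_square inner_commute algebra_simps)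
qed

lemma Gam_has_real_derivative_time:
  assumes "(g has_real_derivative g') (at t within S)" "g t > 0"
  shows "((\<lambda>t. Gam x (g t)) has_real_derivative g' * gauss_laplace x (g t)) (at t within S)"
  unfolding has_field_derivative_def
  by (rule has_derivative_eq_rhs[OF has_derivative_Gam[OF has_derivative_const assms(1)[unfolded has_field_derivative_def] assms(2)]])
     (use assms in \<open>simp add: gauss_laplace_def fun_eq_iff field_simps power2_eq_square\<close>)

text \<open>The case s = 0 is included because the integral in \<open>Hker\<close> runs over a
  closed interval whose right end has normal diffusion time 0.\<close>

lemma dGam1_eq_flux:
  assumes "s \<ge> 0"
  shows "dGam1 \<xi> s = - (1/2) * flux \<xi> s"
proof (cases "s = 0")
  case False
  then have "((\<lambda>z. Gam z s) has_derivative (\<lambda>u. gauss_grad \<xi> s u)) (at \<xi>)"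
    using has_derivative_Gam_space[OF has_derivative_ident, of s \<xi> UNIV] assms by (simp add: fun_eq_iff)
  then have "((\<lambda>z. Gam z s) has_real_derivative - (1/2) * flux \<xi> s) (at \<xi>)"
    unfolding has_field_derivative_def
    by (rule has_derivative_eq_rhs) (simp add: fun_eq_iff gauss_grad_def flux_def)
  then show ?thesis by (simp add: dGam1_def DERIV_imp_deriv)
qed (simp add: dGam1_def)

lemma has_derivative_one_divide:
  fixes g :: "'p::real_normed_vector \<Rightarrow> real"
  assumes g: "(g has_derivative g') (at x within S)" and s: "g x \<noteq> 0"
  shows "((\<lambda>p. 1 / g p) has_derivative (\<lambda>u. - g' u * (1 / g x)\<^sup>2)) (at x within S)"
  using Deriv.has_derivative_inverse[OF s g]
  by (simp add: inverse_eq_divide power2_eq_square)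

lemma has_derivative_flux:
  fixes f g :: "'p::real_normed_vector \<Rightarrow> real"
  assumes f: "(f has_derivative f') (at x within S)" and g: "(g has_derivative g') (at x within S)"
    and s: "g x > 0"
  shows "((\<lambda>p. flux (f p) (g p)) has_derivative
     (\<lambda>u. f' u * flux1 (f x) (g x) + g' u * flux2 (f x) (g x))) (at x within S)"
proof -
  have "g x \<noteq> 0" using s by simp
  from has_derivative_mult[OF has_derivative_mult[OF f has_derivative_one_divide[OF g this]] has_derivative_Gam[OF f g s]]
  show ?thesis
    unfolding flux_def
    by (rule has_derivative_eq_rhs)
       (use s in \<open>simp add: flux1_def flux2_def fun_eq_iff field_simps power2_eq_square power3_eq_cube\<close>)
qed

lemma has_derivative_flux1:
  fixes f :: "'p::real_normed_vector \<Rightarrow> real"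
  assumes f: "(f has_derivative f') (at x within S)" and s: "s > 0"
  shows "((\<lambda>p. flux1 (f p) s) has_derivative (\<lambda>u. f' u * flux2 (f x) s)) (at x within S)"
proof -
  have "((\<lambda>p. 1 / s - (1/2) * (f p)\<^sup>2 * (1 / s)\<^sup>2) has_derivative (\<lambda>u. - f x * f' u * (1 / s)\<^sup>2)) (at x within S)"
    by (auto intro!: derivative_eq_intros f)
  from has_derivative_mult[OF this has_derivative_Gam_space[OF f s]] show ?thesis
    unfolding flux1_def
    by (rule has_derivative_eq_rhs)
       (use s in \<open>simp add: gauss_grad_def flux2_def fun_eq_iff field_simps power2_eq_square power3_eq_cube\<close>)
qed

text \<open>The integrand of H after the substitution. The point w stands for
  \<open>x - refl y\<close>, the leading t is the Jacobian, and a, b, c are the tangential diffusion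
  time, the normal diffusion time and the normal shift, each per unit of t.\<close>

definition slab :: "real \<Rightarrow> real \<Rightarrow> real \<Rightarrow> (real^'n) \<times> real \<Rightarrow> real \<Rightarrow> real" where
  "slab a b c w t = t * (Gam (fst w) (t * a) * flux (snd w + t * c) (t * b))"

definition slab_grad :: "real \<Rightarrow> real \<Rightarrow> real \<Rightarrow> (real^'n) \<times> real \<Rightarrow> real \<Rightarrow> (real^'n) \<times> real \<Rightarrow> real" where
  "slab_grad a b c w t v =
     t * (gauss_grad (fst w) (t * a) (fst v) * flux (snd w + t * c) (t * b)
        + snd v * (Gam (fst w) (t * a) * flux1 (snd w + t * c) (t * b)))"

definition slab_hess ::
    "real \<Rightarrow> real \<Rightarrow> real \<Rightarrow> (real^'n) \<times> real \<Rightarrow> real \<Rightarrow> (real^'n) \<times> real \<Rightarrow> (real^'n) \<times> real \<Rightarrow> real" where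
  "slab_hess a b c w t v u =
     t * (gauss_hess (fst w) (t * a) (fst v) (fst u) * flux (snd w + t * c) (t * b)
        + snd u * (gauss_grad (fst w) (t * a) (fst v) * flux1 (snd w + t * c) (t * b))
        + snd v * (gauss_grad (fst w) (t * a) (fst u) * flux1 (snd w + t * c) (t * b))
        + snd v * snd u * (Gam (fst w) (t * a) * flux2 (snd w + t * c) (t * b)))"

text \<open>The variable t occurs in the Jacobian, in both diffusion times and in the shift, which
  gives four summands. Time derivatives of the factors appear as second spatial derivatives.\<close>

definition slab_time :: "real \<Rightarrow> real \<Rightarrow> real \<Rightarrow> (real^'n) \<times> real \<Rightarrow> real \<Rightarrow> real" where
  "slab_time a b c w t =
     Gam (fst w) (t * a) * flux (snd w + t * c) (t * b)
      + t * (a * (gauss_laplace (fst w) (t * a) * flux (snd w + t * c) (t * b))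
           + c * (Gam (fst w) (t * a) * flux1 (snd w + t * c) (t * b))
           + b * (Gam (fst w) (t * a) * flux2 (snd w + t * c) (t * b)))"

lemma slab_has_derivative:
  assumes "t > 0" "a > 0" "b > 0"
  shows "((\<lambda>w. slab a b c w t) has_derivative slab_grad a b c w t) (at w within X)"
proof -
  have ab: "t * a > 0" "t * b > 0" using assms by auto
  have f: "(fst has_derivative fst) (at w within X)"
    and s: "((\<lambda>w. snd w + t * c) has_derivative snd) (at w within X)"
    by (auto intro!: derivative_eq_intros)
  from has_derivative_mult_right[OF has_derivative_mult[OF has_derivative_Gam_space[OF f ab(1)]
      has_derivative_flux[OF s has_derivative_const ab(2)]], of t]
  show ?thesis
    unfolding slab_def by (rule has_derivative_eq_rhs) (simp add: slab_grad_def fun_eq_iff algebra_simps)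
qed

lemma slab_grad_has_derivative:
  assumes "t > 0" "a > 0" "b > 0"
  shows "((\<lambda>w. slab_grad a b c w t v) has_derivative slab_hess a b c w t v) (at w within X)"
proof -
  have ab: "t * a > 0" "t * b > 0" using assms by auto
  have f: "(fst has_derivative fst) (at w within X)"
    and s: "((\<lambda>w. snd w + t * c) has_derivative snd) (at w within X)"
    by (auto intro!: derivative_eq_intros)
  have 1: "((\<lambda>w. gauss_grad (fst w) (t * a) (fst v) * flux (snd w + t * c) (t * b)) has_derivative
      (\<lambda>u. gauss_grad (fst w) (t * a) (fst v) * (snd u * flux1 (snd w + t * c) (t * b))
        + gauss_hess (fst w) (t * a) (fst v) (fst u) * flux (snd w + t * c) (t * b))) (at w within X)"
    by (rule has_derivative_eq_rhs[OF has_derivative_mult[OF has_derivative_gauss_grad[OF f ab(1)]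
      has_derivative_flux[OF s has_derivative_const ab(2)]]]) simp
  have 2: "((\<lambda>w. Gam (fst w) (t * a) * flux1 (snd w + t * c) (t * b)) has_derivative
      (\<lambda>u. Gam (fst w) (t * a) * (snd u * flux2 (snd w + t * c) (t * b))
        + gauss_grad (fst w) (t * a) (fst u) * flux1 (snd w + t * c) (t * b))) (at w within X)"
    by (rule has_derivative_mult[OF has_derivative_Gam_space[OF f ab(1)] has_derivative_flux1[OF s ab(2)]])
  from has_derivative_mult_right[OF has_derivative_add[OF 1 has_derivative_mult_right[OF 2, of "snd v"]], of t]
  show ?thesis
    unfolding slab_grad_def by (rule has_derivative_eq_rhs) (simp add: slab_hess_def fun_eq_iff algebra_simps)
qed

lemma slab_has_real_derivative:
  assumes "t > 0" "a > 0" "b > 0"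
  shows "((\<lambda>t. slab a b c w t) has_real_derivative slab_time a b c w t) (at t)"
proof -
  have 1: "((\<lambda>t. Gam (fst w) (t * a)) has_real_derivative a * gauss_laplace (fst w) (t * a)) (at t)"
    using assms by (intro Gam_has_real_derivative_time) (auto intro!: derivative_eq_intros)
  have "((\<lambda>t. flux (snd w + t * c) (t * b)) has_derivative
     (\<lambda>u. (u * c) * flux1 (snd w + t * c) (t * b) + (u * b) * flux2 (snd w + t * c) (t * b))) (at t)"
    using assms by (intro has_derivative_flux) (auto intro!: derivative_eq_intros)
  then have 2: "((\<lambda>t. flux (snd w + t * c) (t * b)) has_real_derivative
     (c * flux1 (snd w + t * c) (t * b) + b * flux2 (snd w + t * c) (t * b))) (at t)"
    unfolding has_field_derivative_def by (rule has_derivative_eq_rhs) (simp add: fun_eq_iff algebra_simps)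
  show ?thesis
    unfolding slab_def
    by (rule DERIV_cong[OF DERIV_mult[OF DERIV_ident DERIV_mult[OF 1 2]]])
       (simp add: slab_time_def algebra_simps)
qed

section \<open>The boundary layer kernel\<close>

definition gauss_bounded :: "'a::euclidean_space set \<Rightarrow> ('a \<Rightarrow> real \<Rightarrow> real) \<Rightarrow> bool" where
  "gauss_bounded X F \<longleftrightarrow> continuous_on (X \<times> {0<..}) (\<lambda>(x,t). F x t) \<and>
     (\<forall>t1>0. \<forall>t2. \<exists>C\<ge>0. \<exists>c>0. \<forall>x\<in>X. \<forall>t\<in>{t1..t2}. \<bar>F x t\<bar> \<le> C * exp (- c * (norm x)\<^sup>2))"

lemma gauss_weight_Gam:
  fixes eps :: real
  assumes "eps > 0"
  shows "gauss_weight ((UNIV :: 'a::euclidean_space set) \<times> {0<..}) snd (\<lambda>p. 1 + norm (fst p))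
     (\<lambda>p. Gam (fst p) (snd p / eps)) (\<lambda>p. norm (fst p))"
proof (unfold_locales, goal_cases)
  case (4 m t1 t2)
  then have t1: "t1 > 0" .
  define S where "S = \<bar>t2\<bar> / eps + 1"
  have S: "S > 0" using assms by (simp add: S_def add_nonneg_pos)
  \<comment> \<open>On the time window the kernel decays at least like exp(-norm w^2 / (4S)); half
    of this rate pays for the power of 1 + norm w.\<close>
  obtain C where C: "C > 0" "\<And>y. y \<ge> 0 \<Longrightarrow> (1 + y) ^ m \<le> C * exp (1 / (8 * S) * y\<^sup>2)"
    using one_plus_power_le_exp_square[of "1 / (8 * S)" m] S by auto
  have "Gam w (t / eps) * (1 + norm w) ^ m \<le> (1 + eps / t1) ^ DIM('a) * C * exp (- (1 / (8 * S)) * (norm w)\<^sup>2)"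
    if t: "t1 \<le> t" "t \<le> t2" for w :: 'a and t
  proof -
    have s: "0 < t / eps" "t / eps \<le> S" using t t1 assms by (auto simp: S_def field_simps)
    have "(4 * pi * (t / eps)) powr (- real DIM('a) / 2) \<le> (1 + 1 / (t / eps)) ^ DIM('a)"
      by (rule Gam_prefactor_le[OF s(1)])
    also have "\<dots> \<le> (1 + eps / t1) ^ DIM('a)"
      using t t1 assms by (intro power_mono) (auto simp: field_simps)
    finally have 1: "(4 * pi * (t / eps)) powr (- real DIM('a) / 2) \<le> (1 + eps / t1) ^ DIM('a)" .
    have 2: "exp (- (norm w)\<^sup>2 / (4 * (t / eps))) \<le> exp (- (1 / (4 * S)) * (norm w)\<^sup>2)"
      using s S frac_le[of "(norm w)\<^sup>2" "(norm w)\<^sup>2" "4 * (t / eps)" "4 * S"] by simp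
    have "Gam w (t / eps) * (1 + norm w) ^ m \<le>
       ((1 + eps / t1) ^ DIM('a) * exp (- (1 / (4 * S)) * (norm w)\<^sup>2)) * (C * exp (1 / (8 * S) * (norm w)\<^sup>2))"
      unfolding Gam_def using 1 2 C t1 assms by (intro mult_mono) auto
    also have "\<dots> = (1 + eps / t1) ^ DIM('a) * C *
        exp (- (1 / (4 * S)) * (norm w)\<^sup>2 + 1 / (8 * S) * (norm w)\<^sup>2)"
      unfolding exp_add by (simp only: mult_ac)
    also have "- (1 / (4 * S)) * (norm w)\<^sup>2 + 1 / (8 * S) * (norm w)\<^sup>2 = - (1 / (8 * S)) * (norm w)\<^sup>2"
      by simp
    finally show ?thesis .
  qed
  then show ?case
    using S by (intro exI[of _ "(1 + eps / t1) ^ DIM('a) * C"] exI[of _ "1 / (8 * S)"]) auto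
qed (use assms in \<open>auto simp: Gam_nonneg intro!: continuous_intros\<close>)

section \<open>The parameters and the diffusion times along the layer\<close>

locale dynamic_bc =
  fixes eps delta k :: real
  assumes eps: "eps > 0" and delta: "delta > 0" and k: "k \<ge> 0"
begin

text \<open>At \<tau> = t\<theta> the tangential diffusion time, the normal diffusion time and the
  normal shift are t times \<open>ca\<close>, \<open>cb\<close> and \<open>cc\<close>. For k = 0 the
  functions \<open>ca\<close> and \<open>cb\<close> coincide and both vanish at \<theta> =
  1.\<close>

definition ca :: "real \<Rightarrow> real" where "ca \<theta> = (1 - \<theta>) / eps + k / delta * \<theta>"
definition cb :: "real \<Rightarrow> real" where "cb \<theta> = (1 - \<theta>) / eps"
definition cc :: "real \<Rightarrow> real" where "cc \<theta> = \<theta> / delta"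

lemma cb_pos: "\<theta> < 1 \<Longrightarrow> 0 < cb \<theta>"
  using eps by (simp add: cb_def)

lemma cb_le_ca: "0 \<le> \<theta> \<Longrightarrow> cb \<theta> \<le> ca \<theta>"
  using delta k by (simp add: ca_def cb_def)

lemma ca_pos: "0 \<le> \<theta> \<Longrightarrow> \<theta> < 1 \<Longrightarrow> 0 < ca \<theta>"
  using cb_pos cb_le_ca by force

lemma cc_nonneg: "0 \<le> \<theta> \<Longrightarrow> 0 \<le> cc \<theta>"
  using delta by (simp add: cc_def)

lemma ca_le: "0 \<le> \<theta> \<Longrightarrow> \<theta> \<le> 1 \<Longrightarrow> ca \<theta> \<le> 1 / eps + k / delta"
  unfolding ca_def using eps delta k by (intro add_mono) (auto simp: field_simps intro: mult_left_le_one_le)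

abbreviation slab_dom :: "(((real^'n) \<times> real) \<times> real \<times> real) set" where
  "slab_dom \<equiv> Omega_bar \<times> {0<..} \<times> {0<..<1}"

text \<open>Since \<open>cb\<close> \<le> \<open>ca\<close>, the inverse normal time dominates the
  inverse tangential time, and a single singular factor measures both.\<close>

definition slab_Q :: "((real^'n) \<times> real) \<times> real \<times> real \<Rightarrow> real" where
  "slab_Q p = (1 + 1 / (fst (snd p) * cb (snd (snd p))))
     * (1 + norm (fst (fst p), snd (fst p) + fst (snd p) * cc (snd (snd p))))"

definition slab_E :: "((real^'n) \<times> real) \<times> real \<times> real \<Rightarrow> real" where
  "slab_E p = Gam (fst (fst p)) (fst (snd p) * ca (snd (snd p)))
     * Gam (snd (fst p) + fst (snd p) * cc (snd (snd p))) (fst (snd p) * cb (snd (snd p)))"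

lemma continuous_on_coeffs [continuous_intros]:
  assumes "continuous_on S f"
  shows "continuous_on S (\<lambda>p. ca (f p))" "continuous_on S (\<lambda>p. cb (f p))" "continuous_on S (\<lambda>p. cc (f p))"
  unfolding ca_def cb_def cc_def using eps delta by (auto intro!: continuous_intros assms)

text \<open>For \<theta> \<le> 1/2 the normal diffusion time is at least t1/(2 eps); for \<theta> >
  1/2 the shift makes \<xi> at least t1/(2 delta). Either way \<open>singular_time_bound\<close>
  absorbs all powers of the inverse times, with constants that do not depend on \<theta>. This is
  where the dynamic boundary condition (delta finite) regularises the kernel.\<close>

lemma slab_weight_bound:
  fixes m :: nat and t1 t2 :: real
  assumes t1: "t1 > 0"
  shows "\<exists>C. \<exists>c>0. \<forall>p\<in>(slab_dom :: (((real^'n) \<times> real) \<times> real \<times> real) set). fst (snd p) \<in> {t1..t2} \<longrightarrow>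
      slab_E p * slab_Q p ^ m \<le> C * exp (- c * (norm (fst p))\<^sup>2)"
proof -
  define d where "d = min (t1 / (2 * eps)) (t1 / (2 * delta))"
  define S where "S = \<bar>t2\<bar> * (1 / eps + k / delta) + 1"
  have d: "d > 0" using t1 eps delta by (simp add: d_def)
  have "0 \<le> 1 / eps + k / delta" using eps delta k by simp
  then have S: "S > 0" by (simp add: S_def add_nonneg_pos)
  \<comment> \<open>The exponents of 1 + 1/s2 are collected here: CARD('n) from the tangential
    prefactor, 1 from the normal prefactor and m from \<open>slab_Q\<close>.\<close>
  define M where "M = CARD('n) + 1 + m"
  obtain C1 where C1: "C1 > 0" "\<And>s \<xi>. s > 0 \<Longrightarrow> s \<ge> d \<or> \<xi> \<ge> d \<Longrightarrow> (1 + 1 / s) ^ M * exp (- \<xi>\<^sup>2 / (8 * s)) \<le> C1"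
    using singular_time_bound[OF d, of M] by blast
  obtain C2 where C2: "C2 > 0" "\<And>y. y \<ge> 0 \<Longrightarrow> (1 + y) ^ m \<le> C2 * exp (1 / (16 * S) * y\<^sup>2)"
    using one_plus_power_le_exp_square[of "1 / (16 * S)" m] S by auto
  have "slab_E p * slab_Q p ^ m \<le> (C1 * C2) * exp (- (1 / (16 * S)) * (norm (fst p))\<^sup>2)"
    if p: "p \<in> slab_dom" and t: "fst (snd p) \<in> {t1..t2}" for p :: "((real^'n) \<times> real) \<times> real \<times> real"
  proof -
    obtain z \<rho> t \<theta> where p_eq: "p = ((z, \<rho>), t, \<theta>)" by (metis surj_pair)
    have *: "\<rho> \<ge> 0" "0 < \<theta>" "\<theta> < 1" "t1 \<le> t" "t \<le> t2" "0 < t"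
      using p t t1 by (auto simp: p_eq Omega_bar_def)
    define s1 where "s1 = t * ca \<theta>"
    define s2 where "s2 = t * cb \<theta>"
    define \<xi> where "\<xi> = \<rho> + t * cc \<theta>"
    define y where "y = norm (z, \<xi>)"
    have s: "0 < s1" "0 < s2" "s2 \<le> s1" using * ca_pos cb_pos cb_le_ca by (auto simp: s1_def s2_def)
    have "t * ca \<theta> \<le> \<bar>t2\<bar> * (1 / eps + k / delta)"
      using * ca_le[of \<theta>] ca_pos[of \<theta>] by (intro mult_mono) auto
    then have s1S: "s1 \<le> S" by (simp add: s1_def S_def)
    have \<xi>: "\<rho> \<le> \<xi>" using * cc_nonneg[of \<theta>] by (simp add: \<xi>_def)
    have y2: "y\<^sup>2 = (norm z)\<^sup>2 + \<xi>\<^sup>2" by (simp add: y_def norm_Pair)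
    have nw: "(norm (z, \<rho>))\<^sup>2 \<le> y\<^sup>2" using \<xi> * by (simp add: y2 norm_Pair power_mono)
    have far: "s2 \<ge> d \<or> \<xi> \<ge> d"
    proof (cases "\<theta> \<le> 1/2")
      case True
      have "t1 * (1/2) \<le> t * (1 - \<theta>)" using * True t1 by (intro mult_mono) auto
      then have "t1 / (2 * eps) \<le> s2" using eps by (simp add: s2_def cb_def field_simps)
      then show ?thesis by (simp add: d_def min_le_iff_disj)
    next
      case False
      have "t1 * (1/2) \<le> t * \<theta>" using * False t1 by (intro mult_mono) auto
      then have "t1 / (2 * delta) \<le> t * cc \<theta>" using delta by (simp add: cc_def field_simps)
      then show ?thesis using * by (auto simp: d_def \<xi>_def min_le_iff_disj)
    qed
    have q: "1 + 1 / s1 \<le> 1 + 1 / s2" using s by (simp add: frac_le)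
    have "(4 * pi * s1) powr (- real CARD('n) / 2) \<le> (1 + 1 / s2) ^ CARD('n)"
      by (rule order_trans[OF Gam_prefactor_le[OF s(1)] power_mono[OF q]]) (use s in simp)
    moreover have "(4 * pi * s2) powr (- real 1 / 2) \<le> (1 + 1 / s2)"
      using Gam_prefactor_le[OF s(2), of 1] by simp
    ultimately have pre: "(4 * pi * s1) powr (- real CARD('n) / 2) * (4 * pi * s2) powr (- real 1 / 2)
        \<le> (1 + 1 / s2) ^ CARD('n) * (1 + 1 / s2)"
      using s by (intro mult_mono) auto
    have "(norm z)\<^sup>2 / (8 * S) \<le> (norm z)\<^sup>2 / (4 * s1)" "\<xi>\<^sup>2 / (8 * S) \<le> \<xi>\<^sup>2 / (8 * s2)"
      using s s1S S by (auto intro!: divide_left_mono)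
    \<comment> \<open>The normal exponent is split in two halves: one is reserved for
      \<open>singular_time_bound\<close>, the other joins the tangential exponent to give decay in
      y.\<close>
    then have "- (norm z)\<^sup>2 / (4 * s1) + - \<xi>\<^sup>2 / (4 * s2) \<le> - (1 / (8 * S)) * y\<^sup>2 + - \<xi>\<^sup>2 / (8 * s2)"
    proof -
      have "(1 / (8 * S)) * y\<^sup>2 = (norm z)\<^sup>2 / (8 * S) + \<xi>\<^sup>2 / (8 * S)"
        by (simp add: y2 add_divide_distrib)
      moreover have "\<xi>\<^sup>2 / (4 * s2) = \<xi>\<^sup>2 / (8 * s2) + \<xi>\<^sup>2 / (8 * s2)" by simp
      ultimately show ?thesis
        using \<open>(norm z)\<^sup>2 / (8 * S) \<le> (norm z)\<^sup>2 / (4 * s1)\<close> \<open>\<xi>\<^sup>2 / (8 * S) \<le> \<xi>\<^sup>2 / (8 * s2)\<close>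
        unfolding minus_divide_left[symmetric] by linarith
    qed
    then have ex: "exp (- (norm z)\<^sup>2 / (4 * s1)) * exp (- \<xi>\<^sup>2 / (4 * s2)) \<le>
        exp (- (1 / (8 * S)) * y\<^sup>2) * exp (- \<xi>\<^sup>2 / (8 * s2))"
      by (simp flip: exp_add)
    have "slab_E p * slab_Q p ^ m =
       ((4 * pi * s1) powr (- real CARD('n) / 2) * (4 * pi * s2) powr (- real 1 / 2))
       * (exp (- (norm z)\<^sup>2 / (4 * s1)) * exp (- \<xi>\<^sup>2 / (4 * s2))) * ((1 + 1 / s2) ^ m * (1 + y) ^ m)"
      by (simp add: slab_E_def slab_Q_def p_eq Gam_def power_mult_distrib flip: s1_def s2_def \<xi>_def y_def)
    also have "\<dots> \<le> ((1 + 1 / s2) ^ CARD('n) * (1 + 1 / s2))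
       * (exp (- (1 / (8 * S)) * y\<^sup>2) * exp (- \<xi>\<^sup>2 / (8 * s2))) * ((1 + 1 / s2) ^ m * (C2 * exp (1 / (16 * S) * y\<^sup>2)))"
      by (rule mult_mono[OF mult_mono[OF pre ex] mult_left_mono[OF C2(2)]])
         (use s C2(1) in \<open>auto simp: y_def\<close>)
    also have "\<dots> = ((1 + 1 / s2) ^ M * exp (- \<xi>\<^sup>2 / (8 * s2))) * C2 *
       (exp (- (1 / (8 * S)) * y\<^sup>2) * exp (1 / (16 * S) * y\<^sup>2))"
      by (simp add: M_def power_add mult_ac)
    also have "exp (- (1 / (8 * S)) * y\<^sup>2) * exp (1 / (16 * S) * y\<^sup>2) = exp (- (1 / (16 * S)) * y\<^sup>2)"
      by (simp flip: exp_add)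
    also have "((1 + 1 / s2) ^ M * exp (- \<xi>\<^sup>2 / (8 * s2))) * C2 * exp (- (1 / (16 * S)) * y\<^sup>2)
        \<le> C1 * C2 * exp (- (1 / (16 * S)) * (norm (fst p))\<^sup>2)"
      using C1(1) C1(2)[OF s(2) far] C2(1) nw S
      by (intro mult_mono mult_right_mono) (auto simp: p_eq field_simps)
    finally show ?thesis .
  qed
  then show ?thesis using S by (intro exI[of _ "C1 * C2"] exI[of _ "1 / (16 * S)"]) auto
qed

lemma gauss_weight_slab:
  "gauss_weight (slab_dom :: (((real^'n) \<times> real) \<times> real \<times> real) set) (\<lambda>p. fst (snd p)) slab_Q slab_E (\<lambda>p. norm (fst p))"
proof (unfold_locales, goal_cases)
  case (1 p)
  then have "0 < fst (snd p) * cb (snd (snd p))" by (auto simp: cb_pos)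
  then have "1 * 1 \<le> slab_Q p" unfolding slab_Q_def by (intro mult_mono) auto
  then show ?case by simp
next
  case (4 m t1 t2)
  then show ?case by (rule slab_weight_bound)
qed (auto simp: slab_E_def Gam_nonneg ca_pos cb_pos intro!: continuous_intros mult_nonneg_nonneg)

end

lemma integrable_continuous_bounded:
  fixes f :: "'a::euclidean_space \<Rightarrow> real"
  assumes "continuous_on S f" "open S" "g integrable_on S" "\<And>x. x \<in> S \<Longrightarrow> \<bar>f x\<bar> \<le> g x"
  shows "f integrable_on S"
  using assms by (intro measurable_bounded_by_integrable_imp_integrable[OF _ assms(3)]
      continuous_imp_measurable_on_sets_lebesgue) auto

lemma gauss_boundedD:
  assumes "gauss_bounded X F"
  shows gauss_bounded_continuous: "continuous_on (X \<times> {0<..}) (\<lambda>(x,t). F x t)"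
    and gauss_bounded_bound: "t1 > 0 \<Longrightarrow> \<exists>C\<ge>0. \<exists>c>0. \<forall>x\<in>X. \<forall>t\<in>{t1..t2}. \<bar>F x t\<bar> \<le> C * exp (- c * (norm x)\<^sup>2)"
  using assms by (auto simp: gauss_bounded_def)

context dynamic_bc
begin

context
  fixes K :: "((real^'n) \<times> real) \<times> real \<times> real \<Rightarrow> real"
  assumes K: "gauss_weight.gauss_poly slab_dom (\<lambda>p. fst (snd p)) slab_Q slab_E K"
begin

private lemma continuous_K: "continuous_on slab_dom K"
  and bound_K: "t1 > 0 \<Longrightarrow> \<exists>C\<ge>0. \<exists>c>0. \<forall>p\<in>slab_dom. fst (snd p) \<in> {t1..t2} \<longrightarrow> \<bar>K p\<bar> \<le> C * exp (- c * (norm (fst p))\<^sup>2)"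
  by (rule gauss_weight.gauss_poly_continuous[OF gauss_weight_slab K])
     (rule gauss_weight.gauss_poly_bound[OF gauss_weight_slab K])

lemma dominated_family_slab: "dominated_family {0<..<1} Omega_bar (\<lambda>\<theta> w t. K (w, t, \<theta>))"
  unfolding dominated_family_def
proof (intro conjI ballI allI impI)
  have int1: "(\<lambda>\<theta>::real. C) integrable_on {0<..<1}" for C :: real
    by (simp add: integrable_on_open_interval_real integrable_const_ivl)
  fix w :: "(real^'n) \<times> real" and t :: real assume w: "w \<in> Omega_bar" and t: "t > 0"
  obtain C c where C: "c > 0" "C \<ge> 0" "\<And>p. p \<in> slab_dom \<Longrightarrow> fst (snd p) \<in> {t..t} \<Longrightarrow> \<bar>K p\<bar> \<le> C * exp (- c * (norm (fst p))\<^sup>2)"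
    using bound_K[OF t, of t] by blast
  show "(\<lambda>\<theta>. K (w, t, \<theta>)) integrable_on {0<..<1}"
  proof (rule integrable_continuous_bounded[OF _ _ int1])
    show "continuous_on {0<..<1} (\<lambda>\<theta>. K (w, t, \<theta>))"
      by (rule continuous_on_compose2[OF continuous_K]) (use w t in \<open>auto intro!: continuous_intros\<close>)
    show "\<bar>K (w, t, \<theta>)\<bar> \<le> C * exp (- c * (norm w)\<^sup>2)" if "\<theta> \<in> {0<..<1}" for \<theta>
      using C(3)[of "(w, t, \<theta>)"] that w t by auto
  qed auto
  obtain C c where C: "c > 0" "C \<ge> 0" "\<And>p. p \<in> slab_dom \<Longrightarrow> fst (snd p) \<in> {t/2..2*t} \<Longrightarrow> \<bar>K p\<bar> \<le> C * exp (- c * (norm (fst p))\<^sup>2)"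
    using bound_K[of "t / 2" "2 * t"] t by auto
  show "\<exists>r>0. \<exists>g. g integrable_on {0<..<1} \<and> (\<forall>\<omega>\<in>{0<..<1}. \<forall>x\<in>Omega_bar. \<forall>s>0.
      dist x w < r \<longrightarrow> dist s t < r \<longrightarrow> \<bar>K (x, s, \<omega>)\<bar> \<le> g \<omega>)"
  proof (intro exI[of _ "t / 2"] conjI exI[of _ "\<lambda>_. C"] int1 ballI allI impI)
    fix \<theta> s :: real and x :: "(real^'n) \<times> real"
    assume *: "\<theta> \<in> {0<..<1}" "x \<in> Omega_bar" "0 < s" "dist s t < t / 2"
    then have "\<bar>K (x, s, \<theta>)\<bar> \<le> C * exp (- c * (norm x)\<^sup>2)"
      using C(3)[of "(x, s, \<theta>)"] by (auto simp: dist_real_def abs_if split: if_splits)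
    also have "\<dots> \<le> C * 1" using C by (intro mult_left_mono) auto
    finally show "\<bar>K (x, s, \<theta>)\<bar> \<le> C" by simp
  qed (use t in auto)
next
  fix \<theta> :: real assume "\<theta> \<in> {0<..<1}"
  then show "continuous_on (Omega_bar \<times> {0<..}) (\<lambda>(w, t). K (w, t, \<theta>))"
    unfolding split_beta'
    by (intro continuous_on_compose2[OF continuous_K]) (auto intro!: continuous_intros)
qed

lemma gauss_bounded_slab: "gauss_bounded Omega_bar (\<lambda>w t. integral {0<..<1} (\<lambda>\<theta>. K (w, t, \<theta>)))"
  unfolding gauss_bounded_def
proof (intro conjI allI impI)
  show "continuous_on (Omega_bar \<times> {0<..}) (\<lambda>(w, t). integral {0<..<1} (\<lambda>\<theta>. K (w, t, \<theta>)))"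
    by (rule continuous_on_integral_dominated[OF dominated_family_slab])
  fix t1 t2 :: real assume t1: "t1 > 0"
  obtain C c where C: "c > 0" "C \<ge> 0" "\<And>p. p \<in> slab_dom \<Longrightarrow> fst (snd p) \<in> {t1..t2} \<Longrightarrow> \<bar>K p\<bar> \<le> C * exp (- c * (norm (fst p))\<^sup>2)"
    using bound_K[OF t1, of t2] by auto
  have "\<bar>integral {0<..<1} (\<lambda>\<theta>. K (w, t, \<theta>))\<bar> \<le> C * exp (- c * (norm w)\<^sup>2)"
    if w: "w \<in> Omega_bar" and t: "t \<in> {t1..t2}" for w t
  proof -
    have "norm (integral {0<..<1} (\<lambda>\<theta>. K (w, t, \<theta>))) \<le> integral {0<..<1} (\<lambda>\<theta>::real. C * exp (- c * (norm w)\<^sup>2))"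
      using dominated_family_integrable[OF dominated_family_slab w, of t] t t1 w C(3)[of "(w, t, _)"]
      by (intro integral_norm_bound_integral) (auto simp: integrable_on_open_interval_real integrable_const_ivl)
    also have "\<dots> = C * exp (- c * (norm w)\<^sup>2)"
      by (simp flip: integral_open_interval_real)
    finally show ?thesis by simp
  qed
  then show "\<exists>C\<ge>0. \<exists>c>0. \<forall>w\<in>Omega_bar. \<forall>t\<in>{t1..t2}.
      \<bar>integral {0<..<1} (\<lambda>\<theta>. K (w, t, \<theta>))\<bar> \<le> C * exp (- c * (norm w)\<^sup>2)"
    using C by blast
qed

end

text \<open>Besides \<open>slab\<close> and its derivatives, three summands are listed separately
  because the fundamental theorem of calculus will be applied to combinations of them. The last
  function carries an extra factor 1 / (t * cb \<theta>): its boundedness forces the integrand to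
  vanish linearly at \<theta> = 1.\<close>

lemma gauss_poly_slabs:
  defines "gp \<equiv> gauss_weight.gauss_poly (slab_dom :: (((real^'n) \<times> real) \<times> real \<times> real) set) (\<lambda>p. fst (snd p)) slab_Q slab_E"
  shows gauss_poly_slab: "gp (\<lambda>(w, t, \<theta>). slab (ca \<theta>) (cb \<theta>) (cc \<theta>) w t)"
    and gauss_poly_slab_time: "gp (\<lambda>(w, t, \<theta>). slab_time (ca \<theta>) (cb \<theta>) (cc \<theta>) w t)"
    and gauss_poly_slab_grad: "gp (\<lambda>(w, t, \<theta>). slab_grad (ca \<theta>) (cb \<theta>) (cc \<theta>) w t v)"
    and gauss_poly_slab_hess: "gp (\<lambda>(w, t, \<theta>). slab_hess (ca \<theta>) (cb \<theta>) (cc \<theta>) w t v u)"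
    and gauss_poly_slab_part1: "gp (\<lambda>(w, t, \<theta>). t * (gauss_laplace (fst w) (t * ca \<theta>) * flux (snd w + t * cc \<theta>) (t * cb \<theta>)))"
    and gauss_poly_slab_part2: "gp (\<lambda>(w, t, \<theta>). t * (Gam (fst w) (t * ca \<theta>) * flux1 (snd w + t * cc \<theta>) (t * cb \<theta>)))"
    and gauss_poly_slab_part3: "gp (\<lambda>(w, t, \<theta>). t * (Gam (fst w) (t * ca \<theta>) * flux2 (snd w + t * cc \<theta>) (t * cb \<theta>)))"
    and gauss_poly_slab_flat: "gp (\<lambda>(w, t, \<theta>). (1 / (t * cb \<theta>)) * (Gam (fst w) (t * ca \<theta>) * flux (snd w + t * cc \<theta>) (t * cb \<theta>)))"
proof -
  interpret kw: gauss_weight "slab_dom :: (((real^'n) \<times> real) \<times> real \<times> real) set" "\<lambda>p. fst (snd p)" slab_Q slab_E "\<lambda>p. norm (fst p)"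
    by (rule gauss_weight_slab)
  let ?t = "\<lambda>p :: ((real^'n) \<times> real) \<times> real \<times> real. fst (snd p)"
  let ?th = "\<lambda>p :: ((real^'n) \<times> real) \<times> real \<times> real. snd (snd p)"
  have inv: "0 < 1 / (?t p * cb (?th p))" "1 / (?t p * ca (?th p)) \<le> 1 / (?t p * cb (?th p))"
    "0 < 1 / (?t p * ca (?th p))" if "p \<in> slab_dom" for p
    using that cb_pos[of "?th p"] ca_pos[of "?th p"] cb_le_ca[of "?th p"] by (auto intro!: frac_le)
  have Q1: "norm (fst (fst p), snd (fst p) + ?t p * cc (?th p)) \<le> slab_Q p" if "p \<in> slab_dom" for p
  proof -
    have "1 * norm (fst (fst p), snd (fst p) + ?t p * cc (?th p)) \<le> slab_Q p"
      unfolding slab_Q_def using inv(1)[OF that] by (intro mult_mono) auto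
    then show ?thesis by simp
  qed
  have Q2: "1 / (?t p * cb (?th p)) \<le> slab_Q p" if "p \<in> slab_dom" for p
  proof -
    have "(1 / (?t p * cb (?th p))) * 1 \<le> slab_Q p"
      unfolding slab_Q_def using inv(1)[OF that] by (intro mult_mono) auto
    then show ?thesis by simp
  qed
  have z: "kw.poly_growth (\<lambda>p. fst (fst p) \<bullet> v)" for v
  proof (rule kw.poly_growth_bound1[where c = "norm v"])
    fix p :: "((real^'n) \<times> real) \<times> real \<times> real" assume p: "p \<in> slab_dom"
    have "\<bar>fst (fst p) \<bullet> v\<bar> \<le> norm (fst (fst p)) * norm v" by (rule Cauchy_Schwarz_ineq2)
    also have "\<dots> \<le> slab_Q p * norm v"
      using Q1[OF p] norm_fst_le[of "fst (fst p)"] by (intro mult_right_mono) (auto intro: order_trans)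
    finally show "\<bar>fst (fst p) \<bullet> v\<bar> \<le> norm v * slab_Q p" by (simp add: mult.commute)
  qed (auto intro!: continuous_intros)
  have nz: "kw.poly_growth (\<lambda>p. norm (fst (fst p)))"
  proof (rule kw.poly_growth_bound1[where c = 1])
    fix p :: "((real^'n) \<times> real) \<times> real \<times> real" assume p: "p \<in> slab_dom"
    show "\<bar>norm (fst (fst p))\<bar> \<le> 1 * slab_Q p"
      using Q1[OF p] norm_fst_le[of "fst (fst p)"] by (auto intro: order_trans)
  qed (auto intro!: continuous_intros)
  have xi: "kw.poly_growth (\<lambda>p. snd (fst p) + ?t p * cc (?th p))"
  proof (rule kw.poly_growth_bound1[where c = 1])
    fix p :: "((real^'n) \<times> real) \<times> real \<times> real" assume p: "p \<in> slab_dom"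
    show "\<bar>snd (fst p) + ?t p * cc (?th p)\<bar> \<le> 1 * slab_Q p"
      using Q1[OF p] norm_snd_le[of "snd (fst p) + ?t p * cc (?th p)"] by (auto intro: order_trans)
  qed (auto intro!: continuous_intros)
  have s2: "kw.poly_growth (\<lambda>p. 1 / (?t p * cb (?th p)))"
  proof (rule kw.poly_growth_bound1[where c = 1])
    show "continuous_on slab_dom (\<lambda>p::((real^'n) \<times> real) \<times> real \<times> real. 1 / (?t p * cb (?th p)))"
      by (intro continuous_intros) (auto simp: less_imp_neq[OF cb_pos, symmetric])
  qed (use inv(1) Q2 in \<open>auto simp: abs_of_pos simp del: zero_less_divide_iff\<close>)
  have s1: "kw.poly_growth (\<lambda>p. 1 / (?t p * ca (?th p)))"
  proof (rule kw.poly_growth_bound1[where c = 1])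
    show "continuous_on slab_dom (\<lambda>p::((real^'n) \<times> real) \<times> real \<times> real. 1 / (?t p * ca (?th p)))"
      by (intro continuous_intros) (auto simp: less_imp_neq[OF ca_pos, symmetric])
    fix p :: "((real^'n) \<times> real) \<times> real \<times> real" assume p: "p \<in> slab_dom"
    show "\<bar>1 / (?t p * ca (?th p))\<bar> \<le> 1 * slab_Q p"
      using inv[OF p] Q2[OF p] by linarith
  qed auto
  have t: "kw.poly_growth ?t"
  proof (rule kw.poly_growthI[of _ 0])
    show "\<exists>C\<ge>0. \<forall>p\<in>slab_dom. ?t p \<in> {t1..t2} \<longrightarrow> \<bar>?t p\<bar> \<le> C * slab_Q p ^ 0" for t1 t2
      by (intro exI[of _ "\<bar>t2\<bar>"]) auto
  qed (auto intro!: continuous_intros)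
  have th: "kw.poly_growth ?th"
    by (rule kw.poly_growthI[of _ 0]) (auto intro!: continuous_intros exI[of _ 1])
  have a: "kw.poly_growth (\<lambda>p. ca (?th p))" "kw.poly_growth (\<lambda>p. cb (?th p))" "kw.poly_growth (\<lambda>p. cc (?th p))"
    unfolding ca_def cb_def cc_def divide_inverse by (intro kw.poly_growth_intros th)+
  note intros = kw.poly_growth_intros z xi s1 s2 t a nz
  note fdefs = flux_def flux1_def flux2_def gauss_grad_def gauss_hess_def gauss_laplace_def slab_E_def power2_norm_eq_inner
  have flux: "kw.gauss_poly (\<lambda>p. Gam (fst (fst p)) (?t p * ca (?th p)) * flux (snd (fst p) + ?t p * cc (?th p)) (?t p * cb (?th p)))"
    by (rule kw.gauss_polyI[where R = "\<lambda>p. (snd (fst p) + ?t p * cc (?th p)) * (1 / (?t p * cb (?th p)))"])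
       (intro intros, simp add: fdefs mult_ac)
  have flux1: "kw.gauss_poly (\<lambda>p. Gam (fst (fst p)) (?t p * ca (?th p)) * flux1 (snd (fst p) + ?t p * cc (?th p)) (?t p * cb (?th p)))"
    by (rule kw.gauss_polyI[where R = "\<lambda>p. 1 / (?t p * cb (?th p)) - (1/2) * (snd (fst p) + ?t p * cc (?th p))\<^sup>2 * (1 / (?t p * cb (?th p)))\<^sup>2"])
       (intro intros, simp only: fdefs mult_ac)
  have flux2: "kw.gauss_poly (\<lambda>p. Gam (fst (fst p)) (?t p * ca (?th p)) * flux2 (snd (fst p) + ?t p * cc (?th p)) (?t p * cb (?th p)))"
    by (rule kw.gauss_polyI[where R = "\<lambda>p. (1/4) * (snd (fst p) + ?t p * cc (?th p)) ^ 3 * (1 / (?t p * cb (?th p))) ^ 3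
         - (3/2) * (snd (fst p) + ?t p * cc (?th p)) * (1 / (?t p * cb (?th p)))\<^sup>2"])
       (intro intros, simp only: fdefs mult_ac)
  have g: "kw.gauss_poly (\<lambda>p. gauss_grad (fst (fst p)) (?t p * ca (?th p)) v * flux (snd (fst p) + ?t p * cc (?th p)) (?t p * cb (?th p)))" for v
  proof -
    have "kw.gauss_poly (\<lambda>p. (- (1/2) * (fst (fst p) \<bullet> v) * (1 / (?t p * ca (?th p)))) *
      (Gam (fst (fst p)) (?t p * ca (?th p)) * flux (snd (fst p) + ?t p * cc (?th p)) (?t p * cb (?th p))))"
      by (intro kw.gauss_poly_mult flux intros)
    then show ?thesis by (simp only: gauss_grad_def mult.assoc)
  qed
  have g1: "kw.gauss_poly (\<lambda>p. gauss_grad (fst (fst p)) (?t p * ca (?th p)) v * flux1 (snd (fst p) + ?t p * cc (?th p)) (?t p * cb (?th p)))" for v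
  proof -
    have "kw.gauss_poly (\<lambda>p. (- (1/2) * (fst (fst p) \<bullet> v) * (1 / (?t p * ca (?th p)))) *
      (Gam (fst (fst p)) (?t p * ca (?th p)) * flux1 (snd (fst p) + ?t p * cc (?th p)) (?t p * cb (?th p))))"
      by (intro kw.gauss_poly_mult flux1 intros)
    then show ?thesis by (simp only: gauss_grad_def mult.assoc)
  qed
  have h: "kw.gauss_poly (\<lambda>p. gauss_hess (fst (fst p)) (?t p * ca (?th p)) v u * flux (snd (fst p) + ?t p * cc (?th p)) (?t p * cb (?th p)))" for v u
  proof -
    have "kw.gauss_poly (\<lambda>p. ((1/4) * (fst (fst p) \<bullet> v) * (fst (fst p) \<bullet> u) * (1 / (?t p * ca (?th p)))\<^sup>2
        - (1/2) * (v \<bullet> u) * (1 / (?t p * ca (?th p)))) *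
      (Gam (fst (fst p)) (?t p * ca (?th p)) * flux (snd (fst p) + ?t p * cc (?th p)) (?t p * cb (?th p))))"
      by (intro kw.gauss_poly_mult flux intros)
    then show ?thesis by (simp only: gauss_hess_def mult.assoc)
  qed
  have l: "kw.gauss_poly (\<lambda>p. gauss_laplace (fst (fst p)) (?t p * ca (?th p)) * flux (snd (fst p) + ?t p * cc (?th p)) (?t p * cb (?th p)))"
  proof -
    have "kw.gauss_poly (\<lambda>p. ((1/4) * (norm (fst (fst p)))\<^sup>2 * (1 / (?t p * ca (?th p)))\<^sup>2
        - (DIM(real^'n) / 2) * (1 / (?t p * ca (?th p)))) *
      (Gam (fst (fst p)) (?t p * ca (?th p)) * flux (snd (fst p) + ?t p * cc (?th p)) (?t p * cb (?th p))))"
      by (intro kw.gauss_poly_mult flux intros)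
    then show ?thesis by (simp only: gauss_laplace_def mult.assoc power2_norm_eq_inner)
  qed
  note gintros = kw.gauss_poly_add kw.gauss_poly_mult flux flux1 flux2 g g1 h l intros
  show "gp (\<lambda>(w, t, \<theta>). slab (ca \<theta>) (cb \<theta>) (cc \<theta>) w t)"
    unfolding gp_def slab_def split_beta' by (intro gintros)
  show "gp (\<lambda>(w, t, \<theta>). slab_time (ca \<theta>) (cb \<theta>) (cc \<theta>) w t)"
    unfolding gp_def slab_time_def split_beta' by (intro gintros)
  show "gp (\<lambda>(w, t, \<theta>). slab_grad (ca \<theta>) (cb \<theta>) (cc \<theta>) w t v)"
    unfolding gp_def slab_grad_def split_beta' by (intro gintros)
  show "gp (\<lambda>(w, t, \<theta>). slab_hess (ca \<theta>) (cb \<theta>) (cc \<theta>) w t v u)"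
    unfolding gp_def slab_hess_def split_beta' by (intro gintros)
  show "gp (\<lambda>(w, t, \<theta>). t * (gauss_laplace (fst w) (t * ca \<theta>) * flux (snd w + t * cc \<theta>) (t * cb \<theta>)))"
    unfolding gp_def split_beta' by (intro gintros)
  show "gp (\<lambda>(w, t, \<theta>). t * (Gam (fst w) (t * ca \<theta>) * flux1 (snd w + t * cc \<theta>) (t * cb \<theta>)))"
    unfolding gp_def split_beta' by (intro gintros)
  show "gp (\<lambda>(w, t, \<theta>). t * (Gam (fst w) (t * ca \<theta>) * flux2 (snd w + t * cc \<theta>) (t * cb \<theta>)))"
    unfolding gp_def split_beta' by (intro gintros)
  show "gp (\<lambda>(w, t, \<theta>). (1 / (t * cb \<theta>)) * (Gam (fst w) (t * ca \<theta>) * flux (snd w + t * cc \<theta>) (t * cb \<theta>)))"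
    unfolding gp_def split_beta' by (intro gintros)
qed

end

lemma convex_Omega_bar: "convex Omega_bar"
  by (auto simp: convex_def Omega_bar_def)

lemma sum_Basis_prod:
  fixes f :: "'a::euclidean_space \<times> 'b::euclidean_space \<Rightarrow> 'c::comm_monoid_add"
  shows "sum f Basis = (\<Sum>i\<in>Basis. f (i, 0)) + (\<Sum>i\<in>Basis. f (0, i))"
proof -
  have "inj_on (\<lambda>u. (u::'a, 0::'b)) Basis" "inj_on (\<lambda>u. (0::'a, u::'b)) Basis"
    by (auto intro!: inj_onI)
  then show ?thesis
    unfolding Basis_prod_def by (subst sum.union_disjoint) (auto simp: sum.reindex)
qed

lemma image_stretch_unit_interval:
  fixes t :: real
  assumes "t > 0"
  shows "(\<lambda>x. x / t) ` {0..t} = {0..1}"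
proof
  show "{0..1} \<subseteq> (\<lambda>x. x / t) ` {0..t}"
    using assms by (auto intro!: image_eqI[where x = "_ * t"] simp: mult_le_cancel_right1)
qed (use assms in auto)

section \<open>The layer kernel, its smoothness and its two equations\<close>

context dynamic_bc
begin

text \<open>The open interval matches \<open>slab_dom\<close>: at \<theta> = 1 the normal diffusion
  time is 0 and the derivative formulas for the integrand break down.\<close>

definition layer :: "(real^'n) \<times> real \<Rightarrow> real \<Rightarrow> real" where
  "layer w t = integral {0<..<1} (\<lambda>\<theta>. slab (ca \<theta>) (cb \<theta>) (cc \<theta>) w t)"

definition layer_time :: "(real^'n) \<times> real \<Rightarrow> real \<Rightarrow> real" where
  "layer_time w t = integral {0<..<1} (\<lambda>\<theta>. slab_time (ca \<theta>) (cb \<theta>) (cc \<theta>) w t)"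

definition layer_grad :: "(real^'n) \<times> real \<Rightarrow> real \<Rightarrow> (real^'n) \<times> real \<Rightarrow> real" where
  "layer_grad w t v = integral {0<..<1} (\<lambda>\<theta>. slab_grad (ca \<theta>) (cb \<theta>) (cc \<theta>) w t v)"

definition layer_hess :: "(real^'n) \<times> real \<Rightarrow> real \<Rightarrow> (real^'n) \<times> real \<Rightarrow> (real^'n) \<times> real \<Rightarrow> real" where
  "layer_hess w t v u = integral {0<..<1} (\<lambda>\<theta>. slab_hess (ca \<theta>) (cb \<theta>) (cc \<theta>) w t v u)"

lemmas slab_families =
  dominated_family_slab[OF gauss_poly_slab, simplified]
  dominated_family_slab[OF gauss_poly_slab_time, simplified]
  dominated_family_slab[OF gauss_poly_slab_grad, simplified]
  dominated_family_slab[OF gauss_poly_slab_hess, simplified]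

lemma gauss_bounded_layer:
  "gauss_bounded Omega_bar layer" "gauss_bounded Omega_bar layer_time"
  "gauss_bounded Omega_bar (\<lambda>w t. layer_grad w t v)" "gauss_bounded Omega_bar (\<lambda>w t. layer_hess w t v u)"
  using gauss_bounded_slab[OF gauss_poly_slab] gauss_bounded_slab[OF gauss_poly_slab_time]
    gauss_bounded_slab[OF gauss_poly_slab_grad[where v = v]]
    gauss_bounded_slab[OF gauss_poly_slab_hess[where v = v and u = u]]
  by (auto simp: layer_def[abs_def] layer_time_def[abs_def] layer_grad_def[abs_def] layer_hess_def[abs_def])

lemma C21_layer:
  "C21_derivs (Omega_bar :: ((real^'n) \<times> real) set) layer layer_time layer_grad layer_hess"
  unfolding layer_def[abs_def] layer_time_def[abs_def] layer_grad_def[abs_def] layer_hess_def[abs_def]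
proof (rule C21_derivs_integral[OF convex_Omega_bar])
  fix \<theta> :: real assume \<theta>: "\<theta> \<in> {0<..<1}"
  show "C21_derivs (Omega_bar :: ((real^'n) \<times> real) set) (slab (ca \<theta>) (cb \<theta>) (cc \<theta>)) (slab_time (ca \<theta>) (cb \<theta>) (cc \<theta>))
     (slab_grad (ca \<theta>) (cb \<theta>) (cc \<theta>)) (slab_hess (ca \<theta>) (cb \<theta>) (cc \<theta>))"
    unfolding C21_derivs_def C11_derivs_def
    using \<theta> slab_families[THEN dominated_family_continuous[OF _ \<theta>]]
    by (auto intro!: slab_has_derivative slab_grad_has_derivative slab_has_real_derivative ca_pos cb_pos)
qed (rule slab_families)+

text \<open>H sees x and y only through x' - y' and x_N + y_N, which are the two components of
  \<open>x - refl y\<close>. It is therefore a function of one point and of t, and all estimates can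
  be made for that function.\<close>

lemma Hker_eq_layer:
  assumes t: "t > 0"
  shows "Hker eps delta k x y t = layer (x - refl y) t"
proof -
  define f where "f \<tau> = Gam (fst x - fst y) ((t - \<tau>) / eps + k / delta * \<tau>)
      * dGam1 (snd x + snd y + \<tau> / delta) ((t - \<tau>) / eps)" for \<tau>
  have "integral {0..1} (\<lambda>\<theta>. f (t * \<theta>)) = (1 / t) * integral {0..t} f"
    using integral_stretch_real[of t 0 t f] t by (simp add: image_stretch_unit_interval)
  then have "Hker eps delta k x y t = -2 * t * integral {0..1} (\<lambda>\<theta>. f (t * \<theta>))"
    using t unfolding Hker_def f_def by simp
  also have "\<dots> = integral {0..1} (\<lambda>\<theta>. -2 * t * f (t * \<theta>))" by simp
  also have "\<dots> = integral {0..1} (\<lambda>\<theta>. slab (ca \<theta>) (cb \<theta>) (cc \<theta>) (x - refl y) t)"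
  proof (rule integral_cong)
    fix \<theta> :: real assume "\<theta> \<in> {0..1}"
    then have "dGam1 (snd x + snd y + t * \<theta> / delta) ((t - t * \<theta>) / eps) =
        - (1/2) * flux (snd x + snd y + t * \<theta> / delta) ((t - t * \<theta>) / eps)"
      using t eps by (intro dGam1_eq_flux) (simp add: mult_left_le)
    moreover have "(t - t * \<theta>) / eps + k / delta * (t * \<theta>) = t * ca \<theta>" "(t - t * \<theta>) / eps = t * cb \<theta>"
      "snd x + snd y + t * \<theta> / delta = snd x + snd y + t * cc \<theta>"
      by (auto simp: ca_def cb_def cc_def algebra_simps diff_divide_distrib)
    ultimately show "-2 * t * f (t * \<theta>) = slab (ca \<theta>) (cb \<theta>) (cc \<theta>) (x - refl y) t"
      by (simp add: f_def slab_def refl_def)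
  qed
  finally show ?thesis by (simp add: layer_def integral_open_interval_real)
qed

context
  fixes w :: "(real^'n) \<times> real" and t :: real
  assumes w: "w \<in> Omega_bar" and t: "t > 0"
begin

text \<open>\<open>\<phi>\<close> is the integrand \<open>slab\<close> without its factor t, while
  \<open>P1\<close>, \<open>P2\<close> and \<open>P3\<close> are the tangential Laplacian, the
  normal derivative and the second normal derivative of \<open>slab\<close>.\<close>

private definition \<phi> :: "real \<Rightarrow> real" where
  "\<phi> \<theta> = Gam (fst w) (t * ca \<theta>) * flux (snd w + t * cc \<theta>) (t * cb \<theta>)"
private definition P1 :: "real \<Rightarrow> real" where
  "P1 \<theta> = t * (gauss_laplace (fst w) (t * ca \<theta>) * flux (snd w + t * cc \<theta>) (t * cb \<theta>))"
private definition P2 :: "real \<Rightarrow> real" where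
  "P2 \<theta> = t * (Gam (fst w) (t * ca \<theta>) * flux1 (snd w + t * cc \<theta>) (t * cb \<theta>))"
private definition P3 :: "real \<Rightarrow> real" where
  "P3 \<theta> = t * (Gam (fst w) (t * ca \<theta>) * flux2 (snd w + t * cc \<theta>) (t * cb \<theta>))"

private lemma integrable_P: "P1 integrable_on {0<..<1}" "P2 integrable_on {0<..<1}" "P3 integrable_on {0<..<1}"
  using dominated_family_integrable[OF dominated_family_slab[OF gauss_poly_slab_part1] w t]
    dominated_family_integrable[OF dominated_family_slab[OF gauss_poly_slab_part2] w t]
    dominated_family_integrable[OF dominated_family_slab[OF gauss_poly_slab_part3] w t]
  by (auto simp: P1_def[abs_def] P2_def[abs_def] P3_def[abs_def])

private lemma phi_1: "\<phi> 1 = 0"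
  by (simp add: \<phi>_def cb_def)

text \<open>The chain rule in \<theta> meets the slopes k/delta - 1/eps of \<open>ca\<close>,
  1/delta of \<open>cc\<close> and -1/eps of \<open>cb\<close>; by the heat equation the time
  derivatives of the two factors become \<open>P1\<close> and \<open>P3\<close>.\<close>

private lemma phi_deriv:
  assumes "0 \<le> \<theta>" "\<theta> < 1"
  shows "(\<phi> has_real_derivative ((k / delta - 1 / eps) * P1 \<theta> + (1 / delta) * P2 \<theta> - (1 / eps) * P3 \<theta>)) (at \<theta>)"
proof -
  have 1: "((\<lambda>\<theta>. Gam (fst w) (t * ca \<theta>)) has_real_derivative (t * (k / delta - 1 / eps)) * gauss_laplace (fst w) (t * ca \<theta>)) (at \<theta>)"
  proof (rule Gam_has_real_derivative_time)
    show "((\<lambda>\<theta>. t * ca \<theta>) has_real_derivative t * (k / delta - 1 / eps)) (at \<theta>)"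
      unfolding ca_def using eps delta by (auto intro!: derivative_eq_intros simp: field_simps)
  qed (use assms t ca_pos in auto)
  have "((\<lambda>\<theta>. flux (snd w + t * cc \<theta>) (t * cb \<theta>)) has_derivative
     (\<lambda>u. (t * u / delta) * flux1 (snd w + t * cc \<theta>) (t * cb \<theta>) + (- t * u / eps) * flux2 (snd w + t * cc \<theta>) (t * cb \<theta>))) (at \<theta>)"
  proof (rule has_derivative_flux)
    show "((\<lambda>\<theta>. snd w + t * cc \<theta>) has_derivative (\<lambda>u. t * u / delta)) (at \<theta>)"
      unfolding cc_def using delta by (auto intro!: derivative_eq_intros simp: field_simps)
    show "((\<lambda>\<theta>. t * cb \<theta>) has_derivative (\<lambda>u. - t * u / eps)) (at \<theta>)"
      unfolding cb_def using eps by (auto intro!: derivative_eq_intros simp: field_simps)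
  qed (use assms t cb_pos in auto)
  then have 2: "((\<lambda>\<theta>. flux (snd w + t * cc \<theta>) (t * cb \<theta>)) has_real_derivative
     (t / delta * flux1 (snd w + t * cc \<theta>) (t * cb \<theta>) - t / eps * flux2 (snd w + t * cc \<theta>) (t * cb \<theta>))) (at \<theta>)"
    unfolding has_field_derivative_def by (rule has_derivative_eq_rhs) (simp add: fun_eq_iff algebra_simps)
  show ?thesis
    unfolding \<phi>_def[abs_def] P1_def P2_def P3_def
    by (rule DERIV_cong[OF DERIV_mult[OF 1 2]]) (simp add: algebra_simps)
qed

private lemma phi_continuous: "continuous_on {0..1} \<phi>"
  unfolding continuous_on_eq_continuous_within
proof
  fix \<theta> :: real assume \<theta>: "\<theta> \<in> {0..1}"
  show "continuous (at \<theta> within {0..1}) \<phi>"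
  proof (cases "\<theta> = 1")
    case False
    then show ?thesis
      using \<theta> DERIV_isCont[OF phi_deriv[of \<theta>]] by (auto intro: continuous_at_imp_continuous_at_within)
  next
    case True
    \<comment> \<open>Boundedness of \<phi> / (t * cb \<theta>) means that \<phi> is of order 1 -
      \<theta>, which gives continuity at the degenerate end, where the value is 0 by
      \<open>phi_1\<close>.\<close>
    obtain C c where C: "C \<ge> 0" "c > 0" "\<And>\<theta>. 0 < \<theta> \<Longrightarrow> \<theta> < 1 \<Longrightarrow> \<bar>1 / (t * cb \<theta>) * \<phi> \<theta>\<bar> \<le> C * exp (- c * (norm w)\<^sup>2)"
      using gauss_weight.gauss_poly_bound[OF gauss_weight_slab gauss_poly_slab_flat t, of t] w t
      unfolding \<phi>_def by fastforce
    have "(\<phi> \<longlongrightarrow> 0) (at 1 within {0..1})"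
    proof (rule Lim_null_comparison)
      show "((\<lambda>\<theta>. C * exp (- c * (norm w)\<^sup>2) * (t * cb \<theta>)) \<longlongrightarrow> 0) (at 1 within {0..1})"
        unfolding cb_def using eps by (auto intro!: tendsto_eq_intros)
      have "eventually (\<lambda>\<theta>::real. \<theta> \<in> {0..1} \<and> \<theta> \<noteq> 1 \<and> dist \<theta> 1 < 1) (at 1 within {0..1})"
        unfolding eventually_at by (auto intro: exI[of _ 1])
      then show "eventually (\<lambda>\<theta>. norm (\<phi> \<theta>) \<le> C * exp (- c * (norm w)\<^sup>2) * (t * cb \<theta>)) (at 1 within {0..1})"
      proof (rule eventually_mono)
        fix \<theta> :: real assume "\<theta> \<in> {0..1} \<and> \<theta> \<noteq> 1 \<and> dist \<theta> 1 < 1"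
        then have \<theta>: "0 < \<theta>" "\<theta> < 1" by (auto simp: dist_real_def)
        define s where "s = t * cb \<theta>"
        have "0 < s" using t \<theta> cb_pos by (simp add: s_def)
        then show "norm (\<phi> \<theta>) \<le> C * exp (- c * (norm w)\<^sup>2) * (t * cb \<theta>)"
          using C(3)[OF \<theta>] unfolding s_def[symmetric] by (simp add: abs_mult pos_divide_le_eq)
      qed
    qed
    then show ?thesis by (simp add: continuous_within True phi_1)
  qed
qed

text \<open>The fundamental theorem of calculus for \<phi> on [0,1]. The right-hand side is
  -\<phi>(0), and it becomes the source term in the boundary equation of
  \<open>layer\<close>.\<close>

private lemma integral_identity1:
  "(k / delta - 1 / eps) * integral {0<..<1} P1 + (1 / delta) * integral {0<..<1} P2 - (1 / eps) * integral {0<..<1} P3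
    = - Gam (fst w) (t / eps) * flux (snd w) (t / eps)"
proof -
  have "((\<lambda>\<theta>. (k / delta - 1 / eps) * P1 \<theta> + (1 / delta) * P2 \<theta> - (1 / eps) * P3 \<theta>) has_integral \<phi> 1 - \<phi> 0) {0..1}"
    using phi_continuous phi_deriv
    by (intro fundamental_theorem_of_calculus_interior) (auto simp: has_real_derivative_iff_has_vector_derivative)
  then have "((\<lambda>\<theta>. (k / delta - 1 / eps) * P1 \<theta> + (1 / delta) * P2 \<theta> - (1 / eps) * P3 \<theta>) has_integral \<phi> 1 - \<phi> 0) {0<..<1}"
    by (simp add: has_integral_Icc_iff_Ioo)
  moreover have "((\<lambda>\<theta>. (k / delta - 1 / eps) * P1 \<theta> + (1 / delta) * P2 \<theta> - (1 / eps) * P3 \<theta>) has_integral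
      (k / delta - 1 / eps) * integral {0<..<1} P1 + (1 / delta) * integral {0<..<1} P2 - (1 / eps) * integral {0<..<1} P3) {0<..<1}"
    by (intro has_integral_add has_integral_diff has_integral_mult_right integrable_integral integrable_P)
  ultimately have "(k / delta - 1 / eps) * integral {0<..<1} P1 + (1 / delta) * integral {0<..<1} P2 - (1 / eps) * integral {0<..<1} P3
      = \<phi> 1 - \<phi> 0" by (rule has_integral_unique[rotated])
  then show ?thesis by (simp add: phi_1 \<phi>_def ca_def cb_def cc_def)
qed

text \<open>Because \<open>ca\<close> is 1/eps + \<theta>(k/delta - 1/eps), \<open>cb\<close> is
  1/eps - \<theta>/eps and \<open>cc\<close> is \<theta>/delta, the time derivative of
  \<open>slab\<close> splits into the \<theta>-derivative of \<theta>\<phi>(\<theta>) and (P1 +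
  P3)/eps. The first part integrates to 0, as \<phi>(1) = 0.\<close>

private lemma integral_identity2: "eps * layer_time w t = integral {0<..<1} P1 + integral {0<..<1} P3"
proof -
  have "((\<lambda>\<theta>. \<theta> * \<phi> \<theta>) has_real_derivative
     \<phi> \<theta> + \<theta> * ((k / delta - 1 / eps) * P1 \<theta> + (1 / delta) * P2 \<theta> - (1 / eps) * P3 \<theta>)) (at \<theta>)"
    if "\<theta> \<in> {0<..<1}" for \<theta>
    using that by (auto intro!: derivative_eq_intros phi_deriv)
  then have "((\<lambda>\<theta>. \<phi> \<theta> + \<theta> * ((k / delta - 1 / eps) * P1 \<theta> + (1 / delta) * P2 \<theta> - (1 / eps) * P3 \<theta>)) has_integral
      1 * \<phi> 1 - 0 * \<phi> 0) {0..1}"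
    using phi_continuous
    by (intro fundamental_theorem_of_calculus_interior)
       (auto simp: has_real_derivative_iff_has_vector_derivative intro!: continuous_intros)
  then have *: "((\<lambda>\<theta>. \<phi> \<theta> + \<theta> * ((k / delta - 1 / eps) * P1 \<theta> + (1 / delta) * P2 \<theta> - (1 / eps) * P3 \<theta>)) has_integral 0) {0<..<1}"
    by (simp add: phi_1 has_integral_Icc_iff_Ioo)
  have "((\<lambda>\<theta>. (\<phi> \<theta> + \<theta> * ((k / delta - 1 / eps) * P1 \<theta> + (1 / delta) * P2 \<theta> - (1 / eps) * P3 \<theta>)) + (1 / eps) * (P1 \<theta> + P3 \<theta>))
      has_integral 0 + (1 / eps) * (integral {0<..<1} P1 + integral {0<..<1} P3)) {0<..<1}"
    by (intro has_integral_add has_integral_mult_right integrable_integral integrable_P *)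
  also have "(\<lambda>\<theta>. (\<phi> \<theta> + \<theta> * ((k / delta - 1 / eps) * P1 \<theta> + (1 / delta) * P2 \<theta> - (1 / eps) * P3 \<theta>)) + (1 / eps) * (P1 \<theta> + P3 \<theta>))
     = (\<lambda>\<theta>. slab_time (ca \<theta>) (cb \<theta>) (cc \<theta>) w t)"
    using eps delta
    by (simp add: fun_eq_iff slab_time_def \<phi>_def P1_def P2_def P3_def)
       (simp add: ca_def cb_def cc_def field_simps)
  finally have "layer_time w t = (1 / eps) * (integral {0<..<1} P1 + integral {0<..<1} P3)"
    unfolding layer_time_def by (auto intro: integral_unique)
  then show ?thesis using eps by simp
qed

private lemma sum_layer_hess_tangential:
  "(\<Sum>b\<in>Basis. layer_hess w t (b, 0) (b, 0)) = integral {0<..<1} P1"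
proof -
  have "(\<Sum>b\<in>Basis. layer_hess w t (b, 0) (b, 0)) =
      integral {0<..<1} (\<lambda>\<theta>. \<Sum>b\<in>Basis. slab_hess (ca \<theta>) (cb \<theta>) (cc \<theta>) w t (b, 0) (b, 0))"
    unfolding layer_hess_def using w t
    by (subst integral_sum) (auto intro: dominated_family_integrable slab_families)
  also have "(\<lambda>\<theta>. \<Sum>b\<in>Basis. slab_hess (ca \<theta>) (cb \<theta>) (cc \<theta>) w t (b, 0) (b, 0)) = P1"
    by (simp add: fun_eq_iff slab_hess_def P1_def flip: sum_gauss_hess sum_distrib_left sum_distrib_right)
  finally show ?thesis .
qed

private lemma layer_hess_normal: "layer_hess w t (0, 1) (0, 1) = integral {0<..<1} P3"
  by (simp add: layer_hess_def slab_hess_def P3_def[abs_def] gauss_hess_def gauss_grad_def)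

private lemma layer_grad_normal: "layer_grad w t (0, 1) = integral {0<..<1} P2"
  by (simp add: layer_grad_def slab_grad_def P2_def[abs_def] gauss_grad_def)

lemma layer_heat_equation: "eps * layer_time w t = (\<Sum>b\<in>Basis. layer_hess w t b b)"
  unfolding sum_Basis_prod by (simp add: integral_identity2 sum_layer_hess_tangential layer_hess_normal)

text \<open>Obtained by eliminating \<open>P3\<close> between the two integral identities. It holds
  on the whole closed half space of w; for w = x - refl y with x on the boundary, w_N is y_N and the
  right-hand side is what the normal derivative of \<open>G0\<close> has to compensate.\<close>

lemma layer_boundary_equation:
  "delta * layer_time w t - k * (\<Sum>b\<in>Basis. layer_hess w t (b, 0) (b, 0)) - layer_grad w t (0, 1)
     = delta * (Gam (fst w) (t / eps) * flux (snd w) (t / eps))"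
proof -
  have P3: "integral {0<..<1} P3 = eps * layer_time w t - integral {0<..<1} P1"
    using integral_identity2 by simp
  have "Gam (fst w) (t / eps) * flux (snd w) (t / eps) =
     - ((k / delta - 1 / eps) * integral {0<..<1} P1 + (1 / delta) * integral {0<..<1} P2 - (1 / eps) * integral {0<..<1} P3)"
    using integral_identity1 by simp
  also have "\<dots> = layer_time w t - (k / delta) * integral {0<..<1} P1 - (1 / delta) * integral {0<..<1} P2"
    unfolding P3 using eps by (simp add: field_simps)
  finally have "delta * (Gam (fst w) (t / eps) * flux (snd w) (t / eps)) =
      delta * (layer_time w t - (k / delta) * integral {0<..<1} P1 - (1 / delta) * integral {0<..<1} P2)" by simp
  also have "\<dots> = delta * layer_time w t - k * integral {0<..<1} P1 - integral {0<..<1} P2"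
    using delta by (simp add: right_diff_distrib)
  finally show ?thesis
    unfolding sum_layer_hess_tangential layer_grad_normal by simp
qed

end

end

section \<open>Solutions generated by the kernel\<close>

lemma continuous_on_case_prod_compose:
  assumes "continuous_on S (\<lambda>(x, t). f x t)" "continuous_on A p" "continuous_on A q"
    "\<And>a. a \<in> A \<Longrightarrow> (p a, q a) \<in> S"
  shows "continuous_on A (\<lambda>a. f (p a) (q a))"
proof -
  have "continuous_on A (\<lambda>a. (\<lambda>(x, t). f x t) (p a, q a))"
    by (rule continuous_on_compose2[OF assms(1)]) (use assms in \<open>auto intro!: continuous_intros\<close>)
  then show ?thesis by simp
qed

section \<open>Closure properties of \<open>C21_derivs\<close>\<close>

lemma C21_derivsD:
  assumes "C21_derivs X u ut Du D2u"
  shows "\<And>x t. x \<in> X \<Longrightarrow> t > 0 \<Longrightarrow> ((\<lambda>s. u x s) has_real_derivative ut x t) (at t)"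
    "\<And>x t. x \<in> X \<Longrightarrow> t > 0 \<Longrightarrow> ((\<lambda>y. u y t) has_derivative Du x t) (at x within X)"
    "\<And>x t b. x \<in> X \<Longrightarrow> t > 0 \<Longrightarrow> b \<in> Basis \<Longrightarrow> ((\<lambda>y. Du y t b) has_derivative D2u x t b) (at x within X)"
    "continuous_on (X \<times> {0<..}) (\<lambda>(x,t). u x t)"
    "continuous_on (X \<times> {0<..}) (\<lambda>(x,t). ut x t)"
    "\<And>b. b \<in> Basis \<Longrightarrow> continuous_on (X \<times> {0<..}) (\<lambda>(x,t). Du x t b)"
    "\<And>b c. b \<in> Basis \<Longrightarrow> c \<in> Basis \<Longrightarrow> continuous_on (X \<times> {0<..}) (\<lambda>(x,t). D2u x t b c)"
  using assms unfolding C21_derivs_def C11_derivs_def by auto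

lemma C21_derivsI:
  assumes "\<And>x t. x \<in> X \<Longrightarrow> t > 0 \<Longrightarrow> ((\<lambda>s. u x s) has_real_derivative ut x t) (at t)"
    "\<And>x t. x \<in> X \<Longrightarrow> t > 0 \<Longrightarrow> ((\<lambda>y. u y t) has_derivative Du x t) (at x within X)"
    "\<And>x t b. x \<in> X \<Longrightarrow> t > 0 \<Longrightarrow> b \<in> Basis \<Longrightarrow> ((\<lambda>y. Du y t b) has_derivative D2u x t b) (at x within X)"
    "continuous_on (X \<times> {0<..}) (\<lambda>(x,t). u x t)"
    "continuous_on (X \<times> {0<..}) (\<lambda>(x,t). ut x t)"
    "\<And>b. b \<in> Basis \<Longrightarrow> continuous_on (X \<times> {0<..}) (\<lambda>(x,t). Du x t b)"
    "\<And>b c. b \<in> Basis \<Longrightarrow> c \<in> Basis \<Longrightarrow> continuous_on (X \<times> {0<..}) (\<lambda>(x,t). D2u x t b c)"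
  shows "C21_derivs X u ut Du D2u"
  using assms unfolding C21_derivs_def C11_derivs_def by auto

lemma C21_derivs_cong:
  assumes u: "C21_derivs X u ut Du D2u" and eq: "\<And>x t. x \<in> X \<Longrightarrow> t > 0 \<Longrightarrow> v x t = u x t"
  shows "C21_derivs X v ut Du D2u"
proof (rule C21_derivsI)
  fix x t assume x: "x \<in> X" and t: "(0::real) < t"
  show "((\<lambda>s. v x s) has_real_derivative ut x t) (at t)"
    by (rule has_field_derivative_transform_within_open[OF C21_derivsD(1)[OF u x t], of "{0<..}"]) (use t x eq in auto)
  show "((\<lambda>y. v y t) has_derivative Du x t) (at x within X)"
    by (rule has_derivative_transform[OF x _ C21_derivsD(2)[OF u x t]]) (use t eq in auto)
next
  show "continuous_on (X \<times> {0<..}) (\<lambda>(x, t). v x t)"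
    by (rule continuous_on_eq[OF C21_derivsD(4)[OF u]]) (use eq in auto)
qed (use C21_derivsD[OF u] in auto)

lemma C21_derivs_translate:
  assumes u: "C21_derivs W u ut Du D2u" and W: "\<And>x. x \<in> X \<Longrightarrow> x - a \<in> W"
  shows "C21_derivs X (\<lambda>x. u (x - a)) (\<lambda>x. ut (x - a)) (\<lambda>x. Du (x - a)) (\<lambda>x. D2u (x - a))"
proof (rule C21_derivsI)
  have shift: "((\<lambda>y. f (y - a)) has_derivative f') (at x within X)"
    if "x \<in> X" "(f has_derivative f') (at (x - a) within W)" for f :: "'a \<Rightarrow> real" and f' x
  proof -
    have "((\<lambda>y. y - a) has_derivative (\<lambda>v. v)) (at x within X)" by (auto intro!: derivative_eq_intros)
    moreover have "(f has_derivative f') (at (x - a) within (\<lambda>y. y - a) ` X)"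
      by (rule has_derivative_subset[OF that(2)]) (use W in auto)
    ultimately show ?thesis by (rule has_derivative_in_compose)
  qed
  have cont: "continuous_on (X \<times> {0<..}) (\<lambda>(x, t). f (x - a) t)"
    if "continuous_on (W \<times> {0<..}) (\<lambda>(x, t). f x t)" for f :: "'a \<Rightarrow> real \<Rightarrow> real"
    unfolding split_beta'
    by (rule continuous_on_case_prod_compose[OF that]) (use W in \<open>auto intro!: continuous_intros\<close>)
  show "continuous_on (X \<times> {0<..}) (\<lambda>(x, t). u (x - a) t)"
    "continuous_on (X \<times> {0<..}) (\<lambda>(x, t). ut (x - a) t)"
    by (intro cont C21_derivsD[OF u])+
  show "continuous_on (X \<times> {0<..}) (\<lambda>(x, t). Du (x - a) t b)" if "b \<in> Basis" for b
    using cont[of "\<lambda>x t. Du x t b"] C21_derivsD[OF u] that by auto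
  show "continuous_on (X \<times> {0<..}) (\<lambda>(x, t). D2u (x - a) t b c)" if "b \<in> Basis" "c \<in> Basis" for b c
    using cont[of "\<lambda>x t. D2u x t b c"] C21_derivsD[OF u] that by auto
  fix x t assume x: "x \<in> X" and t: "(0::real) < t"
  show "((\<lambda>s. u (x - a) s) has_real_derivative ut (x - a) t) (at t)"
    by (intro C21_derivsD[OF u] W x t)
  show "((\<lambda>y. u (y - a) t) has_derivative Du (x - a) t) (at x within X)"
    by (intro shift C21_derivsD[OF u] W x t)
  show "((\<lambda>y. Du (y - a) t b) has_derivative D2u (x - a) t b) (at x within X)" if "b \<in> Basis" for b
    by (rule shift[OF x C21_derivsD(3)[OF u W[OF x] t that]])
qed

lemma C21_derivs_add:
  assumes u: "C21_derivs X u ut Du D2u" and v: "C21_derivs X v vt Dv D2v"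
  shows "C21_derivs X (\<lambda>x t. u x t + v x t) (\<lambda>x t. ut x t + vt x t) (\<lambda>x t b. Du x t b + Dv x t b)
     (\<lambda>x t b c. D2u x t b c + D2v x t b c)"
  using continuous_on_add[OF C21_derivsD(4)[OF u] C21_derivsD(4)[OF v]]
    continuous_on_add[OF C21_derivsD(5)[OF u] C21_derivsD(5)[OF v]]
    continuous_on_add[OF C21_derivsD(6)[OF u] C21_derivsD(6)[OF v]]
    continuous_on_add[OF C21_derivsD(7)[OF u] C21_derivsD(7)[OF v]]
  by (intro C21_derivsI) (auto intro!: DERIV_add has_derivative_add C21_derivsD[OF u] C21_derivsD[OF v] simp: split_beta')

lemma C21_derivs_cmult:
  assumes u: "C21_derivs X u ut Du D2u"
  shows "C21_derivs X (\<lambda>x t. r * u x t) (\<lambda>x t. r * ut x t) (\<lambda>x t b. r * Du x t b) (\<lambda>x t b c. r * D2u x t b c)"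
  using continuous_on_mult_left[OF C21_derivsD(4)[OF u], of r]
    continuous_on_mult_left[OF C21_derivsD(5)[OF u], of r]
    continuous_on_mult_left[OF C21_derivsD(6)[OF u], of _ r]
    continuous_on_mult_left[OF C21_derivsD(7)[OF u], of _ _ r]
  by (intro C21_derivsI) (auto intro!: DERIV_cmult has_derivative_mult_right C21_derivsD[OF u] simp: split_beta')

lemma C21_derivs_time_shift:
  assumes u: "C21_derivs X u ut Du D2u" and s: "s \<ge> 0"
  shows "C21_derivs X (\<lambda>x t. u x (t + s)) (\<lambda>x t. ut x (t + s)) (\<lambda>x t. Du x (t + s)) (\<lambda>x t. D2u x (t + s))"
proof (rule C21_derivsI)
  have cont: "continuous_on (X \<times> {0<..}) (\<lambda>(x, t). f x (t + s))"
    if "continuous_on (X \<times> {0<..}) (\<lambda>(x, t). f x t)" for f :: "'a \<Rightarrow> real \<Rightarrow> real"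
    unfolding split_beta'
    by (rule continuous_on_case_prod_compose[OF that]) (use s in \<open>auto intro!: continuous_intros\<close>)
  show "continuous_on (X \<times> {0<..}) (\<lambda>(x, t). u x (t + s))"
    "continuous_on (X \<times> {0<..}) (\<lambda>(x, t). ut x (t + s))"
    by (intro cont C21_derivsD[OF u])+
  show "continuous_on (X \<times> {0<..}) (\<lambda>(x, t). Du x (t + s) b)" if "b \<in> Basis" for b
    using cont[of "\<lambda>x t. Du x t b"] C21_derivsD[OF u] that by auto
  show "continuous_on (X \<times> {0<..}) (\<lambda>(x, t). D2u x (t + s) b c)" if "b \<in> Basis" "c \<in> Basis" for b c
    using cont[of "\<lambda>x t. D2u x t b c"] C21_derivsD[OF u] that by auto
  fix x t assume x: "x \<in> X" and t: "(0::real) < t"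
  show "((\<lambda>t. u x (t + s)) has_real_derivative ut x (t + s)) (at t)"
    using C21_derivsD(1)[OF u x, of "t + s"] t s by (intro iffD1[OF DERIV_shift]) auto
qed (use C21_derivsD[OF u] s in auto)

lemma C21_derivs_subset:
  assumes u: "C21_derivs X u ut Du D2u" and "Y \<subseteq> X"
  shows "C21_derivs Y u ut Du D2u"
proof (rule C21_derivsI)
  fix x t assume "x \<in> Y" and t: "(0::real) < t"
  then have x: "x \<in> X" using assms(2) by auto
  show "((\<lambda>s. u x s) has_real_derivative ut x t) (at t)" by (rule C21_derivsD(1)[OF u x t])
  show "((\<lambda>y. u y t) has_derivative Du x t) (at x within Y)"
    by (rule has_derivative_subset[OF C21_derivsD(2)[OF u x t] assms(2)])
  show "((\<lambda>y. Du y t b) has_derivative D2u x t b) (at x within Y)" if "b \<in> Basis" for b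
    by (rule has_derivative_subset[OF C21_derivsD(3)[OF u x t that] assms(2)])
next
  have sub: "Y \<times> {0<..} \<subseteq> X \<times> ({0<..} :: real set)" using assms(2) by auto
  show "continuous_on (Y \<times> {0<..}) (\<lambda>(x, t). u x t)" "continuous_on (Y \<times> {0<..}) (\<lambda>(x, t). ut x t)"
    by (rule continuous_on_subset[OF C21_derivsD(4)[OF u] sub] continuous_on_subset[OF C21_derivsD(5)[OF u] sub])+
  show "continuous_on (Y \<times> {0<..}) (\<lambda>(x, t). Du x t b)" if "b \<in> Basis" for b
    by (rule continuous_on_subset[OF C21_derivsD(6)[OF u that] sub])
  show "continuous_on (Y \<times> {0<..}) (\<lambda>(x, t). D2u x t b c)" if "b \<in> Basis" "c \<in> Basis" for b c
    by (rule continuous_on_subset[OF C21_derivsD(7)[OF u that] sub])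
qed

lemma Gam_Pair: "Gam (z, \<xi>) s = Gam z s * Gam \<xi> s" for z :: "'a::euclidean_space" and \<xi> :: "'b::euclidean_space"
proof -
  have 1: "- real DIM('a \<times> 'b) / 2 = - real DIM('a) / 2 + - real DIM('b) / 2" by (simp add: field_simps)
  have 2: "- (norm (z, \<xi>))\<^sup>2 / (4 * s) = - (norm z)\<^sup>2 / (4 * s) + - (norm \<xi>)\<^sup>2 / (4 * s)"
    by (simp add: norm_Pair diff_divide_distrib)
  show ?thesis unfolding Gam_def 1 2 powr_add exp_add by (simp only: mult_ac)
qed

text \<open>The weight is now \<open>Gam\<close> itself, and the coefficients of its derivatives are
  polynomials in x and eps/t, so the scheme built for \<open>slab\<close> applies with a single
  Gaussian factor.\<close>

lemma Gam_jet:
  fixes eps :: real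
  assumes eps: "eps > 0"
  defines "gb \<equiv> gauss_bounded (UNIV :: 'a::euclidean_space set)"
  shows C21_Gam: "C21_derivs (UNIV :: 'a set) (\<lambda>x t. Gam x (t / eps)) (\<lambda>x t. (1 / eps) * gauss_laplace x (t / eps))
      (\<lambda>x t. gauss_grad x (t / eps)) (\<lambda>x t. gauss_hess x (t / eps))"
    and gauss_bounded_Gam: "gb (\<lambda>x t. Gam x (t / eps))"
    and gauss_bounded_Gam_time: "gb (\<lambda>x t. (1 / eps) * gauss_laplace x (t / eps))"
    and gauss_bounded_Gam_grad: "gb (\<lambda>x t. gauss_grad x (t / eps) v)"
    and gauss_bounded_Gam_hess: "gb (\<lambda>x t. gauss_hess x (t / eps) v u)"
proof -
  interpret gw: gauss_weight "(UNIV :: 'a set) \<times> {0<..}" snd "\<lambda>p. 1 + norm (fst p)"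
     "\<lambda>p. Gam (fst p) (snd p / eps)" "\<lambda>p. norm (fst p)"
    by (rule gauss_weight_Gam[OF eps])
  have x: "gw.poly_growth (\<lambda>p. fst p \<bullet> v)" for v :: 'a
  proof (rule gw.poly_growth_bound1[where c = "norm v"])
    fix p :: "'a \<times> real"
    have "\<bar>fst p \<bullet> v\<bar> \<le> norm (fst p) * norm v" by (rule Cauchy_Schwarz_ineq2)
    also have "\<dots> \<le> norm v * (1 + norm (fst p))" by (simp add: algebra_simps)
    finally show "\<bar>fst p \<bullet> v\<bar> \<le> norm v * (1 + norm (fst p))" .
  qed (auto intro!: continuous_intros)
  have nx: "gw.poly_growth (\<lambda>p. norm (fst p))"
    by (rule gw.poly_growth_bound1[where c = 1]) (auto intro!: continuous_intros)
  have s: "gw.poly_growth (\<lambda>p. 1 / (snd p / eps))"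
  proof (rule gw.poly_growthI[of _ 0])
    show "\<exists>C\<ge>0. \<forall>p\<in>(UNIV :: 'a set) \<times> {0<..}. snd p \<in> {t1..t2} \<longrightarrow> \<bar>1 / (snd p / eps)\<bar> \<le> C * (1 + norm (fst p)) ^ 0"
      if "t1 > 0" for t1 t2 :: real
      using that eps by (intro exI[of _ "eps / t1"]) (auto simp: frac_le)
  qed (use eps in \<open>auto intro!: continuous_intros\<close>)
  have bounded: "gauss_bounded UNIV F" if F: "gw.gauss_poly (\<lambda>p. F (fst p) (snd p))" for F :: "'a \<Rightarrow> real \<Rightarrow> real"
    unfolding gauss_bounded_def
  proof (intro conjI allI impI)
    show "continuous_on (UNIV \<times> {0<..}) (\<lambda>(x, t). F x t)"
      using gw.gauss_poly_continuous[OF F] by (simp add: split_beta')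
    fix t1 t2 :: real assume t1: "t1 > 0"
    obtain C c where C: "C \<ge> 0" "c > 0"
      and le: "\<forall>p\<in>(UNIV :: 'a set) \<times> {0<..}. snd p \<in> {t1..t2} \<longrightarrow> \<bar>F (fst p) (snd p)\<bar> \<le> C * exp (- c * (norm (fst p))\<^sup>2)"
      using gw.gauss_poly_bound[OF F t1, of t2] by blast
    have "\<bar>F x t\<bar> \<le> C * exp (- c * (norm x)\<^sup>2)" if "t \<in> {t1..t2}" for x t
      using bspec[OF le, of "(x, t)"] that t1 by simp
    then show "\<exists>C\<ge>0. \<exists>c>0. \<forall>x\<in>UNIV. \<forall>t\<in>{t1..t2}. \<bar>F x t\<bar> \<le> C * exp (- c * (norm x)\<^sup>2)"
      using C by blast
  qed
  note intros = gw.poly_growth_intros x nx s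
  show 1: "gb (\<lambda>x t. Gam x (t / eps))"
    unfolding gb_def by (intro bounded gw.gauss_polyI[where R = "\<lambda>_. 1"] intros) auto
  show 2: "gb (\<lambda>x t. (1 / eps) * gauss_laplace x (t / eps))"
    unfolding gb_def
    by (intro bounded gw.gauss_polyI[where R = "\<lambda>p. (1 / eps) * ((1/4) * (norm (fst p))\<^sup>2 * (1 / (snd p / eps))\<^sup>2
         - (DIM('a) / 2) * (1 / (snd p / eps)))"] intros)
       (simp only: gauss_laplace_def power2_norm_eq_inner mult.assoc)
  show 3: "gb (\<lambda>x t. gauss_grad x (t / eps) v)" for v
    unfolding gb_def
    by (intro bounded gw.gauss_polyI[where R = "\<lambda>p. - (1/2) * (fst p \<bullet> v) * (1 / (snd p / eps))"] intros)
       (simp only: gauss_grad_def)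
  show 4: "gb (\<lambda>x t. gauss_hess x (t / eps) v u)" for v u
    unfolding gb_def
    by (intro bounded gw.gauss_polyI[where R = "\<lambda>p. (1/4) * (fst p \<bullet> v) * (fst p \<bullet> u) * (1 / (snd p / eps))\<^sup>2
         - (1/2) * (v \<bullet> u) * (1 / (snd p / eps))"] intros)
       (simp only: gauss_hess_def)
  show "C21_derivs (UNIV :: 'a set) (\<lambda>x t. Gam x (t / eps)) (\<lambda>x t. (1 / eps) * gauss_laplace x (t / eps))
      (\<lambda>x t. gauss_grad x (t / eps)) (\<lambda>x t. gauss_hess x (t / eps))"
  proof (rule C21_derivsI)
    fix x :: 'a and t :: real assume t: "0 < t"
    show "((\<lambda>s. Gam x (s / eps)) has_real_derivative 1 / eps * gauss_laplace x (t / eps)) (at t)"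
      using eps t by (intro Gam_has_real_derivative_time) (auto intro!: derivative_eq_intros)
    show "((\<lambda>y. Gam y (t / eps)) has_derivative gauss_grad x (t / eps)) (at x)"
      using has_derivative_Gam_space[OF has_derivative_ident, of "t / eps" x UNIV] eps t by simp
    show "((\<lambda>y. gauss_grad y (t / eps) b) has_derivative gauss_hess x (t / eps) b) (at x)" for b
      using has_derivative_gauss_grad[OF has_derivative_ident, of "t / eps" b x UNIV] eps t by simp
  qed (use 1 2 3 4 in \<open>auto simp: gb_def intro: gauss_bounded_continuous\<close>)
qed

section \<open>Normalisation and integrability of Gaussians\<close>

lemma Gam_eq_prod: "Gam x s = (\<Prod>b\<in>Basis. Gam (x \<bullet> b) s)" for x :: "'a::euclidean_space"
proof -
  have "(\<Prod>b\<in>(Basis :: 'a set). Gam (x \<bullet> b) s) =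
      ((4 * pi * s) powr (- 1 / 2)) ^ DIM('a) * exp (\<Sum>b\<in>Basis. - (x \<bullet> b)\<^sup>2 / (4 * s))"
    by (simp add: Gam_def prod.distrib exp_sum)
  also have "((4 * pi * s) powr (- 1 / 2)) ^ DIM('a) = (4 * pi * s) powr (- real DIM('a) / 2)"
    by (cases "s = 0") (simp_all add: powr_power)
  also have "(\<Sum>b\<in>Basis. - (x \<bullet> b)\<^sup>2 / (4 * s)) = - (norm x)\<^sup>2 / (4 * s)"
  proof -
    have "(norm x)\<^sup>2 = (\<Sum>b\<in>Basis. (x \<bullet> b)\<^sup>2)"
      unfolding power2_norm_eq_inner by (subst euclidean_inner) (simp add: power2_eq_square)
    then show ?thesis by (simp add: sum_negf flip: sum_divide_distrib)
  qed
  finally show ?thesis by (simp add: Gam_def)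
qed

lemma Gam_real_eq_normal_density:
  "s > 0 \<Longrightarrow> Gam x s = normal_density 0 (sqrt (2 * s)) x" for x :: real
  by (simp add: Gam_def normal_density_def powr_minus powr_half_sqrt field_simps)

lemma borel_measurable_Gam [measurable]: "(\<lambda>x::'a::euclidean_space. Gam x s) \<in> borel_measurable borel"
  unfolding Gam_def by measurable

text \<open>Factorisation over the coordinates reduces the claim to dimension one, where
  \<open>Gam\<close> is the normal density of variance 2s.\<close>

lemma nn_integral_Gam:
  assumes "s > 0"
  shows "(\<integral>\<^sup>+ x. ennreal (Gam x s) \<partial>(lborel :: 'a::euclidean_space measure)) = 1"
proof -
  have 1: "(\<integral>\<^sup>+ x. ennreal (Gam x s) \<partial>(lborel :: real measure)) = 1"
  proof -
    have "prob_space (density lborel (normal_density 0 (sqrt (2 * s))))"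
      using assms by (intro prob_space_normal_density) simp
    from prob_space.emeasure_space_1[OF this] show ?thesis
      by (simp add: emeasure_density Gam_real_eq_normal_density[OF assms])
  qed
  have "(\<integral>\<^sup>+ x. ennreal (Gam x s) \<partial>(lborel :: 'a measure)) = (\<integral>\<^sup>+ x. (\<Prod>b\<in>Basis. ennreal (Gam (x \<bullet> b) s)) \<partial>(lborel :: 'a measure))"
    by (subst Gam_eq_prod) (simp add: prod_ennreal Gam_nonneg)
  also have "\<dots> = (\<Prod>b\<in>(Basis :: 'a set). (\<integral>\<^sup>+ x. ennreal (Gam x s) \<partial>(lborel :: real measure)))"
    by (rule nn_integral_lborel_prod) auto
  finally show ?thesis by (simp add: 1)
qed

lemma has_integral_Gam: "s > 0 \<Longrightarrow> ((\<lambda>x::'a::euclidean_space. Gam x s) has_integral 1) UNIV"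
  by (intro nn_integral_has_integral) (auto simp: Gam_nonneg nn_integral_Gam)

text \<open>Henstock-Kurzweil integrability need not pass to subsets; nonnegativity upgrades it to
  absolute integrability, which does.\<close>

lemma nonneg_integrable_on_open_subset:
  fixes f :: "'a::euclidean_space \<Rightarrow> real"
  assumes "f integrable_on T" "\<And>x. x \<in> T \<Longrightarrow> 0 \<le> f x" "S \<subseteq> T" "open S"
  shows "f integrable_on S"
proof -
  have "f absolutely_integrable_on T"
    using assms by (intro nonnegative_absolutely_integrable_1) auto
  then have "f absolutely_integrable_on S"
    using assms by (intro set_integrable_subset[of lebesgue T f S]) auto
  then show ?thesis by (rule set_lebesgue_integral_eq_integral)
qed

text \<open>The function is a constant multiple of \<open>Gam\<close> at time 1/(4c).\<close>

lemma integrable_gaussian: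
  fixes S :: "'a::euclidean_space set"
  assumes "c > 0" "open S"
  shows "(\<lambda>y. exp (- c * (norm y)\<^sup>2)) integrable_on S"
proof -
  define s where "s = 1 / (4 * c)"
  define r where "r = (4 * pi * s) powr (- real DIM('a) / 2)"
  have s: "s > 0" and r: "r > 0" using assms by (auto simp: s_def r_def)
  have "Gam y s = r * exp (- c * (norm y)\<^sup>2)" for y :: 'a
    unfolding Gam_def r_def using assms by (simp add: s_def mult.commute)
  then have "exp (- c * (norm y)\<^sup>2) = (1 / r) * Gam y s" for y :: 'a
    using r by simp
  moreover have "(\<lambda>y::'a. (1 / r) * Gam y s) integrable_on UNIV"
    using has_integral_Gam[OF s] by (intro integrable_on_mult_right) (auto simp: integrable_on_def)
  ultimately have "(\<lambda>y::'a. exp (- c * (norm y)\<^sup>2)) integrable_on UNIV" by simp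
  then show ?thesis by (rule nonneg_integrable_on_open_subset) (use assms in auto)
qed

lemma norm_refl [simp]: "norm (refl y) = norm y"
  by (simp add: refl_def norm_prod_def)

lemma refl_boundary [simp]: "refl (z, 0) = (z, 0)"
  by (simp add: refl_def)

lemma continuous_on_refl [continuous_intros]: "continuous_on S f \<Longrightarrow> continuous_on S (\<lambda>x. refl (f x))"
  unfolding refl_def by (intro continuous_intros)

lemma diff_refl_in_Omega_bar: "x \<in> Omega_bar \<Longrightarrow> y \<in> Omega_bar \<Longrightarrow> x - refl y \<in> Omega_bar"
  by (simp add: Omega_bar_def refl_def)

lemma boundary_in_Omega_bar [simp]: "(z, 0) \<in> Omega_bar"
  by (simp add: Omega_bar_def)

lemma Omega_subset: "Omega \<subseteq> Omega_bar"
  by (auto simp: Omega_def Omega_bar_def)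

lemma open_Omega: "open Omega"
  unfolding Omega_def by (intro open_Collect_less continuous_intros)

text \<open>Uniformity for x in bounded sets and Gaussian decay in the source y: together they
  provide one dominating function in y for all parameters near a given (x, t).\<close>

definition kernel_bounded ::
    "((real^'n) \<times> real \<Rightarrow> (real^'n) \<times> real \<Rightarrow> real \<Rightarrow> real) \<Rightarrow> bool" where
  "kernel_bounded g \<longleftrightarrow>
     continuous_on (Omega_bar \<times> Omega_bar \<times> {0<..}) (\<lambda>(x, y, t). g x y t) \<and>
     (\<forall>R. \<forall>t1>0. \<forall>t2. \<exists>C\<ge>0. \<exists>c>0. \<forall>x\<in>Omega_bar. \<forall>y\<in>Omega_bar. \<forall>t\<in>{t1..t2}.
        norm x \<le> R \<longrightarrow> \<bar>g x y t\<bar> \<le> C * exp (- c * (norm y)\<^sup>2))"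

lemma kernel_boundedD:
  assumes "kernel_bounded g"
  shows kernel_bounded_continuous: "continuous_on (Omega_bar \<times> Omega_bar \<times> {0<..}) (\<lambda>(x, y, t). g x y t)"
    and kernel_bounded_bound: "t1 > 0 \<Longrightarrow> \<exists>C\<ge>0. \<exists>c>0. \<forall>x\<in>Omega_bar. \<forall>y\<in>Omega_bar. \<forall>t\<in>{t1..t2}.
        norm x \<le> R \<longrightarrow> \<bar>g x y t\<bar> \<le> C * exp (- c * (norm y)\<^sup>2)"
  using assms by (auto simp: kernel_bounded_def)

lemma kernel_bounded_add:
  assumes f: "kernel_bounded f" and g: "kernel_bounded g"
  shows "kernel_bounded (\<lambda>x y t. f x y t + g x y t)"
  unfolding kernel_bounded_def
proof (intro conjI allI impI)
  show "continuous_on (Omega_bar \<times> Omega_bar \<times> {0<..}) (\<lambda>(x, y, t). f x y t + g x y t)"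
    using continuous_on_add[OF kernel_bounded_continuous[OF f] kernel_bounded_continuous[OF g]]
    by (simp add: split_beta')
  fix R t1 t2 :: real assume t1: "t1 > 0"
  obtain C1 c1 where 1: "C1 \<ge> 0" "c1 > 0" "\<And>x y t. x \<in> Omega_bar \<Longrightarrow> y \<in> Omega_bar \<Longrightarrow> t \<in> {t1..t2} \<Longrightarrow>
        norm x \<le> R \<Longrightarrow> \<bar>f x y t\<bar> \<le> C1 * exp (- c1 * (norm y)\<^sup>2)"
    using kernel_bounded_bound[OF f t1, of t2 R] by blast
  obtain C2 c2 where 2: "C2 \<ge> 0" "c2 > 0" "\<And>x y t. x \<in> Omega_bar \<Longrightarrow> y \<in> Omega_bar \<Longrightarrow> t \<in> {t1..t2} \<Longrightarrow>
        norm x \<le> R \<Longrightarrow> \<bar>g x y t\<bar> \<le> C2 * exp (- c2 * (norm y)\<^sup>2)"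
    using kernel_bounded_bound[OF g t1, of t2 R] by blast
  define c where "c = min c1 c2"
  have "\<bar>f x y t + g x y t\<bar> \<le> (C1 + C2) * exp (- c * (norm y)\<^sup>2)"
    if "x \<in> Omega_bar" "y \<in> Omega_bar" "t \<in> {t1..t2}" "norm x \<le> R" for x y t
  proof -
    have "exp (- c1 * (norm y)\<^sup>2) \<le> exp (- c * (norm y)\<^sup>2)" "exp (- c2 * (norm y)\<^sup>2) \<le> exp (- c * (norm y)\<^sup>2)"
      by (auto simp: c_def intro!: mult_right_mono)
    then have "C1 * exp (- c1 * (norm y)\<^sup>2) \<le> C1 * exp (- c * (norm y)\<^sup>2)"
      "C2 * exp (- c2 * (norm y)\<^sup>2) \<le> C2 * exp (- c * (norm y)\<^sup>2)"
      using 1(1) 2(1) by (auto intro: mult_left_mono)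
    then show ?thesis using 1(3)[OF that] 2(3)[OF that] unfolding distrib_right by linarith
  qed
  moreover have "c > 0" using 1 2 by (simp add: c_def)
  ultimately show "\<exists>C\<ge>0. \<exists>c>0. \<forall>x\<in>Omega_bar. \<forall>y\<in>Omega_bar. \<forall>t\<in>{t1..t2}.
        norm x \<le> R \<longrightarrow> \<bar>f x y t + g x y t\<bar> \<le> C * exp (- c * (norm y)\<^sup>2)"
    using 1(1) 2(1) by (intro exI[of _ "C1 + C2"] conjI exI[of _ c]) auto
qed

lemma kernel_bounded_cmult:
  assumes f: "kernel_bounded f"
  shows "kernel_bounded (\<lambda>x y t. r * f x y t)"
  unfolding kernel_bounded_def
proof (intro conjI allI impI)
  show "continuous_on (Omega_bar \<times> Omega_bar \<times> {0<..}) (\<lambda>(x, y, t). r * f x y t)"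
    using continuous_on_mult_left[OF kernel_bounded_continuous[OF f], of r]
    by (simp add: split_beta')
  fix R t1 t2 :: real assume t1: "t1 > 0"
  obtain C1 c1 where 1: "C1 \<ge> 0" "c1 > 0" "\<And>x y t. x \<in> Omega_bar \<Longrightarrow> y \<in> Omega_bar \<Longrightarrow> t \<in> {t1..t2} \<Longrightarrow>
        norm x \<le> R \<Longrightarrow> \<bar>f x y t\<bar> \<le> C1 * exp (- c1 * (norm y)\<^sup>2)"
    using kernel_bounded_bound[OF f t1, of t2 R] by blast
  have "\<bar>r * f x y t\<bar> \<le> (\<bar>r\<bar> * C1) * exp (- c1 * (norm y)\<^sup>2)"
    if "x \<in> Omega_bar" "y \<in> Omega_bar" "t \<in> {t1..t2}" "norm x \<le> R" for x y t
    using mult_left_mono[OF 1(3)[OF that], of "\<bar>r\<bar>"] by (simp add: abs_mult mult.assoc)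
  then show "\<exists>C\<ge>0. \<exists>c>0. \<forall>x\<in>Omega_bar. \<forall>y\<in>Omega_bar. \<forall>t\<in>{t1..t2}.
        norm x \<le> R \<longrightarrow> \<bar>r * f x y t\<bar> \<le> C * exp (- c * (norm y)\<^sup>2)"
    using 1 by (intro exI[of _ "\<bar>r\<bar> * C1"] conjI exI[of _ c1]) auto
qed

text \<open>The map m is the identity or \<open>refl\<close>, both norm preserving. Since norm y^2
  \<le> 2 norm(x - m y)^2 + 2 R^2, decay in x - m y becomes decay in y at half the rate.\<close>

lemma kernel_bounded_translate:
  fixes F :: "(real^'n) \<times> real \<Rightarrow> real \<Rightarrow> real"
  assumes F: "gauss_bounded W F"
    and m: "\<And>y. norm (m y) = norm y" "continuous_on Omega_bar m"
    and W: "\<And>x y. x \<in> Omega_bar \<Longrightarrow> y \<in> Omega_bar \<Longrightarrow> x - m y \<in> W"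
  shows "kernel_bounded (\<lambda>x y t. F (x - m y) t)"
  unfolding kernel_bounded_def
proof (intro conjI allI impI)
  have "continuous_on (Omega_bar \<times> Omega_bar \<times> {0<..}) (\<lambda>p. F (fst p - m (fst (snd p))) (snd (snd p)))"
    by (rule continuous_on_case_prod_compose[OF gauss_bounded_continuous[OF F]])
       (auto intro!: continuous_intros continuous_on_compose2[OF m(2)] W)
  then show "continuous_on (Omega_bar \<times> Omega_bar \<times> {0<..}) (\<lambda>(x, y, t). F (x - m y) t)"
    by (simp add: split_beta')
  fix R t1 t2 :: real assume t1: "t1 > 0"
  obtain C c where C: "C \<ge> 0" "c > 0" "\<And>x t. x \<in> W \<Longrightarrow> t \<in> {t1..t2} \<Longrightarrow> \<bar>F x t\<bar> \<le> C * exp (- c * (norm x)\<^sup>2)"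
    using gauss_bounded_bound[OF F t1, of t2] by blast
  have "\<bar>F (x - m y) t\<bar> \<le> (C * exp (c * R\<^sup>2)) * exp (- (c / 2) * (norm y)\<^sup>2)"
    if "x \<in> Omega_bar" "y \<in> Omega_bar" "t \<in> {t1..t2}" "norm x \<le> R" for x y t
  proof -
    have "norm y \<le> norm (x - m y) + norm x"
      using norm_triangle_ineq2[of "m y" x] m(1)[of y] by (simp add: norm_minus_commute)
    also have "\<dots> \<le> norm (x - m y) + R" using that(4) by simp
    finally have "(norm y)\<^sup>2 \<le> (norm (x - m y) + R)\<^sup>2" by (intro power_mono) auto
    also have "\<dots> \<le> 2 * (norm (x - m y))\<^sup>2 + 2 * R\<^sup>2"
      using sum_squares_ge_zero[of "norm (x - m y) - R" 0] by (simp add: power2_eq_square algebra_simps)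
    finally have "(c / 2) * (norm y)\<^sup>2 \<le> (c / 2) * (2 * (norm (x - m y))\<^sup>2 + 2 * R\<^sup>2)"
      using C(2) by (intro mult_left_mono) auto
    then have "exp (- c * (norm (x - m y))\<^sup>2) \<le> exp (c * R\<^sup>2 + - (c / 2) * (norm y)\<^sup>2)"
      by (simp add: algebra_simps)
    then have "C * exp (- c * (norm (x - m y))\<^sup>2) \<le> C * (exp (c * R\<^sup>2) * exp (- (c / 2) * (norm y)\<^sup>2))"
      using C(1) unfolding exp_add by (intro mult_left_mono)
    then show ?thesis using C(3)[OF W[OF that(1,2)] that(3)] by simp
  qed
  then show "\<exists>C\<ge>0. \<exists>c>0. \<forall>x\<in>Omega_bar. \<forall>y\<in>Omega_bar. \<forall>t\<in>{t1..t2}.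
        norm x \<le> R \<longrightarrow> \<bar>F (x - m y) t\<bar> \<le> C * exp (- c * (norm y)\<^sup>2)"
    using C by (intro exI[of _ "C * exp (c * R\<^sup>2)"] conjI exI[of _ "c / 2"]) auto
qed

text \<open>The pair (S, m) is used both for interior sources (S the half space, m the identity) and for
  boundary sources (S the whole of R^(N-1), m the embedding).\<close>

lemma dominated_family_kernel:
  fixes m :: "'b::euclidean_space \<Rightarrow> (real^'n) \<times> real"
  assumes g: "kernel_bounded g"
    and S: "open S" and m: "\<And>y. y \<in> S \<Longrightarrow> m y \<in> Omega_bar" "\<And>y. norm (m y) = norm y" "continuous_on S m"
    and f: "continuous_on S f" "\<And>y. y \<in> S \<Longrightarrow> \<bar>f y\<bar> \<le> M"
  shows "dominated_family S Omega_bar (\<lambda>y x t. g x (m y) t * f y)"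
  unfolding dominated_family_def
proof (intro conjI ballI allI impI)
  have bound: "\<exists>h. h integrable_on S \<and> (\<forall>y\<in>S. \<forall>x\<in>Omega_bar. \<forall>t\<in>{t1..t2}. norm x \<le> R \<longrightarrow> \<bar>g x (m y) t * f y\<bar> \<le> h y)"
    if t1: "t1 > 0" for R t1 t2
  proof -
    obtain C c where C: "C \<ge> 0" "c > 0" "\<And>x y t. x \<in> Omega_bar \<Longrightarrow> y \<in> Omega_bar \<Longrightarrow> t \<in> {t1..t2} \<Longrightarrow>
        norm x \<le> R \<Longrightarrow> \<bar>g x y t\<bar> \<le> C * exp (- c * (norm y)\<^sup>2)"
      using kernel_bounded_bound[OF g t1, of t2 R] by blast
    have "\<bar>g x (m y) t * f y\<bar> \<le> (C * \<bar>M\<bar>) * exp (- c * (norm y)\<^sup>2)"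
      if "y \<in> S" "x \<in> Omega_bar" "t \<in> {t1..t2}" "norm x \<le> R" for x y t
    proof -
      have "\<bar>g x (m y) t\<bar> * \<bar>f y\<bar> \<le> (C * exp (- c * (norm y)\<^sup>2)) * \<bar>M\<bar>"
        using C(3)[OF that(2) m(1)[OF that(1)] that(3,4)] m(2)[of y] f(2)[OF that(1)] C(1)
        by (intro mult_mono) auto
      then show ?thesis by (simp add: abs_mult mult_ac)
    qed
    moreover have "(\<lambda>y. (C * \<bar>M\<bar>) * exp (- c * (norm y)\<^sup>2)) integrable_on S"
      by (intro integrable_on_mult_right integrable_gaussian C(2) S)
    ultimately show ?thesis by blast
  qed
  fix x :: "(real^'n) \<times> real" and t :: real assume x: "x \<in> Omega_bar" and t: "0 < t"
  obtain h where h: "h integrable_on S" "\<And>y. y \<in> S \<Longrightarrow> \<bar>g x (m y) t * f y\<bar> \<le> h y"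
    using bound[OF t, of t "norm x"] x by auto
  have "continuous_on S (\<lambda>y. (\<lambda>(x, y, t). g x y t) (x, m y, t))"
    by (rule continuous_on_compose2[OF kernel_bounded_continuous[OF g]])
       (use x t m in \<open>auto intro!: continuous_intros\<close>)
  then show "(\<lambda>y. g x (m y) t * f y) integrable_on S"
    using S h f by (intro integrable_continuous_bounded[OF _ S h(1)]) (auto intro!: continuous_intros)
  obtain h where h: "h integrable_on S"
    "\<And>y x' s. y \<in> S \<Longrightarrow> x' \<in> Omega_bar \<Longrightarrow> s \<in> {t/2..2*t} \<Longrightarrow> norm x' \<le> norm x + t / 2 \<Longrightarrow> \<bar>g x' (m y) s * f y\<bar> \<le> h y"
    using bound[of "t / 2" "2 * t" "norm x + t / 2"] t by auto
  show "\<exists>r>0. \<exists>h. h integrable_on S \<and> (\<forall>y\<in>S. \<forall>x'\<in>Omega_bar. \<forall>s>0.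
      dist x' x < r \<longrightarrow> dist s t < r \<longrightarrow> \<bar>g x' (m y) s * f y\<bar> \<le> h y)"
  proof (intro exI[of _ "t / 2"] conjI exI[of _ h] ballI allI impI h)
    fix x' assume "dist x' x < t / 2"
    then show "norm x' \<le> norm x + t / 2"
      using norm_triangle_ineq2[of x' x] by (simp add: dist_norm)
  qed (use t in \<open>auto simp: dist_real_def abs_if split: if_splits\<close>)
next
  fix y assume y: "y \<in> S"
  have "continuous_on (Omega_bar \<times> {0<..}) (\<lambda>p. (\<lambda>(x, y, t). g x y t) (fst p, m y, snd p))"
    by (rule continuous_on_compose2[OF kernel_bounded_continuous[OF g]])
       (use y m in \<open>auto intro!: continuous_intros\<close>)
  then show "continuous_on (Omega_bar \<times> {0<..}) (\<lambda>(x, t). g x (m y) t * f y)"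
    by (auto simp: split_beta' intro!: continuous_intros)
qed

text \<open>The embedding z \<mapsto> (z, 0) maps into \<open>Omega_bar\<close>, so a derivative
  within the closed half space restricts to a full derivative of the trace.\<close>

lemma has_derivative_boundary:
  fixes x' :: "real^'n"
  assumes "(f has_derivative f') (at (x', 0) within Omega_bar)"
  shows "((\<lambda>z. f (z, 0)) has_derivative (\<lambda>v. f' (v, 0))) (at x')"
proof -
  have "((\<lambda>z::real^'n. (z, 0::real)) has_derivative (\<lambda>v. (v, 0))) (at x' within UNIV)"
    by (auto intro!: derivative_eq_intros)
  moreover have "(f has_derivative f') (at (x', 0) within (\<lambda>z. (z, 0)) ` UNIV)"
    by (rule has_derivative_subset[OF assms]) auto
  ultimately show ?thesis by (rule has_derivative_in_compose)
qed

lemma has_derivative_interior: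
  assumes "(f has_derivative f') (at x within Omega_bar)" "x \<in> Omega"
  shows "(f has_derivative f') (at x)"
  using has_derivative_subset[OF assms(1) Omega_subset] at_within_open[OF assms(2) open_Omega] by simp

context dynamic_bc
begin

text \<open>Stronger than \<open>dyn_eqs\<close>: the solution is smooth up to the boundary, the
  heat equation holds there too, and the tangential Laplacian is read off from the full Hessian. The
  notion treats k = 0 and k > 0 alike and is stable under sums, time shifts and integration over
  sources.\<close>

definition smooth_solution :: "((real^'n) \<times> real \<Rightarrow> real \<Rightarrow> real) \<Rightarrow> bool" where
  "smooth_solution u \<longleftrightarrow> (\<exists>ut Du D2u. C21_derivs Omega_bar u ut Du D2u
     \<and> (\<forall>x\<in>Omega_bar. \<forall>t>0. eps * ut x t = (\<Sum>b\<in>Basis. D2u x t b b))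
     \<and> (\<forall>x'. \<forall>t>0. delta * ut (x', 0) t - k * (\<Sum>b\<in>Basis. D2u (x', 0) t (b, 0) (b, 0)) - Du (x', 0) t (0, 1) = 0))"

lemma smooth_solutionE:
  assumes "smooth_solution u"
  obtains ut Du D2u where "C21_derivs Omega_bar u ut Du D2u"
    "\<And>x t. x \<in> Omega_bar \<Longrightarrow> t > 0 \<Longrightarrow> eps * ut x t = (\<Sum>b\<in>Basis. D2u x t b b)"
    "\<And>x' t. t > 0 \<Longrightarrow> delta * ut (x', 0) t - k * (\<Sum>b\<in>Basis. D2u (x', 0) t (b, 0) (b, 0)) - Du (x', 0) t (0, 1) = 0"
  using assms unfolding smooth_solution_def by blast

lemma smooth_solutionI:
  assumes "C21_derivs Omega_bar u ut Du D2u"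
    "\<And>x t. x \<in> Omega_bar \<Longrightarrow> t > 0 \<Longrightarrow> eps * ut x t = (\<Sum>b\<in>Basis. D2u x t b b)"
    "\<And>x' t. t > 0 \<Longrightarrow> delta * ut (x', 0) t - k * (\<Sum>b\<in>Basis. D2u (x', 0) t (b, 0) (b, 0)) - Du (x', 0) t (0, 1) = 0"
  shows "smooth_solution u"
  using assms unfolding smooth_solution_def by blast

lemma smooth_solution_cong:
  assumes "smooth_solution u" "\<And>x t. x \<in> Omega_bar \<Longrightarrow> t > 0 \<Longrightarrow> v x t = u x t"
  shows "smooth_solution v"
  using assms(1) by (elim smooth_solutionE) (auto intro!: smooth_solutionI intro: C21_derivs_cong[OF _ assms(2)])

lemma smooth_solution_add:
  assumes "smooth_solution u" "smooth_solution v"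
  shows "smooth_solution (\<lambda>x t. u x t + v x t)"
proof -
  obtain ut Du D2u where u: "C21_derivs Omega_bar u ut Du D2u"
    "\<And>x t. x \<in> Omega_bar \<Longrightarrow> t > 0 \<Longrightarrow> eps * ut x t = (\<Sum>b\<in>Basis. D2u x t b b)"
    "\<And>x' t. t > 0 \<Longrightarrow> delta * ut (x', 0) t - k * (\<Sum>b\<in>Basis. D2u (x', 0) t (b, 0) (b, 0)) - Du (x', 0) t (0, 1) = 0"
    using smooth_solutionE[OF assms(1)] by blast
  obtain vt Dv D2v where v: "C21_derivs Omega_bar v vt Dv D2v"
    "\<And>x t. x \<in> Omega_bar \<Longrightarrow> t > 0 \<Longrightarrow> eps * vt x t = (\<Sum>b\<in>Basis. D2v x t b b)"
    "\<And>x' t. t > 0 \<Longrightarrow> delta * vt (x', 0) t - k * (\<Sum>b\<in>Basis. D2v (x', 0) t (b, 0) (b, 0)) - Dv (x', 0) t (0, 1) = 0"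
    using smooth_solutionE[OF assms(2)] by blast
  show ?thesis
  proof (rule smooth_solutionI[OF C21_derivs_add[OF u(1) v(1)]])
    show "eps * (ut x t + vt x t) = (\<Sum>b\<in>Basis. D2u x t b b + D2v x t b b)" if "x \<in> Omega_bar" "t > 0" for x t
      using u(2)[OF that] v(2)[OF that] by (simp add: distrib_left sum.distrib)
    show "delta * (ut (x', 0) t + vt (x', 0) t) - k * (\<Sum>b\<in>Basis. D2u (x', 0) t (b, 0) (b, 0) + D2v (x', 0) t (b, 0) (b, 0))
        - (Du (x', 0) t (0, 1) + Dv (x', 0) t (0, 1)) = 0" if "t > 0" for x' t
      using u(3)[OF that, of x'] v(3)[OF that, of x'] unfolding sum.distrib distrib_left by linarith
  qed
qed

lemma smooth_solution_cmult:
  assumes "smooth_solution u"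
  shows "smooth_solution (\<lambda>x t. r * u x t)"
proof -
  obtain ut Du D2u where u: "C21_derivs Omega_bar u ut Du D2u"
    "\<And>x t. x \<in> Omega_bar \<Longrightarrow> t > 0 \<Longrightarrow> eps * ut x t = (\<Sum>b\<in>Basis. D2u x t b b)"
    "\<And>x' t. t > 0 \<Longrightarrow> delta * ut (x', 0) t - k * (\<Sum>b\<in>Basis. D2u (x', 0) t (b, 0) (b, 0)) - Du (x', 0) t (0, 1) = 0"
    using smooth_solutionE[OF assms(1)] by blast
  show ?thesis
  proof (rule smooth_solutionI[OF C21_derivs_cmult[OF u(1)]])
    show "eps * (r * ut x t) = (\<Sum>b\<in>Basis. r * D2u x t b b)" if "x \<in> Omega_bar" "t > 0" for x t
      using u(2)[OF that] by (simp flip: sum_distrib_left)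
    show "delta * (r * ut (x', 0) t) - k * (\<Sum>b\<in>Basis. r * D2u (x', 0) t (b, 0) (b, 0))
        - r * Du (x', 0) t (0, 1) = 0" if "t > 0" for x' t
      using arg_cong[OF u(3)[OF that, of x'], of "(*) r"]
      by (simp add: algebra_simps flip: sum_distrib_left)
  qed
qed

lemma smooth_solution_time_shift:
  assumes "smooth_solution u" "s \<ge> 0"
  shows "smooth_solution (\<lambda>x t. u x (t + s))"
proof -
  obtain ut Du D2u where u: "C21_derivs Omega_bar u ut Du D2u"
    "\<And>x t. x \<in> Omega_bar \<Longrightarrow> t > 0 \<Longrightarrow> eps * ut x t = (\<Sum>b\<in>Basis. D2u x t b b)"
    "\<And>x' t. t > 0 \<Longrightarrow> delta * ut (x', 0) t - k * (\<Sum>b\<in>Basis. D2u (x', 0) t (b, 0) (b, 0)) - Du (x', 0) t (0, 1) = 0"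
    using smooth_solutionE[OF assms(1)] by blast
  show ?thesis
    by (rule smooth_solutionI[OF C21_derivs_time_shift[OF u(1) assms(2)]]) (use u(2,3) assms(2) in auto)
qed

lemma smooth_solution_continuous:
  "smooth_solution u \<Longrightarrow> continuous_on (Omega_bar \<times> {0<..}) (\<lambda>(x, t). u x t)"
  by (erule smooth_solutionE) (rule C21_derivsD)

lemma smooth_solution_dyn_eqs:
  assumes "smooth_solution u"
  shows "dyn_eqs eps delta k u"
proof -
  obtain ut Du D2u where u: "C21_derivs Omega_bar u ut Du D2u"
    "\<And>x t. x \<in> Omega_bar \<Longrightarrow> t > 0 \<Longrightarrow> eps * ut x t = (\<Sum>b\<in>Basis. D2u x t b b)"
    "\<And>x' t. t > 0 \<Longrightarrow> delta * ut (x', 0) t - k * (\<Sum>b\<in>Basis. D2u (x', 0) t (b, 0) (b, 0)) - Du (x', 0) t (0, 1) = 0"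
    using smooth_solutionE[OF assms(1)] by blast
  have "trace_derivs u (\<lambda>x' t v. Du (x', 0) t (v, 0)) (\<lambda>x' t v c. D2u (x', 0) t (v, 0) (c, 0))"
    unfolding trace_derivs_def
    by (auto intro!: has_derivative_boundary C21_derivsD[OF u(1)] simp: Basis_prod_def)
  then show ?thesis
    unfolding dyn_eqs_def
  proof (intro exI[of _ ut] exI[of _ Du] exI[of _ D2u] conjI ballI allI impI)
    assume tr: "trace_derivs u (\<lambda>x' t v. Du (x', 0) t (v, 0)) (\<lambda>x' t v c. D2u (x', 0) t (v, 0) (c, 0))"
    show "if k = 0 then \<forall>x'. \<forall>t>0. delta * ut (x', 0) t - Du (x', 0) t (0, 1) = 0
       else \<exists>Dw D2w. trace_derivs u Dw D2w \<and>
          (\<forall>x'. \<forall>t>0. delta * ut (x', 0) t - k * (\<Sum>b\<in>Basis. D2w x' t b b) - Du (x', 0) t (0, 1) = 0)"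
      using tr u(3) by (cases "k = 0") auto
  qed (use C21_derivsD[OF u(1)] u(2) Omega_subset in \<open>auto intro!: has_derivative_interior\<close>)
qed

text \<open>The time derivative of G, followed by its gradient and Hessian. The factors -1 and 1 /
  delta are kept explicit, so that the rules for sums and scalar multiples apply as they
  stand.\<close>

definition ker_time :: "(real^'n) \<times> real \<Rightarrow> (real^'n) \<times> real \<Rightarrow> real \<Rightarrow> real" where
  "ker_time x y t = (1 / eps) * gauss_laplace (x - y) (t / eps) + (-1) * ((1 / eps) * gauss_laplace (x - refl y) (t / eps))
     + (1 / delta) * layer_time (x - refl y) t"

definition ker_grad :: "(real^'n) \<times> real \<Rightarrow> (real^'n) \<times> real \<Rightarrow> real \<Rightarrow> (real^'n) \<times> real \<Rightarrow> real" where
  "ker_grad x y t v = gauss_grad (x - y) (t / eps) v + (-1) * gauss_grad (x - refl y) (t / eps) v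
     + (1 / delta) * layer_grad (x - refl y) t v"

definition ker_hess ::
    "(real^'n) \<times> real \<Rightarrow> (real^'n) \<times> real \<Rightarrow> real \<Rightarrow> (real^'n) \<times> real \<Rightarrow> (real^'n) \<times> real \<Rightarrow> real" where
  "ker_hess x y t v u = gauss_hess (x - y) (t / eps) v u + (-1) * gauss_hess (x - refl y) (t / eps) v u
     + (1 / delta) * layer_hess (x - refl y) t v u"

lemma Gker_eq:
  "t > 0 \<Longrightarrow> Gker eps delta k x y t = Gam (x - y) (t / eps) + (-1) * Gam (x - refl y) (t / eps)
     + (1 / delta) * layer (x - refl y) t"
  by (simp add: Gker_def G0_def Hker_eq_layer)

lemma C21_Gker:
  assumes y: "y \<in> Omega_bar"
  shows "C21_derivs Omega_bar (\<lambda>x. Gker eps delta k x y) (\<lambda>x. ker_time x y) (\<lambda>x. ker_grad x y) (\<lambda>x. ker_hess x y)"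
proof -
  have "C21_derivs Omega_bar (\<lambda>x t. Gam (x - y) (t / eps) + (-1) * Gam (x - refl y) (t / eps)
     + (1 / delta) * layer (x - refl y) t) (\<lambda>x. ker_time x y) (\<lambda>x. ker_grad x y) (\<lambda>x. ker_hess x y)"
    unfolding ker_time_def[abs_def] ker_grad_def[abs_def] ker_hess_def[abs_def]
    by (intro C21_derivs_add C21_derivs_cmult C21_derivs_translate[OF C21_Gam[OF eps]]
        C21_derivs_translate[OF C21_layer] UNIV_I diff_refl_in_Omega_bar y)
  then show ?thesis by (rule C21_derivs_cong) (rule Gker_eq)
qed

lemma kernel_bounded_cong:
  assumes "kernel_bounded f" "\<And>x y t. t > 0 \<Longrightarrow> g x y t = f x y t"
  shows "kernel_bounded g"
proof -
  have "continuous_on (Omega_bar \<times> Omega_bar \<times> {0<..}) (\<lambda>(x, y, t). g x y t)"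
    by (rule continuous_on_eq[OF kernel_bounded_continuous[OF assms(1)]]) (auto simp: assms(2))
  moreover have "\<exists>C\<ge>0. \<exists>c>0. \<forall>x\<in>Omega_bar. \<forall>y\<in>Omega_bar. \<forall>t\<in>{t1..t2}.
        norm x \<le> R \<longrightarrow> \<bar>g x y t\<bar> \<le> C * exp (- c * (norm y)\<^sup>2)" if t1: "t1 > 0" for R t1 t2
  proof -
    obtain C c where C: "C \<ge> 0" "c > 0" "\<And>x y t. x \<in> Omega_bar \<Longrightarrow> y \<in> Omega_bar \<Longrightarrow> t \<in> {t1..t2} \<Longrightarrow>
          norm x \<le> R \<Longrightarrow> \<bar>f x y t\<bar> \<le> C * exp (- c * (norm y)\<^sup>2)"
      using kernel_bounded_bound[OF assms(1) t1, of t2 R] by blast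
    then show ?thesis using t1 by (intro exI[of _ C] conjI exI[of _ c]) (auto simp: assms(2))
  qed
  ultimately show ?thesis unfolding kernel_bounded_def by blast
qed

lemma kernel_bounded_jet:
  shows kernel_bounded_Gker: "kernel_bounded (Gker eps delta k)"
    and kernel_bounded_time: "kernel_bounded ker_time"
    and kernel_bounded_grad: "kernel_bounded (\<lambda>x y t. ker_grad x y t v)"
    and kernel_bounded_hess: "kernel_bounded (\<lambda>x y t. ker_hess x y t v u)"
    and kernel_bounded_layer: "kernel_bounded (\<lambda>x y t. layer (x - refl y) t)"
proof -
  have id: "kernel_bounded (\<lambda>x y t. F (x - y) t)" and rf: "kernel_bounded (\<lambda>x y t. F (x - refl y) t)"
    if F: "gauss_bounded UNIV F" for F :: "(real^'n) \<times> real \<Rightarrow> real \<Rightarrow> real"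
    by (auto intro!: kernel_bounded_translate[OF F] continuous_intros)
  have ly: "kernel_bounded (\<lambda>x y t. F (x - refl y) t)"
    if F: "gauss_bounded Omega_bar F" for F :: "(real^'n) \<times> real \<Rightarrow> real \<Rightarrow> real"
    by (auto intro!: kernel_bounded_translate[OF F] continuous_intros diff_refl_in_Omega_bar)
  note gam = gauss_bounded_Gam[OF eps] gauss_bounded_Gam_time[OF eps] gauss_bounded_Gam_grad[OF eps, of v]
    gauss_bounded_Gam_hess[OF eps, of v u]
  show "kernel_bounded (\<lambda>x y t. layer (x - refl y) t)" by (rule ly[OF gauss_bounded_layer(1)])
  show "kernel_bounded (Gker eps delta k)"
    by (rule kernel_bounded_cong[OF kernel_bounded_add[OF kernel_bounded_add[OF id[OF gam(1)]
         kernel_bounded_cmult[OF rf[OF gam(1)]]] kernel_bounded_cmult[OF ly[OF gauss_bounded_layer(1)]]] Gker_eq])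
  show "kernel_bounded ker_time"
    unfolding ker_time_def[abs_def]
    by (rule kernel_bounded_add[OF kernel_bounded_add[OF id[OF gam(2)]
         kernel_bounded_cmult[OF rf[OF gam(2)]]] kernel_bounded_cmult[OF ly[OF gauss_bounded_layer(2)]]])
  show "kernel_bounded (\<lambda>x y t. ker_grad x y t v)"
    unfolding ker_grad_def
    by (rule kernel_bounded_add[OF kernel_bounded_add[OF id[OF gam(3)]
         kernel_bounded_cmult[OF rf[OF gam(3)]]] kernel_bounded_cmult[OF ly[OF gauss_bounded_layer(3)]]])
  show "kernel_bounded (\<lambda>x y t. ker_hess x y t v u)"
    unfolding ker_hess_def
    by (rule kernel_bounded_add[OF kernel_bounded_add[OF id[OF gam(4)]
         kernel_bounded_cmult[OF rf[OF gam(4)]]] kernel_bounded_cmult[OF ly[OF gauss_bounded_layer(4)]]])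
qed

lemma ker_heat_equation:
  assumes "x \<in> Omega_bar" "y \<in> Omega_bar" "t > 0"
  shows "eps * ker_time x y t = (\<Sum>b\<in>Basis. ker_hess x y t b b)"
  using layer_heat_equation[OF diff_refl_in_Omega_bar[OF assms(1,2)] assms(3)] eps
  by (simp add: ker_time_def ker_hess_def sum.distrib sum_negf sum_subtractf sum_gauss_hess distrib_left right_diff_distrib
      flip: sum_distrib_left sum_divide_distrib)

text \<open>For x on the boundary, x - y and x - refl y have equal norms and equal tangential parts,
  so the two Gaussians of \<open>G0\<close> cancel in the time derivative and in the tangential
  Hessian. Their normal derivatives are opposite; the difference is a tangential Gaussian times
  \<open>flux\<close> and is offset by the source in \<open>layer_boundary_equation\<close>.\<close>

lemma ker_boundary_equation:
  fixes x' :: "real^'n"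
  assumes "y \<in> Omega_bar" "t > 0"
  shows "delta * ker_time (x', 0) y t - k * (\<Sum>b\<in>Basis. ker_hess (x', 0) y t (b, 0) (b, 0)) - ker_grad (x', 0) y t (0, 1) = 0"
proof -
  obtain z r where y: "y = (z, r)" by fastforce
  define s where "s = t / eps"
  have lap: "gauss_laplace ((x', 0) - y) s = gauss_laplace ((x', 0) - refl y) s"
    by (simp add: gauss_laplace_def y refl_def Gam_def norm_Pair)
  have hess: "gauss_hess ((x', 0) - y) s (b, 0) (b, 0) = gauss_hess ((x', 0) - refl y) s (b, 0) (b, 0)" for b :: "real^'n"
    by (simp add: gauss_hess_def y refl_def Gam_def norm_Pair)
  have grad: "gauss_grad ((x', 0) - y) s (0, 1) - gauss_grad ((x', 0) - refl y) s (0, 1) = Gam (x' - z) s * flux r s"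
    by (simp add: gauss_grad_def y refl_def Gam_Pair flux_def)
  have "delta * layer_time ((x', 0) - refl y) t - k * (\<Sum>b\<in>Basis. layer_hess ((x', 0) - refl y) t (b, 0) (b, 0))
      - layer_grad ((x', 0) - refl y) t (0, 1) = delta * (Gam (x' - z) s * flux r s)"
    using layer_boundary_equation[OF diff_refl_in_Omega_bar[OF _ assms(1)] assms(2), of "(x', 0)"]
    by (simp add: y refl_def s_def)
  then have "layer_time ((x', 0) - refl y) t - k * ((1 / delta) * (\<Sum>b\<in>Basis. layer_hess ((x', 0) - refl y) t (b, 0) (b, 0)))
      - (1 / delta) * layer_grad ((x', 0) - refl y) t (0, 1) = Gam (x' - z) s * flux r s"
    using delta by (simp add: field_simps)
  then show ?thesis
    using grad delta
    by (simp add: ker_time_def ker_hess_def ker_grad_def lap hess distrib_left flip: s_def sum_divide_distrib)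
qed

lemma smooth_solution_Gker:
  "y \<in> Omega_bar \<Longrightarrow> smooth_solution (\<lambda>x t. Gker eps delta k x y t)"
  by (intro smooth_solutionI[OF C21_Gker] ker_heat_equation ker_boundary_equation)

lemma smooth_solution_integral:
  fixes m :: "'b::euclidean_space \<Rightarrow> (real^'n) \<times> real"
  assumes S: "open S" and m: "\<And>y. y \<in> S \<Longrightarrow> m y \<in> Omega_bar" "\<And>y. norm (m y) = norm y" "continuous_on S m"
    and f: "continuous_on S f" "\<And>y. y \<in> S \<Longrightarrow> \<bar>f y\<bar> \<le> M"
  shows "smooth_solution (\<lambda>x t. integral S (\<lambda>y. Gker eps delta k x (m y) t * f y))"
proof (rule smooth_solutionI)
  note dom = dominated_family_kernel[OF _ S m f]
  show "C21_derivs Omega_bar (\<lambda>x t. integral S (\<lambda>y. Gker eps delta k x (m y) t * f y))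
     (\<lambda>x t. integral S (\<lambda>y. ker_time x (m y) t * f y)) (\<lambda>x t v. integral S (\<lambda>y. ker_grad x (m y) t v * f y))
     (\<lambda>x t v u. integral S (\<lambda>y. ker_hess x (m y) t v u * f y))"
  proof (rule C21_derivs_integral[OF convex_Omega_bar])
    show "C21_derivs Omega_bar (\<lambda>x t. Gker eps delta k x (m y) t * f y) (\<lambda>x t. ker_time x (m y) t * f y)
       (\<lambda>x t v. ker_grad x (m y) t v * f y) (\<lambda>x t v u. ker_hess x (m y) t v u * f y)" if "y \<in> S" for y
      using C21_derivs_cmult[OF C21_Gker[OF m(1)[OF that]], of "f y"] by (simp add: mult.commute)
    show "dominated_family S Omega_bar (\<lambda>y x t. Gker eps delta k x (m y) t * f y)"
      by (rule dom[OF kernel_bounded_Gker])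
    show "dominated_family S Omega_bar (\<lambda>y x t. ker_time x (m y) t * f y)"
      by (rule dom[OF kernel_bounded_time])
    show "dominated_family S Omega_bar (\<lambda>y x t. ker_grad x (m y) t b * f y)" for b
      by (rule dom[OF kernel_bounded_grad])
    show "dominated_family S Omega_bar (\<lambda>y x t. ker_hess x (m y) t b c * f y)" for b c
      by (rule dom[OF kernel_bounded_hess])
  qed
  fix x :: "(real^'n) \<times> real" and t :: real assume x: "x \<in> Omega_bar" and t: "t > 0"
  have int: "(\<lambda>y. ker_time x (m y) t * f y) integrable_on S"
    "(\<lambda>y. ker_grad x (m y) t v * f y) integrable_on S"
    "(\<lambda>y. ker_hess x (m y) t v u * f y) integrable_on S" for v u
    using dominated_family_integrable[OF dom[OF kernel_bounded_time] x t]
      dominated_family_integrable[OF dom[OF kernel_bounded_grad] x t]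
      dominated_family_integrable[OF dom[OF kernel_bounded_hess] x t] by auto
  have "(\<Sum>b\<in>Basis. integral S (\<lambda>y. ker_hess x (m y) t b b * f y)) =
      integral S (\<lambda>y. \<Sum>b\<in>Basis. ker_hess x (m y) t b b * f y)"
    by (subst integral_sum) (auto intro: int)
  also have "\<dots> = integral S (\<lambda>y. eps * (ker_time x (m y) t * f y))"
    by (intro integral_cong) (simp add: ker_heat_equation[OF x m(1) t] mult.assoc flip: sum_distrib_right)
  finally show "eps * integral S (\<lambda>y. ker_time x (m y) t * f y) =
      (\<Sum>b\<in>Basis. integral S (\<lambda>y. ker_hess x (m y) t b b * f y))" by simp
next
  fix x' :: "real^'n" and t :: real assume t: "t > 0"
  note dom = dominated_family_kernel[OF _ S m f]
  have int: "(\<lambda>y. ker_time (x', 0) (m y) t * f y) integrable_on S"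
    "(\<lambda>y. ker_grad (x', 0) (m y) t v * f y) integrable_on S"
    "(\<lambda>y. ker_hess (x', 0) (m y) t v u * f y) integrable_on S" for v u
    using dominated_family_integrable[OF dom[OF kernel_bounded_time] boundary_in_Omega_bar t]
      dominated_family_integrable[OF dom[OF kernel_bounded_grad] boundary_in_Omega_bar t]
      dominated_family_integrable[OF dom[OF kernel_bounded_hess] boundary_in_Omega_bar t] by auto
  have "((\<lambda>y. delta * (ker_time (x', 0) (m y) t * f y) - k * (\<Sum>b\<in>Basis. ker_hess (x', 0) (m y) t (b, 0) (b, 0) * f y)
       - ker_grad (x', 0) (m y) t (0, 1) * f y) has_integral
     delta * integral S (\<lambda>y. ker_time (x', 0) (m y) t * f y)
      - k * (\<Sum>b\<in>Basis. integral S (\<lambda>y. ker_hess (x', 0) (m y) t (b, 0) (b, 0) * f y))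
      - integral S (\<lambda>y. ker_grad (x', 0) (m y) t (0, 1) * f y)) S"
    by (intro has_integral_diff has_integral_mult_right has_integral_sum integrable_integral int finite_Basis)
  moreover have "((\<lambda>y. delta * (ker_time (x', 0) (m y) t * f y) - k * (\<Sum>b\<in>Basis. ker_hess (x', 0) (m y) t (b, 0) (b, 0) * f y)
       - ker_grad (x', 0) (m y) t (0, 1) * f y) has_integral 0) S"
  proof (rule has_integral_is_0)
    fix y assume y: "y \<in> S"
    have "(delta * ker_time (x', 0) (m y) t - k * (\<Sum>b\<in>Basis. ker_hess (x', 0) (m y) t (b, 0) (b, 0))
       - ker_grad (x', 0) (m y) t (0, 1)) * f y = 0"
      using ker_boundary_equation[OF m(1)[OF y] t, of x'] by simp
    then show "delta * (ker_time (x', 0) (m y) t * f y) - k * (\<Sum>b\<in>Basis. ker_hess (x', 0) (m y) t (b, 0) (b, 0) * f y)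
       - ker_grad (x', 0) (m y) t (0, 1) * f y = 0"
      by (simp add: algebra_simps flip: sum_distrib_left sum_distrib_right)
  qed
  ultimately show "delta * integral S (\<lambda>y. ker_time (x', 0) (m y) t * f y)
      - k * (\<Sum>b\<in>Basis. integral S (\<lambda>y. ker_hess (x', 0) (m y) t (b, 0) (b, 0) * f y))
      - integral S (\<lambda>y. ker_grad (x', 0) (m y) t (0, 1) * f y) = 0"
    by (rule has_integral_unique)
qed

end

section \<open>Maximum principle\<close>

text \<open>Only differentiability of g' at 0 is used, not continuity of a second derivative. If l
  were positive, g' would be positive immediately to the right of 0, where it vanishes, and the mean
  value theorem would contradict maximality.\<close>

lemma second_derivative_le_0_real:
  fixes g :: "real \<Rightarrow> real"
  assumes r: "r > 0" and g: "\<And>s. \<bar>s\<bar> < r \<Longrightarrow> (g has_real_derivative g' s) (at s)"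
    and g': "(g' has_real_derivative l) (at 0)" and max: "\<And>s. \<bar>s\<bar> < r \<Longrightarrow> g s \<le> g 0"
  shows "l \<le> 0"
proof (rule ccontr)
  assume "\<not> l \<le> 0"
  then have "0 < l" by simp
  have 0: "g' 0 = 0"
    by (rule DERIV_local_max[OF g[of 0], of r]) (use r max in auto)
  obtain d where d: "d > 0" "\<And>h. h > 0 \<Longrightarrow> h < d \<Longrightarrow> g' 0 < g' (0 + h)"
    using DERIV_pos_inc_right[OF g' \<open>0 < l\<close>] by blast
  define h where "h = min (r / 2) (d / 2)"
  have h: "0 < h" "h < r" "h < d" using r d by (auto simp: h_def)
  obtain z where z: "0 < z" "z < h" "g h - g 0 = (h - 0) * g' z"
    using MVT2[of 0 h g g'] g h by auto
  have "g' z > 0" using d(2)[of z] z h 0 by simp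
  then have "g h > g 0" using z h by (smt (verit) mult_pos_pos)
  then show False using max[of h] h by simp
qed

lemma second_derivative_le_0:
  fixes f :: "'a::euclidean_space \<Rightarrow> real"
  assumes r: "r > 0" and F: "\<And>y. y \<in> ball a r \<Longrightarrow> (f has_derivative F y) (at y)"
    and F2: "((\<lambda>y. F y b) has_derivative G) (at a)" and max: "\<And>y. y \<in> ball a r \<Longrightarrow> f y \<le> f a"
    and b: "b \<in> Basis"
  shows "G b \<le> 0"
proof -
  have line: "((\<lambda>s. a + s *\<^sub>R b) has_derivative (\<lambda>h. h *\<^sub>R b)) (at s)" for s
    by (auto intro!: derivative_eq_intros)
  have near: "a + s *\<^sub>R b \<in> ball a r" if "\<bar>s\<bar> < r" for s
    using that b by (simp add: dist_norm)
  show ?thesis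
  proof (rule second_derivative_le_0_real[OF r])
    fix s :: real assume s: "\<bar>s\<bar> < r"
    have "((\<lambda>s. f (a + s *\<^sub>R b)) has_derivative (\<lambda>h. F (a + s *\<^sub>R b) (h *\<^sub>R b))) (at s)"
      by (rule has_derivative_compose[OF line F[OF near[OF s]]])
    moreover have "(\<lambda>h. F (a + s *\<^sub>R b) (h *\<^sub>R b)) = (*) (F (a + s *\<^sub>R b) b)"
      using linear_cmul[OF has_derivative_linear[OF F[OF near[OF s]]]] by (auto simp: mult.commute)
    ultimately show "((\<lambda>s. f (a + s *\<^sub>R b)) has_real_derivative F (a + s *\<^sub>R b) b) (at s)"
      by (simp add: has_field_derivative_def)
    show "f (a + s *\<^sub>R b) \<le> f (a + 0 *\<^sub>R b)" using max[OF near[OF s]] by simp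
  next
    have "((\<lambda>s. F (a + s *\<^sub>R b) b) has_derivative (\<lambda>h. G (h *\<^sub>R b))) (at 0)"
      by (rule has_derivative_compose[OF line]) (use F2 in simp)
    moreover have "(\<lambda>h. G (h *\<^sub>R b)) = (*) (G b)"
      using linear_cmul[OF has_derivative_linear[OF F2]] by (auto simp: mult.commute)
    ultimately show "((\<lambda>s. F (a + s *\<^sub>R b) b) has_real_derivative G b) (at 0)"
      by (simp add: has_field_derivative_def)
  qed
qed

text \<open>Only increments along a segment inside S enter, so at a maximum on the boundary the
  inward normal derivative still has a sign.\<close>

lemma inward_derivative_le_0:
  fixes f :: "'a::real_normed_vector \<Rightarrow> real"
  assumes f: "(f has_derivative F) (at a within S)"
    and S: "\<And>s. 0 \<le> s \<Longrightarrow> s \<le> 1 \<Longrightarrow> a + s *\<^sub>R v \<in> S"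
    and max: "\<And>s. 0 \<le> s \<Longrightarrow> s \<le> 1 \<Longrightarrow> f (a + s *\<^sub>R v) \<le> f a"
  shows "F v \<le> 0"
proof (rule ccontr)
  assume "\<not> F v \<le> 0"
  then have pos: "0 < F v" by simp
  have "((\<lambda>s. a + s *\<^sub>R v) has_derivative (\<lambda>h. h *\<^sub>R v)) (at 0 within {0..1})"
    by (auto intro!: derivative_eq_intros)
  moreover have "(f has_derivative F) (at (a + 0 *\<^sub>R v) within (\<lambda>s. a + s *\<^sub>R v) ` {0..1})"
    using S by (auto intro: has_derivative_subset[OF f])
  ultimately have "((\<lambda>s. f (a + s *\<^sub>R v)) has_derivative (\<lambda>h. F (h *\<^sub>R v))) (at 0 within {0..1})"
    by (rule has_derivative_in_compose)
  moreover have "(\<lambda>h. F (h *\<^sub>R v)) = (*) (F v)"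
    using linear_cmul[OF has_derivative_linear[OF f]] by (auto simp: mult.commute)
  ultimately have "((\<lambda>s. f (a + s *\<^sub>R v)) has_real_derivative F v) (at 0 within {0..1})"
    by (simp add: has_field_derivative_def)
  from has_real_derivative_pos_inc_right[OF this pos]
  obtain d where d: "d > 0" "\<And>h. h > 0 \<Longrightarrow> 0 + h \<in> {0..1} \<Longrightarrow> h < d \<Longrightarrow> f (a + 0 *\<^sub>R v) < f (a + (0 + h) *\<^sub>R v)"
    by blast
  define h where "h = min (1/2) (d / 2)"
  have "0 < h" "h \<le> 1" "h < d" using d by (auto simp: h_def)
  then show False using d(2)[of h] max[of h] by simp
qed

context dynamic_bc
begin

text \<open>The barrier |x|^2 + L t is a strict supersolution that dominates every bounded function at infinity.\<close>

lemma dyn_eqs_max_principle: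
  fixes w :: "(real^'n) \<times> real \<Rightarrow> real \<Rightarrow> real"
  assumes w: "dyn_eqs eps delta k w"
    and cont: "continuous_on (Omega_bar \<times> {0..}) (\<lambda>(x, t). w x t)"
    and bnd: "\<And>T. \<exists>M. \<forall>x\<in>Omega_bar. \<forall>t\<in>{0..T}. w x t \<le> M"
    and init: "\<And>x. x \<in> Omega_bar \<Longrightarrow> w x 0 \<le> 0"
    and x: "x \<in> Omega_bar" and T: "T \<ge> 0"
  shows "w x T \<le> 0"
proof -
  obtain ut Du D2u where
    dt: "\<And>x t. x \<in> Omega_bar \<Longrightarrow> t > 0 \<Longrightarrow> ((\<lambda>s. w x s) has_real_derivative ut x t) (at t)" and
    dx: "\<And>x t. x \<in> Omega_bar \<Longrightarrow> t > 0 \<Longrightarrow> ((\<lambda>y. w y t) has_derivative Du x t) (at x within Omega_bar)" and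
    dxx: "\<And>x t b. x \<in> Omega \<Longrightarrow> t > 0 \<Longrightarrow> b \<in> Basis \<Longrightarrow> ((\<lambda>y. Du y t b) has_derivative D2u x t b) (at x)" and
    heat: "\<And>x t. x \<in> Omega \<Longrightarrow> t > 0 \<Longrightarrow> eps * ut x t - (\<Sum>b\<in>Basis. D2u x t b b) = 0" and
    bc: "if k = 0 then (\<forall>x'. \<forall>t>0. delta * ut (x', 0) t - Du (x', 0) t (0, 1) = 0)
         else (\<exists>Dw D2w. trace_derivs w Dw D2w \<and>
              (\<forall>x'. \<forall>t>0. delta * ut (x', 0) t - k * (\<Sum>b\<in>Basis. D2w x' t b b) - Du (x', 0) t (0, 1) = 0))"
    using w unfolding dyn_eqs_def by blast
  \<comment> \<open>The Laplacians of norm x^2 in the half space and on its boundary are 2N and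
    2(N-1). The two summands make eps * L exceed 2N and delta * L exceed 2k(N-1); the two +1 make
    both inequalities strict.\<close>
  define L where "L = (2 * DIM((real^'n) \<times> real) + 1) / eps + (2 * k * DIM(real^'n) + 1) / delta"
  have "0 < (2 * DIM((real^'n) \<times> real) + 1) / eps" "0 < (2 * k * DIM(real^'n) + 1) / delta"
    using eps delta k by (auto intro!: divide_pos_pos add_nonneg_pos)
  then have L: "L > 0" "2 * DIM((real^'n) \<times> real) < eps * L" "2 * k * DIM(real^'n) < delta * L"
  proof -
    assume *: "0 < (2 * DIM((real^'n) \<times> real) + 1) / eps" "0 < (2 * k * DIM(real^'n) + 1) / delta"
    then show "L > 0" by (simp add: L_def)
    have "eps * ((2 * DIM((real^'n) \<times> real) + 1) / eps) < eps * L"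
      unfolding L_def by (rule mult_strict_left_mono) (use * eps in auto)
    then show "2 * DIM((real^'n) \<times> real) < eps * L" using eps by simp
    have "delta * ((2 * k * DIM(real^'n) + 1) / delta) < delta * L"
      unfolding L_def by (rule mult_strict_left_mono) (use * delta in auto)
    then show "2 * k * DIM(real^'n) < delta * L" using delta by simp
  qed
  obtain M where M: "\<And>x t. x \<in> Omega_bar \<Longrightarrow> t \<in> {0..T} \<Longrightarrow> w x t \<le> M"
    using bnd[of T] by blast
  have barrier: "w x t - \<eta> * ((norm x)\<^sup>2 + L * t) \<le> 0"
    if \<eta>: "\<eta> > 0" and x: "x \<in> Omega_bar" and t: "t \<in> {0..T}" for \<eta> x t
  proof (rule ccontr)
    define z where "z x t = w x t - \<eta> * ((norm x)\<^sup>2 + L * t)" for x :: "(real^'n) \<times> real" and t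
    assume "\<not> w x t - \<eta> * ((norm x)\<^sup>2 + L * t) \<le> 0"
    then have zpos: "z x t > 0" by (simp add: z_def)
    \<comment> \<open>Beyond radius R the barrier is at least \<bar>M\<bar>, so \<open>z\<close> can
      be positive only on a compact set and attains its maximum.\<close>
    define R where "R = sqrt (\<bar>M\<bar> / \<eta>)"
    have far: "z y s \<le> 0" if "y \<in> Omega_bar" "s \<in> {0..T}" "norm y > R" for y s
    proof -
      have "R \<ge> 0" using \<eta> by (simp add: R_def)
      then have "R\<^sup>2 \<le> (norm y)\<^sup>2" using that by (intro power_mono) auto
      then have "\<bar>M\<bar> \<le> \<eta> * (norm y)\<^sup>2" using \<eta> by (simp add: R_def field_simps)
      also have "\<dots> \<le> \<eta> * ((norm y)\<^sup>2 + L * s)" using \<eta> L that by simp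
      finally show ?thesis using M[OF that(1,2)] by (simp add: z_def)
    qed
    define K where "K = (Omega_bar \<inter> cball (0::(real^'n) \<times> real) R) \<times> {0..T}"
    have "closed (Omega_bar :: ((real^'n) \<times> real) set)"
      unfolding Omega_bar_def by (intro closed_Collect_le continuous_intros)
    then have "compact K" unfolding K_def
      by (intro compact_Times closed_Int_compact) auto
    moreover have "\<not> R < norm x" using far[OF x t] zpos by linarith
    then have "(x, t) \<in> K" using x t by (simp add: K_def)
    moreover have "continuous_on K (\<lambda>p. z (fst p) (snd p))"
    proof -
      have "continuous_on K (\<lambda>p. w (fst p) (snd p))"
        by (rule continuous_on_case_prod_compose[OF cont]) (auto simp: K_def intro!: continuous_intros)
      then show ?thesis unfolding z_def by (intro continuous_intros)
    qed
    ultimately obtain p where p: "p \<in> K" "\<And>q. q \<in> K \<Longrightarrow> z (fst q) (snd q) \<le> z (fst p) (snd p)"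
      using continuous_attains_sup[of K "\<lambda>p. z (fst p) (snd p)"] by blast
    obtain a s where p_eq: "p = (a, s)" by fastforce
    have a: "a \<in> Omega_bar" and s: "s \<in> {0..T}" using p by (auto simp: p_eq K_def)
    have zas: "z a s \<ge> z x t" using p(2)[OF \<open>(x, t) \<in> K\<close>] by (simp add: p_eq)
    have max: "z y r \<le> z a s" if "y \<in> Omega_bar" "r \<in> {0..T}" for y r
    proof (cases "norm y > R")
      case True
      then show ?thesis using far[OF that] zpos zas by linarith
    next
      case False
      then show ?thesis using p(2)[of "(y, r)"] that by (auto simp: p_eq K_def)
    qed
    have "0 \<le> \<eta> * (norm a)\<^sup>2" using \<eta> by simp
    then have "z a 0 \<le> 0" using init[OF a] by (simp add: z_def)
    then have s0: "s > 0" using zpos zas s by (cases "s = 0") auto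
    have zt: "((\<lambda>r. z a r) has_real_derivative ut a s - \<eta> * L) (at s)"
      unfolding z_def by (auto intro!: derivative_eq_intros dt a s0)
    \<comment> \<open>The comparison goes backwards in time only, since s may be the final time
      T.\<close>
    have time: "ut a s \<ge> \<eta> * L"
    proof (rule ccontr)
      assume "\<not> ut a s \<ge> \<eta> * L"
      then obtain d where d: "d > 0" "\<And>h. h > 0 \<Longrightarrow> h < d \<Longrightarrow> z a s < z a (s - h)"
        using DERIV_neg_dec_left[OF zt] by auto
      define h where "h = min (d / 2) s"
      have "h > 0" "h < d" "s - h \<in> {0..T}" using d s s0 by (auto simp: h_def)
      then show False using d(2)[of h] max[OF a, of "s - h"] by simp
    qed
    have zx: "((\<lambda>y. z y s) has_derivative (\<lambda>v. Du y s v - 2 * \<eta> * (y \<bullet> v))) (at y within Omega_bar)"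
      if "y \<in> Omega_bar" for y
      unfolding z_def power2_norm_eq_inner
      by (rule has_derivative_eq_rhs, (rule derivative_intros dx that s0)+)
         (simp add: fun_eq_iff inner_commute algebra_simps)
    show False
    proof (cases "a \<in> Omega")
      case True
      obtain r where r: "r > 0" "ball a r \<subseteq> Omega" using open_Omega True by (meson openE)
      have "D2u a s b b - 2 * \<eta> \<le> 0" if b: "b \<in> Basis" for b
      proof -
        have "D2u a s b b - 2 * \<eta> * (b \<bullet> b) \<le> 0"
        proof (rule second_derivative_le_0[OF r(1) _ _ _ b, where f = "\<lambda>y. z y s"
              and F = "\<lambda>y v. Du y s v - 2 * \<eta> * (y \<bullet> v)" and G = "\<lambda>u. D2u a s b u - 2 * \<eta> * (u \<bullet> b)"])
          show "((\<lambda>y. z y s) has_derivative (\<lambda>v. Du y s v - 2 * \<eta> * (y \<bullet> v))) (at y)" if "y \<in> ball a r" for y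
            using that r(2) Omega_subset by (intro has_derivative_interior zx) auto
          show "((\<lambda>y. Du y s b - 2 * \<eta> * (y \<bullet> b)) has_derivative (\<lambda>u. D2u a s b u - 2 * \<eta> * (u \<bullet> b))) (at a)"
            by (intro has_derivative_diff dxx True s0 b has_derivative_mult_right has_derivative_inner_left has_derivative_ident)
          show "z y s \<le> z a s" if "y \<in> ball a r" for y
            using that r(2) Omega_subset by (intro max s) auto
        qed
        then show ?thesis using b by simp
      qed
      then have "(\<Sum>b\<in>Basis. D2u a s b b) \<le> (\<Sum>b\<in>(Basis::((real^'n) \<times> real) set). 2 * \<eta>)"
        by (intro sum_mono) auto
      then have "eps * ut a s \<le> \<eta> * (2 * DIM((real^'n) \<times> real))"
        using heat[OF True s0] by (simp add: algebra_simps)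
      moreover have "eps * (\<eta> * L) \<le> eps * ut a s" using time eps by simp
      moreover have "\<eta> * (2 * DIM((real^'n) \<times> real)) < \<eta> * (eps * L)" using L(2) \<eta> by simp
      ultimately show False by (simp add: mult.left_commute)
    next
      case False
      then obtain x' where a_eq: "a = (x', 0)" using a by (cases a) (auto simp: Omega_def Omega_bar_def)
      \<comment> \<open>The normal derivative of norm x^2 vanishes at the boundary, so the barrier
        does not alter the sign condition.\<close>
      have normal: "Du (x', 0) s (0, 1) \<le> 0"
      proof -
        have "(\<lambda>v. Du a s v - 2 * \<eta> * (a \<bullet> v)) (0, 1) \<le> 0"
        proof (rule inward_derivative_le_0[OF zx[OF a]])
          fix r :: real assume "0 \<le> r"
          then show "a + r *\<^sub>R (0, 1) \<in> Omega_bar" by (simp add: a_eq Omega_bar_def)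
          then show "z (a + r *\<^sub>R (0, 1)) s \<le> z a s" by (intro max s)
        qed
        then show ?thesis by (simp add: a_eq)
      qed
      \<comment> \<open>For k = 0 the sign of the normal derivative suffices, and no second
        derivative at the boundary is touched. For k > 0 the trace is maximal at x' as a function on
        all of R^(N-1), so its pure second derivatives are controlled there.\<close>
      have "delta * ut a s \<le> \<eta> * (2 * k * DIM(real^'n))"
      proof (cases "k = 0")
        case True
        then show ?thesis using bc normal s0 by (simp add: a_eq) 
      next
        case False
        then obtain Dw D2w where tr: "trace_derivs w Dw D2w" and
          eq: "\<And>x' t. t > 0 \<Longrightarrow> delta * ut (x', 0) t - k * (\<Sum>b\<in>Basis. D2w x' t b b) - Du (x', 0) t (0, 1) = 0"
          using bc by auto
        have "D2w x' s b b - 2 * \<eta> \<le> 0" if b: "b \<in> Basis" for b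
        proof -
          have "D2w x' s b b - 2 * \<eta> * (b \<bullet> b) \<le> 0"
          proof (rule second_derivative_le_0[OF zero_less_one _ _ _ b, where f = "\<lambda>y. z (y, 0) s"
                and F = "\<lambda>y v. Dw y s v - 2 * \<eta> * (y \<bullet> v)" and G = "\<lambda>u. D2w x' s b u - 2 * \<eta> * (u \<bullet> b)" and a = x'])
            have dw: "((\<lambda>y. w (y, 0) s) has_derivative Dw y s) (at y)" for y
              using tr s0 by (auto simp: trace_derivs_def)
            show "((\<lambda>y. z (y, 0) s) has_derivative (\<lambda>v. Dw y s v - 2 * \<eta> * (y \<bullet> v))) (at y)" for y
              unfolding z_def power2_norm_eq_inner
              by (rule has_derivative_eq_rhs, (rule derivative_intros dw s0)+)
                 (simp add: fun_eq_iff inner_commute algebra_simps)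
            show "((\<lambda>y. Dw y s b - 2 * \<eta> * (y \<bullet> b)) has_derivative (\<lambda>u. D2w x' s b u - 2 * \<eta> * (u \<bullet> b))) (at x')"
              using tr s0 b
              by (intro has_derivative_diff has_derivative_mult_right has_derivative_inner_left has_derivative_ident)
                 (auto simp: trace_derivs_def)
            show "z (y, 0) s \<le> z (x', 0) s" for y using max[of "(y, 0)" s] s by (simp add: a_eq)
          qed
          then show ?thesis using b by simp
        qed
        then have "(\<Sum>b\<in>Basis. D2w x' s b b) \<le> (\<Sum>b\<in>(Basis::(real^'n) set). 2 * \<eta>)"
          by (intro sum_mono) auto
        then have "k * (\<Sum>b\<in>Basis. D2w x' s b b) \<le> k * (DIM(real^'n) * (2 * \<eta>))"
          using k by (intro mult_left_mono) auto
        then show ?thesis using eq[OF s0, of x'] normal by (simp add: a_eq algebra_simps)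
      qed
      moreover have "delta * (\<eta> * L) \<le> delta * ut a s" using time delta by simp
      moreover have "\<eta> * (2 * k * DIM(real^'n)) < \<eta> * (delta * L)" using L(3) \<eta> by simp
      ultimately show False by (simp add: mult.left_commute)
    qed
  qed
  show ?thesis
  proof (rule field_le_epsilon)
    fix e :: real assume e: "e > 0"
    \<comment> \<open>The added 1 keeps B positive even for x = 0 and T = 0. With \<eta> = e / B the
      barrier at (x, T) is at most e.\<close>
    define B where "B = (norm x)\<^sup>2 + L * T + 1"
    have B: "B > 0" using L T by (simp add: B_def add_nonneg_pos)
    have "w x T - (e / B) * ((norm x)\<^sup>2 + L * T) \<le> 0"
      using barrier[of "e / B" x T] e B x T by simp
    moreover have "(e / B) * ((norm x)\<^sup>2 + L * T) \<le> (e / B) * B"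
      using e B by (intro mult_left_mono) (auto simp: B_def)
    ultimately show "w x T \<le> 0 + e" using B by simp
  qed
qed

lemma dyn_eqs_diff:
  fixes u v :: "(real^'n) \<times> real \<Rightarrow> real \<Rightarrow> real"
  assumes u: "dyn_eqs eps delta k u" and v: "dyn_eqs eps delta k v"
  shows "dyn_eqs eps delta k (\<lambda>x t. u x t - v x t)"
proof -
  obtain ut Du D2u where 1:
    "\<And>x t. x \<in> Omega_bar \<Longrightarrow> t > 0 \<Longrightarrow> ((\<lambda>s. u x s) has_real_derivative ut x t) (at t)"
    "\<And>x t. x \<in> Omega_bar \<Longrightarrow> t > 0 \<Longrightarrow> ((\<lambda>y. u y t) has_derivative Du x t) (at x within Omega_bar)"
    "\<And>x t b. x \<in> Omega \<Longrightarrow> t > 0 \<Longrightarrow> b \<in> Basis \<Longrightarrow> ((\<lambda>y. Du y t b) has_derivative D2u x t b) (at x)"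
    "\<And>x t. x \<in> Omega \<Longrightarrow> t > 0 \<Longrightarrow> eps * ut x t - (\<Sum>b\<in>Basis. D2u x t b b) = 0" and
    bc1: "if k = 0 then (\<forall>x'. \<forall>t>0. delta * ut (x', 0) t - Du (x', 0) t (0, 1) = 0)
         else (\<exists>Dw D2w. trace_derivs u Dw D2w \<and>
              (\<forall>x'. \<forall>t>0. delta * ut (x', 0) t - k * (\<Sum>b\<in>Basis. D2w x' t b b) - Du (x', 0) t (0, 1) = 0))"
    using u unfolding dyn_eqs_def by blast
  obtain vt Dv D2v where 2:
    "\<And>x t. x \<in> Omega_bar \<Longrightarrow> t > 0 \<Longrightarrow> ((\<lambda>s. v x s) has_real_derivative vt x t) (at t)"
    "\<And>x t. x \<in> Omega_bar \<Longrightarrow> t > 0 \<Longrightarrow> ((\<lambda>y. v y t) has_derivative Dv x t) (at x within Omega_bar)"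
    "\<And>x t b. x \<in> Omega \<Longrightarrow> t > 0 \<Longrightarrow> b \<in> Basis \<Longrightarrow> ((\<lambda>y. Dv y t b) has_derivative D2v x t b) (at x)"
    "\<And>x t. x \<in> Omega \<Longrightarrow> t > 0 \<Longrightarrow> eps * vt x t - (\<Sum>b\<in>Basis. D2v x t b b) = 0" and
    bc2: "if k = 0 then (\<forall>x'. \<forall>t>0. delta * vt (x', 0) t - Dv (x', 0) t (0, 1) = 0)
         else (\<exists>Dw D2w. trace_derivs v Dw D2w \<and>
              (\<forall>x'. \<forall>t>0. delta * vt (x', 0) t - k * (\<Sum>b\<in>Basis. D2w x' t b b) - Dv (x', 0) t (0, 1) = 0))"
    using v unfolding dyn_eqs_def by blast
  show ?thesis
    unfolding dyn_eqs_def
  proof (intro exI[of _ "\<lambda>x t. ut x t - vt x t"] exI[of _ "\<lambda>x t b. Du x t b - Dv x t b"]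
      exI[of _ "\<lambda>x t b c. D2u x t b c - D2v x t b c"] conjI ballI allI impI)
    fix x :: "(real^'n) \<times> real" and t :: real assume t: "t > 0"
    show "((\<lambda>s. u x s - v x s) has_real_derivative ut x t - vt x t) (at t)" if "x \<in> Omega_bar"
      by (intro DERIV_diff 1 2 that t)
    show "((\<lambda>y. u y t - v y t) has_derivative (\<lambda>b. Du x t b - Dv x t b)) (at x within Omega_bar)" if "x \<in> Omega_bar"
      by (intro has_derivative_diff 1 2 that t)
    show "((\<lambda>y. Du y t b - Dv y t b) has_derivative (\<lambda>c. D2u x t b c - D2v x t b c)) (at x)" if "x \<in> Omega" "b \<in> Basis" for b
      by (intro has_derivative_diff 1 2 that t)
    show "eps * (ut x t - vt x t) - (\<Sum>b\<in>Basis. D2u x t b b - D2v x t b b) = 0" if "x \<in> Omega"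
      using 1(4)[OF that t] 2(4)[OF that t] by (simp add: right_diff_distrib sum_subtractf)
  next
    show "if k = 0 then (\<forall>x'. \<forall>t>0. delta * (ut (x', 0) t - vt (x', 0) t) - (Du (x', 0) t (0, 1) - Dv (x', 0) t (0, 1)) = 0)
         else (\<exists>Dw D2w. trace_derivs (\<lambda>x t. u x t - v x t) Dw D2w \<and>
              (\<forall>x'. \<forall>t>0. delta * (ut (x', 0) t - vt (x', 0) t) - k * (\<Sum>b\<in>Basis. D2w x' t b b)
                 - (Du (x', 0) t (0, 1) - Dv (x', 0) t (0, 1)) = 0))"
    proof (cases "k = 0")
      case True
      then show ?thesis using bc1 bc2 by (simp add: right_diff_distrib)
    next
      case False
      then obtain Dw D2w Ew E2w where w: "trace_derivs u Dw D2w" "trace_derivs v Ew E2w"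
        "\<And>x' t. t > 0 \<Longrightarrow> delta * ut (x', 0) t - k * (\<Sum>b\<in>Basis. D2w x' t b b) - Du (x', 0) t (0, 1) = 0"
        "\<And>x' t. t > 0 \<Longrightarrow> delta * vt (x', 0) t - k * (\<Sum>b\<in>Basis. E2w x' t b b) - Dv (x', 0) t (0, 1) = 0"
        using bc1 bc2 by auto
      have "trace_derivs (\<lambda>x t. u x t - v x t) (\<lambda>x t b. Dw x t b - Ew x t b) (\<lambda>x t b c. D2w x t b c - E2w x t b c)"
        using w(1,2) unfolding trace_derivs_def by (auto intro!: has_derivative_diff)
      moreover have "delta * (ut (x', 0) t - vt (x', 0) t) - k * (\<Sum>b\<in>Basis. D2w x' t b b - E2w x' t b b)
                 - (Du (x', 0) t (0, 1) - Dv (x', 0) t (0, 1)) = 0" if "t > 0" for x' t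
        using w(3)[OF that, of x'] w(4)[OF that, of x'] by (simp add: right_diff_distrib sum_subtractf)
      ultimately show ?thesis using False by auto
    qed
  qed
qed

text \<open>The maximum principle applied to both differences. Continuity on the closed half space
  down to t = 0 is essential to this argument; solutions that jump at the corner are reduced to this
  case by a time shift.\<close>

lemma dyn_eqs_unique:
  fixes u v :: "(real^'n) \<times> real \<Rightarrow> real \<Rightarrow> real"
  assumes u: "dyn_eqs eps delta k u" "continuous_on (Omega_bar \<times> {0..}) (\<lambda>(x, t). u x t)"
    "\<And>T. \<exists>M. \<forall>x\<in>Omega_bar. \<forall>t\<in>{0..T}. \<bar>u x t\<bar> \<le> M"
    and v: "dyn_eqs eps delta k v" "continuous_on (Omega_bar \<times> {0..}) (\<lambda>(x, t). v x t)"
    "\<And>T. \<exists>M. \<forall>x\<in>Omega_bar. \<forall>t\<in>{0..T}. \<bar>v x t\<bar> \<le> M"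
    and init: "\<And>x. x \<in> Omega_bar \<Longrightarrow> u x 0 = v x 0"
    and x: "x \<in> Omega_bar" and t: "t \<ge> 0"
  shows "u x t = v x t"
proof -
  have le: "f x t \<le> g x t"
    if f: "dyn_eqs eps delta k f" "continuous_on (Omega_bar \<times> {0..}) (\<lambda>(x, t). f x t)"
      "\<And>T. \<exists>M. \<forall>x\<in>Omega_bar. \<forall>t\<in>{0..T}. \<bar>f x t\<bar> \<le> M"
    and g: "dyn_eqs eps delta k g" "continuous_on (Omega_bar \<times> {0..}) (\<lambda>(x, t). g x t)"
      "\<And>T. \<exists>M. \<forall>x\<in>Omega_bar. \<forall>t\<in>{0..T}. \<bar>g x t\<bar> \<le> M"
    and fg: "\<And>x. x \<in> Omega_bar \<Longrightarrow> f x 0 = g x 0" for f g :: "(real^'n) \<times> real \<Rightarrow> real \<Rightarrow> real"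
  proof -
    have "f x t - g x t \<le> 0"
    proof (rule dyn_eqs_max_principle[OF dyn_eqs_diff[OF f(1) g(1)] _ _ _ x t])
      show "continuous_on (Omega_bar \<times> {0..}) (\<lambda>(x, t). f x t - g x t)"
        using continuous_on_diff[OF f(2) g(2)] by (simp add: split_beta')
      fix T
      obtain M N where "\<forall>x\<in>Omega_bar. \<forall>t\<in>{0..T}. \<bar>f x t\<bar> \<le> M" "\<forall>x\<in>Omega_bar. \<forall>t\<in>{0..T}. \<bar>g x t\<bar> \<le> N"
        using f(3)[of T] g(3)[of T] by blast
      then have "\<forall>x\<in>Omega_bar. \<forall>t\<in>{0..T}. f x t - g x t \<le> M + N" by (smt (verit))
      then show "\<exists>M. \<forall>x\<in>Omega_bar. \<forall>t\<in>{0..T}. f x t - g x t \<le> M" by blast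
    qed (simp add: fg)
    then show ?thesis by simp
  qed
  show ?thesis using le[OF u v init] le[OF v u init[symmetric]] by simp
qed

end

section \<open>The error function and Gaussian masses\<close>

text \<open>The usual error function. An integral over \<open>{a..b}\<close> is 0 for b < a, so the
  second integral supplies the negative arguments and makes the function odd.\<close>

definition erf :: "real \<Rightarrow> real" where
  "erf z = 2 / sqrt pi * (integral {0..z} (\<lambda>r. exp (- r\<^sup>2)) - integral {z..0} (\<lambda>r. exp (- r\<^sup>2)))"

lemma integrable_exp_square: "(\<lambda>r::real. exp (- r\<^sup>2)) integrable_on {a..b}"
  by (intro integrable_continuous_real continuous_intros)

lemma erf_0 [simp]: "erf 0 = 0"
  by (simp add: erf_def)

lemma erf_minus: "erf (- z) = - erf z"
  using Henstock_Kurzweil_Integration.integral_reflect_real[of 0 z "\<lambda>r. exp (- r\<^sup>2)"]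
    Henstock_Kurzweil_Integration.integral_reflect_real[of z 0 "\<lambda>r. exp (- r\<^sup>2)"]
  by (simp add: erf_def algebra_simps)

lemma erf_has_real_derivative: "(erf has_real_derivative 2 / sqrt pi * exp (- z\<^sup>2)) (at z)"
proof -
  \<comment> \<open>A base point below both z and 0: near z, \<open>erf\<close> is then a constant
    plus a multiple of the integral from a, whatever the sign of z.\<close>
  define a where "a = - \<bar>z\<bar> - 1"
  have a: "a < z" "a < 0" by (auto simp: a_def)
  have eq: "erf w = 2 / sqrt pi * (integral {a..w} (\<lambda>r. exp (- r\<^sup>2)) - integral {a..0} (\<lambda>r. exp (- r\<^sup>2)))"
    if "a < w" for w
  proof (cases "w \<ge> 0")
    case True
    then have "integral {a..0} (\<lambda>r. exp (- r\<^sup>2)) + integral {0..w} (\<lambda>r. exp (- r\<^sup>2)) = integral {a..w} (\<lambda>r. exp (- r\<^sup>2))"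
      using a by (intro Henstock_Kurzweil_Integration.integral_combine integrable_exp_square) auto
    moreover have "integral {w..0} (\<lambda>r. exp (- r\<^sup>2)) = 0" using True by (cases "w = 0") auto
    ultimately have "integral {0..w} (\<lambda>r. exp (- r\<^sup>2)) - integral {w..0} (\<lambda>r. exp (- r\<^sup>2)) =
        integral {a..w} (\<lambda>r. exp (- r\<^sup>2)) - integral {a..0} (\<lambda>r. exp (- r\<^sup>2))" by linarith
    then show ?thesis by (simp only: erf_def)
  next
    case False
    then have "integral {a..w} (\<lambda>r. exp (- r\<^sup>2)) + integral {w..0} (\<lambda>r. exp (- r\<^sup>2)) = integral {a..0} (\<lambda>r. exp (- r\<^sup>2))"
      using that by (intro Henstock_Kurzweil_Integration.integral_combine integrable_exp_square) auto
    moreover have "integral {0..w} (\<lambda>r. exp (- r\<^sup>2)) = 0" using False by auto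
    ultimately have "integral {0..w} (\<lambda>r. exp (- r\<^sup>2)) - integral {w..0} (\<lambda>r. exp (- r\<^sup>2)) =
        integral {a..w} (\<lambda>r. exp (- r\<^sup>2)) - integral {a..0} (\<lambda>r. exp (- r\<^sup>2))" by linarith
    then show ?thesis by (simp only: erf_def)
  qed
  have "((\<lambda>w. integral {a..w} (\<lambda>r. exp (- r\<^sup>2))) has_real_derivative exp (- z\<^sup>2)) (at z within {a..z + 1})"
    using a by (intro integral_has_real_derivative continuous_intros) auto
  moreover have "at z within {a..z + 1} = at z"
    using a by (intro at_within_Icc_at) auto
  ultimately have "((\<lambda>w. integral {a..w} (\<lambda>r. exp (- r\<^sup>2))) has_real_derivative exp (- z\<^sup>2)) (at z)" by simp
  then have "((\<lambda>w. 2 / sqrt pi * (integral {a..w} (\<lambda>r. exp (- r\<^sup>2)) - integral {a..0} (\<lambda>r. exp (- r\<^sup>2))))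
      has_real_derivative 2 / sqrt pi * exp (- z\<^sup>2)) (at z)"
    by (intro DERIV_cmult) (auto intro!: derivative_eq_intros)
  then show ?thesis
    by (rule has_field_derivative_transform_within_open[of _ _ _ "{a<..}"]) (use a eq in auto)
qed

lemma erf_mono: "mono erf"
proof (rule monoI)
  fix x y :: real assume "x \<le> y"
  then show "erf x \<le> erf y"
  proof (rule DERIV_nonneg_imp_nondecreasing)
    fix z
    have "0 \<le> 2 / sqrt pi * exp (- z\<^sup>2)" by simp
    then show "\<exists>d. (erf has_real_derivative d) (at z) \<and> 0 \<le> d"
      using erf_has_real_derivative by blast
  qed
qed

text \<open>Monotonicity reduces the limit to integer arguments; the value of the half-line integral
  is the Gaussian moment of order 0.\<close>

lemma erf_at_top: "(erf \<longlongrightarrow> 1) at_top"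
proof (rule tendsto_at_topI_sequentially_real[OF erf_mono])
  have hi: "((\<lambda>r::real. exp (- r\<^sup>2)) has_integral sqrt pi / 2) {0..}"
  proof -
    have "((\<lambda>x. indicat_real {0..} x *\<^sub>R exp (- x\<^sup>2)) has_integral sqrt pi / 2) UNIV"
    proof -
      note * = iffD1[OF has_bochner_integral_iff gaussian_moment_0]
      show ?thesis using has_integral_integral_lborel[OF conjunct1[OF *]] unfolding conjunct2[OF *] .
    qed
    then have "((\<lambda>x. if x \<in> {0..} then exp (- x\<^sup>2) else 0) has_integral sqrt pi / 2) (UNIV :: real set)"
      by (rule has_integral_eq[rotated]) (simp add: indicator_def)
    then show ?thesis by (simp only: has_integral_restrict_UNIV)
  qed
  have "(\<lambda>n. integral {0..} (\<lambda>r::real. if r \<in> {0..real n} then exp (- r\<^sup>2) else 0)) \<longlonglongrightarrow>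
      integral {0..} (\<lambda>r::real. exp (- r\<^sup>2))"
  proof (rule dominated_convergence(2))
    show "(\<lambda>r::real. exp (- r\<^sup>2)) integrable_on {0..}" using hi by blast
    show "(\<lambda>r. if r \<in> {0..real n} then exp (- r\<^sup>2) else 0) integrable_on {0..}" for n
      using integrable_exp_square[of 0 "real n"]
      by (subst Henstock_Kurzweil_Integration.integrable_restrict_Int) (simp add: Int_absorb2)
    show "(\<lambda>n. if r \<in> {0..real n} then exp (- r\<^sup>2) else 0) \<longlonglongrightarrow> exp (- r\<^sup>2)" if "r \<in> {0..}" for r :: real
    proof (rule tendsto_eventually)
      show "\<forall>\<^sub>F n in sequentially. (if r \<in> {0..real n} then exp (- r\<^sup>2) else 0) = exp (- r\<^sup>2)"
        using that by (intro eventually_mono[OF eventually_ge_at_top[of "nat \<lceil>r\<rceil>"]])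
          (auto simp: nat_le_iff ceiling_le_iff)
    qed
  qed auto
  moreover have "integral {0..} (\<lambda>r::real. if r \<in> {0..real n} then exp (- r\<^sup>2) else 0) = integral {0..real n} (\<lambda>r. exp (- r\<^sup>2))" for n
    by (subst Henstock_Kurzweil_Integration.integral_restrict_Int) (simp add: Int_absorb2)
  ultimately have "(\<lambda>n. integral {0..real n} (\<lambda>r. exp (- r\<^sup>2))) \<longlonglongrightarrow> sqrt pi / 2"
    using hi by (simp add: integral_unique)
  from tendsto_mult[OF tendsto_const this, of "2 / sqrt pi"]
  have "(\<lambda>n. 2 / sqrt pi * integral {0..real n} (\<lambda>r. exp (- r\<^sup>2))) \<longlonglongrightarrow> 1" by simp
  moreover have "2 / sqrt pi * integral {0..real n} (\<lambda>r. exp (- r\<^sup>2)) = erf (real n)" for n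
    by (cases "n = 0") (auto simp: erf_def)
  ultimately show "(\<lambda>n. erf (real n)) \<longlonglongrightarrow> 1" by simp
qed

lemma Gam_real_eq:
  fixes \<xi> s :: real
  assumes "s > 0"
  shows "Gam \<xi> s = exp (- (\<xi> / (2 * sqrt s))\<^sup>2) / (2 * sqrt pi * sqrt s)"
proof -
  have "(4 * pi * s) powr (- real DIM(real) / 2) = inverse (sqrt (4 * pi * s))"
    using assms by (simp add: powr_minus powr_half_sqrt)
  also have "sqrt (4 * pi * s) = 2 * sqrt pi * sqrt s" by (simp add: real_sqrt_mult)
  finally have 1: "(4 * pi * s) powr (- real DIM(real) / 2) = inverse (2 * sqrt pi * sqrt s)" .
  have 2: "- (norm \<xi>)\<^sup>2 / (4 * s) = - (\<xi> / (2 * sqrt s))\<^sup>2"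
    using assms by (simp add: power_divide power_mult_distrib)
  show ?thesis unfolding Gam_def 1 2 by (simp only: divide_inverse mult.commute)
qed

text \<open>The chain rule behind conservation of mass. With f the shifted normal variable and g the
  normal diffusion time, the two terms are the weighted \<theta>-densities of the mass of interior
  and of boundary sources.\<close>

lemma erf_scaled_has_real_derivative:
  fixes f g :: "real \<Rightarrow> real"
  assumes f: "(f has_real_derivative f') (at x)" and g: "(g has_real_derivative g') (at x)" and s: "g x > 0"
  shows "((\<lambda>x. erf (f x / (2 * sqrt (g x)))) has_real_derivative
     2 * f' * Gam (f x) (g x) - g' * flux (f x) (g x)) (at x)"
proof -
  have sq: "sqrt (g x) * sqrt (g x) = g x" using s by simp
  have "((\<lambda>x. f x / (2 * sqrt (g x))) has_real_derivative
      f' / (2 * sqrt (g x)) - f x * g' / (4 * g x * sqrt (g x))) (at x)"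
    using s by (auto intro!: derivative_eq_intros f g simp: field_simps)
  from DERIV_chain2[OF erf_has_real_derivative this] show ?thesis
  proof (rule DERIV_cong)
    define q E P where "q = sqrt (g x)" and "E = exp (- (f x / (2 * q))\<^sup>2)" and "P = sqrt pi"
    have q: "q > 0" "g x = q * q" and P: "P > 0" using s by (auto simp: q_def P_def)
    have Gam: "Gam (f x) (g x) = E / (2 * P * q)" using Gam_real_eq[OF s] by (simp add: q_def E_def P_def)
    have "2 / P * E * (f' / (2 * q) - f x * g' / (4 * (q * q) * q)) = 2 * f' * (E / (2 * P * q)) - g' * (f x * (1 / (q * q)) * (E / (2 * P * q)))"
      using q P by (simp add: field_simps)
    then show "2 / sqrt pi * exp (- (f x / (2 * sqrt (g x)))\<^sup>2) * (f' / (2 * sqrt (g x)) - f x * g' / (4 * g x * sqrt (g x)))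
        = 2 * f' * Gam (f x) (g x) - g' * flux (f x) (g x)"
      unfolding flux_def Gam q_def[symmetric] unfolding E_def[symmetric] P_def[symmetric] q(2) .
  qed
qed

lemma Gam_at_top: "((\<lambda>y. Gam (\<xi> + y) s) \<longlongrightarrow> 0) at_top" if s: "s > 0" for \<xi> s :: real
proof -
  have "filterlim (\<lambda>y::real. \<xi> + y) at_top at_top"
    by (rule filterlim_tendsto_add_at_top[OF tendsto_const filterlim_ident])
  then have "filterlim (\<lambda>y::real. (\<xi> + y)\<^sup>2) at_top at_top"
    by (rule filterlim_pow_at_top[rotated]) simp
  then have "filterlim (\<lambda>y::real. (1 / (4 * s)) * (\<xi> + y)\<^sup>2) at_top at_top"
    by (rule filterlim_tendsto_pos_mult_at_top[OF tendsto_const, rotated]) (use s in simp)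
  then have "filterlim (\<lambda>y::real. - ((1 / (4 * s)) * (\<xi> + y)\<^sup>2)) at_bot at_top"
    by (simp add: filterlim_uminus_at_bot)
  then have "((\<lambda>y::real. exp (- ((1 / (4 * s)) * (\<xi> + y)\<^sup>2))) \<longlongrightarrow> 0) at_top"
    by (rule filterlim_compose[OF exp_at_bot])
  from tendsto_mult[OF tendsto_const this, of "(4 * pi * s) powr (- real DIM(real) / 2)"]
  show ?thesis by (simp add: Gam_def)
qed

lemma borel_measurable_Gam2 [measurable (raw)]:
  fixes f :: "'b \<Rightarrow> 'a::euclidean_space"
  assumes [measurable]: "f \<in> borel_measurable M" "g \<in> borel_measurable M"
  shows "(\<lambda>x. Gam (f x) (g x)) \<in> borel_measurable M"
  unfolding Gam_def by measurable

lemma borel_measurable_flux [measurable (raw)]: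
  assumes [measurable]: "f \<in> borel_measurable M" "g \<in> borel_measurable M"
  shows "(\<lambda>x. flux (f x) (g x)) \<in> borel_measurable M"
  unfolding flux_def by measurable

text \<open>The function -2 * \<open>Gam\<close> is a primitive of the flux in its spatial variable
  and vanishes at infinity.\<close>

lemma nn_integral_flux:
  assumes \<xi>: "\<xi> \<ge> 0" and s: "s > 0"
  shows "(\<integral>\<^sup>+y\<in>{0..}. ennreal (flux (\<xi> + y) s) \<partial>lborel) = ennreal (2 * Gam \<xi> s)"
proof -
  have "(\<integral>\<^sup>+y\<in>{0..}. ennreal (flux (\<xi> + y) s) \<partial>lborel) = ennreal (0 - (-2) * Gam (\<xi> + 0) s)"
  proof (rule nn_integral_FTC_atLeast)
    show "((\<lambda>y. (-2) * Gam (\<xi> + y) s) has_real_derivative flux (\<xi> + y) s) (at y)" for y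
    proof -
      have "((\<lambda>y. Gam (\<xi> + y) s) has_derivative (\<lambda>u. gauss_grad (\<xi> + y) s u)) (at y)"
        by (rule has_derivative_Gam_space) (use s in \<open>auto intro!: derivative_eq_intros\<close>)
      from has_derivative_mult_right[OF this, of "-2"] show ?thesis
        unfolding has_field_derivative_def
        by (rule has_derivative_eq_rhs) (simp add: gauss_grad_def flux_def fun_eq_iff)
    qed
    show "((\<lambda>y. (-2) * Gam (\<xi> + y) s) \<longlongrightarrow> 0) at_top"
      using tendsto_mult[OF tendsto_const Gam_at_top[OF s], of "-2" \<xi>] by simp
  qed (use \<xi> s in \<open>auto intro: flux_nonneg\<close>)
  then show ?thesis by simp
qed

text \<open>Half the difference of two error functions is a primitive. The value is the mass that
  the heat equation on the half line retains under the zero boundary condition.\<close>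

lemma nn_integral_Gam_reflected:
  assumes x: "x \<ge> 0" and s: "s > 0"
  shows "(\<integral>\<^sup>+y\<in>{0..}. ennreal (Gam (x - y) s - Gam (x + y) s) \<partial>lborel) = ennreal (erf (x / (2 * sqrt s)))"
proof -
  define F where "F y = (erf ((y - x) / (2 * sqrt s)) - erf ((y + x) / (2 * sqrt s))) / 2" for y
  have "(\<integral>\<^sup>+y\<in>{0..}. ennreal (Gam (x - y) s - Gam (x + y) s) \<partial>lborel) = ennreal (0 - F 0)"
  proof (rule nn_integral_FTC_atLeast)
    show "(F has_real_derivative Gam (x - y) s - Gam (x + y) s) (at y)" for y
    proof -
      have 1: "((\<lambda>y. erf ((y + c) / (2 * sqrt s))) has_real_derivative 2 * Gam (y + c) s) (at y)" for c
      proof -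
        have "((\<lambda>y. y + c) has_real_derivative 1) (at y)" by (auto intro!: derivative_eq_intros)
        from erf_scaled_has_real_derivative[OF this DERIV_const s] show ?thesis by simp
      qed
      have "Gam (y - x) s = Gam (x - y) s" using Gam_minus[of "x - y" s] by simp
      then show ?thesis
        unfolding F_def using DERIV_cdivide[OF DERIV_diff[OF 1[of "-x"] 1[of x]], of 2]
        by (simp add: add.commute diff_divide_distrib)
    qed
    show "0 \<le> Gam (x - y) s - Gam (x + y) s" if "0 \<le> y" for y
    proof -
      have "(x - y)\<^sup>2 \<le> (x + y)\<^sup>2" using x that by (simp add: power2_eq_square algebra_simps)
      then have "exp (- (x + y)\<^sup>2 / (4 * s)) \<le> exp (- (x - y)\<^sup>2 / (4 * s))"
        using s by (simp add: divide_right_mono)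
      then show ?thesis by (simp add: Gam_def mult_left_mono)
    qed
    have lim: "((\<lambda>y. erf ((y + c) / (2 * sqrt s))) \<longlongrightarrow> 1) at_top" for c
    proof (rule filterlim_compose[OF erf_at_top])
      have "filterlim (\<lambda>y. c + y) at_top at_top"
        by (rule filterlim_tendsto_add_at_top[OF tendsto_const filterlim_ident])
      then have "filterlim (\<lambda>y. (1 / (2 * sqrt s)) * (c + y)) at_top at_top"
        by (rule filterlim_tendsto_pos_mult_at_top[OF tendsto_const, rotated]) (use s in simp)
      then show "filterlim (\<lambda>y. (y + c) / (2 * sqrt s)) at_top at_top"
        by (simp add: add.commute)
    qed
    show "(F \<longlongrightarrow> 0) at_top"
      unfolding F_def using tendsto_divide[OF tendsto_diff[OF lim[of "-x"] lim[of x]] tendsto_const, of 2] by simp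
  qed auto
  also have "0 - F 0 = erf (x / (2 * sqrt s))"
    using erf_minus[of "x / (2 * sqrt s)"] by (simp add: F_def)
  finally show ?thesis .
qed

lemma nn_integral_Gam_translate:
  assumes "s > 0"
  shows "(\<integral>\<^sup>+ y. ennreal (Gam (x - y) s) \<partial>(lborel :: 'a::euclidean_space measure)) = 1"
proof -
  have "(\<integral>\<^sup>+ y. ennreal (Gam (x - y) s) \<partial>(lborel :: 'a measure)) =
      (\<integral>\<^sup>+ y. ennreal (Gam (x - y) s) \<partial>distr lborel borel (\<lambda>y. x + y))"
    by (simp add: lborel_distr_plus)
  also have "\<dots> = (\<integral>\<^sup>+ y. ennreal (Gam y s) \<partial>(lborel :: 'a measure))"
    by (subst nn_integral_distr) auto
  finally show ?thesis by (simp add: nn_integral_Gam[OF assms])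
qed

lemma nn_integral_lborel_Times:
  fixes f :: "'a::euclidean_space \<Rightarrow> ennreal" and g :: "'b::euclidean_space \<Rightarrow> ennreal"
  assumes [measurable]: "f \<in> borel_measurable borel" "g \<in> borel_measurable borel"
  shows "(\<integral>\<^sup>+ p. f (fst p) * g (snd p) \<partial>lborel) = (\<integral>\<^sup>+ y. f y \<partial>lborel) * (\<integral>\<^sup>+ z. g z \<partial>lborel)"
proof -
  have "(\<integral>\<^sup>+ p. f (fst p) * g (snd p) \<partial>lborel) = (\<integral>\<^sup>+ p. f (fst p) * g (snd p) \<partial>(lborel \<Otimes>\<^sub>M lborel))"
    by (simp add: lborel_prod)
  also have "\<dots> = (\<integral>\<^sup>+ y. \<integral>\<^sup>+ z. f y * g z \<partial>lborel \<partial>lborel)"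
    by (subst lborel.nn_integral_fst[symmetric]) auto
  also have "\<dots> = (\<integral>\<^sup>+ y. f y * (\<integral>\<^sup>+ z. g z \<partial>lborel) \<partial>lborel)"
    by (simp add: nn_integral_cmult)
  also have "\<dots> = (\<integral>\<^sup>+ y. f y \<partial>lborel) * (\<integral>\<^sup>+ z. g z \<partial>lborel)"
    by (simp add: nn_integral_multc)
  finally show ?thesis .
qed

lemma nn_integral_Omega_Times:
  fixes f :: "real^'n \<Rightarrow> real" and g :: "real \<Rightarrow> real"
  assumes [measurable]: "f \<in> borel_measurable borel" "g \<in> borel_measurable borel"
    and f: "\<And>y. 0 \<le> f y"
  shows "(\<integral>\<^sup>+p\<in>Omega. ennreal (f (fst p) * g (snd p)) \<partial>lborel) =
     (\<integral>\<^sup>+ y. ennreal (f y) \<partial>lborel) * (\<integral>\<^sup>+z\<in>{0..}. ennreal (g z) \<partial>lborel)"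
proof -
  have "(\<integral>\<^sup>+p\<in>Omega. ennreal (f (fst p) * g (snd p)) \<partial>lborel) =
      (\<integral>\<^sup>+ p. ennreal (f (fst p)) * (ennreal (g (snd p)) * indicator {0<..} (snd p)) \<partial>lborel)"
    by (intro nn_integral_cong) (auto simp: Omega_def indicator_def ennreal_mult' f)
  also have "\<dots> = (\<integral>\<^sup>+ y. ennreal (f y) \<partial>lborel) * (\<integral>\<^sup>+z\<in>{0<..}. ennreal (g z) \<partial>lborel)"
    by (rule nn_integral_lborel_Times) auto
  also have "(\<integral>\<^sup>+z\<in>{0<..}. ennreal (g z) \<partial>lborel) = (\<integral>\<^sup>+z\<in>{0..}. ennreal (g z) \<partial>lborel)"
    by (intro nn_integral_cong_AE eventually_mono[OF AE_lborel_singleton[of 0]]) (auto simp: indicator_def)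
  finally show ?thesis .
qed

section \<open>Mass and concentration of the kernel\<close>

lemma nn_integral_set_has_integral:
  fixes f :: "'a::euclidean_space \<Rightarrow> real"
  assumes [measurable]: "f \<in> borel_measurable borel" "S \<in> sets borel" and f: "\<And>x. x \<in> S \<Longrightarrow> 0 \<le> f x"
    and r: "(\<integral>\<^sup>+x\<in>S. ennreal (f x) \<partial>lborel) = ennreal r" "0 \<le> r"
  shows "(f has_integral r) S"
proof -
  have "((\<lambda>x. indicator S x * f x) has_integral r) UNIV"
  proof (rule nn_integral_has_integral)
    have "(\<integral>\<^sup>+ x. ennreal (indicator S x * f x) \<partial>lborel) = (\<integral>\<^sup>+x\<in>S. ennreal (f x) \<partial>lborel)"
      by (intro nn_integral_cong) (simp add: indicator_def)
    then show "(\<integral>\<^sup>+ x. ennreal (indicator S x * f x) \<partial>lborel) = ennreal r" using r by simp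
  qed (use f r in \<open>auto simp: indicator_def\<close>)
  then have "((\<lambda>x. if x \<in> S then f x else 0) has_integral r) UNIV"
    by (rule has_integral_eq[rotated]) (simp add: indicator_def)
  then show ?thesis by (simp only: has_integral_restrict_UNIV)
qed

lemma norm_diff_refl_le:
  assumes "x \<in> Omega_bar" "y \<in> Omega_bar"
  shows "(norm (x - y))\<^sup>2 \<le> (norm (x - refl y))\<^sup>2"
proof -
  have "0 \<le> snd x * snd y" using assms by (simp add: Omega_bar_def)
  then have "(snd x - snd y)\<^sup>2 \<le> (snd x + snd y)\<^sup>2" by (simp add: power2_eq_square algebra_simps)
  then show ?thesis by (simp add: norm_prod_def refl_def)
qed

lemma G0_nonneg:
  assumes "x \<in> Omega_bar" "y \<in> Omega_bar" "s > 0"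
  shows "0 \<le> G0 x y s"
proof -
  have "- (norm (x - refl y))\<^sup>2 / (4 * s) \<le> - (norm (x - y))\<^sup>2 / (4 * s)"
    using norm_diff_refl_le[OF assms(1,2)] assms(3) by (simp add: divide_right_mono)
  then show ?thesis unfolding G0_def Gam_def by (simp add: mult_left_mono)
qed

context dynamic_bc
begin

lemma slab_diff_refl:
  "slab a b c (x - refl y) t = t * (Gam (fst x - fst y) (t * a) * flux (snd x + snd y + t * c) (t * b))"
  by (simp add: slab_def refl_def)

lemma slab_pos:
  assumes "w \<in> Omega_bar" "t > 0" "0 < \<theta>" "\<theta> < 1"
  shows "0 < slab (ca \<theta>) (cb \<theta>) (cc \<theta>) w t"
proof -
  have "0 < cc \<theta>" using assms delta by (simp add: cc_def)
  then have "0 < snd w + t * cc \<theta>" using assms by (simp add: Omega_bar_def add_nonneg_pos)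
  then show ?thesis
    using assms ca_pos[of \<theta>] cb_pos[of \<theta>] unfolding slab_def by (intro mult_pos_pos Gam_pos flux_pos) auto
qed

lemma slab_integrable:
  assumes "w \<in> Omega_bar" "t > 0"
  shows "(\<lambda>\<theta>. slab (ca \<theta>) (cb \<theta>) (cc \<theta>) w t) integrable_on {0<..<1}"
  by (rule dominated_family_integrable[OF slab_families(1) assms])

lemma layer_nonneg: "w \<in> Omega_bar \<Longrightarrow> t > 0 \<Longrightarrow> 0 \<le> layer w t"
  unfolding layer_def by (intro integral_nonneg slab_integrable) (auto intro: less_imp_le[OF slab_pos])

text \<open>On the compact interval [1/4, 1/2] the integrand is continuous and strictly positive, so
  this part of the integral alone is nonzero.\<close>

lemma layer_pos:
  assumes w: "w \<in> Omega_bar" and t: "t > 0"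
  shows "0 < layer w t"
proof -
  let ?f = "\<lambda>\<theta>. slab (ca \<theta>) (cb \<theta>) (cc \<theta>) w t"
  let ?I = "cbox (1/4) (1/2 :: real)"
  have cont: "continuous_on ?I ?f"
  proof -
    have "continuous_on ?I (\<lambda>\<theta>. (\<lambda>(w, t, \<theta>). slab (ca \<theta>) (cb \<theta>) (cc \<theta>) w t) (w, t, \<theta>))"
      by (rule continuous_on_compose2[OF gauss_weight.gauss_poly_continuous[OF gauss_weight_slab gauss_poly_slab]])
         (use w t in \<open>auto intro!: continuous_intros\<close>)
    then show ?thesis by simp
  qed
  have pos: "0 < ?f \<theta>" if "\<theta> \<in> {0<..<1}" for \<theta> using slab_pos[OF w t] that by auto
  have int: "?f integrable_on ?I" by (rule integrable_continuous[OF cont])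
  have "integral ?I ?f \<le> layer w t"
    unfolding layer_def using pos
    by (intro integral_subset_le int slab_integrable w t) (auto intro: less_imp_le)
  moreover have "0 \<le> integral ?I ?f" by (intro integral_nonneg int) (auto intro!: less_imp_le[OF pos])
  moreover have "integral ?I ?f \<noteq> 0"
  proof
    assume eq: "integral ?I ?f = 0"
    have "(?f has_integral 0) ?I" using integrable_integral[OF int] unfolding eq .
    then have "?f (1/4) = 0"
    proof (rule has_integral_0_cbox_imp_0[OF cont, rotated])
      show "0 \<le> ?f \<theta>" if "\<theta> \<in> box (1/4) (1/2)" for \<theta>
        using pos[of \<theta>] that by simp
      show "1 / 4 \<in> ?I" "box (1/4) (1/2 :: real) \<noteq> {}" by auto
    qed
    then show False using pos[of "1/4"] by simp
  qed
  ultimately show ?thesis by linarith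
qed

lemma ennreal_layer:
  assumes w: "w \<in> Omega_bar" and t: "t > 0"
  shows "ennreal (layer w t) = (\<integral>\<^sup>+\<theta>\<in>{0<..<1}. ennreal (slab (ca \<theta>) (cb \<theta>) (cc \<theta>) w t) \<partial>lborel)"
  unfolding layer_def using slab_pos[OF w t]
  by (intro nn_integral_has_integral_lebesgue'[symmetric] integrable_integral slab_integrable w t)
     (auto intro: less_imp_le)

text \<open>Strict positivity has to come from the layer, since \<open>G0\<close> vanishes as soon
  as x or y lies on the boundary.\<close>

lemma Gker_pos:
  assumes "x \<in> Omega_bar" "y \<in> Omega_bar" "t > 0"
  shows "0 < Gker eps delta k x y t"
proof -
  have "0 < layer (x - refl y) t / delta"
    using layer_pos[OF diff_refl_in_Omega_bar[OF assms(1,2)] assms(3)] delta by simp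
  moreover have "0 \<le> G0 x y (t / eps)" using assms eps by (intro G0_nonneg) auto
  ultimately show ?thesis unfolding Gker_def Hker_eq_layer[OF assms(3)] by linarith
qed

text \<open>H depends on norm (x' - y') and x_N + y_N, and \<open>G0\<close> on the norms of x - y
  and x - refl y; all four are symmetric in x and y.\<close>

lemma Gker_sym: "Gker eps delta k x y t = Gker eps delta k y x t"
proof -
  have n: "norm (x - y) = norm (y - x)" "norm (fst x - fst y) = norm (fst y - fst x)"
    by (simp_all add: norm_minus_commute)
  then have "norm (x - refl y) = norm (y - refl x)"
    by (simp add: norm_prod_def refl_def add.commute)
  then show ?thesis
    unfolding Gker_def G0_def Hker_def using n by (simp add: Gam_def add.commute)
qed

text \<open>After exchanging the integrals by Tonelli, the tangential Gaussian has mass 1 for each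
  \<theta>, and the normal flux integrates to twice the one-dimensional kernel.\<close>

lemma nn_integral_layer_Omega:
  fixes x :: "(real^'n) \<times> real"
  assumes x: "x \<in> Omega_bar" and t: "t > 0"
  shows "(\<integral>\<^sup>+y\<in>Omega. ennreal (layer (x - refl y) t) \<partial>lborel) =
     (\<integral>\<^sup>+\<theta>\<in>{0<..<1}. ennreal (2 * t * Gam (snd x + t * cc \<theta>) (t * cb \<theta>)) \<partial>lborel)"
proof -
  note [measurable] = borel_open[OF open_Omega]
  \<comment> \<open>The projections receive names so that \<open>measurable\<close> uses their Borel
    measurability on the product, derived from continuity.\<close>
  define p1 :: "(real^'n) \<times> real \<Rightarrow> real^'n" where "p1 = fst"
  define p2 :: "(real^'n) \<times> real \<Rightarrow> real" where "p2 = snd"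
  have [measurable]: "p1 \<in> borel_measurable borel" "p2 \<in> borel_measurable borel"
    unfolding p1_def p2_def by (intro borel_measurable_continuous_onI continuous_intros)+
  let ?f = "\<lambda>(y, \<theta>). ennreal (t * (Gam (fst x - p1 y) (t * ca \<theta>) * flux (snd x + p2 y + t * cc \<theta>) (t * cb \<theta>)))
      * indicator {0<..<1} \<theta> * indicator Omega y"
  have "(\<integral>\<^sup>+y\<in>Omega. ennreal (layer (x - refl y) t) \<partial>lborel) = (\<integral>\<^sup>+ y. \<integral>\<^sup>+ \<theta>. ?f (y, \<theta>) \<partial>lborel \<partial>lborel)"
  proof (rule nn_integral_cong)
    fix y :: "(real^'n) \<times> real"
    show "ennreal (layer (x - refl y) t) * indicator Omega y = (\<integral>\<^sup>+ \<theta>. ?f (y, \<theta>) \<partial>lborel)"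
      using Omega_subset ennreal_layer[OF diff_refl_in_Omega_bar[OF x, of y] t]
      by (cases "y \<in> Omega") (auto simp: slab_diff_refl p1_def p2_def)
  qed
  also have "\<dots> = (\<integral>\<^sup>+ \<theta>. \<integral>\<^sup>+ y. ?f (y, \<theta>) \<partial>lborel \<partial>lborel)"
    by (rule lborel_pair.Fubini[symmetric]) (unfold ca_def cb_def cc_def, measurable)
  also have "\<dots> = (\<integral>\<^sup>+\<theta>\<in>{0<..<1}. ennreal (2 * t * Gam (snd x + t * cc \<theta>) (t * cb \<theta>)) \<partial>lborel)"
  proof (rule nn_integral_cong)
    fix \<theta> :: real
    show "(\<integral>\<^sup>+ y. ?f (y, \<theta>) \<partial>lborel) = ennreal (2 * t * Gam (snd x + t * cc \<theta>) (t * cb \<theta>)) * indicator {0<..<1} \<theta>"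
    proof (cases "\<theta> \<in> {0<..<1}")
      case True
      then have \<theta>: "0 < \<theta>" "\<theta> < 1" by auto
      define s1 s2 \<xi> where "s1 = t * ca \<theta>" and "s2 = t * cb \<theta>" and "\<xi> = snd x + t * cc \<theta>"
      have s: "s1 > 0" "s2 > 0" "\<xi> \<ge> 0"
        using \<theta> t x ca_pos[of \<theta>] cb_pos[of \<theta>] cc_nonneg[of \<theta>] by (auto simp: s1_def s2_def \<xi>_def Omega_bar_def)
      have "(\<integral>\<^sup>+ y. ?f (y, \<theta>) \<partial>lborel) = (\<integral>\<^sup>+y\<in>Omega. ennreal (Gam (fst x - fst y) s1 * (t * flux (\<xi> + snd y) s2)) \<partial>lborel)"
        using True by (simp add: s1_def s2_def \<xi>_def p1_def p2_def mult_ac add_ac)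
      also have "\<dots> = (\<integral>\<^sup>+ y. ennreal (Gam (fst x - y) s1) \<partial>lborel) * (\<integral>\<^sup>+z\<in>{0..}. ennreal (t * flux (\<xi> + z) s2) \<partial>lborel)"
        by (rule nn_integral_Omega_Times) (auto simp: Gam_nonneg)
      also have "(\<integral>\<^sup>+ y. ennreal (Gam (fst x - y) s1) \<partial>lborel) = 1"
        by (rule nn_integral_Gam_translate[OF s(1)])
      also have "(\<integral>\<^sup>+z\<in>{0..}. ennreal (t * flux (\<xi> + z) s2) \<partial>lborel) = ennreal t * (\<integral>\<^sup>+z\<in>{0..}. ennreal (flux (\<xi> + z) s2) \<partial>lborel)"
        using t by (subst nn_integral_cmult[symmetric]) (auto simp: ennreal_mult' mult.assoc)
      also have "\<dots> = ennreal (2 * t * Gam \<xi> s2)"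
        unfolding nn_integral_flux[OF s(3,2)] using t by (simp add: ennreal_mult'[symmetric] mult_ac)
      finally show ?thesis using True by (simp add: s2_def \<xi>_def)
    qed simp
  qed
  finally show ?thesis .
qed

lemma nn_integral_layer_boundary:
  fixes x :: "(real^'n) \<times> real"
  assumes x: "x \<in> Omega_bar" and t: "t > 0"
  shows "(\<integral>\<^sup>+ y. ennreal (layer (x - (y, 0)) t) \<partial>lborel) =
     (\<integral>\<^sup>+\<theta>\<in>{0<..<1}. ennreal (t * flux (snd x + t * cc \<theta>) (t * cb \<theta>)) \<partial>lborel)"
proof -
  let ?f = "\<lambda>(y :: real^'n, \<theta>). ennreal (t * (Gam (fst x - y) (t * ca \<theta>) * flux (snd x + t * cc \<theta>) (t * cb \<theta>)))
      * indicator {0<..<1} \<theta>"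
  have "(\<integral>\<^sup>+ y. ennreal (layer (x - (y, 0)) t) \<partial>lborel) = (\<integral>\<^sup>+ y. \<integral>\<^sup>+ \<theta>. ?f (y, \<theta>) \<partial>lborel \<partial>lborel)"
  proof (rule nn_integral_cong)
    fix y :: "real^'n"
    show "ennreal (layer (x - (y, 0)) t) = (\<integral>\<^sup>+ \<theta>. ?f (y, \<theta>) \<partial>lborel)"
      using ennreal_layer[OF diff_refl_in_Omega_bar[OF x, of "(y, 0)"] t] unfolding slab_diff_refl by simp
  qed
  also have "\<dots> = (\<integral>\<^sup>+ \<theta>. \<integral>\<^sup>+ y. ?f (y, \<theta>) \<partial>lborel \<partial>lborel)"
    by (rule lborel_pair.Fubini[symmetric]) (unfold ca_def cb_def cc_def, measurable)
  also have "\<dots> = (\<integral>\<^sup>+\<theta>\<in>{0<..<1}. ennreal (t * flux (snd x + t * cc \<theta>) (t * cb \<theta>)) \<partial>lborel)"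
  proof (rule nn_integral_cong)
    fix \<theta> :: real
    show "(\<integral>\<^sup>+ y. ?f (y, \<theta>) \<partial>lborel) = ennreal (t * flux (snd x + t * cc \<theta>) (t * cb \<theta>)) * indicator {0<..<1} \<theta>"
    proof (cases "\<theta> \<in> {0<..<1}")
      case True
      then have \<theta>: "0 < \<theta>" "\<theta> < 1" by auto
      define s1 F where "s1 = t * ca \<theta>" and "F = t * flux (snd x + t * cc \<theta>) (t * cb \<theta>)"
      have s: "s1 > 0" using \<theta> t ca_pos[of \<theta>] by (auto simp: s1_def)
      have "(\<integral>\<^sup>+ y. ?f (y, \<theta>) \<partial>lborel) = (\<integral>\<^sup>+ y. ennreal F * ennreal (Gam (fst x - y) s1) \<partial>lborel)"
        using True by (intro nn_integral_cong) (simp add: s1_def F_def ennreal_mult'[OF Gam_nonneg, symmetric] mult_ac)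
      also have "\<dots> = ennreal F * (\<integral>\<^sup>+ y. ennreal (Gam (fst x - y) s1) \<partial>lborel)"
        by (rule nn_integral_cmult) auto
      finally show ?thesis using True by (simp add: nn_integral_Gam_translate[OF s] F_def)
    qed simp
  qed
  finally show ?thesis .
qed

text \<open>The integrand is the derivative of u, the error function of the shifted normal variable
  over twice the root of the normal diffusion time. At \<theta> = 1 the numerator is at least
  t/delta while the denominator tends to 0, so u tends to 1; at \<theta> = 0 it is the mass of
  \<open>G0\<close>.\<close>

lemma has_integral_layer_total:
  assumes x: "x \<in> Omega_bar" and t: "t > 0"
  shows "((\<lambda>\<theta>. (1 / delta) * (2 * t * Gam (snd x + t * cc \<theta>) (t * cb \<theta>))
      + (1 / eps) * (t * flux (snd x + t * cc \<theta>) (t * cb \<theta>))) has_integral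
    1 - erf (snd x / (2 * sqrt (t / eps)))) {0<..<1}"
proof -
  \<comment> \<open>The value at \<theta> = 1 is prescribed: division by zero would give
    \<open>erf 0\<close>, hence 0 instead of the limit 1.\<close>
  define u where "u \<theta> = (if \<theta> = 1 then 1 else erf ((snd x + t * cc \<theta>) / (2 * sqrt (t * cb \<theta>))))" for \<theta>
  define u' where "u' \<theta> = (1 / delta) * (2 * t * Gam (snd x + t * cc \<theta>) (t * cb \<theta>))
      + (1 / eps) * (t * flux (snd x + t * cc \<theta>) (t * cb \<theta>))" for \<theta>
  have deriv: "(u has_real_derivative u' \<theta>) (at \<theta>)" if "0 \<le> \<theta>" "\<theta> < 1" for \<theta>
  proof -
    have 1: "((\<lambda>\<theta>. snd x + t * cc \<theta>) has_real_derivative t / delta) (at \<theta>)"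
      unfolding cc_def using delta by (auto intro!: derivative_eq_intros)
    have 2: "((\<lambda>\<theta>. t * cb \<theta>) has_real_derivative - t / eps) (at \<theta>)"
      unfolding cb_def using eps by (auto intro!: derivative_eq_intros)
    have "((\<lambda>\<theta>. erf ((snd x + t * cc \<theta>) / (2 * sqrt (t * cb \<theta>)))) has_real_derivative u' \<theta>) (at \<theta>)"
      by (rule DERIV_cong[OF erf_scaled_has_real_derivative[OF 1 2]])
         (use that t cb_pos[of \<theta>] in \<open>auto simp: u'_def\<close>)
    then show ?thesis
      by (rule has_field_derivative_transform_within_open[of _ _ _ "{..<1}"]) (use that in \<open>auto simp: u_def\<close>)
  qed
  have cont: "continuous_on {0..1} u"
    unfolding continuous_on_eq_continuous_within
  proof
    fix \<theta> :: real assume \<theta>: "\<theta> \<in> {0..1}"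
    show "continuous (at \<theta> within {0..1}) u"
    proof (cases "\<theta> = 1")
      case False
      then show ?thesis
        using \<theta> DERIV_isCont[OF deriv[of \<theta>]] by (auto intro: continuous_at_imp_continuous_at_within)
    next
      case True
      have ev: "eventually (\<lambda>\<theta>::real. \<theta> < 1) (at 1 within {0..1})"
        unfolding eventually_at by (auto intro: exI[of _ 1])
      have "((\<lambda>\<theta>. 2 * sqrt (t * cb \<theta>)) \<longlongrightarrow> 2 * sqrt (t * cb 1)) (at 1 within {0..1})"
        unfolding cb_def using eps by (intro tendsto_intros) auto
      then have "((\<lambda>\<theta>. 2 * sqrt (t * cb \<theta>)) \<longlongrightarrow> 0) (at 1 within {0..1})" by (simp add: cb_def)
      then have inv: "filterlim (\<lambda>\<theta>. inverse (2 * sqrt (t * cb \<theta>))) at_top (at 1 within {0..1})"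
      proof (rule filterlim_inverse_at_top)
        show "\<forall>\<^sub>F \<theta> in at 1 within {0..1}. 0 < 2 * sqrt (t * cb \<theta>)"
          using ev by (rule eventually_mono) (use t cb_pos in auto)
      qed
      have num: "((\<lambda>\<theta>. snd x + t * cc \<theta>) \<longlongrightarrow> snd x + t * cc 1) (at 1 within {0..1})"
        unfolding cc_def using delta by (intro tendsto_intros) auto
      have num0: "0 < snd x + t * cc 1"
        using x t delta by (simp add: cc_def Omega_bar_def add_nonneg_pos)
      from filterlim_compose[OF erf_at_top filterlim_tendsto_pos_mult_at_top[OF num num0 inv]]
      have "((\<lambda>\<theta>. erf ((snd x + t * cc \<theta>) / (2 * sqrt (t * cb \<theta>)))) \<longlongrightarrow> 1) (at 1 within {0..1})"
        unfolding divide_inverse .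
      then have "(u \<longlongrightarrow> 1) (at 1 within {0..1})"
      proof (rule Lim_transform_eventually)
        show "\<forall>\<^sub>F \<theta> in at 1 within {0..1}. erf ((snd x + t * cc \<theta>) / (2 * sqrt (t * cb \<theta>))) = u \<theta>"
          using ev by (rule eventually_mono) (simp add: u_def)
      qed
      then show ?thesis by (simp add: continuous_within True u_def)
    qed
  qed
  have "(u' has_integral u 1 - u 0) {0..1}"
    using cont deriv
    by (intro fundamental_theorem_of_calculus_interior) (auto simp: has_real_derivative_iff_has_vector_derivative)
  then show ?thesis
    by (simp add: has_integral_Icc_iff_Ioo u_def u'_def[abs_def] cb_def cc_def)
qed

lemma layer_integrable_Omega:
  assumes "x \<in> Omega_bar" "t > 0"
  shows "(\<lambda>y. layer (x - refl y) t) integrable_on Omega"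
proof -
  have "dominated_family Omega Omega_bar (\<lambda>y x t. layer (x - refl y) t * 1)"
    by (rule dominated_family_kernel[where g = "\<lambda>x y t. layer (x - refl y) t" and m = "\<lambda>y. y" and M = 1])
       (use kernel_bounded_layer open_Omega Omega_subset in auto)
  from dominated_family_integrable[OF this assms] show ?thesis by simp
qed

lemma layer_integrable_boundary:
  assumes "x \<in> Omega_bar" "t > 0"
  shows "(\<lambda>y. layer (x - (y, 0)) t) integrable_on UNIV"
proof -
  have "dominated_family UNIV Omega_bar (\<lambda>y x t. layer (x - refl (y, 0)) t * 1)"
    by (rule dominated_family_kernel[where g = "\<lambda>x y t. layer (x - refl y) t" and m = "\<lambda>y. (y, 0)" and M = 1])
       (use kernel_bounded_layer in \<open>auto simp: norm_Pair intro!: continuous_intros\<close>)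
  from dominated_family_integrable[OF this assms] show ?thesis by simp
qed

text \<open>The second bound is the integral over (0,1) of 2t / sqrt(t * cb \<theta>), whose
  singularity at \<theta> = 1 is integrable. It shows that interior data do not influence the
  boundary values as t tends to 0, so that \<open>\<psi>\<close> may be prescribed independently of
  \<open>\<phi>\<close>.\<close>

lemma layer_mass:
  assumes x: "x \<in> Omega_bar" and t: "t > 0"
  shows layer_total_mass: "(1 / delta) * integral Omega (\<lambda>y. layer (x - refl y) t)
      + (1 / eps) * integral UNIV (\<lambda>y. layer (x - (y, 0)) t) = 1 - erf (snd x / (2 * sqrt (t / eps)))" (is ?mass)
    and layer_interior_mass_le: "integral Omega (\<lambda>y. layer (x - refl y) t) \<le> 4 * sqrt (eps * t)"
proof -
  let ?B = "integral Omega (\<lambda>y. layer (x - refl y) t)" and ?C = "integral UNIV (\<lambda>y. layer (x - (y, 0)) t)"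
  have nonneg: "0 \<le> layer (x - refl y) t" if "y \<in> Omega_bar" for y
    by (intro layer_nonneg diff_refl_in_Omega_bar x that t)
  have nonneg': "0 \<le> layer (x - (y, 0)) t" for y using nonneg[of "(y, 0)"] by simp
  have B: "0 \<le> ?B" using nonneg Omega_subset by (intro integral_nonneg layer_integrable_Omega x t) auto
  have C: "0 \<le> ?C" using nonneg' by (intro integral_nonneg layer_integrable_boundary x t) auto
  have nB: "(\<integral>\<^sup>+\<theta>\<in>{0<..<1}. ennreal (2 * t * Gam (snd x + t * cc \<theta>) (t * cb \<theta>)) \<partial>lborel) = ennreal ?B"
    unfolding nn_integral_layer_Omega[OF x t, symmetric]
    using nonneg Omega_subset
    by (intro nn_integral_has_integral_lebesgue' integrable_integral layer_integrable_Omega x t) auto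
  have nC: "(\<integral>\<^sup>+\<theta>\<in>{0<..<1}. ennreal (t * flux (snd x + t * cc \<theta>) (t * cb \<theta>)) \<partial>lborel) = ennreal ?C"
    unfolding nn_integral_layer_boundary[OF x t, symmetric]
    using nn_integral_has_integral_lebesgue'[OF _ integrable_integral[OF layer_integrable_boundary[OF x t]]] nonneg'
    by simp
  have pos: "0 \<le> 2 * t * Gam (snd x + t * cc \<theta>) (t * cb \<theta>)" "0 \<le> t * flux (snd x + t * cc \<theta>) (t * cb \<theta>)"
    if "\<theta> \<in> {0<..<1}" for \<theta>
    using that x t cb_pos[of \<theta>] cc_nonneg[of \<theta>]
    by (auto intro!: mult_nonneg_nonneg Gam_nonneg flux_nonneg simp: Omega_bar_def)
  have iB: "((\<lambda>\<theta>. 2 * t * Gam (snd x + t * cc \<theta>) (t * cb \<theta>)) has_integral ?B) {0<..<1}"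
    by (rule nn_integral_set_has_integral[OF _ _ pos(1) nB B]) (simp_all add: cb_def cc_def)
  have "((\<lambda>\<theta>. t * flux (snd x + t * cc \<theta>) (t * cb \<theta>)) has_integral ?C) {0<..<1}"
    by (rule nn_integral_set_has_integral[OF _ _ pos(2) nC C]) (simp_all add: cb_def cc_def)
  then have "((\<lambda>\<theta>. (1 / delta) * (2 * t * Gam (snd x + t * cc \<theta>) (t * cb \<theta>))
      + (1 / eps) * (t * flux (snd x + t * cc \<theta>) (t * cb \<theta>))) has_integral (1 / delta) * ?B + (1 / eps) * ?C) {0<..<1}"
    by (intro has_integral_add has_integral_mult_right iB)
  from has_integral_unique[OF this has_integral_layer_total[OF x t]]
  show mass: ?mass .
  have "((\<lambda>\<theta>. - (4 * sqrt (eps * t)) * sqrt (1 - \<theta>)) has_real_derivative 2 * t / sqrt (t * cb \<theta>)) (at \<theta>)"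
    if "\<theta> \<in> {0<..<1}" for \<theta>
  proof -
    have c: "sqrt (t * cb \<theta>) = sqrt (1 - \<theta>) * sqrt (eps * t) / eps"
    proof -
      have "t * cb \<theta> = (1 - \<theta>) * (eps * t) / eps\<^sup>2"
        using eps by (simp add: cb_def field_simps power2_eq_square)
      also have "sqrt \<dots> = sqrt (1 - \<theta>) * sqrt (eps * t) / eps"
        unfolding real_sqrt_divide real_sqrt_mult[of "1 - \<theta>"] real_sqrt_abs using eps by simp
      finally show ?thesis .
    qed
    have "((\<lambda>\<theta>. sqrt (1 - \<theta>)) has_real_derivative - 1 / (2 * sqrt (1 - \<theta>))) (at \<theta>)"
      using that by (auto intro!: derivative_eq_intros simp: field_simps)
    from DERIV_cmult[OF this, of "- (4 * sqrt (eps * t))"]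
    show ?thesis
    proof (rule DERIV_cong)
      define A B where "A = sqrt (eps * t)" and "B = sqrt (1 - \<theta>)"
      have q: "A * A = eps * t" "A > 0" "B > 0" using eps t that by (auto simp: A_def B_def)
      have "2 * t / (B * A / eps) = 2 * (eps * t) / (B * A)" using eps q(2,3) by (simp add: divide_simps)
      also have "\<dots> = 2 * A / B" unfolding q(1)[symmetric] using q(2,3) by simp
      finally show "- (4 * sqrt (eps * t)) * (- 1 / (2 * sqrt (1 - \<theta>))) = 2 * t / sqrt (t * cb \<theta>)"
        unfolding c A_def[symmetric] B_def[symmetric] by simp
    qed
  qed
  then have "((\<lambda>\<theta>. 2 * t / sqrt (t * cb \<theta>)) has_integral
      - (4 * sqrt (eps * t)) * sqrt (1 - 1) - - (4 * sqrt (eps * t)) * sqrt (1 - 0)) {0..1}"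
    by (intro fundamental_theorem_of_calculus_interior)
       (auto simp: has_real_derivative_iff_has_vector_derivative intro!: continuous_intros)
  then have bound: "((\<lambda>\<theta>. 2 * t / sqrt (t * cb \<theta>)) has_integral 4 * sqrt (eps * t)) {0<..<1}"
    by (simp add: has_integral_Icc_iff_Ioo)
  show "?B \<le> 4 * sqrt (eps * t)"
  proof (rule has_integral_le[OF iB bound])
    fix \<theta> :: real assume "\<theta> \<in> {0<..<1}"
    then have s: "t * cb \<theta> > 0" using t cb_pos by simp
    have ex: "exp (- ((snd x + t * cc \<theta>) / (2 * sqrt (t * cb \<theta>)))\<^sup>2) \<le> 1" by simp
    have "1 \<le> sqrt pi" using pi_gt3 by simp
    then have "1 \<le> 2 * sqrt pi" by linarith
    then have sq: "sqrt (t * cb \<theta>) \<le> 2 * sqrt pi * sqrt (t * cb \<theta>)"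
      using s by (simp add: mult_le_cancel_right1)
    have "Gam (snd x + t * cc \<theta>) (t * cb \<theta>) \<le> 1 / sqrt (t * cb \<theta>)"
      unfolding Gam_real_eq[OF s] by (rule frac_le[OF zero_le_one ex _ sq]) (use s in simp)
    then have "2 * t * Gam (snd x + t * cc \<theta>) (t * cb \<theta>) \<le> 2 * t * (1 / sqrt (t * cb \<theta>))"
      using t by (intro mult_left_mono) auto
    then show "2 * t * Gam (snd x + t * cc \<theta>) (t * cb \<theta>) \<le> 2 * t / sqrt (t * cb \<theta>)" by simp
  qed
qed

end

text \<open>The exponent of the kernel at time s is twice that at time 2s: one half forms the
  doubled kernel and the other half is the gain. The prefactors differ by 2^(d/2) in dimension d,
  rounded up to 2^d.\<close>

lemma Gam_le_double:
  fixes x :: "'a::euclidean_space"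
  assumes s: "s > 0"
  shows "Gam x s \<le> 2 ^ DIM('a) * exp (- (norm x)\<^sup>2 / (8 * s)) * Gam x (2 * s)"
proof -
  have "(4 * pi * s) powr (- real DIM('a) / 2) = 2 powr (real DIM('a) / 2) * (4 * pi * (2 * s)) powr (- real DIM('a) / 2)"
  proof -
    have "(4 * pi * (2 * s)) powr (- real DIM('a) / 2) = 2 powr (- real DIM('a) / 2) * (4 * pi * s) powr (- real DIM('a) / 2)"
      using s powr_mult[of 2 "4 * pi * s" "- real DIM('a) / 2"] by (simp add: mult_ac)
    then show ?thesis by (simp add: powr_minus field_simps)
  qed
  also have "\<dots> \<le> 2 ^ DIM('a) * (4 * pi * (2 * s)) powr (- real DIM('a) / 2)"
  proof (rule mult_right_mono)
    have "(2::real) powr (real DIM('a) / 2) \<le> 2 powr real DIM('a)" by (rule powr_mono) auto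
    then show "(2::real) powr (real DIM('a) / 2) \<le> 2 ^ DIM('a)" by (simp add: powr_realpow)
  qed simp
  finally have pre: "(4 * pi * s) powr (- real DIM('a) / 2) \<le> 2 ^ DIM('a) * (4 * pi * (2 * s)) powr (- real DIM('a) / 2)" .
  have "- (norm x)\<^sup>2 / (4 * s) = - (norm x)\<^sup>2 / (8 * s) + - (norm x)\<^sup>2 / (4 * (2 * s))" by simp
  then have ex: "exp (- (norm x)\<^sup>2 / (4 * s)) = exp (- (norm x)\<^sup>2 / (8 * s)) * exp (- (norm x)\<^sup>2 / (4 * (2 * s)))"
    by (simp only: exp_add)
  have "Gam x s \<le> (2 ^ DIM('a) * (4 * pi * (2 * s)) powr (- real DIM('a) / 2)) *
      (exp (- (norm x)\<^sup>2 / (8 * s)) * exp (- (norm x)\<^sup>2 / (4 * (2 * s))))"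
    unfolding Gam_def ex by (rule mult_right_mono[OF pre]) simp
  then show ?thesis unfolding Gam_def by (simp only: mult_ac)
qed

text \<open>The constant 4 has one factor 2 from the kernel in dimension one and another from 1/s =
  2 * (1/(2s)).\<close>

lemma flux_le_double:
  assumes s: "s > 0" and \<xi>: "\<xi> \<ge> 0"
  shows "flux \<xi> s \<le> 4 * exp (- \<xi>\<^sup>2 / (8 * s)) * flux \<xi> (2 * s)"
proof -
  have "\<xi> * (1 / s) * Gam \<xi> s \<le> \<xi> * (1 / s) * (2 * exp (- \<xi>\<^sup>2 / (8 * s)) * Gam \<xi> (2 * s))"
    using Gam_le_double[OF s, of \<xi>] s \<xi> by (intro mult_left_mono) auto
  also have "\<dots> = 4 * exp (- \<xi>\<^sup>2 / (8 * s)) * flux \<xi> (2 * s)"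
    using s by (simp add: flux_def)
  finally show ?thesis by (simp add: flux_def)
qed

text \<open>\<open>G0\<close> is a tangential Gaussian times a reflected normal kernel. The mass 1 -
  erf that it loses through the boundary is exactly what \<open>layer_total_mass\<close>
  returns.\<close>

lemma has_integral_G0:
  fixes x :: "(real^'n) \<times> real"
  assumes x: "x \<in> Omega_bar" and s: "s > 0"
  shows "((\<lambda>y. G0 x y s) has_integral erf (snd x / (2 * sqrt s))) Omega"
proof (rule nn_integral_set_has_integral)
  have "continuous_on UNIV (\<lambda>y. G0 x y s)"
    unfolding G0_def using s by (intro continuous_intros) auto
  then show "(\<lambda>y. G0 x y s) \<in> borel_measurable borel" by (rule borel_measurable_continuous_onI)
  show "Omega \<in> sets (borel :: ((real^'n) \<times> real) measure)" by (rule borel_open[OF open_Omega])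
  show "0 \<le> G0 x y s" if "y \<in> Omega" for y
    using G0_nonneg[OF x _ s] that Omega_subset by blast
  have "0 \<le> snd x / (2 * sqrt s)" using x s by (simp add: Omega_bar_def)
  from monoD[OF erf_mono this] show "0 \<le> erf (snd x / (2 * sqrt s))" by simp
  have eq: "G0 x y s = Gam (fst x - fst y) s * (Gam (snd x - snd y) s - Gam (snd x + snd y) s)" for y
    by (cases x; cases y) (simp add: G0_def refl_def Gam_Pair right_diff_distrib)
  have "(\<integral>\<^sup>+y\<in>Omega. ennreal (G0 x y s) \<partial>lborel) =
     (\<integral>\<^sup>+ y. ennreal (Gam (fst x - y) s) \<partial>lborel) * (\<integral>\<^sup>+z\<in>{0..}. ennreal (Gam (snd x - z) s - Gam (snd x + z) s) \<partial>lborel)"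
    unfolding eq by (rule nn_integral_Omega_Times) (auto simp: Gam_nonneg)
  also have "\<dots> = ennreal (erf (snd x / (2 * sqrt s)))"
    using x by (simp add: nn_integral_Gam_translate[OF s] nn_integral_Gam_reflected[OF _ s] Omega_bar_def)
  finally show "(\<integral>\<^sup>+y\<in>Omega. ennreal (G0 x y s) \<partial>lborel) = ennreal (erf (snd x / (2 * sqrt s)))" .
qed

lemma Gam_translate_mass_le:
  fixes x :: "(real^'n) \<times> real"
  assumes s: "s > 0"
  shows "(\<lambda>y. Gam (x - y) s) integrable_on Omega" "integral Omega (\<lambda>y. Gam (x - y) s) \<le> 1"
proof -
  have 1: "((\<lambda>y. Gam (x - y) s) has_integral 1) UNIV"
    by (rule nn_integral_has_integral) (auto simp: Gam_nonneg nn_integral_Gam_translate[OF s])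
  show int: "(\<lambda>y. Gam (x - y) s) integrable_on Omega"
    by (rule nonneg_integrable_on_open_subset[OF has_integral_integrable[OF 1] _ subset_UNIV open_Omega])
       (rule Gam_nonneg)
  have "integral Omega (\<lambda>y. Gam (x - y) s) \<le> integral UNIV (\<lambda>y. Gam (x - y) s)"
    using 1 by (intro integral_subset_le int) (auto simp: Gam_nonneg)
  then show "integral Omega (\<lambda>y. Gam (x - y) s) \<le> 1" using integral_unique[OF 1] by simp
qed

section \<open>Mass of the full kernel and its concentration\<close>

context dynamic_bc
begin

lemma erf_nonneg_at: "x \<in> Omega_bar \<Longrightarrow> t > 0 \<Longrightarrow> 0 \<le> erf (snd x / (2 * sqrt (t / eps)))"
  using monoD[OF erf_mono, of 0 "snd x / (2 * sqrt (t / eps))"] eps by (simp add: Omega_bar_def)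

lemma layer_mass_le:
  assumes x: "x \<in> Omega_bar" and t: "t > 0"
  shows "(1 / delta) * integral Omega (\<lambda>y. layer (x - refl y) t) \<le> 1"
    "(1 / eps) * integral UNIV (\<lambda>y. layer (x - (y, 0)) t) \<le> 1"
proof -
  have "0 \<le> layer (x - refl y) t" if "y \<in> Omega_bar" for y
    by (intro layer_nonneg diff_refl_in_Omega_bar x that t)
  from this this[of "(_, 0)"] have
    "0 \<le> integral Omega (\<lambda>y. layer (x - refl y) t)" "0 \<le> integral UNIV (\<lambda>y. layer (x - (y, 0)) t)"
    using Omega_subset by (auto intro!: integral_nonneg layer_integrable_Omega layer_integrable_boundary x t)
  then have "0 \<le> (1 / delta) * integral Omega (\<lambda>y. layer (x - refl y) t)"
    "0 \<le> (1 / eps) * integral UNIV (\<lambda>y. layer (x - (y, 0)) t)"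
    using eps delta by auto
  then show "(1 / delta) * integral Omega (\<lambda>y. layer (x - refl y) t) \<le> 1"
    "(1 / eps) * integral UNIV (\<lambda>y. layer (x - (y, 0)) t) \<le> 1"
    using layer_total_mass[OF x t] erf_nonneg_at[OF x t] by linarith+
qed

lemma Gker_times_integrable:
  fixes m :: "'b::euclidean_space \<Rightarrow> (real^'n) \<times> real"
  assumes "open S" "\<And>y. y \<in> S \<Longrightarrow> m y \<in> Omega_bar" "\<And>y. norm (m y) = norm y" "continuous_on S m"
    and "continuous_on S f" "\<And>y. y \<in> S \<Longrightarrow> \<bar>f y\<bar> \<le> M" and x: "x \<in> Omega_bar" "t > 0"
  shows "(\<lambda>y. Gker eps delta k x (m y) t * f y) integrable_on S"
    "(\<lambda>y. layer (x - refl (m y)) t * f y) integrable_on S"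
  using dominated_family_integrable[OF dominated_family_kernel[OF kernel_bounded_Gker assms(1-6)] x]
    dominated_family_integrable[OF dominated_family_kernel[OF kernel_bounded_layer assms(1-6)] x]
  by simp_all

lemma Gker_Omega_integrable:
  assumes f: "continuous_on Omega f" "\<And>y. y \<in> Omega \<Longrightarrow> \<bar>f y\<bar> \<le> M" and x: "x \<in> Omega_bar" "t > 0"
  shows "(\<lambda>y. Gker eps delta k x y t * f y) integrable_on Omega"
    "(\<lambda>y. layer (x - refl y) t * f y) integrable_on Omega"
proof -
  have "\<And>y. y \<in> Omega \<Longrightarrow> y \<in> Omega_bar" using Omega_subset by auto
  from Gker_times_integrable[OF open_Omega this _ continuous_on_id f x]
  show "(\<lambda>y. Gker eps delta k x y t * f y) integrable_on Omega"
    "(\<lambda>y. layer (x - refl y) t * f y) integrable_on Omega" by auto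
qed

lemma Gker_boundary_integrable:
  fixes f :: "real^'n \<Rightarrow> real"
  assumes f: "continuous_on UNIV f" "\<And>y. \<bar>f y\<bar> \<le> M" and x: "x \<in> Omega_bar" "t > 0"
  shows "(\<lambda>y. Gker eps delta k x (y, 0) t * f y) integrable_on UNIV"
    "(\<lambda>y. layer (x - (y, 0)) t * f y) integrable_on UNIV"
proof -
  have "continuous_on UNIV (\<lambda>y :: real^'n. (y, 0 :: real))" by (intro continuous_intros)
  from Gker_times_integrable[OF open_UNIV _ _ this f x]
  show "(\<lambda>y. Gker eps delta k x (y, 0) t * f y) integrable_on UNIV"
    "(\<lambda>y. layer (x - (y, 0)) t * f y) integrable_on UNIV"
    by (auto simp: norm_Pair)
qed

lemma Gker_eq_layer: "t > 0 \<Longrightarrow> Gker eps delta k x y t = G0 x y (t / eps) + (1 / delta) * layer (x - refl y) t"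
  by (simp add: Gker_def Hker_eq_layer)

lemma Gker_boundary_eq: "t > 0 \<Longrightarrow> Gker eps delta k x (y, 0) t = (1 / delta) * layer (x - (y, 0)) t"
  by (simp add: Gker_eq_layer G0_def)

lemma Gker_integrable:
  assumes x: "x \<in> Omega_bar" and t: "t > 0"
  shows "(\<lambda>y. Gker eps delta k x y t) integrable_on Omega"
    "(\<lambda>y. Gker eps delta k x (y, 0) t) integrable_on UNIV"
  using Gker_Omega_integrable(1)[of "\<lambda>_. 1" 1, OF _ _ x t] Gker_boundary_integrable(1)[of "\<lambda>_. 1" 1, OF _ _ x t]
  by auto

lemma Gker_Omega_mass:
  assumes x: "x \<in> Omega_bar" and t: "t > 0"
  shows "integral Omega (\<lambda>y. Gker eps delta k x y t) =
    erf (snd x / (2 * sqrt (t / eps))) + (1 / delta) * integral Omega (\<lambda>y. layer (x - refl y) t)"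
proof -
  have "t / eps > 0" using t eps by simp
  from has_integral_add[OF has_integral_G0[OF x this]
      has_integral_mult_right[OF integrable_integral[OF layer_integrable_Omega[OF x t]], of "1 / delta"]]
  show ?thesis by (simp add: Gker_eq_layer[OF t] integral_unique)
qed

lemma Gker_mass:
  assumes x: "x \<in> Omega_bar" and t: "t > 0"
  shows "integral Omega (\<lambda>y. Gker eps delta k x y t) + delta / eps * integral UNIV (\<lambda>y. Gker eps delta k x (y, 0) t) = 1"
proof -
  have "integral UNIV (\<lambda>y. Gker eps delta k x (y, 0) t) = (1 / delta) * integral UNIV (\<lambda>y. layer (x - (y, 0)) t)"
    by (simp add: Gker_boundary_eq[OF t])
  then have "delta / eps * integral UNIV (\<lambda>y. Gker eps delta k x (y, 0) t) = (1 / eps) * integral UNIV (\<lambda>y. layer (x - (y, 0)) t)"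
    using delta by simp
  then show ?thesis using layer_total_mass[OF x t] unfolding Gker_Omega_mass[OF x t] by linarith
qed

lemma Gker_nonneg: "x \<in> Omega_bar \<Longrightarrow> y \<in> Omega_bar \<Longrightarrow> t > 0 \<Longrightarrow> 0 \<le> Gker eps delta k x y t"
  by (rule less_imp_le[OF Gker_pos])

lemma Gker_mass_nonneg:
  assumes x: "x \<in> Omega_bar" and t: "t > 0"
  shows "0 \<le> integral Omega (\<lambda>y. Gker eps delta k x y t)" "0 \<le> integral UNIV (\<lambda>y. Gker eps delta k x (y, 0) t)"
  using Omega_subset by (auto intro!: integral_nonneg Gker_integrable x t Gker_nonneg)

lemma doubled_time: "dynamic_bc (eps / 2) delta (2 * k)"
  using eps delta k by unfold_locales auto

text \<open>Doubling both diffusion times costs a constant and gains a Gaussian factor; since the doubled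
  kernel belongs to the parameters (eps/2, delta, 2k), its total mass is already known to be at most 1.\<close>

lemma layer_le_doubled:
  fixes w :: "(real^'n) \<times> real"
  assumes w: "w \<in> Omega_bar" and t: "t > 0"
  shows "layer w t \<le> 2 ^ (CARD('n) + 2) * exp (- (norm w)\<^sup>2 / (8 * t * (1 / eps + k / delta))) * dynamic_bc.layer (eps / 2) delta (2 * k) w t"
proof -
  interpret dbl: dynamic_bc "eps / 2" delta "2 * k" by (rule doubled_time)
  define A where "A = 1 / eps + k / delta"
  have A: "A > 0" using eps delta k by (simp add: A_def add_pos_nonneg)
  \<comment> \<open>The function \<open>cc\<close> involves delta only, so both kernels have the
    same normal shift and exactly the two diffusion times double.\<close>
  have coeffs: "dbl.ca \<theta> = 2 * ca \<theta>" "dbl.cb \<theta> = 2 * cb \<theta>" for \<theta>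
    unfolding dbl.ca_def ca_def dbl.cb_def cb_def
    using eps delta by (simp_all add: field_simps)
  let ?K = "2 ^ (CARD('n) + 2) * exp (- (norm w)\<^sup>2 / (8 * t * A))"
  have "slab (ca \<theta>) (cb \<theta>) (cc \<theta>) w t \<le> ?K * slab (dbl.ca \<theta>) (dbl.cb \<theta>) (dbl.cc \<theta>) w t"
    if \<theta>: "\<theta> \<in> {0<..<1}" for \<theta>
  proof -
    define s1 s2 \<xi> where "s1 = t * ca \<theta>" and "s2 = t * cb \<theta>" and "\<xi> = snd w + t * cc \<theta>"
    have s: "s1 > 0" "s2 > 0" "s1 \<le> t * A" "s2 \<le> t * A" and \<xi>: "0 \<le> snd w" "snd w \<le> \<xi>"
      using \<theta> t w ca_pos[of \<theta>] cb_pos[of \<theta>] cb_le_ca[of \<theta>] ca_le[of \<theta>] cc_nonneg[of \<theta>]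
      by (auto simp: s1_def s2_def \<xi>_def A_def Omega_bar_def)
    have "(norm (fst w))\<^sup>2 / (8 * (t * A)) \<le> (norm (fst w))\<^sup>2 / (8 * s1)" "\<xi>\<^sup>2 / (8 * (t * A)) \<le> \<xi>\<^sup>2 / (8 * s2)"
      using s t A by (auto intro!: divide_left_mono)
    moreover have "(snd w)\<^sup>2 / (8 * (t * A)) \<le> \<xi>\<^sup>2 / (8 * (t * A))"
      using \<xi> t A by (intro divide_right_mono power_mono) auto
    moreover have "(norm w)\<^sup>2 / (8 * (t * A)) = (norm (fst w))\<^sup>2 / (8 * (t * A)) + (snd w)\<^sup>2 / (8 * (t * A))"
      by (simp add: norm_prod_def add_divide_distrib)
    ultimately have "- (norm (fst w))\<^sup>2 / (8 * s1) + - \<xi>\<^sup>2 / (8 * s2) \<le> - (norm w)\<^sup>2 / (8 * (t * A))"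
      unfolding minus_divide_left[symmetric] by linarith
    then have ex: "exp (- (norm (fst w))\<^sup>2 / (8 * s1)) * exp (- \<xi>\<^sup>2 / (8 * s2)) \<le> exp (- (norm w)\<^sup>2 / (8 * t * A))"
      by (simp add: mult.assoc flip: exp_add)
    have "Gam (fst w) s1 * flux \<xi> s2 \<le>
       (2 ^ CARD('n) * exp (- (norm (fst w))\<^sup>2 / (8 * s1)) * Gam (fst w) (2 * s1)) * (4 * exp (- \<xi>\<^sup>2 / (8 * s2)) * flux \<xi> (2 * s2))"
      using Gam_le_double[OF s(1), of "fst w"] flux_le_double[OF s(2), of \<xi>] s \<xi>
      by (intro mult_mono) (auto simp: Gam_nonneg flux_nonneg)
    also have "\<dots> = (2 ^ (CARD('n) + 2) * (exp (- (norm (fst w))\<^sup>2 / (8 * s1)) * exp (- \<xi>\<^sup>2 / (8 * s2)))) * (Gam (fst w) (2 * s1) * flux \<xi> (2 * s2))"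
      by (simp add: power_add mult_ac)
    also have "\<dots> \<le> ?K * (Gam (fst w) (2 * s1) * flux \<xi> (2 * s2))"
      using s \<xi> by (intro mult_right_mono mult_left_mono ex) (auto simp: Gam_nonneg flux_nonneg)
    finally have "t * (Gam (fst w) s1 * flux \<xi> s2) \<le> t * (?K * (Gam (fst w) (2 * s1) * flux \<xi> (2 * s2)))"
      using t by (intro mult_left_mono) auto
    moreover have "slab (ca \<theta>) (cb \<theta>) (cc \<theta>) w t = t * (Gam (fst w) s1 * flux \<xi> s2)"
      by (simp only: slab_def s1_def s2_def \<xi>_def)
    moreover have "slab (dbl.ca \<theta>) (dbl.cb \<theta>) (dbl.cc \<theta>) w t = t * (Gam (fst w) (2 * s1) * flux \<xi> (2 * s2))"
      by (simp only: slab_def coeffs s1_def s2_def \<xi>_def mult.left_commute[of t 2])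
    ultimately show ?thesis by (simp only: mult.left_commute[of t ?K])
  qed
  then have "integral {0<..<1} (\<lambda>\<theta>. slab (ca \<theta>) (cb \<theta>) (cc \<theta>) w t) \<le>
     integral {0<..<1} (\<lambda>\<theta>. ?K * slab (dbl.ca \<theta>) (dbl.cb \<theta>) (dbl.cc \<theta>) w t)"
    by (intro integral_le integrable_on_mult_right slab_integrable dbl.slab_integrable w t)
  then show ?thesis by (simp add: layer_def dbl.layer_def A_def)
qed

text \<open>The crude estimate exp(-y) \<le> 1/y suffices: a factor linear in t already removes, as
  t tends to 0, all mass at distance at least r.\<close>

lemma gaussian_tail_factor:
  assumes t: "t > 0" and r: "r > 0" "r \<le> \<rho>"
  shows "exp (- \<rho>\<^sup>2 / (8 * t * (1 / eps + k / delta))) \<le> 8 * (1 / eps + k / delta) * t / r\<^sup>2"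
proof -
  define A where "A = 1 / eps + k / delta"
  have A: "A > 0" using eps delta k by (simp add: A_def add_pos_nonneg)
  define y where "y = r\<^sup>2 / (8 * t * A)"
  have y: "y > 0" using t r A by (simp add: y_def)
  have "r\<^sup>2 \<le> \<rho>\<^sup>2" using r by (intro power_mono) auto
  then have "- \<rho>\<^sup>2 / (8 * t * A) \<le> - y" using t A by (simp add: y_def divide_right_mono)
  then have "exp (- \<rho>\<^sup>2 / (8 * t * A)) \<le> exp (- y)" by simp
  also have "\<dots> \<le> 1 / y"
  proof -
    have "y \<le> exp y" using exp_ge_add_one_self[of y] by linarith
    then show ?thesis using y frac_le[of 1 1 y "exp y"] by (simp add: exp_minus inverse_eq_divide)
  qed
  also have "\<dots> = 8 * A * t / r\<^sup>2" by (simp add: y_def)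
  finally show ?thesis by (simp add: A_def)
qed

text \<open>A majorant of the doubled kernel: the negative reflected Gaussian is dropped. Each
  summand has mass at most 1 over \<open>Omega\<close>.\<close>

definition tail :: "(real^'n) \<times> real \<Rightarrow> (real^'n) \<times> real \<Rightarrow> real \<Rightarrow> real" where
  "tail x y t = Gam (x - y) (2 * (t / eps)) + (1 / delta) * dynamic_bc.layer (eps / 2) delta (2 * k) (x - refl y) t"

text \<open>Within the half space reflection does not shorten distances, so norm (x - y) \<ge> r is
  inherited by x - refl y. Boundary sources are treated apart: there \<open>G0\<close> is 0, whereas
  the N-dimensional Gaussian has no bounded mass over the boundary as t tends to 0.\<close>

lemma Gker_le_tail:
  fixes x y :: "(real^'n) \<times> real"
  assumes x: "x \<in> Omega_bar" and y: "y \<in> Omega_bar" and t: "t > 0" and r: "r > 0" "r \<le> norm (x - y)"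
  shows "Gker eps delta k x y t \<le> (2 ^ (CARD('n) + 2) * (8 * (1 / eps + k / delta))) * (t / r\<^sup>2) * tail x y t"
    and "snd y = 0 \<Longrightarrow> Gker eps delta k x y t \<le> (2 ^ (CARD('n) + 2) * (8 * (1 / eps + k / delta))) * (t / r\<^sup>2)
      * ((1 / delta) * dynamic_bc.layer (eps / 2) delta (2 * k) (x - refl y) t)"
proof -
  interpret dbl: dynamic_bc "eps / 2" delta "2 * k" by (rule doubled_time)
  define A where "A = 1 / eps + k / delta"
  have A: "A > 0" "1 / eps \<le> A" using eps delta k by (auto simp: A_def add_pos_nonneg)
  define K where "K = (2 ^ (CARD('n) + 2) * (8 * A)) * (t / r\<^sup>2)"
  have K: "K = 2 ^ (CARD('n) + 2) * (8 * A * t / r\<^sup>2)" by (simp add: K_def)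
  have w: "x - refl y \<in> Omega_bar" by (rule diff_refl_in_Omega_bar[OF x y])
  have "(norm (x - y))\<^sup>2 \<le> (norm (x - refl y))\<^sup>2" by (rule norm_diff_refl_le[OF x y])
  then have r2: "r \<le> norm (x - refl y)" using r by (auto dest: power2_le_imp_le)
  have L: "layer (x - refl y) t \<le> K * dbl.layer (x - refl y) t"
  proof -
    have "layer (x - refl y) t \<le> 2 ^ (CARD('n) + 2) * exp (- (norm (x - refl y))\<^sup>2 / (8 * t * A)) * dbl.layer (x - refl y) t"
      using layer_le_doubled[OF w t] by (simp add: A_def)
    also have "\<dots> \<le> 2 ^ (CARD('n) + 2) * (8 * A * t / r\<^sup>2) * dbl.layer (x - refl y) t"
      using gaussian_tail_factor[OF t r(1) r2] dbl.layer_nonneg[OF w t]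
      by (intro mult_right_mono mult_left_mono) (auto simp: A_def)
    finally show ?thesis by (simp add: K)
  qed
  have G: "Gam (x - y) (t / eps) \<le> K * Gam (x - y) (2 * (t / eps))"
  proof -
    have s: "t / eps > 0" "t / eps \<le> t * A"
      using t eps mult_left_mono[OF A(2), of t] by auto
    have "(norm (x - y))\<^sup>2 / (8 * (t * A)) \<le> (norm (x - y))\<^sup>2 / (8 * (t / eps))"
      using s t A eps by (intro divide_left_mono) auto
    then have "exp (- (norm (x - y))\<^sup>2 / (8 * (t / eps))) \<le> exp (- (norm (x - y))\<^sup>2 / (8 * t * A))"
      by (simp add: mult.assoc)
    also have "\<dots> \<le> 8 * A * t / r\<^sup>2" using gaussian_tail_factor[OF t r] by (simp add: A_def)
    finally have e: "exp (- (norm (x - y))\<^sup>2 / (8 * (t / eps))) \<le> 8 * A * t / r\<^sup>2" .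
    have "Gam (x - y) (t / eps) \<le> 2 ^ DIM((real^'n) \<times> real) * exp (- (norm (x - y))\<^sup>2 / (8 * (t / eps))) * Gam (x - y) (2 * (t / eps))"
      by (rule Gam_le_double[OF s(1)])
    also have "\<dots> \<le> 2 ^ (CARD('n) + 2) * (8 * A * t / r\<^sup>2) * Gam (x - y) (2 * (t / eps))"
    proof (intro mult_right_mono mult_mono e)
      show "(2::real) ^ DIM((real^'n) \<times> real) \<le> 2 ^ (CARD('n) + 2)" by (intro power_increasing) auto
    qed (auto simp: Gam_nonneg)
    finally show ?thesis by (simp add: K)
  qed
  have ld: "(1 / delta) * layer (x - refl y) t \<le> K * ((1 / delta) * dbl.layer (x - refl y) t)"
    using mult_left_mono[OF L, of "1 / delta"] delta by (simp add: mult_ac)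
  have "G0 x y (t / eps) \<le> Gam (x - y) (t / eps)" by (simp add: G0_def Gam_nonneg)
  then show "Gker eps delta k x y t \<le> (2 ^ (CARD('n) + 2) * (8 * (1 / eps + k / delta))) * (t / r\<^sup>2) * tail x y t"
    unfolding A_def[symmetric] K_def[symmetric] Gker_eq_layer[OF t] tail_def distrib_left
    using G ld by linarith
  show "Gker eps delta k x y t \<le> (2 ^ (CARD('n) + 2) * (8 * (1 / eps + k / delta))) * (t / r\<^sup>2)
      * ((1 / delta) * dbl.layer (x - refl y) t)" if "snd y = 0"
  proof -
    have "refl y = y" using that by (cases y) (simp add: refl_def)
    then have "G0 x y (t / eps) = 0" by (simp add: G0_def)
    then show ?thesis using ld unfolding Gker_eq_layer[OF t] by (simp add: K_def A_def)
  qed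
qed

lemma tail_mass:
  assumes x: "x \<in> Omega_bar" and t: "t > 0"
  shows "(\<lambda>y. tail x y t) integrable_on Omega" "integral Omega (\<lambda>y. tail x y t) \<le> 2"
    "(\<lambda>y. (1 / delta) * dynamic_bc.layer (eps / 2) delta (2 * k) (x - refl (y, 0)) t) integrable_on UNIV"
    "delta / eps * integral UNIV (\<lambda>y. (1 / delta) * dynamic_bc.layer (eps / 2) delta (2 * k) (x - refl (y, 0)) t) \<le> 1"
proof -
  interpret dbl: dynamic_bc "eps / 2" delta "2 * k" by (rule doubled_time)
  have s: "2 * (t / eps) > 0" using t eps by simp
  have L: "(\<lambda>y. (1 / delta) * dbl.layer (x - refl y) t) integrable_on Omega"
    by (intro integrable_on_mult_right dbl.layer_integrable_Omega x t)
  show "(\<lambda>y. tail x y t) integrable_on Omega"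
    unfolding tail_def by (intro integrable_add Gam_translate_mass_le L s)
  have "integral Omega (\<lambda>y. tail x y t) = integral Omega (\<lambda>y. Gam (x - y) (2 * (t / eps)))
      + (1 / delta) * integral Omega (\<lambda>y. dbl.layer (x - refl y) t)"
    unfolding tail_def
    by (subst Henstock_Kurzweil_Integration.integral_add[OF Gam_translate_mass_le(1)[OF s] L]) simp
  then show "integral Omega (\<lambda>y. tail x y t) \<le> 2"
    using Gam_translate_mass_le(2)[OF s, of x] dbl.layer_mass_le(1)[OF x t] by linarith
  show "(\<lambda>y. (1 / delta) * dbl.layer (x - refl (y, 0)) t) integrable_on UNIV"
    using dbl.layer_integrable_boundary[OF x t] by (intro integrable_on_mult_right) simp
  have "0 \<le> integral UNIV (\<lambda>y. dbl.layer (x - (y, 0)) t)"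
    using dbl.layer_nonneg[OF diff_refl_in_Omega_bar[OF x] t, of "(_, 0)"]
    by (intro integral_nonneg dbl.layer_integrable_boundary x t) auto
  then show "delta / eps * integral UNIV (\<lambda>y. (1 / delta) * dbl.layer (x - refl (y, 0)) t) \<le> 1"
    using dbl.layer_mass_le(2)[OF x t] delta eps by (simp add: field_simps)
qed

end

section \<open>Initial data and uniqueness\<close>

text \<open>The hypothesis \<open>lim\<close> handles nearby points with t > 0 and
  \<open>init\<close> those with t = 0. D will be the open half space, the boundary or the closed
  half space.\<close>

lemma continuous_on_from_positive_times:
  fixes u :: "'a::metric_space \<Rightarrow> real \<Rightarrow> real"
  assumes u: "continuous_on (X \<times> {0<..}) (\<lambda>(x, t). u x t)" and D: "D \<subseteq> X"
    and init: "continuous_on D (\<lambda>x. u x 0)"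
    and lim: "\<And>x0 e. x0 \<in> D \<Longrightarrow> e > 0 \<Longrightarrow>
      \<exists>d>0. \<forall>x\<in>D. \<forall>t. dist x x0 < d \<longrightarrow> 0 < t \<longrightarrow> t < d \<longrightarrow> \<bar>u x t - u x0 0\<bar> < e"
  shows "continuous_on (D \<times> {0..}) (\<lambda>(x, t). u x t)"
  unfolding continuous_on_iff
proof (intro ballI allI impI)
  fix p e assume p: "p \<in> D \<times> {0::real..}" and e: "(e::real) > 0"
  obtain x0 t0 where p_eq: "p = (x0, t0)" "x0 \<in> D" "t0 \<ge> 0" using p by auto
  show "\<exists>d>0. \<forall>q\<in>D \<times> {0..}. dist q p < d \<longrightarrow> dist (case q of (x, t) \<Rightarrow> u x t) (case p of (x, t) \<Rightarrow> u x t) < e"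
  proof (cases "t0 = 0")
    case True
    obtain d1 where d1: "d1 > 0" "\<And>x t. x \<in> D \<Longrightarrow> dist x x0 < d1 \<Longrightarrow> 0 < t \<Longrightarrow> t < d1 \<Longrightarrow> \<bar>u x t - u x0 0\<bar> < e"
      using lim[OF p_eq(2) e] by blast
    obtain d2 where d2: "d2 > 0" "\<And>x. x \<in> D \<Longrightarrow> dist x x0 < d2 \<Longrightarrow> dist (u x 0) (u x0 0) < e"
      using init e p_eq(2) unfolding continuous_on_iff by blast
    have "dist (u x t) (u x0 t0) < e" if "x \<in> D" "t \<ge> 0" "dist (x, t) p < min d1 d2" for x t
    proof -
      have "dist x x0 < min d1 d2" "dist t t0 < min d1 d2"
        using that(3) dist_fst_le[of "(x, t)" p] dist_snd_le[of "(x, t)" p] by (auto simp: p_eq)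
      then show ?thesis
        using d1(2)[of x t] d2(2)[of x] that True by (cases "t = 0") (auto simp: dist_real_def)
    qed
    then show ?thesis using d1 d2 by (intro exI[of _ "min d1 d2"]) (auto simp: p_eq)
  next
    case False
    then have "p \<in> X \<times> {0<..}" using p_eq D by auto
    then obtain d where d: "d > 0" "\<And>q. q \<in> X \<times> {0<..} \<Longrightarrow> dist q p < d \<Longrightarrow>
        dist (case q of (x, t) \<Rightarrow> u x t) (case p of (x, t) \<Rightarrow> u x t) < e"
      using u e unfolding continuous_on_iff by blast
    have "q \<in> X \<times> {0<..}" if "q \<in> D \<times> {0..}" "dist q p < t0" for q
    proof -
      have "dist (snd q) t0 < t0" using that(2) dist_snd_le[of q p] by (simp add: p_eq)
      then show ?thesis using that(1) D by (auto simp: dist_real_def)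
    qed
    then show ?thesis using d False p_eq(3) by (intro exI[of _ "min d t0"]) auto
  qed
qed

context dynamic_bc
begin

abbreviation "sl \<equiv> sol eps delta k"

lemma sol_pos_time: "t > 0 \<Longrightarrow> sl \<phi> \<psi> x t = integral Omega (\<lambda>y. Gker eps delta k x y t * \<phi> y)
    + delta / eps * integral UNIV (\<lambda>y'. Gker eps delta k x (y', 0) t * \<psi> y')"
  by (simp add: sol_def)

lemma smooth_solution_sol:
  fixes \<phi> :: "(real^'n) \<times> real \<Rightarrow> real"
  assumes \<phi>: "continuous_on Omega \<phi>" "\<And>y. y \<in> Omega \<Longrightarrow> \<bar>\<phi> y\<bar> \<le> M"
    and \<psi>: "continuous_on UNIV \<psi>" "\<And>y. \<bar>\<psi> y\<bar> \<le> M"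
  shows "smooth_solution (sl \<phi> \<psi>)"
proof (rule smooth_solution_cong)
  have "\<And>y. y \<in> Omega \<Longrightarrow> y \<in> Omega_bar" using Omega_subset by auto
  from smooth_solution_integral[OF open_Omega this _ continuous_on_id \<phi>]
  have 1: "smooth_solution (\<lambda>x t. integral Omega (\<lambda>y. Gker eps delta k x y t * \<phi> y))" by simp
  have "continuous_on UNIV (\<lambda>y :: real^'n. (y, 0 :: real))" by (intro continuous_intros)
  from smooth_solution_integral[OF open_UNIV _ _ this \<psi>]
  have 2: "smooth_solution (\<lambda>x t. integral UNIV (\<lambda>y. Gker eps delta k x (y, 0) t * \<psi> y))"
    by (simp add: norm_Pair)
  show "smooth_solution (\<lambda>x t. integral Omega (\<lambda>y. Gker eps delta k x y t * \<phi> y)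
      + delta / eps * integral UNIV (\<lambda>y'. Gker eps delta k x (y', 0) t * \<psi> y'))"
    by (rule smooth_solution_add[OF 1 smooth_solution_cmult[OF 2]])
qed (rule sol_pos_time)

text \<open>As the total mass is 1, L can be moved inside the integrals. The tolerances e1 and e2
  are separate because near an interior point only \<open>\<phi>\<close> is close to L, and near a
  boundary point only \<open>\<psi>\<close>. The factor 3 collects the tail masses, 2 over the half
  space and 1 over the boundary.\<close>

lemma sol_close:
  fixes \<phi> :: "(real^'n) \<times> real \<Rightarrow> real"
  assumes \<phi>: "continuous_on Omega \<phi>" "\<And>y. y \<in> Omega \<Longrightarrow> \<bar>\<phi> y\<bar> \<le> M"
    and \<psi>: "continuous_on UNIV \<psi>" "\<And>y. \<bar>\<psi> y\<bar> \<le> M"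
    and x: "x \<in> Omega_bar" and t: "t > 0" and r: "r > 0" and N: "N \<ge> 0" and e: "e1 \<ge> 0" "e2 \<ge> 0"
    and near1: "\<And>y. y \<in> Omega \<Longrightarrow> \<bar>\<phi> y - L\<bar> \<le> e1 + (if r \<le> norm (x - y) then N else 0)"
    and near2: "\<And>y. \<bar>\<psi> y - L\<bar> \<le> e2 + (if r \<le> norm (x - (y, 0)) then N else 0)"
  shows "\<bar>sl \<phi> \<psi> x t - L\<bar> \<le> e1 * integral Omega (\<lambda>y. Gker eps delta k x y t) + e2
      + 3 * N * (2 ^ (CARD('n) + 2) * (8 * (1 / eps + k / delta))) * (t / r\<^sup>2)"
proof -
  let ?G = "\<lambda>y. Gker eps delta k x y t"
  define K where "K = (2 ^ (CARD('n) + 2) * (8 * (1 / eps + k / delta))) * (t / r\<^sup>2)"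
  have K: "K \<ge> 0" using eps delta k t by (simp add: K_def)
  define tb where "tb y = (1 / delta) * dynamic_bc.layer (eps / 2) delta (2 * k) (x - refl (y, 0)) t" for y
  have tb0: "0 \<le> tb y" for y
    using dynamic_bc.layer_nonneg[OF doubled_time diff_refl_in_Omega_bar[OF x] t, of "(y, 0)"] delta
    by (simp add: tb_def)
  have tl0: "0 \<le> tail x y t" if "y \<in> Omega_bar" for y
    using dynamic_bc.layer_nonneg[OF doubled_time diff_refl_in_Omega_bar[OF x that] t] delta
    by (simp add: tail_def Gam_nonneg)
  have int\<phi>: "(\<lambda>y. ?G y * \<phi> y) integrable_on Omega" by (rule Gker_Omega_integrable(1)[OF \<phi> x t])
  have int\<psi>: "(\<lambda>y. ?G (y, 0) * \<psi> y) integrable_on UNIV" by (rule Gker_boundary_integrable(1)[OF \<psi> x t])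
  note intG = Gker_integrable[OF x t]
  note tm = tail_mass[OF x t, folded tb_def]
  have i1: "integral Omega (\<lambda>y. ?G y * (\<phi> y - L)) = integral Omega (\<lambda>y. ?G y * \<phi> y) - L * integral Omega ?G"
    and n1: "(\<lambda>y. ?G y * (\<phi> y - L)) integrable_on Omega"
  proof -
    have "((\<lambda>y. ?G y * \<phi> y - L * ?G y) has_integral integral Omega (\<lambda>y. ?G y * \<phi> y) - L * integral Omega ?G) Omega"
      by (intro has_integral_diff has_integral_mult_right integrable_integral int\<phi> intG)
    then have "((\<lambda>y. ?G y * (\<phi> y - L)) has_integral integral Omega (\<lambda>y. ?G y * \<phi> y) - L * integral Omega ?G) Omega"
      by (simp add: algebra_simps)
    then show "integral Omega (\<lambda>y. ?G y * (\<phi> y - L)) = integral Omega (\<lambda>y. ?G y * \<phi> y) - L * integral Omega ?G"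
      "(\<lambda>y. ?G y * (\<phi> y - L)) integrable_on Omega" by (auto simp: integral_unique)
  qed
  have i2: "integral UNIV (\<lambda>y. ?G (y, 0) * (\<psi> y - L)) = integral UNIV (\<lambda>y. ?G (y, 0) * \<psi> y) - L * integral UNIV (\<lambda>y. ?G (y, 0))"
    and n2: "(\<lambda>y. ?G (y, 0) * (\<psi> y - L)) integrable_on UNIV"
  proof -
    have "((\<lambda>y. ?G (y, 0) * \<psi> y - L * ?G (y, 0)) has_integral integral UNIV (\<lambda>y. ?G (y, 0) * \<psi> y) - L * integral UNIV (\<lambda>y. ?G (y, 0))) UNIV"
      by (intro has_integral_diff has_integral_mult_right integrable_integral int\<psi> intG)
    then have "((\<lambda>y. ?G (y, 0) * (\<psi> y - L)) has_integral integral UNIV (\<lambda>y. ?G (y, 0) * \<psi> y) - L * integral UNIV (\<lambda>y. ?G (y, 0))) UNIV"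
      by (simp add: algebra_simps)
    then show "integral UNIV (\<lambda>y. ?G (y, 0) * (\<psi> y - L)) = integral UNIV (\<lambda>y. ?G (y, 0) * \<psi> y) - L * integral UNIV (\<lambda>y. ?G (y, 0))"
      "(\<lambda>y. ?G (y, 0) * (\<psi> y - L)) integrable_on UNIV" by (auto simp: integral_unique)
  qed
  have b1: "\<bar>integral Omega (\<lambda>y. ?G y * (\<phi> y - L))\<bar> \<le> e1 * integral Omega ?G + N * K * 2"
  proof -
    have "norm (integral Omega (\<lambda>y. ?G y * (\<phi> y - L))) \<le> integral Omega (\<lambda>y. e1 * ?G y + (N * K) * tail x y t)"
    proof (rule integral_norm_bound_integral[OF n1])
      show "(\<lambda>y. e1 * ?G y + (N * K) * tail x y t) integrable_on Omega"
        by (intro integrable_add integrable_on_mult_right intG tm)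
      fix y :: "(real^'n) \<times> real" assume y: "y \<in> Omega"
      then have yb: "y \<in> Omega_bar" using Omega_subset by auto
      have G: "0 \<le> ?G y" by (rule Gker_nonneg[OF x yb t])
      have "?G y * (if r \<le> norm (x - y) then N else 0) \<le> (N * K) * tail x y t"
      proof (cases "r \<le> norm (x - y)")
        case True
        have "?G y \<le> K * tail x y t" unfolding K_def by (rule Gker_le_tail(1)[OF x yb t r True])
        from mult_left_mono[OF this N] show ?thesis using True by (simp add: mult_ac)
      qed (use N K tl0[OF yb] in simp)
      moreover have "?G y * \<bar>\<phi> y - L\<bar> \<le> ?G y * (e1 + (if r \<le> norm (x - y) then N else 0))"
        by (rule mult_left_mono[OF near1[OF y] G])
      ultimately show "norm (?G y * (\<phi> y - L)) \<le> e1 * ?G y + (N * K) * tail x y t"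
        using G by (simp add: abs_mult distrib_left mult.commute)
    qed
    also have "\<dots> = e1 * integral Omega ?G + (N * K) * integral Omega (\<lambda>y. tail x y t)"
      by (intro integral_unique has_integral_add has_integral_mult_right integrable_integral intG tm)
    also have "\<dots> \<le> e1 * integral Omega ?G + (N * K) * 2"
      using tm(2) N K by (intro add_left_mono mult_left_mono) auto
    finally show ?thesis by simp
  qed
  have b2: "\<bar>integral UNIV (\<lambda>y. ?G (y, 0) * (\<psi> y - L))\<bar> \<le> e2 * integral UNIV (\<lambda>y. ?G (y, 0)) + (N * K) * integral UNIV tb"
  proof -
    have "norm (integral UNIV (\<lambda>y. ?G (y, 0) * (\<psi> y - L))) \<le> integral UNIV (\<lambda>y. e2 * ?G (y, 0) + (N * K) * tb y)"
    proof (rule integral_norm_bound_integral[OF n2])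
      show "(\<lambda>y. e2 * ?G (y, 0) + (N * K) * tb y) integrable_on UNIV"
        by (intro integrable_add integrable_on_mult_right intG tm)
      fix y :: "real^'n"
      have G: "0 \<le> ?G (y, 0)" by (rule Gker_nonneg[OF x _ t]) simp
      have "?G (y, 0) * (if r \<le> norm (x - (y, 0)) then N else 0) \<le> (N * K) * tb y"
      proof (cases "r \<le> norm (x - (y, 0))")
        case True
        have "?G (y, 0) \<le> K * tb y"
          unfolding K_def tb_def by (rule Gker_le_tail(2)[OF x boundary_in_Omega_bar t r True]) simp
        from mult_left_mono[OF this N] show ?thesis using True by (simp add: mult_ac)
      qed (use N K tb0[of y] in simp)
      moreover have "?G (y, 0) * \<bar>\<psi> y - L\<bar> \<le> ?G (y, 0) * (e2 + (if r \<le> norm (x - (y, 0)) then N else 0))"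
        by (rule mult_left_mono[OF near2 G])
      ultimately show "norm (?G (y, 0) * (\<psi> y - L)) \<le> e2 * ?G (y, 0) + (N * K) * tb y"
        using G by (simp add: abs_mult distrib_left mult.commute)
    qed
    also have "\<dots> = e2 * integral UNIV (\<lambda>y. ?G (y, 0)) + (N * K) * integral UNIV tb"
      by (intro integral_unique has_integral_add has_integral_mult_right integrable_integral intG tm)
    finally show ?thesis by simp
  qed
  have "delta / eps * \<bar>integral UNIV (\<lambda>y. ?G (y, 0) * (\<psi> y - L))\<bar> \<le>
      e2 * (delta / eps * integral UNIV (\<lambda>y. ?G (y, 0))) + (N * K) * (delta / eps * integral UNIV tb)"
    using mult_left_mono[OF b2, of "delta / eps"] eps delta by (simp add: distrib_left mult_ac)
  also have "\<dots> \<le> e2 * 1 + (N * K) * 1"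
    using Gker_mass[OF x t] Gker_mass_nonneg[OF x t] tm(4) e N K
    by (intro add_mono mult_left_mono) auto
  finally have b3: "delta / eps * \<bar>integral UNIV (\<lambda>y. ?G (y, 0) * (\<psi> y - L))\<bar> \<le> e2 + N * K" by simp
  have "sl \<phi> \<psi> x t - L = integral Omega (\<lambda>y. ?G y * (\<phi> y - L)) + delta / eps * integral UNIV (\<lambda>y. ?G (y, 0) * (\<psi> y - L))"
  proof -
    have "L = L * (integral Omega ?G + delta / eps * integral UNIV (\<lambda>y. ?G (y, 0)))" by (simp only: Gker_mass[OF x t])
    then have "L = L * integral Omega ?G + delta / eps * (L * integral UNIV (\<lambda>y. ?G (y, 0)))" by (simp add: distrib_left mult_ac)
    then show ?thesis unfolding i1 i2 sol_pos_time[OF t] unfolding right_diff_distrib[of "delta / eps"] by linarith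
  qed
  then have "\<bar>sl \<phi> \<psi> x t - L\<bar> \<le> \<bar>integral Omega (\<lambda>y. ?G y * (\<phi> y - L))\<bar> + delta / eps * \<bar>integral UNIV (\<lambda>y. ?G (y, 0) * (\<psi> y - L))\<bar>"
    using eps delta abs_triangle_ineq[of "integral Omega (\<lambda>y. ?G y * (\<phi> y - L))" "delta / eps * integral UNIV (\<lambda>y. ?G (y, 0) * (\<psi> y - L))"]
    by (simp add: abs_mult)
  also have "\<dots> \<le> e1 * integral Omega ?G + e2 + 3 * N * K" using b1 b3 by linarith
  finally show ?thesis by (simp add: K_def mult_ac)
qed

lemma Gker_Omega_mass_le_1:
  assumes "x \<in> Omega_bar" "t > 0"
  shows "integral Omega (\<lambda>y. Gker eps delta k x y t) \<le> 1"
proof -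
  have "0 \<le> delta / eps * integral UNIV (\<lambda>y. Gker eps delta k x (y, 0) t)"
    using Gker_mass_nonneg(2)[OF assms] eps delta by (intro mult_nonneg_nonneg) auto
  then show ?thesis using Gker_mass[OF assms] by linarith
qed

text \<open>An instance of \<open>sol_close\<close> with L = 0 and N = 0: the interior and the
  boundary integral contribute at most M each.\<close>

lemma sol_bound:
  fixes \<phi> :: "(real^'n) \<times> real \<Rightarrow> real"
  assumes \<phi>: "continuous_on Omega \<phi>" "\<And>y. y \<in> Omega \<Longrightarrow> \<bar>\<phi> y\<bar> \<le> M"
    and \<psi>: "continuous_on UNIV \<psi>" "\<And>y. \<bar>\<psi> y\<bar> \<le> M"
    and x: "x \<in> Omega_bar" and t: "t \<ge> 0"
  shows "\<bar>sl \<phi> \<psi> x t\<bar> \<le> 2 * M"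
proof -
  have M: "0 \<le> M" using \<psi>(2)[of 0] by linarith
  show ?thesis
  proof (cases "t = 0")
    case True
    have "x \<in> Omega" if "snd x \<noteq> 0" using x that by (auto simp: Omega_bar_def Omega_def)
    then have "\<bar>sl \<phi> \<psi> x t\<bar> \<le> M" using \<phi>(2)[of x] \<psi>(2)[of "fst x"] True by (auto simp: sol_def)
    then show ?thesis using M by linarith
  next
    case False
    then have t: "t > 0" using t by simp
    have "\<bar>sl \<phi> \<psi> x t - 0\<bar> \<le> M * integral Omega (\<lambda>y. Gker eps delta k x y t) + M
      + 3 * 0 * (2 ^ (CARD('n) + 2) * (8 * (1 / eps + k / delta))) * (t / 1\<^sup>2)"
      by (rule sol_close[OF \<phi> \<psi> x t zero_less_one]) (use M \<phi> \<psi> in auto)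
    also have "\<dots> \<le> M * 1 + M" using mult_left_mono[OF Gker_Omega_mass_le_1[OF x t] M] by simp
    finally show ?thesis by simp
  qed
qed


context
  fixes \<phi> :: "(real^'n) \<times> real \<Rightarrow> real" and \<psi> :: "real^'n \<Rightarrow> real" and M :: real
  assumes \<phi>: "continuous_on Omega \<phi>" "\<And>y. y \<in> Omega \<Longrightarrow> \<bar>\<phi> y\<bar> \<le> M"
    and \<psi>: "continuous_on UNIV \<psi>" "\<And>y. \<bar>\<psi> y\<bar> \<le> M"
begin

private lemma M_nonneg: "0 \<le> M"
  using \<psi>(2)[of 0] by linarith

private lemma tail_const_nonneg: "0 \<le> 3 * (2 * M) * (2 ^ (CARD('n) + 2) * (8 * (1 / eps + k / delta))) / r\<^sup>2"
  using M_nonneg eps delta k by (intro divide_nonneg_nonneg mult_nonneg_nonneg add_nonneg_nonneg) auto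

private lemma small_time:
  assumes "e > 0" "c \<ge> 0"
  shows "\<exists>d>0. \<forall>t. 0 < t \<longrightarrow> t < d \<longrightarrow> c * t < (e::real)"
proof (intro exI[of _ "e / (c + 1)"] conjI allI impI)
  show "e / (c + 1) > 0" using assms by simp
  fix t assume t: "0 < t" "t < e / (c + 1)"
  then have "(c + 1) * t < e" using assms by (simp add: pos_less_divide_eq mult.commute)
  then show "c * t < e" using t by (simp add: distrib_right)
qed

lemma continuous_on_sol_interior: "continuous_on (Omega \<times> {0..}) (\<lambda>(x, t). sl \<phi> \<psi> x t)"
proof (rule continuous_on_from_positive_times[OF smooth_solution_continuous[OF smooth_solution_sol[OF \<phi> \<psi>]] Omega_subset])
  have s0: "sl \<phi> \<psi> x 0 = \<phi> x" if "x \<in> Omega" for x using that by (simp add: sol_def Omega_def)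
  show "continuous_on Omega (\<lambda>x. sl \<phi> \<psi> x 0)"
    using \<phi>(1) by (rule continuous_on_eq) (simp add: s0)
  fix x0 :: "(real^'n) \<times> real" and e :: real assume x0: "x0 \<in> Omega" and e: "e > 0"
  obtain d where d: "d > 0" "\<And>y. y \<in> Omega \<Longrightarrow> dist y x0 < d \<Longrightarrow> dist (\<phi> y) (\<phi> x0) < e / 2"
    using \<phi>(1) x0 e unfolding continuous_on_iff by (meson half_gt_zero)
  \<comment> \<open>The second entry keeps every boundary source at distance at least r from points
    within r of x0, so e2 = 0 is admissible.\<close>
  define r where "r = min (d / 2) (snd x0 / 2)"
  have r: "r > 0" "2 * r \<le> d" "2 * r \<le> snd x0" using d x0 by (auto simp: r_def Omega_def)
  define c where "c = 3 * (2 * M) * (2 ^ (CARD('n) + 2) * (8 * (1 / eps + k / delta))) / r\<^sup>2"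
  have c: "c \<ge> 0" unfolding c_def by (rule tail_const_nonneg)
  obtain d' where d': "d' > 0" "\<And>t. 0 < t \<Longrightarrow> t < d' \<Longrightarrow> c * t < e / 2"
    using small_time[OF half_gt_zero[OF e] c] by blast
  show "\<exists>d>0. \<forall>x\<in>Omega. \<forall>t. dist x x0 < d \<longrightarrow> 0 < t \<longrightarrow> t < d \<longrightarrow> \<bar>sl \<phi> \<psi> x t - sl \<phi> \<psi> x0 0\<bar> < e"
  proof (intro exI[of _ "min r d'"] conjI ballI allI impI)
    fix x t assume x: "x \<in> Omega" "dist x x0 < min r d'" and t: "0 < t" "t < min r d'"
    have xb: "x \<in> Omega_bar" using x Omega_subset by auto
    have "\<bar>sl \<phi> \<psi> x t - \<phi> x0\<bar> \<le> e / 2 * integral Omega (\<lambda>y. Gker eps delta k x y t) + 0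
        + 3 * (2 * M) * (2 ^ (CARD('n) + 2) * (8 * (1 / eps + k / delta))) * (t / r\<^sup>2)"
    proof (rule sol_close[OF \<phi> \<psi> xb t(1) r(1)])
      fix y :: "(real^'n) \<times> real" assume y: "y \<in> Omega"
      show "\<bar>\<phi> y - \<phi> x0\<bar> \<le> e / 2 + (if r \<le> norm (x - y) then 2 * M else 0)"
      proof (cases "r \<le> norm (x - y)")
        case True
        then show ?thesis using \<phi>(2)[OF y] \<phi>(2)[OF x0] e by simp
      next
        case False
        then have "dist y x0 < d"
          using x(2) r dist_triangle[of y x0 x] by (simp add: dist_norm norm_minus_commute)
        then show ?thesis using d(2)[OF y] False by (simp add: dist_real_def)
      qed
    next
      fix y :: "real^'n"
      have "snd x0 \<le> dist (y, 0) x0" using dist_snd_le[of "(y, 0)" x0] by (simp add: dist_real_def)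
      then have "r \<le> norm (x - (y, 0))"
        using x(2) r dist_triangle[of "(y, 0)" x0 x] by (simp add: dist_norm norm_minus_commute)
      then show "\<bar>\<psi> y - \<phi> x0\<bar> \<le> 0 + (if r \<le> norm (x - (y, 0)) then 2 * M else 0)"
        using \<psi>(2)[of y] \<phi>(2)[OF x0] by simp
    qed (use e M_nonneg in auto)
    also have "\<dots> \<le> e / 2 * 1 + c * t"
      using mult_left_mono[OF Gker_Omega_mass_le_1[OF xb t(1)], of "e / 2"] e by (simp add: c_def)
    also have "\<dots> < e" using d'(2)[of t] t by simp
    finally show "\<bar>sl \<phi> \<psi> x t - sl \<phi> \<psi> x0 0\<bar> < e" by (simp add: s0[OF x0])
  qed (use r d' in auto)
qed

lemma continuous_on_sol_boundary: "continuous_on (UNIV \<times> {0..}) (\<lambda>(x', t). sl \<phi> \<psi> (x', 0) t)"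
proof (rule continuous_on_from_positive_times[of UNIV])
  show "continuous_on (UNIV \<times> {0<..}) (\<lambda>(x', t). sl \<phi> \<psi> (x', 0) t)"
    unfolding split_beta'
    by (rule continuous_on_case_prod_compose[OF smooth_solution_continuous[OF smooth_solution_sol[OF \<phi> \<psi>]]])
       (auto intro!: continuous_intros)
  have s0: "sl \<phi> \<psi> (x', 0) 0 = \<psi> x'" for x' by (simp add: sol_def)
  show "continuous_on UNIV (\<lambda>x'. sl \<phi> \<psi> (x', 0) 0)" using \<psi>(1) by (simp add: s0)
  fix x0 :: "real^'n" and e :: real assume e: "e > 0"
  obtain d where d: "d > 0" "\<And>y. dist y x0 < d \<Longrightarrow> dist (\<psi> y) (\<psi> x0) < e / 2"
    using \<psi>(1) e unfolding continuous_on_iff by (meson UNIV_I half_gt_zero)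
  define r where "r = d / 2"
  have r: "r > 0" "2 * r \<le> d" using d by (auto simp: r_def)
  define c where "c = 3 * (2 * M) * (2 ^ (CARD('n) + 2) * (8 * (1 / eps + k / delta))) / r\<^sup>2"
  have c: "c \<ge> 0" unfolding c_def by (rule tail_const_nonneg)
  have e4: "e / 4 > 0" using e by simp
  obtain d1 where d1: "d1 > 0" "\<And>t. 0 < t \<Longrightarrow> t < d1 \<Longrightarrow> c * t < e / 4"
    using small_time[OF e4 c] by blast
  \<comment> \<open>From the crude tolerance e1 = 2M for interior data, times the interior mass at a
    boundary point, which is at most (1/delta) * 4 * sqrt (eps * t).\<close>
  define c' where "c' = 2 * M * (1 / delta) * 4 * sqrt eps"
  have c': "c' \<ge> 0" using M_nonneg eps delta by (simp add: c'_def)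
  obtain d2 where d2: "d2 > 0" "\<And>t. 0 < t \<Longrightarrow> t < d2 \<Longrightarrow> c' * t < e / 4"
    using small_time[OF e4 c'] by blast
  \<comment> \<open>The square appears because the interior contribution is linear in sqrt t rather
    than in t.\<close>
  define dd where "dd = Min {r, d1, d2\<^sup>2}"
  have dd: "dd > 0" "dd \<le> r" "dd \<le> d1" "dd \<le> d2\<^sup>2" using r d1 d2 by (auto simp: dd_def)
  show "\<exists>d>0. \<forall>x'\<in>UNIV. \<forall>t. dist x' x0 < d \<longrightarrow> 0 < t \<longrightarrow> t < d \<longrightarrow> \<bar>sl \<phi> \<psi> (x', 0) t - sl \<phi> \<psi> (x0, 0) 0\<bar> < e"
  proof (intro exI[of _ dd] conjI ballI allI impI dd(1))
    fix x' :: "real^'n" and t assume x: "dist x' x0 < dd" and t: "0 < t" "t < dd"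
    have "\<bar>sl \<phi> \<psi> (x', 0) t - \<psi> x0\<bar> \<le> 2 * M * integral Omega (\<lambda>y. Gker eps delta k (x', 0) y t) + e / 2
        + 3 * (2 * M) * (2 ^ (CARD('n) + 2) * (8 * (1 / eps + k / delta))) * (t / r\<^sup>2)"
    proof (rule sol_close[OF \<phi> \<psi> boundary_in_Omega_bar t(1) r(1)])
      show "\<bar>\<phi> y - \<psi> x0\<bar> \<le> 2 * M + (if r \<le> norm ((x', 0) - y) then 2 * M else 0)" if "y \<in> Omega" for y
        using \<phi>(2)[OF that] \<psi>(2)[of x0] M_nonneg by auto
      fix y :: "real^'n"
      show "\<bar>\<psi> y - \<psi> x0\<bar> \<le> e / 2 + (if r \<le> norm ((x', 0) - (y, 0)) then 2 * M else 0)"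
      proof (cases "r \<le> norm (x' - y)")
        case True
        then show ?thesis using \<psi>(2)[of y] \<psi>(2)[of x0] e by (simp add: norm_Pair)
      next
        case False
        then have "dist y x0 < d"
          using x r dd dist_triangle[of y x0 x'] by (simp add: dist_norm norm_minus_commute)
        then show ?thesis using d(2)[of y] False by (simp add: dist_real_def norm_Pair)
      qed
    qed (use e M_nonneg in auto)
    \<comment> \<open>At boundary points \<open>erf 0\<close> = 0, so the interior mass consists of
      the layer part alone.\<close>
    also have "\<dots> = c' * sqrt t * (integral Omega (\<lambda>y. layer ((x', 0) - refl y) t) / (4 * sqrt (eps * t))) + e / 2 + c * t"
      using t eps by (simp add: Gker_Omega_mass c'_def c_def real_sqrt_mult)
    also have "\<dots> \<le> c' * sqrt t * 1 + e / 2 + c * t"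
    proof (intro add_mono mult_left_mono order_refl)
      show "integral Omega (\<lambda>y. layer ((x', 0) - refl y) t) / (4 * sqrt (eps * t)) \<le> 1"
        using layer_interior_mass_le[OF boundary_in_Omega_bar t(1), of x'] t eps by (simp add: divide_le_eq)
      show "0 \<le> c' * sqrt t" using c' t by simp
    qed (use c in auto)
    also have "\<dots> < e"
    proof -
      have "sqrt t < d2" using t dd d2 by (intro real_less_lsqrt) auto
      then show ?thesis using d1(2)[of t] d2(2)[of "sqrt t"] t dd by simp
    qed
    finally show "\<bar>sl \<phi> \<psi> (x', 0) t - sl \<phi> \<psi> (x0, 0) 0\<bar> < e" by (simp add: s0)
  qed
qed simp

text \<open>When \<open>\<psi>\<close> is the boundary trace of a continuous \<open>\<phi>\<close>,
  both data are close to the same value and the solution is continuous even at the corner. This is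
  the situation of any solution restarted at a positive time.\<close>

lemma continuous_on_sol_closure:
  assumes cont: "continuous_on Omega_bar \<phi>" and trace: "\<And>y. \<psi> y = \<phi> (y, 0)"
  shows "continuous_on (Omega_bar \<times> {0..}) (\<lambda>(x, t). sl \<phi> \<psi> x t)"
proof (rule continuous_on_from_positive_times[OF smooth_solution_continuous[OF smooth_solution_sol[OF \<phi> \<psi>]] subset_refl])
  have s0: "sl \<phi> \<psi> x 0 = \<phi> x" for x by (cases x) (simp add: sol_def trace)
  show "continuous_on Omega_bar (\<lambda>x. sl \<phi> \<psi> x 0)" using cont by (simp add: s0)
  fix x0 :: "(real^'n) \<times> real" and e :: real assume x0: "x0 \<in> Omega_bar" and e: "e > 0"
  have bd: "\<bar>\<phi> y\<bar> \<le> M" if "y \<in> Omega_bar" for y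
  proof (cases "y \<in> Omega")
    case False
    then have "y = (fst y, 0)" using that by (cases y) (auto simp: Omega_def Omega_bar_def)
    then show ?thesis using \<psi>(2)[of "fst y"] by (simp add: trace)
  qed (rule \<phi>(2))
  obtain d where d: "d > 0" "\<And>y. y \<in> Omega_bar \<Longrightarrow> dist y x0 < d \<Longrightarrow> dist (\<phi> y) (\<phi> x0) < e / 4"
  proof -
    have "e / 4 > 0" using e by simp
    with cont x0 show ?thesis using that unfolding continuous_on_iff by blast
  qed
  define r where "r = d / 2"
  have r: "r > 0" "2 * r \<le> d" using d by (auto simp: r_def)
  define c where "c = 3 * (2 * M) * (2 ^ (CARD('n) + 2) * (8 * (1 / eps + k / delta))) / r\<^sup>2"
  have c: "c \<ge> 0" unfolding c_def by (rule tail_const_nonneg)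
  obtain d' where d': "d' > 0" "\<And>t. 0 < t \<Longrightarrow> t < d' \<Longrightarrow> c * t < e / 2"
    using small_time[OF half_gt_zero[OF e] c] by blast
  show "\<exists>d>0. \<forall>x\<in>Omega_bar. \<forall>t. dist x x0 < d \<longrightarrow> 0 < t \<longrightarrow> t < d \<longrightarrow> \<bar>sl \<phi> \<psi> x t - sl \<phi> \<psi> x0 0\<bar> < e"
  proof (intro exI[of _ "min r d'"] conjI ballI allI impI)
    fix x t assume x: "x \<in> Omega_bar" "dist x x0 < min r d'" and t: "0 < t" "t < min r d'"
    have near: "\<bar>\<phi> y - \<phi> x0\<bar> \<le> e / 4 + (if r \<le> norm (x - y) then 2 * M else 0)" if y: "y \<in> Omega_bar" for y
    proof (cases "r \<le> norm (x - y)")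
      case True
      then show ?thesis using bd[OF y] bd[OF x0] e by simp
    next
      case False
      then have "dist y x0 < d"
        using x(2) r dist_triangle[of y x0 x] by (simp add: dist_norm norm_minus_commute)
      then show ?thesis using d(2)[OF y] False by (simp add: dist_real_def)
    qed
    have "\<bar>sl \<phi> \<psi> x t - \<phi> x0\<bar> \<le> e / 4 * integral Omega (\<lambda>y. Gker eps delta k x y t) + e / 4
        + 3 * (2 * M) * (2 ^ (CARD('n) + 2) * (8 * (1 / eps + k / delta))) * (t / r\<^sup>2)"
    proof (rule sol_close[OF \<phi> \<psi> x(1) t(1) r(1)])
      show "\<bar>\<phi> y - \<phi> x0\<bar> \<le> e / 4 + (if r \<le> norm (x - y) then 2 * M else 0)" if "y \<in> Omega" for y
        by (rule near[OF subsetD[OF Omega_subset that]])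
      show "\<bar>\<psi> y - \<phi> x0\<bar> \<le> e / 4 + (if r \<le> norm (x - (y, 0)) then 2 * M else 0)" for y
        using near[OF boundary_in_Omega_bar, of y] by (simp only: trace)
    qed (use e M_nonneg in auto)
    also have "\<dots> \<le> e / 4 * 1 + e / 4 + c * t"
    proof -
      have "e / 4 * integral Omega (\<lambda>y. Gker eps delta k x y t) \<le> e / 4 * 1"
        by (rule mult_left_mono[OF Gker_Omega_mass_le_1[OF x(1) t(1)]]) (use e in simp)
      moreover have "3 * (2 * M) * (2 ^ (CARD('n) + 2) * (8 * (1 / eps + k / delta))) * (t / r\<^sup>2) = c * t"
        by (simp add: c_def)
      ultimately show ?thesis by linarith
    qed
    also have "\<dots> < e" using d'(2)[of t] t by simp
    finally show "\<bar>sl \<phi> \<psi> x t - sl \<phi> \<psi> x0 0\<bar> < e" by (simp add: s0)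
  qed (use r d' in auto)
qed

end

section \<open>Representation, uniqueness and the semigroup law\<close>

lemma representation:
  fixes v :: "(real^'n) \<times> real \<Rightarrow> real \<Rightarrow> real"
  assumes v: "dyn_eqs eps delta k v" "continuous_on (Omega_bar \<times> {0..}) (\<lambda>(x, t). v x t)"
    "\<And>T. \<exists>M. \<forall>x\<in>Omega_bar. \<forall>t\<in>{0..T}. \<bar>v x t\<bar> \<le> M"
    and x: "x \<in> Omega_bar" and t: "t \<ge> 0"
  shows "v x t = sl (\<lambda>y. v y 0) (\<lambda>y. v (y, 0) 0) x t"
proof -
  obtain M where M: "\<And>x. x \<in> Omega_bar \<Longrightarrow> \<bar>v x 0\<bar> \<le> M" using v(3)[of 0] by auto
  have cont: "continuous_on Omega_bar (\<lambda>y. v y 0)"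
    by (rule continuous_on_case_prod_compose[OF v(2)]) (auto intro!: continuous_intros)
  have \<phi>: "continuous_on Omega (\<lambda>y. v y 0)" "\<And>y. y \<in> Omega \<Longrightarrow> \<bar>v y 0\<bar> \<le> M"
    using continuous_on_subset[OF cont Omega_subset] M Omega_subset by auto
  have \<psi>: "continuous_on UNIV (\<lambda>y. v (y, 0) 0)" "\<And>y. \<bar>v (y, 0) 0\<bar> \<le> M"
    using M by (auto intro!: continuous_on_compose2[OF cont, of UNIV "\<lambda>y. (y, 0)"] continuous_intros)
  show ?thesis
  proof (rule dyn_eqs_unique[OF v _ _ _ _ x t])
    show "dyn_eqs eps delta k (sl (\<lambda>y. v y 0) (\<lambda>y. v (y, 0) 0))"
      by (rule smooth_solution_dyn_eqs[OF smooth_solution_sol[OF \<phi> \<psi>]])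
    \<comment> \<open>The two data are the values of one continuous function at time 0, so they are
      compatible at the corner.\<close>
    show "continuous_on (Omega_bar \<times> {0..}) (\<lambda>(x, t). sl (\<lambda>y. v y 0) (\<lambda>y. v (y, 0) 0) x t)"
      by (rule continuous_on_sol_closure[OF \<phi> \<psi> cont]) simp_all
    show "\<exists>M. \<forall>x\<in>Omega_bar. \<forall>t\<in>{0..T}. \<bar>sl (\<lambda>y. v y 0) (\<lambda>y. v (y, 0) 0) x t\<bar> \<le> M" for T
      using sol_bound[OF \<phi> \<psi>] by (intro exI[of _ "2 * M"]) auto
    show "v x 0 = sl (\<lambda>y. v y 0) (\<lambda>y. v (y, 0) 0) x 0" for x
      by (cases x) (simp add: sol_def)
  qed
qed

lemma dyn_eqs_time_shift:
  fixes u :: "(real^'n) \<times> real \<Rightarrow> real \<Rightarrow> real"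
  assumes u: "dyn_eqs eps delta k u" and s: "s \<ge> 0"
  shows "dyn_eqs eps delta k (\<lambda>x t. u x (t + s))"
proof -
  obtain ut Du D2u where 1:
    "\<And>x t. x \<in> Omega_bar \<Longrightarrow> t > 0 \<Longrightarrow> ((\<lambda>s. u x s) has_real_derivative ut x t) (at t)"
    "\<And>x t. x \<in> Omega_bar \<Longrightarrow> t > 0 \<Longrightarrow> ((\<lambda>y. u y t) has_derivative Du x t) (at x within Omega_bar)"
    "\<And>x t b. x \<in> Omega \<Longrightarrow> t > 0 \<Longrightarrow> b \<in> Basis \<Longrightarrow> ((\<lambda>y. Du y t b) has_derivative D2u x t b) (at x)"
    "\<And>x t. x \<in> Omega \<Longrightarrow> t > 0 \<Longrightarrow> eps * ut x t - (\<Sum>b\<in>Basis. D2u x t b b) = 0" and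
    bc: "if k = 0 then (\<forall>x'. \<forall>t>0. delta * ut (x', 0) t - Du (x', 0) t (0, 1) = 0)
         else (\<exists>Dw D2w. trace_derivs u Dw D2w \<and>
              (\<forall>x'. \<forall>t>0. delta * ut (x', 0) t - k * (\<Sum>b\<in>Basis. D2w x' t b b) - Du (x', 0) t (0, 1) = 0))"
    using u unfolding dyn_eqs_def by blast
  show ?thesis
    unfolding dyn_eqs_def
  proof (intro exI[of _ "\<lambda>x t. ut x (t + s)"] exI[of _ "\<lambda>x t. Du x (t + s)"] exI[of _ "\<lambda>x t. D2u x (t + s)"]
      conjI ballI allI impI)
    fix x :: "(real^'n) \<times> real" and t :: real assume x: "x \<in> Omega_bar" and t: "t > 0"
    show "((\<lambda>t. u x (t + s)) has_real_derivative ut x (t + s)) (at t)"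
      using 1(1)[OF x, of "t + s"] t s by (intro iffD1[OF DERIV_shift]) auto
  next
    show "if k = 0 then (\<forall>x'. \<forall>t>0. delta * ut (x', 0) (t + s) - Du (x', 0) (t + s) (0, 1) = 0)
         else (\<exists>Dw D2w. trace_derivs (\<lambda>x t. u x (t + s)) Dw D2w \<and>
              (\<forall>x'. \<forall>t>0. delta * ut (x', 0) (t + s) - k * (\<Sum>b\<in>Basis. D2w x' t b b) - Du (x', 0) (t + s) (0, 1) = 0))"
    proof (cases "k = 0")
      case True
      then show ?thesis using bc s by simp
    next
      case False
      then obtain Dw D2w where w: "trace_derivs u Dw D2w"
        "\<And>x' t. t > 0 \<Longrightarrow> delta * ut (x', 0) t - k * (\<Sum>b\<in>Basis. D2w x' t b b) - Du (x', 0) t (0, 1) = 0"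
        using bc by auto
      have "trace_derivs (\<lambda>x t. u x (t + s)) (\<lambda>x t. Dw x (t + s)) (\<lambda>x t. D2w x (t + s))"
        using w(1) s unfolding trace_derivs_def by simp
      moreover have "\<forall>x'. \<forall>t>0. delta * ut (x', 0) (t + s) - k * (\<Sum>b\<in>Basis. D2w x' (t + s) b b) - Du (x', 0) (t + s) (0, 1) = 0"
        using w(2) s by simp
      ultimately show ?thesis using False by auto
    qed
  qed (use 1(2-) s in auto)
qed

text \<open>A bounded solution may jump at the corner (boundary, t = 0), so the maximum principle is only
  applied after a time shift s; the initial data at time s converge pointwise, and dominated
  convergence removes the shift.\<close>

lemma bounded_solution_unique:
  fixes v :: "(real^'n) \<times> real \<Rightarrow> real \<Rightarrow> real"
  assumes v: "dyn_eqs eps delta k v"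
    and cont: "continuous_on (Omega_bar \<times> {0<..}) (\<lambda>(x, t). v x t)"
      "continuous_on (Omega \<times> {0..}) (\<lambda>(x, t). v x t)" "continuous_on (UNIV \<times> {0..}) (\<lambda>(x', t). v (x', 0) t)"
    and init: "\<And>x. x \<in> Omega \<Longrightarrow> v x 0 = \<phi> x" "\<And>x'. v (x', 0) 0 = \<psi> x'"
    and bnd: "\<And>x t. x \<in> Omega_bar \<Longrightarrow> t \<ge> 0 \<Longrightarrow> \<bar>v x t\<bar> \<le> M"
    and x: "x \<in> Omega_bar" and t: "t \<ge> 0"
  shows "v x t = sl \<phi> \<psi> x t"
proof (cases "t = 0")
  case True
  then show ?thesis using init x by (cases x) (auto simp: sol_def Omega_def Omega_bar_def)
next
  case False
  then have t: "t > 0" using t by simp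
  define s where "s n = 1 / real (Suc n)" for n
  have s: "s n > 0" for n by (simp add: s_def)
  have slim: "s \<longlonglongrightarrow> 0" unfolding s_def by (rule LIMSEQ_Suc[OF lim_1_over_n])
  have M: "0 \<le> M" using bnd[OF x, of 0] by linarith
  have cs: "continuous_on Omega_bar (\<lambda>y. v y (s n))" for n
    by (rule continuous_on_case_prod_compose[OF cont(1)]) (use s in \<open>auto intro!: continuous_intros\<close>)
  have \<phi>: "continuous_on Omega (\<lambda>y. v y (s n))" "\<And>y. y \<in> Omega \<Longrightarrow> \<bar>v y (s n)\<bar> \<le> M" for n
    using continuous_on_subset[OF cs Omega_subset] bnd s[of n] Omega_subset by (auto simp: less_imp_le)
  have \<psi>: "continuous_on UNIV (\<lambda>y. v (y, 0) (s n))" "\<And>y. \<bar>v (y, 0) (s n)\<bar> \<le> M" for n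
    using bnd s[of n]
    by (auto intro!: continuous_on_compose2[OF cs, of UNIV "\<lambda>y. (y, 0)"] continuous_intros simp: less_imp_le)
  have rep: "v x (t + s n) = sl (\<lambda>y. v y (s n)) (\<lambda>y. v (y, 0) (s n)) x t" for n
  proof -
    have "v x (t + s n) = sl (\<lambda>y. v y (0 + s n)) (\<lambda>y. v (y, 0) (0 + s n)) x t"
    proof (rule representation[OF dyn_eqs_time_shift[OF v less_imp_le[OF s]]])
      show "continuous_on (Omega_bar \<times> {0..}) (\<lambda>(x, t). v x (t + s n))"
        unfolding split_beta'
        by (rule continuous_on_case_prod_compose[OF cont(1)])
           (use s in \<open>auto intro!: continuous_intros add_nonneg_pos\<close>)
      show "\<exists>M. \<forall>x\<in>Omega_bar. \<forall>t\<in>{0..T}. \<bar>v x (t + s n)\<bar> \<le> M" for T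
        using bnd s[of n] by (intro exI[of _ M]) (auto simp: less_imp_le)
    qed (use x t in auto)
    then show ?thesis by simp
  qed
  have "(\<lambda>n. v x (t + s n)) \<longlonglongrightarrow> v x t"
  proof -
    have "((\<lambda>r. v x r) \<longlongrightarrow> v x t) (at t within {0<..})"
    proof -
      have "continuous_on {0<..} (\<lambda>r. v x r)"
        by (rule continuous_on_case_prod_compose[OF cont(1)]) (use x in \<open>auto intro!: continuous_intros\<close>)
      then show ?thesis using t by (auto simp: continuous_on_def)
    qed
    moreover have "filterlim (\<lambda>n. t + s n) (at t within {0<..}) sequentially"
      using tendsto_add[OF tendsto_const slim, of t] t s
      by (auto simp: filterlim_at less_imp_neq[OF s, symmetric] add_pos_pos intro!: always_eventually)
    ultimately show ?thesis by (rule filterlim_compose)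
  qed
  moreover have "(\<lambda>n. v x (t + s n)) \<longlonglongrightarrow> sl \<phi> \<psi> x t"
  proof -
    have vs: "(\<lambda>n. f (s n)) \<longlonglongrightarrow> f 0" if "continuous_on {0..} f" for f :: "real \<Rightarrow> real"
      by (rule continuous_on_tendsto_compose[OF that slim]) (use s in \<open>auto simp: less_imp_le\<close>)
    \<comment> \<open>Pointwise convergence of the data on the open half space and, separately, on
      the boundary is all that is available. With the integrable majorant G * M it suffices, so a
      jump at the corner is invisible in the limit.\<close>
    have "(\<lambda>n. integral Omega (\<lambda>y. Gker eps delta k x y t * v y (s n))) \<longlonglongrightarrow> integral Omega (\<lambda>y. Gker eps delta k x y t * \<phi> y)"
    proof (rule dominated_convergence(2))
      show "(\<lambda>y. Gker eps delta k x y t * v y (s n)) integrable_on Omega" for n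
        by (rule Gker_Omega_integrable(1)[OF \<phi> x t])
      show "(\<lambda>y. Gker eps delta k x y t * M) integrable_on Omega"
        by (intro integrable_on_mult_left Gker_integrable x t)
      fix y :: "(real^'n) \<times> real" assume y: "y \<in> Omega"
      have yb: "y \<in> Omega_bar" using y Omega_subset by auto
      show "norm (Gker eps delta k x y t * v y (s n)) \<le> Gker eps delta k x y t * M" for n
        using Gker_nonneg[OF x yb t] \<phi>(2)[OF y, of n] by (simp add: abs_mult mult_left_mono)
      have "continuous_on {0..} (\<lambda>r. v y r)"
        by (rule continuous_on_case_prod_compose[OF cont(2)]) (use y in \<open>auto intro!: continuous_intros\<close>)
      from vs[OF this] show "(\<lambda>n. Gker eps delta k x y t * v y (s n)) \<longlonglongrightarrow> Gker eps delta k x y t * \<phi> y"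
        by (intro tendsto_intros) (simp add: init(1)[OF y])
    qed
    moreover have "(\<lambda>n. integral UNIV (\<lambda>y. Gker eps delta k x (y, 0) t * v (y, 0) (s n))) \<longlonglongrightarrow>
        integral UNIV (\<lambda>y. Gker eps delta k x (y, 0) t * \<psi> y)"
    proof (rule dominated_convergence(2))
      show "(\<lambda>y. Gker eps delta k x (y, 0) t * v (y, 0) (s n)) integrable_on UNIV" for n
        by (rule Gker_boundary_integrable(1)[OF \<psi> x t])
      show "(\<lambda>y. Gker eps delta k x (y, 0) t * M) integrable_on UNIV"
        by (intro integrable_on_mult_left Gker_integrable x t)
      fix y :: "real^'n"
      show "norm (Gker eps delta k x (y, 0) t * v (y, 0) (s n)) \<le> Gker eps delta k x (y, 0) t * M" for n
        using Gker_nonneg[OF x boundary_in_Omega_bar t, of y] \<psi>(2)[of y n] by (simp add: abs_mult mult_left_mono)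
      have "continuous_on {0..} (\<lambda>r. v (y, 0) r)"
        by (rule continuous_on_case_prod_compose[OF cont(3)]) (auto intro!: continuous_intros)
      from vs[OF this] show "(\<lambda>n. Gker eps delta k x (y, 0) t * v (y, 0) (s n)) \<longlonglongrightarrow> Gker eps delta k x (y, 0) t * \<psi> y"
        by (intro tendsto_intros) (simp add: init(2))
    qed
    ultimately show ?thesis unfolding rep sol_pos_time[OF t] by (intro tendsto_intros)
  qed
  ultimately show ?thesis by (rule LIMSEQ_unique)
qed


lemma Gker_semigroup:
  fixes x y :: "(real^'n) \<times> real"
  assumes x: "x \<in> Omega_bar" and y: "y \<in> Omega_bar" and t: "t > 0" and s: "s > 0"
  shows "Gker eps delta k x y (t + s) = integral Omega (\<lambda>z. Gker eps delta k x z t * Gker eps delta k z y s)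
      + delta / eps * integral UNIV (\<lambda>z'. Gker eps delta k x (z', 0) t * Gker eps delta k (z', 0) y s)"
proof -
  have smooth: "smooth_solution (\<lambda>x t. Gker eps delta k x y (t + s))"
    by (rule smooth_solution_time_shift[OF smooth_solution_Gker[OF y] less_imp_le[OF s]])
  have "Gker eps delta k x y (t + s) = sl (\<lambda>z. Gker eps delta k z y (0 + s)) (\<lambda>z. Gker eps delta k (z, 0) y (0 + s)) x t"
  proof (rule representation[OF smooth_solution_dyn_eqs[OF smooth] _ _ x less_imp_le[OF t]])
    show "continuous_on (Omega_bar \<times> {0..}) (\<lambda>(x, t). Gker eps delta k x y (t + s))"
      unfolding split_beta'
      by (rule continuous_on_case_prod_compose[OF smooth_solution_continuous[OF smooth_solution_Gker[OF y]]])
         (use s in \<open>auto intro!: continuous_intros add_nonneg_pos\<close>)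
    fix T
    \<comment> \<open>\<open>kernel_bounded\<close> controls the kernel when its first argument
      stays bounded. By symmetry y takes that place, which gives a bound uniform in x.\<close>
    obtain C c where C: "C \<ge> 0" "c > 0" "\<And>x t. x \<in> Omega_bar \<Longrightarrow> t \<in> {s..T + s} \<Longrightarrow>
        \<bar>Gker eps delta k y x t\<bar> \<le> C * exp (- c * (norm x)\<^sup>2)"
      using kernel_bounded_bound[OF kernel_bounded_Gker s, of "T + s" "norm y"] y by blast
    have "\<bar>Gker eps delta k x y (t + s)\<bar> \<le> C" if "x \<in> Omega_bar" "t \<in> {0..T}" for x t
    proof -
      have "\<bar>Gker eps delta k x y (t + s)\<bar> \<le> C * exp (- c * (norm x)\<^sup>2)"
        unfolding Gker_sym[of x y] using that by (intro C(3)) auto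
      also have "\<dots> \<le> C * 1" using C by (intro mult_left_mono) auto
      finally show ?thesis by simp
    qed
    then show "\<exists>M. \<forall>x\<in>Omega_bar. \<forall>t\<in>{0..T}. \<bar>Gker eps delta k x y (t + s)\<bar> \<le> M" by blast
  qed
  then show ?thesis by (simp add: sol_pos_time[OF t])
qed

lemma sol_formula:
  fixes \<phi> :: "(real^'n) \<times> real \<Rightarrow> real"
  assumes \<phi>: "continuous_on Omega \<phi>" "\<And>y. y \<in> Omega \<Longrightarrow> \<bar>\<phi> y\<bar> \<le> M" and x: "x \<in> Omega_bar" and t: "t > 0"
  shows "integral Omega (\<lambda>y. Gker eps delta k x y t * \<phi> y)
      + delta / eps * integral UNIV (\<lambda>y'. Gker eps delta k x (y', 0) t * \<psi> y')
    = integral Omega (\<lambda>y. G0 x y (t / eps) * \<phi> y) + 1 / delta * integral Omega (\<lambda>y. Hker eps delta k x y t * \<phi> y)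
      + 1 / eps * integral UNIV (\<lambda>y'. Hker eps delta k x (y', 0) t * \<psi> y')"
proof -
  note int = Gker_Omega_integrable[OF \<phi> x t]
  \<comment> \<open>The integral of \<open>G0\<close> times \<open>\<phi>\<close> is obtained as the
    difference of two integrals already known to exist.\<close>
  have "((\<lambda>y. Gker eps delta k x y t * \<phi> y - (1 / delta) * (layer (x - refl y) t * \<phi> y)) has_integral
      integral Omega (\<lambda>y. Gker eps delta k x y t * \<phi> y) - (1 / delta) * integral Omega (\<lambda>y. layer (x - refl y) t * \<phi> y)) Omega"
    by (intro has_integral_diff has_integral_mult_right integrable_integral int)
  then have 1: "integral Omega (\<lambda>y. G0 x y (t / eps) * \<phi> y) =
      integral Omega (\<lambda>y. Gker eps delta k x y t * \<phi> y) - (1 / delta) * integral Omega (\<lambda>y. layer (x - refl y) t * \<phi> y)"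
    by (intro integral_unique) (simp add: Gker_eq_layer[OF t] algebra_simps)
  have "integral UNIV (\<lambda>y'. Gker eps delta k x (y', 0) t * \<psi> y') = (1 / delta) * integral UNIV (\<lambda>y'. layer (x - (y', 0)) t * \<psi> y')"
    by (simp add: Gker_boundary_eq[OF t])
  then have "delta / eps * integral UNIV (\<lambda>y'. Gker eps delta k x (y', 0) t * \<psi> y') = 1 / eps * integral UNIV (\<lambda>y'. layer (x - (y', 0)) t * \<psi> y')"
    using delta by simp
  then show ?thesis by (simp add: 1 Hker_eq_layer[OF t])
qed

section \<open>Passing between classical solutions and \<open>dyn_eqs\<close>\<close>

lemma classical_HDD_dyn_eqs:
  assumes "classical_HDD eps delta k \<phi> \<psi> v" "k > 0"
  shows "dyn_eqs eps delta k v" "continuous_on (Omega_bar \<times> {0<..}) (\<lambda>(x, t). v x t)"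
proof -
  obtain ut Du D2u Dw D2w where u: "C21_derivs Omega_bar v ut Du D2u" and w: "trace_derivs v Dw D2w" and
    eqs: "\<forall>x\<in>Omega. \<forall>t>0. eps * ut x t - (\<Sum>b\<in>Basis. D2u x t b b) = 0"
      "\<forall>x'. \<forall>t>0. delta * ut (x', 0) t - k * (\<Sum>b\<in>Basis. D2w x' t b b) - Du (x', 0) t (0, 1) = 0"
    using assms(1) unfolding classical_HDD_def by blast
  show "continuous_on (Omega_bar \<times> {0<..}) (\<lambda>(x, t). v x t)" by (rule C21_derivsD(4)[OF u])
  show "dyn_eqs eps delta k v"
    unfolding dyn_eqs_def
  proof (intro exI[of _ ut] exI[of _ Du] exI[of _ D2u] conjI ballI allI impI)
    show "if k = 0 then \<forall>x'. \<forall>t>0. delta * ut (x', 0) t - Du (x', 0) t (0, 1) = 0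
       else \<exists>Dw D2w. trace_derivs v Dw D2w \<and>
          (\<forall>x'. \<forall>t>0. delta * ut (x', 0) t - k * (\<Sum>b\<in>Basis. D2w x' t b b) - Du (x', 0) t (0, 1) = 0)"
      using w eqs(2) assms(2) by auto
  qed (use C21_derivsD[OF u] eqs(1) Omega_subset in \<open>auto intro!: has_derivative_interior\<close>)
qed

lemma classical_HD_dyn_eqs:
  fixes v :: "(real^'n) \<times> real \<Rightarrow> real \<Rightarrow> real"
  assumes "classical_HD eps delta \<phi> \<psi> v" "k = 0"
  shows "dyn_eqs eps delta k v" "continuous_on (Omega_bar \<times> {0<..}) (\<lambda>(x, t). v x t)"
proof -
  obtain ut Du D2u where u: "C21_derivs Omega v ut Du D2u" and w: "C11_derivs Omega_bar v ut Du" and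
    eqs: "\<forall>x\<in>Omega. \<forall>t>0. eps * ut x t - (\<Sum>b\<in>Basis. D2u x t b b) = 0"
      "\<forall>x'. \<forall>t>0. delta * ut (x', 0) t - Du (x', 0) t (0, 1) = 0"
    using assms(1) unfolding classical_HD_def by blast
  show "continuous_on (Omega_bar \<times> {0<..}) (\<lambda>(x, t). v x t)" using w unfolding C11_derivs_def by blast
  have at: "at x within Omega = at x" if "x \<in> Omega" for x by (rule at_within_open[OF that open_Omega])
  show "dyn_eqs eps delta k v"
    unfolding dyn_eqs_def
  proof (intro exI[of _ ut] exI[of _ Du] exI[of _ D2u] conjI ballI allI impI)
    fix x b :: "(real^'n) \<times> real" and t :: real assume "x \<in> Omega" "0 < t" "b \<in> Basis"
    then show "((\<lambda>y. Du y t b) has_derivative D2u x t b) (at x)"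
      using C21_derivsD(3)[OF u, of x t b] by (simp add: at)
  next
    show "if k = 0 then \<forall>x'. \<forall>t>0. delta * ut (x', 0) t - Du (x', 0) t (0, 1) = 0
       else \<exists>Dw D2w. trace_derivs v Dw D2w \<and>
          (\<forall>x'. \<forall>t>0. delta * ut (x', 0) t - k * (\<Sum>b\<in>Basis. D2w x' t b b) - Du (x', 0) t (0, 1) = 0)"
      using eqs(2) assms(2) by simp
  qed (use w eqs(1) in \<open>auto simp: C11_derivs_def\<close>)
qed

context
  fixes \<phi> :: "(real^'n) \<times> real \<Rightarrow> real" and \<psi> :: "real^'n \<Rightarrow> real" and M :: real
  assumes \<phi>: "continuous_on Omega \<phi>" "\<And>y. y \<in> Omega \<Longrightarrow> \<bar>\<phi> y\<bar> \<le> M"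
    and \<psi>: "continuous_on UNIV \<psi>" "\<And>y. \<bar>\<psi> y\<bar> \<le> M"
begin

private lemma sol_init: "x \<in> Omega \<Longrightarrow> sl \<phi> \<psi> x 0 = \<phi> x" "sl \<phi> \<psi> (x', 0) 0 = \<psi> x'"
  by (auto simp: sol_def Omega_def)

text \<open>The derivatives of the trace are those of the full solution restricted to tangential
  directions, so the tangential Laplacian required on the boundary is a partial sum of the full
  one.\<close>

lemma sol_classical_HDD: "classical_HDD eps delta k \<phi> \<psi> (sl \<phi> \<psi>)"
proof -
  obtain ut Du D2u where u: "C21_derivs Omega_bar (sl \<phi> \<psi>) ut Du D2u"
    "\<And>x t. x \<in> Omega_bar \<Longrightarrow> t > 0 \<Longrightarrow> eps * ut x t = (\<Sum>b\<in>Basis. D2u x t b b)"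
    "\<And>x' t. t > 0 \<Longrightarrow> delta * ut (x', 0) t - k * (\<Sum>b\<in>Basis. D2u (x', 0) t (b, 0) (b, 0)) - Du (x', 0) t (0, 1) = 0"
    using smooth_solutionE[OF smooth_solution_sol[OF \<phi> \<psi>]] by blast
  have "trace_derivs (sl \<phi> \<psi>) (\<lambda>x' t v. Du (x', 0) t (v, 0)) (\<lambda>x' t v c. D2u (x', 0) t (v, 0) (c, 0))"
    unfolding trace_derivs_def
    by (auto intro!: has_derivative_boundary C21_derivsD[OF u(1)] simp: Basis_prod_def)
  then have "\<exists>ut Du D2u Dw D2w. C21_derivs Omega_bar (sl \<phi> \<psi>) ut Du D2u \<and> trace_derivs (sl \<phi> \<psi>) Dw D2w
      \<and> (\<forall>x\<in>Omega. \<forall>t>0. eps * ut x t - (\<Sum>b\<in>Basis. D2u x t b b) = 0)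
      \<and> (\<forall>x'. \<forall>t>0. delta * ut (x', 0) t - k * (\<Sum>b\<in>Basis. D2w x' t b b) - Du (x', 0) t (0, 1) = 0)"
    using u Omega_subset by (intro exI conjI) auto
  then show ?thesis
    unfolding classical_HDD_def
    using continuous_on_sol_interior[OF \<phi> \<psi>] continuous_on_sol_boundary[OF \<phi> \<psi>] sol_init by blast
qed

lemma sol_classical_HD:
  assumes "k = 0"
  shows "classical_HD eps delta \<phi> \<psi> (sl \<phi> \<psi>)"
proof -
  obtain ut Du D2u where u: "C21_derivs Omega_bar (sl \<phi> \<psi>) ut Du D2u"
    "\<And>x t. x \<in> Omega_bar \<Longrightarrow> t > 0 \<Longrightarrow> eps * ut x t = (\<Sum>b\<in>Basis. D2u x t b b)"
    "\<And>x' t. t > 0 \<Longrightarrow> delta * ut (x', 0) t - k * (\<Sum>b\<in>Basis. D2u (x', 0) t (b, 0) (b, 0)) - Du (x', 0) t (0, 1) = 0"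
    using smooth_solutionE[OF smooth_solution_sol[OF \<phi> \<psi>]] by blast
  have "C11_derivs Omega_bar (sl \<phi> \<psi>) ut Du" using u(1) by (simp add: C21_derivs_def)
  then have "\<exists>ut Du D2u. C21_derivs Omega (sl \<phi> \<psi>) ut Du D2u \<and> C11_derivs Omega_bar (sl \<phi> \<psi>) ut Du
      \<and> (\<forall>x\<in>Omega. \<forall>t>0. eps * ut x t - (\<Sum>b\<in>Basis. D2u x t b b) = 0)
      \<and> (\<forall>x'. \<forall>t>0. delta * ut (x', 0) t - Du (x', 0) t (0, 1) = 0)"
    using C21_derivs_subset[OF u(1) Omega_subset] u(2,3) Omega_subset assms
    by (intro exI[of _ ut] exI[of _ Du] exI[of _ D2u] conjI) auto
  then show ?thesis
    unfolding classical_HD_def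
    using continuous_on_sol_interior[OF \<phi> \<psi>] continuous_on_sol_boundary[OF \<phi> \<psi>] sol_init by blast
qed

lemma bounded_sol: "bounded ((\<lambda>(x, t). sl \<phi> \<psi> x t) ` (Omega_bar \<times> {0..}))"
  unfolding bounded_iff using sol_bound[OF \<phi> \<psi>] by (intro exI[of _ "2 * M"]) auto

end

end

theorem theorem1p1:
  fixes eps delta k :: real
  assumes "eps > 0" and "delta > 0" and "k \<ge> 0"
  shows
    \<comment> \<open>(1) symmetry and positivity\<close>
    "(\<forall>x\<in>(Omega_bar :: ((real^'n) \<times> real) set). \<forall>y\<in>Omega_bar. \<forall>t>0.
        Gker eps delta k x y t = Gker eps delta k y x t \<and> Gker eps delta k x y t > 0)
   \<comment> \<open>(2) the equations in (x,t) for fixed y\<close>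
   \<and> (\<forall>y\<in>(Omega_bar :: ((real^'n) \<times> real) set). dyn_eqs eps delta k (\<lambda>x t. Gker eps delta k x y t))
   \<comment> \<open>(3) conservation\<close>
   \<and> (\<forall>x\<in>(Omega_bar :: ((real^'n) \<times> real) set). \<forall>t>0.
        (\<lambda>y. Gker eps delta k x y t) integrable_on Omega
      \<and> (\<lambda>y'. Gker eps delta k x (y', 0) t) integrable_on UNIV
      \<and> integral Omega (\<lambda>y. Gker eps delta k x y t)
          + delta / eps * integral UNIV (\<lambda>y'. Gker eps delta k x (y', 0) t) = 1)
   \<comment> \<open>(4) semigroup / Chapman-Kolmogorov property\<close>
   \<and> (\<forall>x\<in>(Omega_bar :: ((real^'n) \<times> real) set). \<forall>y\<in>Omega_bar. \<forall>t>0. \<forall>s>0.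
        Gker eps delta k x y (t + s)
          = integral Omega (\<lambda>z. Gker eps delta k x z t * Gker eps delta k z y s)
            + delta / eps * integral UNIV (\<lambda>z'. Gker eps delta k x (z', 0) t * Gker eps delta k (z', 0) y s))
   \<comment> \<open>(5) representation and uniqueness of bounded classical solutions\<close>
   \<and> (\<forall>(\<phi> :: (real^'n) \<times> real \<Rightarrow> real) (\<psi> :: real^'n \<Rightarrow> real).
        continuous_on Omega \<phi> \<and> bounded (\<phi> ` Omega) \<and> continuous_on UNIV \<psi> \<and> bounded (range \<psi>)
        \<longrightarrow>
          (\<forall>x\<in>Omega_bar. \<forall>t>0.
             integral Omega (\<lambda>y. Gker eps delta k x y t * \<phi> y)
               + delta / eps * integral UNIV (\<lambda>y'. Gker eps delta k x (y', 0) t * \<psi> y')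
             = integral Omega (\<lambda>y. G0 x y (t / eps) * \<phi> y)
               + 1 / delta * integral Omega (\<lambda>y. Hker eps delta k x y t * \<phi> y)
               + 1 / eps * integral UNIV (\<lambda>y'. Hker eps delta k x (y', 0) t * \<psi> y'))
        \<and> (k > 0 \<longrightarrow>
             classical_HDD eps delta k \<phi> \<psi> (sol eps delta k \<phi> \<psi>)
           \<and> bounded ((\<lambda>(x,t). sol eps delta k \<phi> \<psi> x t) ` (Omega_bar \<times> {0..}))
           \<and> (\<forall>v. classical_HDD eps delta k \<phi> \<psi> v
                   \<and> bounded ((\<lambda>(x,t). v x t) ` (Omega_bar \<times> {0..}))
                   \<longrightarrow> (\<forall>x\<in>Omega_bar. \<forall>t\<ge>0. v x t = sol eps delta k \<phi> \<psi> x t)))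
        \<and> (k = 0 \<longrightarrow>
             classical_HD eps delta \<phi> \<psi> (sol eps delta k \<phi> \<psi>)
           \<and> bounded ((\<lambda>(x,t). sol eps delta k \<phi> \<psi> x t) ` (Omega_bar \<times> {0..}))
           \<and> (\<forall>v. classical_HD eps delta \<phi> \<psi> v
                   \<and> bounded ((\<lambda>(x,t). v x t) ` (Omega_bar \<times> {0..}))
                   \<longrightarrow> (\<forall>x\<in>Omega_bar. \<forall>t\<ge>0. v x t = sol eps delta k \<phi> \<psi> x t))))"
proof -
  interpret dynamic_bc eps delta k using assms by unfold_locales
  have part5: "(\<forall>x\<in>Omega_bar. \<forall>t>0.
             integral Omega (\<lambda>y. Gker eps delta k x y t * \<phi> y)
               + delta / eps * integral UNIV (\<lambda>y'. Gker eps delta k x (y', 0) t * \<psi> y')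
             = integral Omega (\<lambda>y. G0 x y (t / eps) * \<phi> y)
               + 1 / delta * integral Omega (\<lambda>y. Hker eps delta k x y t * \<phi> y)
               + 1 / eps * integral UNIV (\<lambda>y'. Hker eps delta k x (y', 0) t * \<psi> y'))
        \<and> (k > 0 \<longrightarrow>
             classical_HDD eps delta k \<phi> \<psi> (sol eps delta k \<phi> \<psi>)
           \<and> bounded ((\<lambda>(x,t). sol eps delta k \<phi> \<psi> x t) ` (Omega_bar \<times> {0..}))
           \<and> (\<forall>v. classical_HDD eps delta k \<phi> \<psi> v
                   \<and> bounded ((\<lambda>(x,t). v x t) ` (Omega_bar \<times> {0..}))
                   \<longrightarrow> (\<forall>x\<in>Omega_bar. \<forall>t\<ge>0. v x t = sol eps delta k \<phi> \<psi> x t)))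
        \<and> (k = 0 \<longrightarrow>
             classical_HD eps delta \<phi> \<psi> (sol eps delta k \<phi> \<psi>)
           \<and> bounded ((\<lambda>(x,t). sol eps delta k \<phi> \<psi> x t) ` (Omega_bar \<times> {0..}))
           \<and> (\<forall>v. classical_HD eps delta \<phi> \<psi> v
                   \<and> bounded ((\<lambda>(x,t). v x t) ` (Omega_bar \<times> {0..}))
                   \<longrightarrow> (\<forall>x\<in>Omega_bar. \<forall>t\<ge>0. v x t = sol eps delta k \<phi> \<psi> x t)))"
    if data: "continuous_on Omega \<phi> \<and> bounded (\<phi> ` Omega) \<and> continuous_on UNIV \<psi> \<and> bounded (range \<psi>)"
    for \<phi> :: "(real^'n) \<times> real \<Rightarrow> real" and \<psi> :: "real^'n \<Rightarrow> real"
  proof -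
    obtain M1 M2 where "\<And>y. y \<in> Omega \<Longrightarrow> \<bar>\<phi> y\<bar> \<le> M1" "\<And>y. \<bar>\<psi> y\<bar> \<le> M2"
      using data unfolding bounded_iff by (metis image_eqI rangeI real_norm_def)
    then have b: "\<And>y. y \<in> Omega \<Longrightarrow> \<bar>\<phi> y\<bar> \<le> max M1 M2" "\<And>y. \<bar>\<psi> y\<bar> \<le> max M1 M2"
      by (meson max.cobounded1 max.cobounded2 order_trans)+
    have c: "continuous_on Omega \<phi>" "continuous_on UNIV \<psi>" using data by auto
    have uniq: "\<forall>x\<in>Omega_bar. \<forall>t\<ge>0. v x t = sol eps delta k \<phi> \<psi> x t"
      if v: "dyn_eqs eps delta k v" "continuous_on (Omega_bar \<times> {0<..}) (\<lambda>(x, t). v x t)"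
        "continuous_on (Omega \<times> {0..}) (\<lambda>(x, t). v x t)" "continuous_on (UNIV \<times> {0..}) (\<lambda>(x', t). v (x', 0) t)"
        "\<forall>x\<in>Omega. v x 0 = \<phi> x" "\<forall>x'. v (x', 0) 0 = \<psi> x'"
        and bd: "bounded ((\<lambda>(x,t). v x t) ` (Omega_bar \<times> {0..}))" for v
    proof -
      obtain B where "\<forall>y\<in>(\<lambda>(x,t). v x t) ` (Omega_bar \<times> {0..}). norm y \<le> B"
        using bd unfolding bounded_iff by blast
      then have "\<And>x t. x \<in> Omega_bar \<Longrightarrow> t \<ge> 0 \<Longrightarrow> \<bar>v x t\<bar> \<le> B" by force
      then show ?thesis using bounded_solution_unique[OF v(1-4), of \<phi> \<psi> B] v(5,6) by blast
    qed
    show ?thesis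
    proof (intro conjI impI allI)
      show "\<forall>x\<in>Omega_bar. \<forall>t>0.
             integral Omega (\<lambda>y. Gker eps delta k x y t * \<phi> y)
               + delta / eps * integral UNIV (\<lambda>y'. Gker eps delta k x (y', 0) t * \<psi> y')
             = integral Omega (\<lambda>y. G0 x y (t / eps) * \<phi> y)
               + 1 / delta * integral Omega (\<lambda>y. Hker eps delta k x y t * \<phi> y)
               + 1 / eps * integral UNIV (\<lambda>y'. Hker eps delta k x (y', 0) t * \<psi> y')"
        using sol_formula[OF c(1) b(1)] by blast
      show "classical_HDD eps delta k \<phi> \<psi> (sol eps delta k \<phi> \<psi>)"
        using sol_classical_HDD[OF c(1) b(1) c(2) b(2)] by blast
      show "bounded ((\<lambda>(x,t). sol eps delta k \<phi> \<psi> x t) ` (Omega_bar \<times> {0..}))"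
        "bounded ((\<lambda>(x,t). sol eps delta k \<phi> \<psi> x t) ` (Omega_bar \<times> {0..}))"
        using bounded_sol[OF c(1) b(1) c(2) b(2)] by blast+
      show "classical_HD eps delta \<phi> \<psi> (sol eps delta k \<phi> \<psi>)" if "k = 0"
        using sol_classical_HD[OF c(1) b(1) c(2) b(2) that] by blast
    next
      fix v assume "k > 0" and v: "classical_HDD eps delta k \<phi> \<psi> v \<and> bounded ((\<lambda>(x,t). v x t) ` (Omega_bar \<times> {0..}))"
      then show "\<forall>x\<in>Omega_bar. \<forall>t\<ge>0. v x t = sol eps delta k \<phi> \<psi> x t"
        using classical_HDD_dyn_eqs[of \<phi> \<psi> v] by (intro uniq) (auto simp: classical_HDD_def)
    next
      fix v assume "k = 0" and v: "classical_HD eps delta \<phi> \<psi> v \<and> bounded ((\<lambda>(x,t). v x t) ` (Omega_bar \<times> {0..}))"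
      then show "\<forall>x\<in>Omega_bar. \<forall>t\<ge>0. v x t = sol eps delta k \<phi> \<psi> x t"
        using classical_HD_dyn_eqs[of \<phi> \<psi> v] by (intro uniq) (auto simp: classical_HD_def)
    qed
  qed
  show ?thesis
  proof (rule conjI[OF _ conjI[OF _ conjI[OF _ conjI]]], goal_cases)
    case 1
    show ?case using Gker_sym Gker_pos by blast
  next
    case 2
    show ?case using smooth_solution_dyn_eqs[OF smooth_solution_Gker] by blast
  next
    case 3
    show ?case using Gker_integrable Gker_mass by blast
  next
    case 4
    show ?case using Gker_semigroup by blast
  next
    case 5
    show ?case by (intro allI impI) (rule part5)
  qed
qed

end
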